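(* Let $1<p<\infty$. The projections $\bm{\pi}_+,\bm{\pi}_-,\bm{\pi}_0$, defined on $\bm{C}^\infty(\mathbb{S})$ by $\bm{\pi}_+\bm{f}=\sum_{\ell\ge0}\sum_{|m|\le\ell}\langle\bm{f},\tfrac{\bm{E}^+_{\ell,m}}{\mu^+_\ell}\rangle\tfrac{\bm{E}^+_{\ell,m}}{\mu^+_\ell}$, $\bm{\pi}_-\bm{f}=\sum_{\ell\ge1}\sum_{|m|\le\ell}\langle\bm{f},\tfrac{\bm{E}^-_{\ell,m}}{\mu^-_\ell}\rangle\tfrac{\bm{E}^-_{\ell,m}}{\mu^-_\ell}$, $\bm{\pi}_0\bm{f}=\sum_{\ell\ge1}\sum_{|m|\le\ell}\langle\bm{f},\tfrac{\bm{E}^0_{\ell,m}}{\mu^0_\ell}\rangle\tfrac{\bm{E}^0_{\ell,m}}{\mu^0_\ell}$, extend to bounded projections on $\bm{L}^p(\mathbb{S})$, and $\bm{L}^p(\mathbb{S})=\bm{L}^p_+(\mathbb{S})\oplus\bm{L}^p_-(\mathbb{S})\oplus\bm{L}^p_0(\mathbb{S})$ (topological direct sum), where $\bm{L}^p_\#(\mathbb{S})=\bm{\pi}_\#(\bm{L}^p(\mathbb{S}))$, $\#\in\{+,-,0\}$.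
   Context: $\mathbb{S}$ is the unit sphere of $\mathbb{R}^3$, $\sigma$ surface measure, $\langle\bm{f},\bm{g}\rangle=\int_{\mathbb{S}}\bm{f}\cdot\bm{g}\,d\sigma$, $\bm{L}^p(\mathbb{S})$ the $\mathbb{R}^3$-valued $L^p$ space, $\bm{C}^\infty(\mathbb{S})$ the smooth vector fields on $\mathbb{S}$. $\{Y_{\ell,m}\}_{\ell\ge0,|m|\le\ell}$ is an orthonormal basis of $L^2(\mathbb{S})$ of real spherical harmonics of degree $\ell$; $\nabla_\sigma$ is the spherical gradient; $\bm{f}^\vee(\eta)=f(\eta)\eta$. $\bm{E}^+_{\ell,m}=(\ell+1)\bm{Y}^\vee_{\ell,m}-\nabla_\sigma Y_{\ell,m}$, $\bm{E}^-_{\ell,m}=\ell\bm{Y}^\vee_{\ell,m}+\nabla_\sigma Y_{\ell,m}$, $\bm{E}^0_{\ell,m}(\eta)=\eta\times\nabla_\sigma Y_{\ell,m}(\eta)$; $\mu^+_\ell=\sqrt{(\ell+1)(2\ell+1)}$, $\mu^-_\ell=\sqrt{\ell(2\ell+1)}$, $\mu^0_\ell=\sqrt{\ell(\ell+1)}$ (these normalize the $\bm{E}$'s, which together form an orthonormal basis of $\bm{L}^2(\mathbb{S})$). *)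

theory Defs
  imports "HOL-Analysis.Analysis"
begin

type_synonym vec3 = "real^3"

text \<open>Cone construction: sigma(A) = 3 * Lebesgue measure of {x. 0 < |x| <= 1, x/|x| in A}.\<close>
definition sphere_measure :: "vec3 measure" where
  "sphere_measure = measure_of (sphere 0 1) (sets (restrict_space borel (sphere 0 1)))
     (\<lambda>A. 3 * emeasure lborel {x. 0 < norm x \<and> norm x \<le> 1 \<and> x /\<^sub>R norm x \<in> A})"

definition Lp_S :: "real \<Rightarrow> (vec3 \<Rightarrow> vec3) set" where
  "Lp_S p = {f. f \<in> borel_measurable sphere_measure \<and>
                 (\<integral>\<^sup>+ x. ennreal (norm (f x) powr p) \<partial>sphere_measure) < \<infinity>}"

definition Lp_norm :: "real \<Rightarrow> (vec3 \<Rightarrow> vec3) \<Rightarrow> real" where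
  "Lp_norm p f = (\<integral> x. norm (f x) powr p \<partial>sphere_measure) powr (1 / p)"

definition inner_S :: "(vec3 \<Rightarrow> vec3) \<Rightarrow> (vec3 \<Rightarrow> vec3) \<Rightarrow> real" where
  "inner_S f g = (\<integral> x. f x \<bullet> g x \<partial>sphere_measure)"

coinductive smooth_on :: "vec3 set \<Rightarrow> (vec3 \<Rightarrow> vec3) \<Rightarrow> bool" where
  "\<lbrakk>\<forall>x\<in>U. f differentiable (at x);
    \<forall>i. smooth_on U (\<lambda>x. frechet_derivative f (at x) (axis i 1))\<rbrakk> \<Longrightarrow> smooth_on U f"

definition smooth_field :: "(vec3 \<Rightarrow> vec3) \<Rightarrow> bool" where
  "smooth_field f \<longleftrightarrow> smooth_on (UNIV - {0}) (\<lambda>x. f (x /\<^sub>R norm x))"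

definition laplacian :: "(vec3 \<Rightarrow> real) \<Rightarrow> vec3 \<Rightarrow> real" where
  "laplacian P x = (\<Sum>i\<in>UNIV. deriv (\<lambda>s. deriv (\<lambda>t. P (x + t *\<^sub>R axis i 1)) s) 0)"

definition hom_poly :: "nat \<Rightarrow> (vec3 \<Rightarrow> real) \<Rightarrow> bool" where
  "hom_poly l P \<longleftrightarrow> (\<exists>c :: nat \<Rightarrow> nat \<Rightarrow> real. \<forall>x.
      P x = (\<Sum>a\<le>l. \<Sum>b\<le>l - a. c a b * (x$1) ^ a * (x$2) ^ b * (x$3) ^ (l - a - b)))"

definition spherical_harmonic :: "nat \<Rightarrow> (vec3 \<Rightarrow> real) \<Rightarrow> bool" where
  "spherical_harmonic l Y \<longleftrightarrow>
     (\<exists>P. hom_poly l P \<and> (\<forall>x. laplacian P x = 0) \<and> (\<forall>\<eta>\<in>sphere 0 1. Y \<eta> = P \<eta>))"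

text \<open>Spherical gradient: gradient of the 0-homogeneous extension.\<close>
definition sgrad :: "(vec3 \<Rightarrow> real) \<Rightarrow> vec3 \<Rightarrow> vec3" where
  "sgrad f \<eta> = (\<chi> i. frechet_derivative (\<lambda>x. f (x /\<^sub>R norm x)) (at \<eta>) (axis i 1))"

definition E_plus :: "(nat \<Rightarrow> int \<Rightarrow> vec3 \<Rightarrow> real) \<Rightarrow> nat \<Rightarrow> int \<Rightarrow> vec3 \<Rightarrow> vec3" where
  "E_plus Y l m \<eta> = (real l + 1) *\<^sub>R (Y l m \<eta> *\<^sub>R \<eta>) - sgrad (Y l m) \<eta>"

definition E_minus :: "(nat \<Rightarrow> int \<Rightarrow> vec3 \<Rightarrow> real) \<Rightarrow> nat \<Rightarrow> int \<Rightarrow> vec3 \<Rightarrow> vec3" where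
  "E_minus Y l m \<eta> = real l *\<^sub>R (Y l m \<eta> *\<^sub>R \<eta>) + sgrad (Y l m) \<eta>"

definition E_zero :: "(nat \<Rightarrow> int \<Rightarrow> vec3 \<Rightarrow> real) \<Rightarrow> nat \<Rightarrow> int \<Rightarrow> vec3 \<Rightarrow> vec3" where
  "E_zero Y l m \<eta> = cross3 \<eta> (sgrad (Y l m) \<eta>)"

definition mu_plus :: "nat \<Rightarrow> real" where "mu_plus l = sqrt ((real l + 1) * (2 * real l + 1))"
definition mu_minus :: "nat \<Rightarrow> real" where "mu_minus l = sqrt (real l * (2 * real l + 1))"
definition mu_zero :: "nat \<Rightarrow> real" where "mu_zero l = sqrt (real l * (real l + 1))"

definition proj_series ::
  "nat \<Rightarrow> (nat \<Rightarrow> int \<Rightarrow> vec3 \<Rightarrow> vec3) \<Rightarrow> (nat \<Rightarrow> real) \<Rightarrow> (vec3 \<Rightarrow> vec3) \<Rightarrow> vec3 \<Rightarrow> vec3" where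
  "proj_series l0 E mu f \<eta> =
     (\<Sum>k. let l = k + l0 in
        \<Sum>m\<in>{- int l..int l}.
          inner_S f (\<lambda>x. E l m x /\<^sub>R mu l) *\<^sub>R (E l m \<eta> /\<^sub>R mu l))"

definition pi_plus where "pi_plus Y = proj_series 0 (E_plus Y) mu_plus"
definition pi_minus where "pi_minus Y = proj_series 1 (E_minus Y) mu_minus"
definition pi_zero where "pi_zero Y = proj_series 1 (E_zero Y) mu_zero"

definition Lp_projection_extending ::
  "real \<Rightarrow> ((vec3 \<Rightarrow> vec3) \<Rightarrow> vec3 \<Rightarrow> vec3) \<Rightarrow> ((vec3 \<Rightarrow> vec3) \<Rightarrow> vec3 \<Rightarrow> vec3) \<Rightarrow> bool" where
  "Lp_projection_extending p P \<pi> \<longleftrightarrow>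
     (\<forall>f\<in>Lp_S p. P f \<in> Lp_S p) \<and>
     (\<forall>f\<in>Lp_S p. \<forall>g\<in>Lp_S p. (AE x in sphere_measure. f x = g x) \<longrightarrow>
                              (AE x in sphere_measure. P f x = P g x)) \<and>
     (\<forall>f\<in>Lp_S p. \<forall>g\<in>Lp_S p. \<forall>a b::real.
        AE x in sphere_measure. P (\<lambda>y. a *\<^sub>R f y + b *\<^sub>R g y) x = a *\<^sub>R P f x + b *\<^sub>R P g x) \<and>
     (\<exists>C. \<forall>f\<in>Lp_S p. Lp_norm p (P f) \<le> C * Lp_norm p f) \<and>
     (\<forall>f\<in>Lp_S p. AE x in sphere_measure. P (P f) x = P f x) \<and>
     (\<forall>f. smooth_field f \<longrightarrow> (AE x in sphere_measure. P f x = \<pi> f x))"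

definition Lp_direct_sum3 ::
  "real \<Rightarrow> ((vec3 \<Rightarrow> vec3) \<Rightarrow> vec3 \<Rightarrow> vec3) \<Rightarrow> ((vec3 \<Rightarrow> vec3) \<Rightarrow> vec3 \<Rightarrow> vec3)
        \<Rightarrow> ((vec3 \<Rightarrow> vec3) \<Rightarrow> vec3 \<Rightarrow> vec3) \<Rightarrow> bool" where
  "Lp_direct_sum3 p P1 P2 P3 \<longleftrightarrow>
     (\<forall>f\<in>Lp_S p. AE x in sphere_measure. f x = P1 f x + P2 f x + P3 f x) \<and>
     (\<forall>g1\<in>P1 ` Lp_S p. \<forall>g2\<in>P2 ` Lp_S p. \<forall>g3\<in>P3 ` Lp_S p.
        (AE x in sphere_measure. g1 x + g2 x + g3 x = 0) \<longrightarrow>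
        (AE x in sphere_measure. g1 x = 0) \<and> (AE x in sphere_measure. g2 x = 0) \<and>
        (AE x in sphere_measure. g3 x = 0))"

end

theory Submission
  imports Defs
begin

text \<open>
  The field \<open>E\<^sup>-\<close> of degree \<open>l\<close> has harmonic Cartesian components of degree \<open>l - 1\<close>, \<open>E\<^sup>0\<close> of
  degree \<open>l\<close> and \<open>E\<^sup>+\<close> of degree \<open>l + 1\<close>; in terms of the component degree \<open>k\<close> they are the
  eigenspaces of the operator \<open>T F = (x \<times> \<nabla>) \<times> F\<close> for the eigenvalues \<open>k\<close>, \<open>- 1\<close> and \<open>- (k + 1)\<close>.
  Averaging \<open>f\<close> over all rotations, with axis \<open>\<xi>\<close> and angle \<open>\<alpha>\<close> uniformly distributed, multiplies
  harmonics of degree \<open>k\<close> by \<open>1 / (2 k + 1)\<close>; weighting the average by \<open>\<xi>\<close> and by a conjugate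
  Fejer kernel in \<open>\<alpha>\<close> produces \<open>(x \<times> \<nabla>) f / (2 k + 1)\<close>. Both averages are \<open>L\<^sup>p\<close> bounded, the
  second by the conjugate function theorem on the circle, and so is \<open>(2 T + 1) / (2 k + 1)\<close>. This
  operator is \<open>1\<close> on the \<open>E\<^sup>-\<close> part, \<open>- 1\<close> on the \<open>E\<^sup>+\<close> part and a contraction on the \<open>E\<^sup>0\<close> part,
  so that the projections of polynomial fields can be recovered from it. Duality covers \<open>p > 2\<close>,
  density of the polynomial fields gives the extension to \<open>L\<^sup>p\<close>, and for smooth fields the series
  converges because the coefficients decay like \<open>1 / (k (k + 1))\<close>.
\<close>

section \<open>Polynomials on the sphere\<close>

text \<open>The obstacle is that \<open>T\<close> is a differential operator of first order and that
  the division by 2 k + 1 making it bounded depends on the degree, so that no single kernel is at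
  hand. Both come from one computation: in axis-angle coordinates the generator of left
  multiplication by rotations has the denominator 1 - cos \<alpha>, and cancelling it leaves the
  Dirichlet kernels, which are the characters of the rotation group. A uniformly distributed angle
  is not Haar measure, whose density is 1 - cos \<alpha>. Haar measure annihilates all positive
  degrees, and this is the source of the constant that makes the \<open>E\<^sup>0\<close> part a
  contraction strong enough to be inverted by absorption. The conjugate function theorem is proved
  for trigonometric polynomials, by subharmonicity of a multiple of |u|^p minus |F|^p, which
  confines it to p \<le> 2. All bounds up to the extension concern polynomial fields, and their
  point is that no constant depends on the degree.\<close>

definition pd :: "3 \<Rightarrow> (vec3 \<Rightarrow> real) \<Rightarrow> vec3 \<Rightarrow> real" where
  "pd i f x = frechet_derivative f (at x) (axis i 1)"

text \<open>Component \<open>a\<close> of the angular momentum operator: the derivative along the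
  rotation field e_a \<times> x, which is tangent to every sphere about 0. It is defined by the
  derivative itself and not by a rule for polynomials, because it is later applied to smooth
  functions as well.\<close>

definition Lop :: "3 \<Rightarrow> (vec3 \<Rightarrow> real) \<Rightarrow> vec3 \<Rightarrow> real" where
  "Lop a f x = frechet_derivative f (at x) (cross3 (axis a 1) x)"

abbreviation "rpf \<equiv> (real_polynomial_function :: (vec3 \<Rightarrow> real) \<Rightarrow> bool)"

lemma frechet_derivative_pd:
  assumes "f differentiable (at x)"
  shows "frechet_derivative f (at x) v = (\<Sum>i\<in>UNIV. v $ i * pd i f x)"
proof -
  have lin: "linear (frechet_derivative f (at x))"
    using assms by (rule linear_frechet_derivative)
  have "v = (\<Sum>i\<in>UNIV. v $ i *\<^sub>R axis i 1)"
    using basis_expansion[of v] by (simp add: scalar_mult_eq_scaleR)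
  then have "frechet_derivative f (at x) v = frechet_derivative f (at x) (\<Sum>i\<in>UNIV. v $ i *\<^sub>R axis i 1)"
    by simp
  also have "\<dots> = (\<Sum>i\<in>UNIV. v $ i * pd i f x)"
    using lin by (simp add: linear_sum linear_scale pd_def)
  finally show ?thesis .
qed

lemma rpf_differentiable: "rpf f \<Longrightarrow> f differentiable (at x)"
  by (rule differentiable_at_real_polynomial_function)

lemma rpf_const [simp]: "rpf (\<lambda>x. c)"
  by auto

lemma rpf_coord [simp]: "rpf (\<lambda>x. x $ i)"
  by (rule real_polynomial_function.intros(1)) (rule bounded_linear_vec_nth)

lemma rpf_add [simp]: "rpf f \<Longrightarrow> rpf g \<Longrightarrow> rpf (\<lambda>x. f x + g x)"
  by auto

lemma rpf_mult [simp]: "rpf f \<Longrightarrow> rpf g \<Longrightarrow> rpf (\<lambda>x. f x * g x)"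
  by auto

lemma rpf_minus [simp]: "rpf f \<Longrightarrow> rpf (\<lambda>x. - f x)"
  using rpf_mult[of "\<lambda>x. -1" f] by simp

lemma rpf_diff [simp]: "rpf f \<Longrightarrow> rpf g \<Longrightarrow> rpf (\<lambda>x. f x - g x)"
  using rpf_add[of f "\<lambda>x. - g x"] by simp

lemma rpf_sum [simp]: "(\<And>i. i \<in> I \<Longrightarrow> rpf (f i)) \<Longrightarrow> rpf (\<lambda>x. \<Sum>i\<in>I. f i x)"
  by (induction I rule: infinite_finite_induct) auto

lemma rpf_power [simp]: "rpf f \<Longrightarrow> rpf (\<lambda>x. f x ^ n)"
  by (induction n) auto

lemma rpf_inner [simp]: "rpf (\<lambda>x. v \<bullet> x)"
  by (rule real_polynomial_function.intros(1)) (rule bounded_linear_inner_right)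

text \<open>The generators in the inherited induction are arbitrary bounded linear functionals; in
  three dimensions each is a combination of coordinates, so coordinates suffice as base
  case.\<close>

lemma rpf_induct [consumes 1, case_names coord const add mult]:
  assumes "rpf f"
    and "\<And>i. P (\<lambda>x. x $ i)" and "\<And>c. P (\<lambda>x. c)"
    and "\<And>f g. rpf f \<Longrightarrow> rpf g \<Longrightarrow> P f \<Longrightarrow> P g \<Longrightarrow> P (\<lambda>x. f x + g x)"
    and "\<And>f g. rpf f \<Longrightarrow> rpf g \<Longrightarrow> P f \<Longrightarrow> P g \<Longrightarrow> P (\<lambda>x. f x * g x)"
  shows "P f"
  using assms(1)
proof (induction rule: real_polynomial_function.induct)
  case (linear f)
  have "f = (\<lambda>x. f (axis 1 1) * x $ 1 + (f (axis 2 1) * x $ 2 + f (axis 3 1) * x $ 3))"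
  proof
    fix x
    have "f x = f (\<Sum>i\<in>UNIV. x $ i *\<^sub>R axis i 1)"
      using basis_expansion[of x] by (simp add: scalar_mult_eq_scaleR)
    then show "f x = f (axis 1 1) * x $ 1 + (f (axis 2 1) * x $ 2 + f (axis 3 1) * x $ 3)"
      using linear by (simp add: bounded_linear.linear linear_sum linear_scale sum_3)
        (simp add: linear_add linear_scale bounded_linear.linear algebra_simps)
  qed
  moreover have "P (\<lambda>x. f (axis 1 1) * x $ 1 + (f (axis 2 1) * x $ 2 + f (axis 3 1) * x $ 3))"
    by (intro assms) auto
  ultimately show ?case by simp
qed (use assms in auto)

lemma pd_const [simp]: "pd i (\<lambda>x. c) = (\<lambda>x. 0)"
  by (rule ext) (simp add: pd_def)

lemma pd_coord [simp]: "pd i (\<lambda>x. x $ j) = (\<lambda>x. if i = j then 1 else 0)"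
proof
  fix x :: vec3
  have "((\<lambda>x. x $ j) has_derivative (\<lambda>h. h $ j)) (at x)"
    by (intro bounded_linear_imp_has_derivative bounded_linear_vec_nth)
  then have "frechet_derivative (\<lambda>x. x $ j) (at x) = (\<lambda>h. h $ j)"
    by (rule frechet_derivative_at[symmetric])
  then show "pd i (\<lambda>x. x $ j) x = (if i = j then 1 else 0)"
    by (simp add: pd_def axis_def)
qed

lemma pd_add_at:
  assumes "f differentiable (at x)" "g differentiable (at x)"
  shows "pd i (\<lambda>x. f x + g x) x = pd i f x + pd i g x"
proof -
  have "((\<lambda>x. f x + g x) has_derivative (\<lambda>h. frechet_derivative f (at x) h + frechet_derivative g (at x) h)) (at x)"
    using assms by (intro has_derivative_add) (auto simp: frechet_derivative_works[symmetric])
  from fun_cong[OF frechet_derivative_at[OF this], of "axis i 1"] show ?thesis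
    unfolding pd_def by simp
qed

lemma pd_mult_at:
  assumes "f differentiable (at x)" "g differentiable (at x)"
  shows "pd i (\<lambda>x. f x * g x) x = pd i f x * g x + f x * pd i g x"
proof -
  have "((\<lambda>x. f x * g x) has_derivative (\<lambda>h. f x * frechet_derivative g (at x) h + frechet_derivative f (at x) h * g x)) (at x)"
    using assms by (intro has_derivative_mult) (auto simp: frechet_derivative_works[symmetric])
  from fun_cong[OF frechet_derivative_at[OF this], of "axis i 1"] show ?thesis
    unfolding pd_def by simp
qed

lemma pd_add [simp]: "rpf f \<Longrightarrow> rpf g \<Longrightarrow> pd i (\<lambda>x. f x + g x) = (\<lambda>x. pd i f x + pd i g x)"
  by (rule ext) (simp add: pd_add_at rpf_differentiable)

lemma pd_mult [simp]: "rpf f \<Longrightarrow> rpf g \<Longrightarrow> pd i (\<lambda>x. f x * g x) = (\<lambda>x. pd i f x * g x + f x * pd i g x)"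
  by (rule ext) (simp add: pd_mult_at rpf_differentiable)

lemma pd_minus [simp]: "rpf f \<Longrightarrow> pd i (\<lambda>x. - f x) = (\<lambda>x. - pd i f x)"
  using pd_mult[of "\<lambda>x. -1" f] by simp

lemma pd_diff [simp]: "rpf f \<Longrightarrow> rpf g \<Longrightarrow> pd i (\<lambda>x. f x - g x) = (\<lambda>x. pd i f x - pd i g x)"
  using pd_add[of f "\<lambda>x. - g x"] by simp

lemma pd_divide [simp]: "rpf f \<Longrightarrow> pd i (\<lambda>x. f x / c) = (\<lambda>x. pd i f x / c)"
  using pd_mult[of f "\<lambda>x. 1 / c"] by simp

lemma pd_sum [simp]: "(\<And>j. j \<in> I \<Longrightarrow> rpf (f j)) \<Longrightarrow> pd i (\<lambda>x. \<Sum>j\<in>I. f j x) = (\<lambda>x. \<Sum>j\<in>I. pd i (f j) x)"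
  by (induction I rule: infinite_finite_induct) auto

lemma rpf_pd [simp]: "rpf f \<Longrightarrow> rpf (pd i f)"
  by (induction rule: rpf_induct) auto

lemma pd_commute: "rpf f \<Longrightarrow> pd i (pd j f) = pd j (pd i f)"
  by (induction rule: rpf_induct) (auto simp: algebra_simps fun_eq_iff)

lemma Lop_pd_at:
  assumes "f differentiable (at x)"
  shows "Lop 1 f x = x$2 * pd 3 f x - x$3 * pd 2 f x"
    and "Lop 2 f x = x$3 * pd 1 f x - x$1 * pd 3 f x"
    and "Lop 3 f x = x$1 * pd 2 f x - x$2 * pd 1 f x"
  unfolding Lop_def
  by (simp_all add: frechet_derivative_pd[OF assms] sum_3 cross_components axis_def)

lemma Lop_pd:
  assumes "rpf f"
  shows "Lop 1 f = (\<lambda>x. x$2 * pd 3 f x - x$3 * pd 2 f x)"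
    and "Lop 2 f = (\<lambda>x. x$3 * pd 1 f x - x$1 * pd 3 f x)"
    and "Lop 3 f = (\<lambda>x. x$1 * pd 2 f x - x$2 * pd 1 f x)"
  using Lop_pd_at[OF rpf_differentiable[OF assms]] by auto

lemma rpf_Lop [simp]: "rpf f \<Longrightarrow> rpf (Lop a f)"
  using exhaust_3[of a] by (auto simp: Lop_pd)

section \<open>Homogeneous polynomials, Euler's identity and the Casimir operator\<close>

inductive hpoly :: "nat \<Rightarrow> (vec3 \<Rightarrow> real) \<Rightarrow> bool" where
  hpoly_const: "hpoly 0 (\<lambda>x. c)"
| hpoly_coord_mult: "hpoly n f \<Longrightarrow> hpoly (Suc n) (\<lambda>x. x $ i * f x)"
| hpoly_add: "hpoly n f \<Longrightarrow> hpoly n g \<Longrightarrow> hpoly n (\<lambda>x. f x + g x)"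

lemma hpoly_rpf: "hpoly n f \<Longrightarrow> rpf f"
  by (induction rule: hpoly.induct) auto

lemma hpoly_cmult: "hpoly n f \<Longrightarrow> hpoly n (\<lambda>x. c * f x)"
proof (induction rule: hpoly.induct)
  case (hpoly_const d)
  then show ?case using hpoly.hpoly_const[of "c * d"] by simp
next
  case (hpoly_coord_mult n f i)
  then show ?case using hpoly.hpoly_coord_mult[of n "\<lambda>x. c * f x" i] by (simp add: mult.left_commute)
next
  case (hpoly_add n f g)
  then show ?case using hpoly.hpoly_add by (simp add: distrib_left)
qed

lemma hpoly_zero: "hpoly n (\<lambda>x. 0)"
proof (induction n)
  case 0
  then show ?case by (rule hpoly_const)
next
  case (Suc n)
  then show ?case using hpoly_coord_mult[OF Suc, of 1] by simp
qed

lemma hpoly_minus: "hpoly n f \<Longrightarrow> hpoly n (\<lambda>x. - f x)"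
  using hpoly_cmult[of n f "-1"] by simp

lemma hpoly_diff: "hpoly n f \<Longrightarrow> hpoly n g \<Longrightarrow> hpoly n (\<lambda>x. f x - g x)"
  using hpoly_add[OF _ hpoly_minus, of n f g] by simp

lemma hpoly_mult: "hpoly m f \<Longrightarrow> hpoly n g \<Longrightarrow> hpoly (m + n) (\<lambda>x. f x * g x)"
proof (induction rule: hpoly.induct)
  case (hpoly_const c)
  then show ?case by (simp add: hpoly_cmult)
next
  case (hpoly_coord_mult m f i)
  then show ?case using hpoly.hpoly_coord_mult[of "m + n" "\<lambda>x. f x * g x" i] by (simp add: mult.assoc)
next
  case (hpoly_add m f h)
  then show ?case using hpoly.hpoly_add by (simp add: distrib_right)
qed

lemma hpoly_sum: "(\<And>i. i \<in> I \<Longrightarrow> hpoly n (f i)) \<Longrightarrow> hpoly n (\<lambda>x. \<Sum>i\<in>I. f i x)"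
  by (induction I rule: infinite_finite_induct) (auto simp: hpoly_zero hpoly_add)

lemma hpoly_coord: "hpoly 1 (\<lambda>x. x $ i)"
  using hpoly_coord_mult[OF hpoly_const[of 1], of i] by simp

lemma hpoly_power: "hpoly m f \<Longrightarrow> hpoly (m * n) (\<lambda>x. f x ^ n)"
proof (induction n)
  case 0
  then show ?case using hpoly_const[of 1] by simp
next
  case (Suc n)
  then show ?case using hpoly_mult[of m f "m * n" "\<lambda>x. f x ^ n"] by simp
qed

lemma hpoly_coord_power: "hpoly n (\<lambda>x. x $ i ^ n)"
  using hpoly_power[OF hpoly_coord[of i], of n] by simp

text \<open>The inductive form replaces the array of coefficients, since Euler's identity,
  differentiation and restriction to rotation orbits become plain inductions over multiplication by
  a coordinate.\<close>

lemma hom_poly_imp_hpoly: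
  assumes "hom_poly l P"
  shows "hpoly l P"
proof -
  obtain c where c: "\<And>x. P x = (\<Sum>a\<le>l. \<Sum>b\<le>l - a. c a b * (x$1) ^ a * (x$2) ^ b * (x$3) ^ (l - a - b))"
    using assms unfolding hom_poly_def by blast
  have "hpoly l (\<lambda>x. c a b * (x$1) ^ a * (x$2) ^ b * (x$3) ^ (l - a - b))"
    if "a \<le> l" "b \<le> l - a" for a b
  proof -
    have "hpoly (0 + a + b + (l - a - b)) (\<lambda>x. c a b * (x$1) ^ a * (x$2) ^ b * (x$3) ^ (l - a - b))"
      by (intro hpoly_mult hpoly_coord_power hpoly_const)
    with that show ?thesis by simp
  qed
  then have "hpoly l (\<lambda>x. \<Sum>a\<le>l. \<Sum>b\<le>l - a. c a b * (x$1) ^ a * (x$2) ^ b * (x$3) ^ (l - a - b))"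
    by (intro hpoly_sum) auto
  moreover have "P = (\<lambda>x. \<Sum>a\<le>l. \<Sum>b\<le>l - a. c a b * (x$1) ^ a * (x$2) ^ b * (x$3) ^ (l - a - b))"
    using c by auto
  ultimately show ?thesis by simp
qed

lemma hpoly_scale: "hpoly n f \<Longrightarrow> f (t *\<^sub>R x) = t ^ n * f x"
  by (induction rule: hpoly.induct) (auto simp: algebra_simps)

lemma hpoly_euler: "hpoly n f \<Longrightarrow> (\<Sum>i\<in>UNIV. x $ i * pd i f x) = n * f x"
proof (induction rule: hpoly.induct)
  case (hpoly_coord_mult n f i)
  then have f: "rpf f" by (simp add: hpoly_rpf)
  have "x $ i * (\<Sum>i\<in>UNIV. x $ i * pd i f x) = x $ i * (n * f x)"
    using hpoly_coord_mult by simp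
  then show ?case using f exhaust_3[of i]
    by (auto simp: sum_3 algebra_simps)
next
  case (hpoly_add n f g)
  then have "rpf f" "rpf g" by (simp_all add: hpoly_rpf)
  then show ?case using hpoly_add
    by (auto simp: sum_3 algebra_simps) 
qed auto

lemma hpoly_pd: "hpoly n f \<Longrightarrow> hpoly (n - 1) (pd i f)"
proof (induction rule: hpoly.induct)
  case (hpoly_const c)
  then show ?case by (simp add: hpoly.hpoly_const)
next
  case (hpoly_coord_mult n f j)
  then have f: "rpf f" by (simp add: hpoly_rpf)
  \<comment> \<open>For \<open>n = 0\<close> the truncated degree \<open>n - 1\<close> is again 0,
    and multiplication by a coordinate would give degree 1; there the derivative vanishes, and zero
    is homogeneous of every degree.\<close>
  have "hpoly n (\<lambda>x. x $ j * pd i f x)"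
  proof (cases n)
    case 0
    with hpoly_coord_mult(1) have "pd i f = (\<lambda>x. 0)"
    proof (induction n f rule: hpoly.induct)
      case (hpoly_add n f g)
      then show ?case by (simp add: hpoly_rpf)
    qed auto
    then show ?thesis by (simp add: hpoly_zero)
  next
    case (Suc m)
    with hpoly_coord_mult show ?thesis
      using hpoly.hpoly_coord_mult[of m "pd i f" j] by simp
  qed
  moreover have "hpoly n (\<lambda>x. (if i = j then 1 else 0) * f x)"
    using hpoly_coord_mult by (intro hpoly_cmult)
  ultimately show ?case using f hpoly_add by simp
next
  case (hpoly_add n f g)
  then show ?case by (simp add: hpoly.hpoly_add hpoly_rpf)
qed

lemma hpoly_pd_Suc: "hpoly (Suc n) f \<Longrightarrow> hpoly n (pd i f)"
  using hpoly_pd[of "Suc n"] by simp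

lemma hpoly_0_pd: "hpoly 0 f \<Longrightarrow> pd i f = (\<lambda>x. 0)"
proof (induction "0::nat" f rule: hpoly.induct)
  case (hpoly_add f g)
  then show ?case by (simp add: hpoly_rpf)
qed auto

lemma hpoly_coord_mult_pd: "hpoly n f \<Longrightarrow> hpoly n (\<lambda>x. x $ j * pd i f x)"
proof (cases n)
  case 0
  then show "hpoly n f \<Longrightarrow> hpoly n (\<lambda>x. x $ j * pd i f x)"
    using hpoly_0_pd[of f i] by (simp add: hpoly_zero)
next
  case (Suc m)
  then show "hpoly n f \<Longrightarrow> hpoly n (\<lambda>x. x $ j * pd i f x)"
    by (simp add: hpoly_pd_Suc hpoly_coord_mult)
qed

lemma hpoly_Lop: "hpoly n f \<Longrightarrow> hpoly n (Lop a f)"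
  using exhaust_3[of a] by (auto simp: Lop_pd hpoly_rpf intro!: hpoly_diff hpoly_coord_mult_pd)

definition lap :: "(vec3 \<Rightarrow> real) \<Rightarrow> vec3 \<Rightarrow> real" where
  "lap f = (\<lambda>x. pd 1 (pd 1 f) x + pd 2 (pd 2 f) x + pd 3 (pd 3 f) x)"

text \<open>The Casimir operator of the rotation group; for functions on the unit sphere it is the
  Laplace-Beltrami operator.\<close>

definition Cas :: "(vec3 \<Rightarrow> real) \<Rightarrow> vec3 \<Rightarrow> real" where
  "Cas f = (\<lambda>x. Lop 1 (Lop 1 f) x + Lop 2 (Lop 2 f) x + Lop 3 (Lop 3 f) x)"

definition sqn :: "vec3 \<Rightarrow> real" where
  "sqn x = x$1 * x$1 + x$2 * x$2 + x$3 * x$3"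

lemma rpf_sqn [simp]: "rpf sqn"
  unfolding sqn_def[abs_def] by simp

lemma sqn_eq: "sqn x = (norm x)\<^sup>2"
  by (simp add: sqn_def power2_norm_eq_inner inner_vec_def sum_3)

text \<open>\<open>laplacian\<close> differentiates along coordinate lines with nested one-variable
  \<open>deriv\<close>; this turns each of the two layers into \<open>pd\<close>.\<close>

lemma rpf_line_derivative:
  assumes "rpf P"
  shows "((\<lambda>t. P (x + t *\<^sub>R axis i 1)) has_field_derivative pd i P (x + s *\<^sub>R axis i 1)) (at s)"
proof -
  have 1: "(P has_derivative frechet_derivative P (at (x + s *\<^sub>R axis i 1))) (at (x + s *\<^sub>R axis i 1))"
    using rpf_differentiable[OF assms] frechet_derivative_works by blast
  have 2: "((\<lambda>t. x + t *\<^sub>R axis i 1) has_derivative (\<lambda>t. t *\<^sub>R axis i 1)) (at s)"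
    by (auto intro!: derivative_eq_intros)
  from has_derivative_compose[OF 2 1]
  have "((\<lambda>t. P (x + t *\<^sub>R axis i 1)) has_derivative (\<lambda>t. frechet_derivative P (at (x + s *\<^sub>R axis i 1)) (t *\<^sub>R axis i 1))) (at s)" .
  moreover have "(\<lambda>t. frechet_derivative P (at (x + s *\<^sub>R axis i 1)) (t *\<^sub>R axis i 1)) = (*) (pd i P (x + s *\<^sub>R axis i 1))"
    using linear_frechet_derivative[OF rpf_differentiable[OF assms]]
    by (auto simp: pd_def linear_scale)
  ultimately show ?thesis
    by (simp add: has_field_derivative_def)
qed

lemma laplacian_eq_lap: "rpf P \<Longrightarrow> laplacian P x = lap P x"
  by (simp add: laplacian_def lap_def DERIV_imp_deriv[OF rpf_line_derivative] sum_3)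

lemma hpoly_pd_euler1:
  assumes "hpoly n f"
  shows "x$1 * pd 1 f x + x$2 * pd 2 f x + x$3 * pd 3 f x = n * f x"
  using hpoly_euler[OF assms, of x] by (simp add: sum_3)

lemma hpoly_pd_euler2:
  assumes "hpoly n f"
  shows "x$1 * pd 1 (pd j f) x + x$2 * pd 2 (pd j f) x + x$3 * pd 3 (pd j f) x = (real n - 1) * pd j f x"
proof (cases n)
  case 0
  with assms show ?thesis by (simp add: hpoly_0_pd)
next
  case (Suc m)
  with hpoly_pd_euler1[OF hpoly_pd[OF assms, of j], of x] show ?thesis by simp
qed

text \<open>Polar form of the Laplacian: |x|^2 \<open>lap\<close> is \<open>Cas\<close> plus E (E +
  1), where the Euler operator E acts as \<open>n\<close> on homogeneous polynomials of degree
  \<open>n\<close>.\<close>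

lemma Cas_hpoly:
  assumes "hpoly n f"
  shows "Cas f x = sqn x * lap f x - n * (n + 1) * f x"
proof -
  have f: "rpf f" using assms by (rule hpoly_rpf)
  have e1: "n * f x = x$1 * pd 1 f x + x$2 * pd 2 f x + x$3 * pd 3 f x"
    using hpoly_pd_euler1[OF assms] by simp
  have e3: "(real n - 1) * (n * f x) = x$1 * ((real n - 1) * pd 1 f x) + x$2 * ((real n - 1) * pd 2 f x) + x$3 * ((real n - 1) * pd 3 f x)"
    unfolding e1 by (simp add: distrib_left mult.left_commute)
  have c: "pd 2 (pd 1 f) = pd 1 (pd 2 f)" "pd 3 (pd 1 f) = pd 1 (pd 3 f)" "pd 3 (pd 2 f) = pd 2 (pd 3 f)"
    using pd_commute[OF f] by auto
  \<comment> \<open>In E (E + 1) = E (E - 1) + 2 E the first part is the Hessian contracted twice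
    with x; Euler's identity for \<open>f\<close> and for its derivatives evaluates both
    parts.\<close>
  have "real n * (n + 1) * f x = (real n - 1) * (n * f x) + 2 * (n * f x)" by (simp add: algebra_simps)
  also have "\<dots> = x$1 * (x$1 * pd 1 (pd 1 f) x + x$2 * pd 2 (pd 1 f) x + x$3 * pd 3 (pd 1 f) x)
     + x$2 * (x$1 * pd 1 (pd 2 f) x + x$2 * pd 2 (pd 2 f) x + x$3 * pd 3 (pd 2 f) x)
     + x$3 * (x$1 * pd 1 (pd 3 f) x + x$2 * pd 2 (pd 3 f) x + x$3 * pd 3 (pd 3 f) x)
     + 2 * (x$1 * pd 1 f x + x$2 * pd 2 f x + x$3 * pd 3 f x)"
    using e1 e3 hpoly_pd_euler2[OF assms] by simp
  finally show ?thesis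
    using f by (simp add: Cas_def lap_def sqn_def Lop_pd c algebra_simps)
qed

section \<open>Harmonic polynomials\<close>

definition harmp :: "nat \<Rightarrow> (vec3 \<Rightarrow> real) \<Rightarrow> bool" where
  "harmp k f \<longleftrightarrow> hpoly k f \<and> (\<forall>x. lap f x = 0)"

lemma harmp_hpoly: "harmp k f \<Longrightarrow> hpoly k f"
  by (simp add: harmp_def)

lemma harmp_rpf: "harmp k f \<Longrightarrow> rpf f"
  unfolding harmp_def using hpoly_rpf by blast

lemma harmp_zero: "harmp k (\<lambda>x. 0)"
  by (simp add: harmp_def hpoly_zero lap_def)

lemma harmp_add: "harmp k f \<Longrightarrow> harmp k g \<Longrightarrow> harmp k (\<lambda>x. f x + g x)"
  using harmp_rpf[of k f] harmp_rpf[of k g]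
  by (auto simp: harmp_def hpoly_add lap_def algebra_simps) (smt (verit))

lemma harmp_cmult: "harmp k f \<Longrightarrow> harmp k (\<lambda>x. c * f x)"
  using harmp_rpf[of k f]
  by (auto simp: harmp_def hpoly_cmult lap_def distrib_left[symmetric])

lemma harmp_sum: "(\<And>i. i \<in> I \<Longrightarrow> harmp k (f i)) \<Longrightarrow> harmp k (\<lambda>x. \<Sum>i\<in>I. f i x)"
  by (induction I rule: infinite_finite_induct) (auto simp: harmp_zero harmp_add)

lemma harmp_minus: "harmp k f \<Longrightarrow> harmp k (\<lambda>x. - f x)"
  using harmp_cmult[of k f "-1"] by simp

lemma harmp_diff: "harmp k f \<Longrightarrow> harmp k g \<Longrightarrow> harmp k (\<lambda>x. f x - g x)"
  using harmp_add[OF _ harmp_minus, of k f g] by simp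

lemma lap_pd: "rpf f \<Longrightarrow> lap (pd i f) = pd i (lap f)"
  by (simp add: lap_def pd_commute[of _ i] fun_eq_iff)

lemma harmp_pd: "harmp k f \<Longrightarrow> harmp (k - 1) (pd i f)"
  using harmp_rpf[of k f] pd_const[of i 0]
  by (auto simp: harmp_def hpoly_pd[simplified] lap_pd fun_eq_iff[symmetric])

lemma lap_coord_mult:
  assumes "rpf g" shows "lap (\<lambda>x. x $ i * g x) = (\<lambda>x. 2 * pd i g x + x $ i * lap g x)"
  using exhaust_3[of i] assms by (auto simp: lap_def algebra_simps)

lemma lap_diff: "rpf f \<Longrightarrow> rpf g \<Longrightarrow> lap (\<lambda>x. f x - g x) = (\<lambda>x. lap f x - lap g x)"
  by (simp add: lap_def algebra_simps)

text \<open>The Laplacian commutes with rotations: applied to x_i times one derivative minus x_j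
  times the other, it leaves two mixed second derivatives, which cancel.\<close>

lemma harmp_Lop:
  assumes "harmp k f" shows "harmp k (Lop a f)"
proof -
  have f: "rpf f" using assms by (rule harmp_rpf)
  have l: "lap f = (\<lambda>x. 0)" using assms by (simp add: harmp_def fun_eq_iff)
  have "lap (\<lambda>x. x $ i * pd j f x - x $ j * pd i f x) x = 0" for i j x
    by (simp add: lap_diff lap_coord_mult lap_pd f l pd_commute[OF f, of i j])
  then have "lap (Lop a f) x = 0" for x
    using f exhaust_3[of a] by (auto simp: Lop_pd)
  then show ?thesis
    using assms by (simp add: harmp_def hpoly_Lop)
qed

lemma Cas_harm: "harmp k f \<Longrightarrow> Cas f x = - (real k * (real k + 1)) * f x"
  using Cas_hpoly[of k f x] by (simp add: harmp_def)

lemma Lop_add: "rpf f \<Longrightarrow> rpf g \<Longrightarrow> Lop a (\<lambda>x. f x + g x) = (\<lambda>x. Lop a f x + Lop a g x)"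
  using exhaust_3[of a] by (auto simp: Lop_pd algebra_simps)

lemma Lop_mult: "rpf f \<Longrightarrow> rpf g \<Longrightarrow> Lop a (\<lambda>x. f x * g x) = (\<lambda>x. Lop a f x * g x + f x * Lop a g x)"
  using exhaust_3[of a] by (auto simp: Lop_pd algebra_simps)

lemma Lop_const: "Lop a (\<lambda>x. c) = (\<lambda>x. 0)"
  using exhaust_3[of a] by (auto simp: Lop_pd)

lemma Lop_cmult: "rpf f \<Longrightarrow> Lop a (\<lambda>x. c * f x) = (\<lambda>x. c * Lop a f x)"
  by (simp add: Lop_mult Lop_const)

lemma Cas_add: "rpf f \<Longrightarrow> rpf g \<Longrightarrow> Cas (\<lambda>x. f x + g x) = (\<lambda>x. Cas f x + Cas g x)"
  by (simp add: Cas_def Lop_add algebra_simps)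

lemma Cas_cmult: "rpf f \<Longrightarrow> Cas (\<lambda>x. c * f x) = (\<lambda>x. c * Cas f x)"
  by (simp add: Cas_def Lop_cmult algebra_simps)

lemma Cas_diff:
  assumes "rpf f" "rpf g" shows "Cas (\<lambda>x. f x - g x) = (\<lambda>x. Cas f x - Cas g x)"
  using Cas_add[of f "\<lambda>x. - 1 * g x"] Cas_cmult[of g "- 1"] assms by simp

lemma Cas_sum: "finite I \<Longrightarrow> (\<And>i. i \<in> I \<Longrightarrow> rpf (f i)) \<Longrightarrow> Cas (\<lambda>x. \<Sum>i\<in>I. f i x) = (\<lambda>x. \<Sum>i\<in>I. Cas (f i) x)"
proof (induction I rule: finite_induct)
  case empty
  then show ?case by (simp add: Cas_def Lop_const)
next
  case (insert i I)
  then show ?case by (simp add: Cas_add)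
qed

lemma Lop_sqn: "Lop a sqn = (\<lambda>x. 0)"
proof -
  have p: "pd i sqn = (\<lambda>x. 2 * x $ i)" for i
    unfolding sqn_def[abs_def] using exhaust_3[of i] by (auto simp: fun_eq_iff)
  show ?thesis using exhaust_3[of a] by (auto simp: Lop_pd p)
qed

lemma Lop_sqn_power: "Lop a (\<lambda>x. sqn x ^ j) = (\<lambda>x. 0)"
  by (induction j) (auto simp: Lop_const Lop_mult Lop_sqn)

lemma Cas_sqn_mult: "rpf f \<Longrightarrow> Cas (\<lambda>x. sqn x ^ j * f x) = (\<lambda>x. sqn x ^ j * Cas f x)"
  by (simp add: Cas_def Lop_mult Lop_sqn_power algebra_simps)

lemma hpoly_sqn: "hpoly 2 sqn"
  unfolding sqn_def[abs_def]
  using hpoly_mult[OF hpoly_coord hpoly_coord] by (intro hpoly_add) (simp_all add: numeral_2_eq_2)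

lemma hpoly_lap: "hpoly n f \<Longrightarrow> hpoly (n - 2) (lap f)"
  unfolding lap_def using hpoly_pd[OF hpoly_pd[of n f]]
  by (intro hpoly_add) (simp_all add: numeral_2_eq_2)

text \<open>The Casimir operator acts by the distinct scalars \<open>- k * (k + 1)\<close> on the candidate summands
  \<open>|x|^(2 j) h\<close>, so subtracting from \<open>p\<close> the suitably rescaled decomposition of its Laplacian
  leaves a harmonic polynomial.\<close>

lemma hpoly_harmonic_decomposition:
  assumes "hpoly n p"
  shows "\<exists>h. (\<forall>j. 2 * j \<le> n \<longrightarrow> harmp (n - 2 * j) (h j)) \<and> (\<forall>x. p x = (\<Sum>j\<le>n div 2. sqn x ^ j * h j x))"
  using assms
proof (induction n arbitrary: p rule: less_induct)
  case (less n p)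
  have p: "rpf p" using less.prems by (rule hpoly_rpf)
  show ?case
  proof (cases "n < 2")
    case True
    have "pd i (pd i p) = (\<lambda>x. 0)" for i
    proof -
      have "hpoly 0 (pd i p)" using hpoly_pd[OF less.prems, of i] True by (cases n) auto
      then show ?thesis by (rule hpoly_0_pd)
    qed
    then have "harmp n p" using less.prems by (simp add: harmp_def lap_def)
    moreover have "j = 0" if "2 * j \<le> n" for j using that True by simp
    ultimately show ?thesis using True by (intro exI[of _ "\<lambda>j. p"]) fastforce
  next
    case False
    define N where "N = n div 2 - 1"
    obtain g where g: "\<And>j. 2 * j \<le> n - 2 \<Longrightarrow> harmp (n - 2 - 2 * j) (g j)"
      and lapp: "\<And>x. lap p x = (\<Sum>j\<le>N. sqn x ^ j * g j x)"
    proof -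
      have "n - 2 < n" "(n - 2) div 2 = N" using False by (auto simp: N_def)
      with less.IH[OF this(1) hpoly_lap[OF less.prems]] show ?thesis using that by auto
    qed
    \<comment> \<open>The gap between the eigenvalues in degrees \<open>n\<close> and
      \<open>n - 2 - 2 * j\<close>, positive because the degree drops. Division by it makes
      \<open>Cas\<close> act on \<open>h0\<close> as - n (n + 1), whereupon \<open>Cas_hpoly\<close>
      leaves |x|^2 \<open>lap h0\<close> = 0.\<close>
    define c where "c j = real n * (n + 1) - real (n - 2 - 2 * j) * (real (n - 2 - 2 * j) + 1)" for j
    have cpos: "c j > 0" for j
    proof -
      have "real (n - 2 - 2 * j) * (real (n - 2 - 2 * j) + 1) < real n * (n + 1)"
        using False by (intro mult_strict_mono) auto
      then show ?thesis by (simp add: c_def)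
    qed
    have bound: "2 * j \<le> n - 2" if "j \<le> N" for j
      using that False unfolding N_def by auto
    define h where "h i = (\<lambda>x. (1 / c i) * g i x)" for i
    have hh: "harmp (n - 2 - 2 * j) (h j)" if "j \<le> N" for j
      unfolding h_def by (intro harmp_cmult g bound that)
    define r where "r x = (\<Sum>j\<le>N. sqn x ^ Suc j * h j x)" for x
    define h0 where "h0 x = p x - r x" for x
    have rr: "rpf (\<lambda>x. sqn x ^ Suc j * h j x)" if "j \<le> N" for j
      using harmp_rpf[OF hh[OF that]] by (intro rpf_mult rpf_power rpf_sqn)
    have "hpoly n (\<lambda>x. sqn x ^ Suc j * h j x)" if "j \<le> N" for j
    proof -
      have "2 * Suc j + (n - 2 - 2 * j) = n" using bound[OF that] False by simp
      with hpoly_mult[OF hpoly_power[OF hpoly_sqn, of "Suc j"] harmp_hpoly[OF hh[OF that]]]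
      show ?thesis by metis
    qed
    then have rh: "hpoly n r" unfolding r_def by (intro hpoly_sum) auto
    then have h0: "hpoly n h0" unfolding h0_def using less.prems by (intro hpoly_diff)
    define k where "k j = real (n - 2 - 2 * j) * (real (n - 2 - 2 * j) + 1)" for j
    have Ch: "Cas (\<lambda>x. sqn x ^ Suc j * h j x) x = - k j * (sqn x ^ Suc j * h j x)" if "j \<le> N" for j x
      by (simp add: Cas_sqn_mult[OF harmp_rpf[OF hh[OF that]], of "Suc j"] Cas_harm[OF hh[OF that]] k_def del: power_Suc)
    have "Cas r = (\<lambda>x. \<Sum>j\<le>N. Cas (\<lambda>x. sqn x ^ Suc j * h j x) x)"
      unfolding r_def[abs_def] by (rule Cas_sum) (auto simp: rr simp del: power_Suc)
    then have Cr: "Cas r x = (\<Sum>j\<le>N. - k j * (sqn x ^ Suc j * h j x))" for x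
      using Ch by simp
    have "Cas h0 x = - (real n * (real n + 1)) * h0 x" for x
    proof -
      have "Cas h0 x = Cas p x - Cas r x"
        unfolding h0_def[abs_def] using p hpoly_rpf[OF rh] by (simp add: Cas_diff)
      also have "Cas p x = sqn x * lap p x - real n * (real n + 1) * p x"
        using Cas_hpoly[OF less.prems] .
      also have "sqn x * lap p x = (\<Sum>j\<le>N. c j * (sqn x ^ Suc j * h j x))"
        unfolding lapp sum_distrib_left h_def
      proof (intro sum.cong refl)
        fix j show "sqn x * (sqn x ^ j * g j x) = c j * (sqn x ^ Suc j * (1 / c j * g j x))"
          using cpos[of j] by simp
      qed
      finally have A: "Cas h0 x = (\<Sum>j\<le>N. c j * (sqn x ^ Suc j * h j x)) + (\<Sum>j\<le>N. k j * (sqn x ^ Suc j * h j x)) - real n * (real n + 1) * p x"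
        unfolding Cr by (simp add: sum_negf del: power_Suc)
      have B: "(\<Sum>j\<le>N. c j * (sqn x ^ Suc j * h j x)) + (\<Sum>j\<le>N. k j * (sqn x ^ Suc j * h j x)) = real n * (real n + 1) * r x"
        unfolding sum.distrib[symmetric] r_def sum_distrib_left
      proof (intro sum.cong refl)
        fix j
        have "real n * (real n + 1) = c j + k j" by (simp add: c_def k_def)
        then show "c j * (sqn x ^ Suc j * h j x) + k j * (sqn x ^ Suc j * h j x) = real n * (real n + 1) * (sqn x ^ Suc j * h j x)"
          by (simp only: distrib_right)
      qed
      have "real n * (real n + 1) * h0 x = real n * (real n + 1) * p x - real n * (real n + 1) * r x"
        by (simp only: h0_def right_diff_distrib)
      with A B show ?thesis by (simp only: minus_mult_left[symmetric])
    qed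
    then have "sqn x * lap h0 x = 0" for x
      using Cas_hpoly[OF h0, of x] by simp
    then have l: "lap h0 x = 0" if "x \<noteq> 0" for x
      using that by (auto simp: sqn_eq)
    \<comment> \<open>At the origin the factor |x|^2 hides the value; homogeneity carries it over
      from a unit vector, also in degree 0.\<close>
    have "lap h0 (0 *\<^sub>R axis 1 1) = 0"
      unfolding hpoly_scale[OF hpoly_lap[OF h0]] using l[of "axis 1 1"] by simp
    then have "lap h0 x = 0" for x using l[of x] by (cases "x = 0") auto
    then have hh0: "harmp n h0" using h0 by (simp add: harmp_def)
    define H where "H j = (case j of 0 \<Rightarrow> h0 | Suc i \<Rightarrow> h i)" for j
    have "harmp (n - 2 * j) (H j)" if "2 * j \<le> n" for j
    proof (cases j)
      case 0
      then show ?thesis using hh0 by (simp add: H_def)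
    next
      case (Suc i)
      then have "i \<le> N" using that False unfolding N_def by auto
      from hh[OF this] show ?thesis using Suc by (simp add: H_def)
    qed
    moreover have "p x = (\<Sum>j\<le>n div 2. sqn x ^ j * H j x)" for x
    proof -
      have "n div 2 = Suc N" using False unfolding N_def by auto
      then show ?thesis by (simp add: sum.atMost_Suc_shift H_def h0_def r_def del: sum.atMost_Suc)
    qed
    ultimately show ?thesis by blast
  qed
qed

section \<open>Restrictions of polynomials to the sphere as sums of harmonics\<close>

inductive hsum :: "(vec3 \<Rightarrow> real) \<Rightarrow> bool" where
  hsum_hpoly: "hpoly n f \<Longrightarrow> hsum f"
| hsum_add: "hsum f \<Longrightarrow> hsum g \<Longrightarrow> hsum (\<lambda>x. f x + g x)"

lemma hsum_mult:
  assumes "hsum f" "hsum g" shows "hsum (\<lambda>x. f x * g x)"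
  using assms(1)
proof induction
  case (hsum_hpoly n f)
  show ?case using assms(2)
  proof induction
    case (hsum_hpoly m g)
    show ?case using hpoly_mult[OF \<open>hpoly n f\<close> hsum_hpoly] by (rule hsum.hsum_hpoly)
  next
    case (hsum_add g h)
    then show ?case by (simp add: distrib_left hsum.hsum_add)
  qed
next
  case (hsum_add f h)
  then show ?case by (simp add: distrib_right hsum.hsum_add)
qed

lemma rpf_hsum: "rpf f \<Longrightarrow> hsum f"
proof (induction rule: rpf_induct)
  case (coord i)
  then show ?case using hpoly_coord by (rule hsum_hpoly)
next
  case (const c)
  then show ?case using hpoly_const by (rule hsum_hpoly)
qed (auto intro: hsum_add hsum_mult)

text \<open>On the unit sphere the factors |x|^(2 j) of the harmonic decomposition are 1, so every
  polynomial agrees there with a finite sum of harmonics; the case \<open>cong\<close> expresses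
  this passage to restrictions.\<close>

lemma sphere_harmonic_induct [consumes 1, case_names harmp add cong]:
  assumes f: "rpf f"
    and H: "\<And>k h. harmp k h \<Longrightarrow> P h"
    and A: "\<And>f g. P f \<Longrightarrow> P g \<Longrightarrow> P (\<lambda>x. f x + g x)"
    and C: "\<And>f g. P f \<Longrightarrow> (\<And>x. norm x = 1 \<Longrightarrow> g x = f x) \<Longrightarrow> P g"
  shows "P f"
  using rpf_hsum[OF f]
proof induction
  case (hsum_hpoly n p)
  obtain h where h: "\<And>j. 2 * j \<le> n \<Longrightarrow> harmp (n - 2 * j) (h j)"
    and p: "\<And>x. p x = (\<Sum>j\<le>n div 2. sqn x ^ j * h j x)"
    using hpoly_harmonic_decomposition[OF hsum_hpoly] by blast
  have "P (\<lambda>x. \<Sum>j\<in>J. h j x)" if "finite J" "J \<subseteq> {..n div 2}" for J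
    using that
  proof (induction J rule: finite_induct)
    case empty
    show ?case using H[OF harmp_zero] by simp
  next
    case (insert j J)
    then have "2 * j \<le> n" by auto
    with insert show ?case by (simp add: A H[OF h])
  qed
  from this[of "{..n div 2}"] show ?case
    by (rule C) (auto simp: p sqn_eq)
qed (rule A)

section \<open>Dimension bound for harmonic polynomials of a given degree\<close>

lemma exists_nontrivial_combination:
  fixes v :: "'a \<Rightarrow> 'b \<Rightarrow> real"
  assumes "finite J" "finite I" "card J < card I"
  shows "\<exists>w. (\<exists>i\<in>I. w i \<noteq> 0) \<and> (\<forall>j\<in>J. (\<Sum>i\<in>I. w i * v i j) = 0)"
  using assms
proof (induction J arbitrary: I v rule: finite_induct)
  case empty
  then have "I \<noteq> {}" by auto
  then show ?case by (intro exI[of _ "\<lambda>i. 1"]) auto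
next
  case (insert j J)
  show ?case
  proof (cases "\<exists>p\<in>I. v p j \<noteq> 0")
    case False
    have "card J < card I" using insert by simp
    from insert.IH[OF insert.prems(1) this, of v] obtain w where
      "(\<exists>i\<in>I. w i \<noteq> 0)" "\<forall>j\<in>J. (\<Sum>i\<in>I. w i * v i j) = 0" by blast
    moreover have "(\<Sum>i\<in>I. w i * v i j) = 0" using False by (intro sum.neutral) auto
    ultimately show ?thesis by blast
  next
    case True
    then obtain p where p: "p \<in> I" "v p j \<noteq> 0" by blast
    define I' where "I' = I - {p}"
    have I': "I = insert p I'" "p \<notin> I'" "finite I'" using p insert.prems by (auto simp: I'_def)
    have "card J < card I'" using insert p I' by simp
    from insert.IH[OF I'(3) this, of "\<lambda>i k. v i k - v i j / v p j * v p k"] obtain \<mu> where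
      mu: "\<exists>i\<in>I'. \<mu> i \<noteq> 0" "\<And>k. k \<in> J \<Longrightarrow> (\<Sum>i\<in>I'. \<mu> i * (v i k - v i j / v p j * v p k)) = 0" by blast
    \<comment> \<open>The coefficient of the pivot solves equation \<open>j\<close>; its
      contribution to every other equation is already contained in the modified coefficients passed
      to the induction hypothesis.\<close>
    define lp where "lp = - (\<Sum>i\<in>I'. \<mu> i * v i j / v p j)"
    define w where "w = \<mu>(p := lp)"
    have s: "(\<Sum>i\<in>I. w i * v i k) = lp * v p k + (\<Sum>i\<in>I'. \<mu> i * v i k)" for k
      unfolding I'(1) using I'(2,3) by (auto simp: w_def intro!: sum.cong)
    have "(\<Sum>i\<in>I. w i * v i j) = 0"
      unfolding s lp_def using p by (simp add: sum_distrib_right sum_negf)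
    moreover have "(\<Sum>i\<in>I. w i * v i k) = 0" if "k \<in> J" for k
    proof -
      have "(\<Sum>i\<in>I'. \<mu> i * (v i k - v i j / v p j * v p k)) = lp * v p k + (\<Sum>i\<in>I'. \<mu> i * v i k)"
        unfolding lp_def by (simp add: sum_distrib_right sum_subtractf right_diff_distrib mult.assoc)
      with mu(2)[OF that] s show ?thesis by simp
    qed
    moreover have "\<exists>i\<in>I. w i \<noteq> 0" using mu(1) I' by (auto simp: w_def)
    ultimately show ?thesis by blast
  qed
qed

lemma pd_zero_on_plane:
  assumes "rpf f" "\<And>x. x $ 3 = 0 \<Longrightarrow> f x = 0" "x $ 3 = 0" "i \<noteq> 3"
  shows "pd i f x = 0"
proof -
  have "(\<lambda>t. f (x + t *\<^sub>R axis i 1)) = (\<lambda>t. 0)"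
    using assms by (auto simp: axis_def)
  with rpf_line_derivative[OF assms(1), of x i 0] have "((\<lambda>t::real. 0::real) has_field_derivative pd i f x) (at 0)"
    by simp
  then show ?thesis using DERIV_unique DERIV_const by blast
qed

text \<open>Uniqueness for the Cauchy problem on the plane x_3 = 0. The normal derivative satisfies
  the same hypotheses one degree lower, because its own normal derivative is minus the tangential
  second derivatives of \<open>f\<close>, which vanish on the plane; hence \<open>f\<close> does not
  depend on x_3.\<close>

lemma harmp_unique_on_plane:
  assumes "harmp l f" "\<And>x. x $ 3 = 0 \<Longrightarrow> f x = 0" "\<And>x. x $ 3 = 0 \<Longrightarrow> pd 3 f x = 0"
  shows "f x = 0"
  using assms
proof (induction l arbitrary: f x)
  case 0
  from hpoly_scale[OF harmp_hpoly[OF 0(1)], of 0 x] 0(2)[of 0] show ?case by simp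
next
  case (Suc l)
  have f: "rpf f" using Suc.prems(1) by (rule harmp_rpf)
  have "pd 3 f y = 0" for y
  proof (rule Suc.IH)
    show "harmp l (pd 3 f)" using harmp_pd[OF Suc.prems(1)] by simp
    show "pd 3 f x = 0" if "x $ 3 = 0" for x using Suc.prems(3) that .
    show "pd 3 (pd 3 f) x = 0" if "x $ 3 = 0" for x
    proof -
      have "pd i (pd i f) x = 0" if "i \<noteq> 3" for i
        using that \<open>x $ 3 = 0\<close> f Suc.prems(2) by (intro pd_zero_on_plane) (auto intro: pd_zero_on_plane)
      from this[of 1] this[of 2] show ?thesis using Suc.prems(1) by (simp add: harmp_def lap_def) (smt (verit))
    qed
  qed
  then have "((\<lambda>t. f (x + t *\<^sub>R axis 3 1)) has_field_derivative 0) (at s)" for s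
    using rpf_line_derivative[OF f, of x 3 s] by simp
  then have "f (x + 0 *\<^sub>R axis 3 1) = f (x + (- x $ 3) *\<^sub>R axis 3 1)"
    by (rule DERIV_isconst_all[OF allI])
  also have "\<dots> = 0" by (rule Suc.prems(2)) (simp add: axis_def)
  finally show ?case by simp
qed

lemma hpoly_plane:
  assumes "hpoly l f"
  shows "\<exists>c. \<forall>x. x $ 3 = 0 \<longrightarrow> f x = (\<Sum>a\<le>l. c a * (x $ 1 ^ a * x $ 2 ^ (l - a)))"
  using assms
proof induction
  case (hpoly_const c)
  show ?case by (rule exI[of _ "\<lambda>_. c"]) simp
next
  case (hpoly_add n f g)
  then obtain c d where "\<forall>x. x $ 3 = 0 \<longrightarrow> f x = (\<Sum>a\<le>n. c a * (x $ 1 ^ a * x $ 2 ^ (n - a)))"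
    "\<forall>x. x $ 3 = 0 \<longrightarrow> g x = (\<Sum>a\<le>n. d a * (x $ 1 ^ a * x $ 2 ^ (n - a)))" by blast
  then show ?case by (intro exI[of _ "\<lambda>a. c a + d a"]) (simp add: distrib_right sum.distrib)
next
  case (hpoly_coord_mult n f i)
  then obtain c where c: "\<forall>x. x $ 3 = 0 \<longrightarrow> f x = (\<Sum>a\<le>n. c a * (x $ 1 ^ a * x $ 2 ^ (n - a)))" by blast
  consider "i = 1" | "i = 2" | "i = 3" using exhaust_3 by blast
  then show ?case
  proof cases
    case 1
    have "x $ 1 * f x = (\<Sum>a\<le>Suc n. (case a of 0 \<Rightarrow> 0 | Suc b \<Rightarrow> c b) * (x $ 1 ^ a * x $ 2 ^ (Suc n - a)))" if "x $ 3 = 0" for x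
      using c that by (simp add: sum.atMost_Suc_shift sum_distrib_left algebra_simps del: sum.atMost_Suc)
    then show ?thesis using 1 by blast
  next
    case 2
    have "x $ 2 * f x = (\<Sum>a\<le>Suc n. (if a \<le> n then c a else 0) * (x $ 1 ^ a * x $ 2 ^ (Suc n - a)))" if "x $ 3 = 0" for x
    proof -
      have "x $ 2 * f x = (\<Sum>a\<le>n. c a * (x $ 1 ^ a * x $ 2 ^ (Suc n - a)))"
        using c that by (simp add: sum_distrib_left Suc_diff_le mult.left_commute)
      then show ?thesis by simp
    qed
    then show ?thesis using 2 by (intro exI[of _ "\<lambda>a. if a \<le> n then c a else 0"]) blast
  next
    case 3
    then show ?thesis by (intro exI[of _ "\<lambda>_. 0"]) auto
  qed
qed

text \<open>The Cauchy data on the plane are homogeneous polynomials in two variables with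
  \<open>l + 1\<close> and \<open>l\<close> coefficients, so any 2 l + 2 harmonic polynomials, here
  the given ones and \<open>f\<close>, satisfy a linear relation. Independence forces the
  coefficient of \<open>f\<close> in it to be nonzero.\<close>

lemma harmp_span:
  fixes P :: "'a \<Rightarrow> vec3 \<Rightarrow> real"
  assumes M: "finite M" "card M = 2 * l + 1"
    and P: "\<And>m. m \<in> M \<Longrightarrow> harmp l (P m)"
    and indep: "\<And>w. (\<And>x. (\<Sum>m\<in>M. w m * P m x) = 0) \<Longrightarrow> (\<And>m. m \<in> M \<Longrightarrow> w m = 0)"
    and f: "harmp l f"
  shows "\<exists>c. \<forall>x. f x = (\<Sum>m\<in>M. c m * P m x)"
proof -
  define g where "g i = (case i of None \<Rightarrow> f | Some m \<Rightarrow> P m)" for i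
  define I where "I = insert None (Some ` M)"
  have I: "finite I" "card I = 2 * l + 2"
    using M by (auto simp: I_def card_insert_if card_image)
  have g: "harmp l (g i)" if "i \<in> I" for i using that P f by (auto simp: g_def I_def)
  have "\<forall>i. \<exists>c. i \<in> I \<longrightarrow> (\<forall>x. x $ 3 = 0 \<longrightarrow> g i x = (\<Sum>a\<le>l. c a * (x $ 1 ^ a * x $ 2 ^ (l - a))))"
    using hpoly_plane[OF harmp_hpoly[OF g]] by blast
  from choice[OF this] obtain c where c: "\<And>i x. i \<in> I \<Longrightarrow> x $ 3 = 0 \<Longrightarrow> g i x = (\<Sum>a\<le>l. c i a * (x $ 1 ^ a * x $ 2 ^ (l - a)))"
    by blast
  have "\<forall>i. \<exists>d. i \<in> I \<longrightarrow> (\<forall>x. x $ 3 = 0 \<longrightarrow> pd 3 (g i) x = (\<Sum>a\<le>l - 1. d a * (x $ 1 ^ a * x $ 2 ^ (l - 1 - a))))"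
    using hpoly_plane[OF harmp_hpoly[OF harmp_pd[OF g]]] by blast
  from choice[OF this] obtain d where d: "\<And>i x. i \<in> I \<Longrightarrow> x $ 3 = 0 \<Longrightarrow> pd 3 (g i) x = (\<Sum>a\<le>l - 1. d i a * (x $ 1 ^ a * x $ 2 ^ (l - 1 - a)))"
    by blast
  \<comment> \<open>One list of 2 l + 1 equations: indices up to \<open>l\<close> for the values on
    the plane, the following \<open>l\<close> for the normal derivative.\<close>
  define v where "v i j = (if j \<le> l then c i j else d i (j - l - 1))" for i j
  have "card {..<2 * l + 1} < card I" using I by simp
  then obtain w where nz: "\<exists>i\<in>I. w i \<noteq> 0" and z: "\<And>j. j < 2 * l + 1 \<Longrightarrow> (\<Sum>i\<in>I. w i * v i j) = 0"
    using exists_nontrivial_combination[OF finite_lessThan I(1), of "2 * l + 1" v] by auto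
  define F where "F x = (\<Sum>i\<in>I. w i * g i x)" for x
  have F: "harmp l F" unfolding F_def using g by (intro harmp_sum harmp_cmult) auto
  have F0: "F x = 0" if "x $ 3 = 0" for x
  proof -
    have "F x = (\<Sum>i\<in>I. \<Sum>a\<le>l. (w i * v i a) * (x $ 1 ^ a * x $ 2 ^ (l - a)))"
      unfolding F_def by (intro sum.cong refl) (simp add: c that v_def sum_distrib_left mult.assoc)
    also have "\<dots> = (\<Sum>a\<le>l. (\<Sum>i\<in>I. w i * v i a) * (x $ 1 ^ a * x $ 2 ^ (l - a)))"
      by (subst sum.swap) (simp add: sum_distrib_right)
    also have "\<dots> = 0" by (intro sum.neutral) (auto simp: z)
    finally show ?thesis .
  qed
  have F1: "pd 3 F x = 0" if "x $ 3 = 0" for x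
  \<comment> \<open>For \<open>l = 0\<close> the truncated \<open>l - 1\<close> would ask for one
    coefficient more than there are equations, so the derivative of a constant is treated
    apart.\<close>
  proof (cases "l = 0")
    case True
    with F have "hpoly 0 F" by (simp add: harmp_def)
    then show ?thesis by (simp add: hpoly_0_pd)
  next
    case False
    have "pd 3 F x = (\<Sum>i\<in>I. w i * pd 3 (g i) x)"
      unfolding F_def[abs_def] using harmp_rpf[OF g] by (simp add: pd_mult)
    also have "\<dots> = (\<Sum>i\<in>I. \<Sum>a\<le>l - 1. (w i * v i (Suc l + a)) * (x $ 1 ^ a * x $ 2 ^ (l - 1 - a)))"
      by (intro sum.cong refl) (simp add: d that v_def sum_distrib_left mult.assoc)
    also have "\<dots> = (\<Sum>a\<le>l - 1. (\<Sum>i\<in>I. w i * v i (Suc l + a)) * (x $ 1 ^ a * x $ 2 ^ (l - 1 - a)))"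
      by (subst sum.swap) (simp add: sum_distrib_right)
    also have "\<dots> = 0"
    proof (intro sum.neutral ballI)
      fix a assume "a \<in> {..l - 1}"
      then have "(\<Sum>i\<in>I. w i * v i (Suc l + a)) = 0" using False by (intro z) auto
      then show "(\<Sum>i\<in>I. w i * v i (Suc l + a)) * (x $ 1 ^ a * x $ 2 ^ (l - 1 - a)) = 0" by simp
    qed
    finally show ?thesis .
  qed
  have Fz: "F x = 0" for x using harmp_unique_on_plane[OF F F0 F1] .
  have Fs: "F x = w None * f x + (\<Sum>m\<in>M. w (Some m) * P m x)" for x
    unfolding F_def I_def using M by (subst sum.insert) (auto simp: g_def sum.reindex)
  have "w None \<noteq> 0"
  proof
    assume 0: "w None = 0"
    then have "w (Some m) = 0" if "m \<in> M" for m
      using indep[of "\<lambda>m. w (Some m)"] Fs Fz that by simp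
    with 0 nz show False by (auto simp: I_def)
  qed
  then have "f x = (\<Sum>m\<in>M. (- w (Some m) / w None) * P m x)" for x
    using Fs[of x] Fz[of x] by (simp add: sum_divide_distrib[symmetric] sum_negf field_simps)
  then show ?thesis by (intro exI[of _ "\<lambda>m. - w (Some m) / w None"]) blast
qed

section \<open>Surface measure and rotations\<close>

lemma lborel_distr_orthogonal:
  fixes T :: "vec3 \<Rightarrow> vec3"
  assumes T: "orthogonal_transformation T"
  shows "distr lborel borel T = lborel"
proof (rule lborel_eqI[symmetric])
  have lin: "linear T" using T by (rule orthogonal_transformation_linear)
  then have cont: "continuous_on UNIV T" by (rule linear_continuous_on[OF linear_conv_bounded_linear[THEN iffD1]])
  have meas[measurable]: "T \<in> borel_measurable borel"
    using cont by (rule borel_measurable_continuous_onI)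
  fix l u :: vec3
  assume le: "\<And>b. b \<in> Basis \<Longrightarrow> l \<bullet> b \<le> u \<bullet> b"
  have inv: "orthogonal_transformation (inv T)" using T by (rule orthogonal_transformation_inv)
  have bij: "bij T" using T by (rule orthogonal_transformation_bij)
  have vim: "T -` box l u = inv T ` box l u"
    using bij by (rule bij_vimage_eq_inv_image)
  have lm: "box l u \<in> lmeasurable" by simp
  have "emeasure (distr lborel borel T) (box l u) = emeasure lborel (T -` box l u)"
    by (subst emeasure_distr) auto
  also have "\<dots> = emeasure lebesgue (T -` box l u)"
    using measurable_sets[OF meas, of "box l u"] by (simp add: emeasure_completion)
  also have "\<dots> = ennreal (measure lebesgue (inv T ` box l u))"
    unfolding vim using measurable_orthogonal_image[OF inv lm] by (simp add: emeasure_eq_measure2)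
  also have "measure lebesgue (inv T ` box l u) = measure lebesgue (box l u)"
    by (rule measure_orthogonal_image[OF inv lm])
  also have "\<dots> = (\<Prod>b\<in>Basis. (u - l) \<bullet> b)"
    using le by (simp add: measure_lborel_box_eq)
  finally show "emeasure (distr lborel borel T) (box l u) = (\<Prod>b\<in>Basis. (u - l) \<bullet> b)" .
qed simp

abbreviation "\<sigma> \<equiv> sphere_measure"

definition unit_cone :: "vec3 measure" where
  "unit_cone = restrict_space lborel {x. 0 < norm x \<and> norm x \<le> 1}"

lemma sets_unit_cone: "{x :: vec3. 0 < norm x \<and> norm x \<le> 1} \<in> sets borel"
  by measurable

lemma space_unit_cone: "space unit_cone = {x. 0 < norm x \<and> norm x \<le> 1}"
  by (simp add: unit_cone_def space_restrict_space)

lemma emeasure_unit_cone: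
  "emeasure unit_cone (space unit_cone) = emeasure lborel {x :: vec3. 0 < norm x \<and> norm x \<le> 1}"
  unfolding space_unit_cone unfolding unit_cone_def
  by (rule emeasure_restrict_space) (use sets_unit_cone in auto)

lemma measurable_normalize: "(\<lambda>x. x /\<^sub>R norm x) \<in> unit_cone \<rightarrow>\<^sub>M restrict_space borel (sphere 0 1)"
proof (rule measurable_restrict_space2)
  show "(\<lambda>x. x /\<^sub>R norm x) \<in> space unit_cone \<rightarrow> sphere 0 1"
    by (auto simp: space_unit_cone)
  show "(\<lambda>x. x /\<^sub>R norm x) \<in> borel_measurable unit_cone"
    unfolding unit_cone_def by (rule measurable_restrict_space1) measurable
qed

text \<open>\<open>measure_of\<close> keeps the given set function only if it is a measure. Writing
  it as a scaled image of Lebesgue measure under radial projection of the punctured ball settles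
  this, and later transfers rotation invariance to the sphere.\<close>

lemma sphere_measure_eq:
  "\<sigma> = scale_measure 3 (distr unit_cone (restrict_space borel (sphere 0 1)) (\<lambda>x. x /\<^sub>R norm x))"
  (is "_ = ?M")
proof -
  let ?R = "restrict_space borel (sphere 0 1) :: vec3 measure"
  have sp: "space ?M = sphere 0 1" "sets ?M = sets ?R"
    by (auto simp: space_scale_measure space_restrict_space)
  have "\<sigma> = measure_of (sphere 0 1) (sets ?R) (emeasure ?M)"
    unfolding sphere_measure_def
  proof (rule measure_of_eq)
    show "sets ?R \<subseteq> Pow (sphere 0 1)"
      using sets.space_closed[of ?R] by (simp add: space_restrict_space)
    fix A assume "A \<in> sigma_sets (sphere 0 1) (sets ?R)"
    then have A: "A \<in> sets ?R"
      using sets.sigma_sets_eq[of ?R] by (simp add: space_restrict_space)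
    have "(\<lambda>x. x /\<^sub>R norm x) -` A \<inter> space unit_cone \<in> sets unit_cone"
      using measurable_sets[OF measurable_normalize A] .
    then have "emeasure ?M A = 3 * emeasure unit_cone ((\<lambda>x. x /\<^sub>R norm x) -` A \<inter> space unit_cone)"
      using A by (simp add: emeasure_distr[OF measurable_normalize])
    also have "(\<lambda>x. x /\<^sub>R norm x) -` A \<inter> space unit_cone = {x. 0 < norm x \<and> norm x \<le> 1 \<and> x /\<^sub>R norm x \<in> A}"
      by (auto simp: space_unit_cone)
    also have "emeasure unit_cone \<dots> = emeasure lborel {x. 0 < norm x \<and> norm x \<le> 1 \<and> x /\<^sub>R norm x \<in> A}"
      unfolding unit_cone_def by (rule emeasure_restrict_space) (use sets_unit_cone in auto)
    finally show "3 * emeasure lborel {x. 0 < norm x \<and> norm x \<le> 1 \<and> x /\<^sub>R norm x \<in> A} = emeasure ?M A"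
      by simp
  qed
  also have "\<dots> = ?M" using measure_of_of_measure[of ?M] by (simp add: sp)
  finally show ?thesis .
qed

lemma space_sigma [simp]: "space \<sigma> = sphere 0 1"
  by (simp add: sphere_measure_eq space_scale_measure space_restrict_space)

lemma sets_sigma [measurable_cong]: "sets \<sigma> = sets (restrict_space borel (sphere 0 1))"
  by (simp add: sphere_measure_eq)

lemma emeasure_sigma_space: "emeasure \<sigma> (sphere 0 1) = 3 * emeasure unit_cone (space unit_cone)"
proof -
  let ?R = "restrict_space borel (sphere 0 1) :: vec3 measure"
  have "(\<lambda>x. x /\<^sub>R norm x) -` space ?R \<inter> space unit_cone = space unit_cone"
    using measurable_space[OF measurable_normalize] by auto
  then show ?thesis
    unfolding sphere_measure_eq
    using emeasure_distr[OF measurable_normalize sets.top]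
    by (simp add: space_restrict_space)
qed

lemma finite_measure_sigma: "finite_measure \<sigma>"
proof
  have "emeasure unit_cone (space unit_cone) \<le> emeasure lborel (cball (0 :: vec3) 1)"
    unfolding emeasure_unit_cone by (rule emeasure_mono) auto
  also have "\<dots> < \<infinity>" by (rule emeasure_lborel_cball_finite)
  finally show "emeasure \<sigma> (space \<sigma>) \<noteq> \<infinity>" 
    by (auto simp: emeasure_sigma_space ennreal_mult_eq_top_iff less_top[symmetric])
qed

interpretation sigma: finite_measure \<sigma>
  by (rule finite_measure_sigma)

text \<open>An orthogonal map preserves Lebesgue measure on the punctured ball and commutes with
  radial projection.\<close>

lemma distr_sigma_orthogonal:
  assumes T: "orthogonal_transformation T"
  shows "distr \<sigma> \<sigma> T = \<sigma>"
proof -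
  let ?R = "restrict_space borel (sphere 0 1) :: vec3 measure" and ?n = "\<lambda>x::vec3. x /\<^sub>R norm x"
  have lin: "linear T" using T by (rule orthogonal_transformation_linear)
  have nT: "norm (T x) = norm x" for x using T by (rule orthogonal_transformation_norm)
  then have T0: "T x = 0 \<longleftrightarrow> x = 0" for x by (metis norm_eq_zero)
  have cont: "continuous_on UNIV T" using lin by (rule linear_continuous_on[OF linear_conv_bounded_linear[THEN iffD1]])
  have meas: "T \<in> borel_measurable borel"
    using cont by (rule borel_measurable_continuous_onI)
  have mR: "T \<in> ?R \<rightarrow>\<^sub>M ?R"
    using meas by (intro measurable_restrict_space2 measurable_restrict_space1) (auto simp: space_restrict_space nT T0)
  have mC: "T \<in> unit_cone \<rightarrow>\<^sub>M unit_cone"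
    unfolding unit_cone_def
    using meas by (intro measurable_restrict_space2 measurable_restrict_space1) (auto simp: space_restrict_space nT T0)
  have C: "distr unit_cone unit_cone T = unit_cone"
  proof (rule measure_eqI)
    fix A assume "A \<in> sets (distr unit_cone unit_cone T)"
    then have A: "A \<in> sets unit_cone" by simp
    then have A': "A \<in> sets borel" "A \<subseteq> {x. 0 < norm x \<and> norm x \<le> 1}"
      using sets_unit_cone by (auto simp: unit_cone_def sets_restrict_space_iff)
    have eqs: "T -` A \<inter> space unit_cone = T -` A" using A'(2) nT T0 by (auto simp: space_unit_cone)
    have "emeasure (distr unit_cone unit_cone T) A = emeasure unit_cone (T -` A)"
      using A by (simp add: emeasure_distr[OF mC] eqs)
    also have "\<dots> = emeasure lborel (T -` A)"
      unfolding unit_cone_def using sets_unit_cone A'(2) nT T0[of 0] by (intro emeasure_restrict_space) auto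
    also have "\<dots> = emeasure (distr lborel borel T) A"
      using A'(1) meas by (simp add: emeasure_distr)
    also have "\<dots> = emeasure unit_cone A"
      unfolding lborel_distr_orthogonal[OF T] unit_cone_def
      using sets_unit_cone A'(2) by (intro emeasure_restrict_space[symmetric]) auto
    finally show "emeasure (distr unit_cone unit_cone T) A = emeasure unit_cone A" .
  qed simp
  have nm: "?n (T x) = T (?n x)" for x using lin nT by (simp add: linear_scale)
  have D: "distr (distr unit_cone ?R ?n) ?R T = distr unit_cone ?R ?n"
  proof -
    have "distr (distr unit_cone ?R ?n) ?R T = distr unit_cone ?R (T \<circ> ?n)"
      by (rule distr_distr[OF mR measurable_normalize])
    also have "\<dots> = distr unit_cone ?R (?n \<circ> T)"
      by (rule distr_cong) (auto simp: nm)
    also have "\<dots> = distr (distr unit_cone unit_cone T) ?R ?n"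
      by (rule distr_distr[OF measurable_normalize mC, symmetric])
    finally show ?thesis unfolding C .
  qed
  show ?thesis
  proof (rule measure_eqI)
    fix A assume "A \<in> sets (distr \<sigma> \<sigma> T)"
    then have A: "A \<in> sets ?R" by (simp add: sets_sigma)
    have mS: "T \<in> \<sigma> \<rightarrow>\<^sub>M \<sigma>" using mR by (simp add: measurable_cong_sets[OF sets_sigma sets_sigma])
    have "emeasure (distr \<sigma> \<sigma> T) A = emeasure \<sigma> (T -` A \<inter> space \<sigma>)"
      using A by (simp add: emeasure_distr[OF mS] sets_sigma)
    also have "\<dots> = 3 * emeasure (distr unit_cone ?R ?n) (T -` A \<inter> space ?R)"
      unfolding sphere_measure_eq by (simp add: space_scale_measure)
    also have "emeasure (distr unit_cone ?R ?n) (T -` A \<inter> space ?R) = emeasure (distr (distr unit_cone ?R ?n) ?R T) A"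
      using A mR by (subst emeasure_distr) auto
    also have "\<dots> = emeasure (distr unit_cone ?R ?n) A" unfolding D ..
    also have "3 * \<dots> = emeasure \<sigma> A" unfolding sphere_measure_eq by simp
    finally show "emeasure (distr \<sigma> \<sigma> T) A = emeasure \<sigma> A" .
  qed simp
qed

lemma measurable_sigma_orthogonal:
  assumes T: "orthogonal_transformation T"
  shows "T \<in> \<sigma> \<rightarrow>\<^sub>M \<sigma>"
proof -
  have "linear T" using T by (rule orthogonal_transformation_linear)
  then have "continuous_on UNIV T" by (rule linear_continuous_on[OF linear_conv_bounded_linear[THEN iffD1]])
  then have "T \<in> borel_measurable borel" by (rule borel_measurable_continuous_onI)
  then have "T \<in> restrict_space borel (sphere 0 1) \<rightarrow>\<^sub>M restrict_space borel (sphere 0 1)"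
    by (intro measurable_restrict_space2 measurable_restrict_space1)
      (auto simp: space_restrict_space orthogonal_transformation_norm[OF T])
  then show ?thesis by (simp add: measurable_cong_sets[OF sets_sigma sets_sigma])
qed

lemma integral_sigma_orthogonal:
  fixes f :: "vec3 \<Rightarrow> 'b::{banach, second_countable_topology}"
  assumes T: "orthogonal_transformation T" and f: "f \<in> borel_measurable \<sigma>"
  shows "(\<integral>x. f (T x) \<partial>\<sigma>) = (\<integral>x. f x \<partial>\<sigma>)"
  using integral_distr[OF measurable_sigma_orthogonal[OF T] f] distr_sigma_orthogonal[OF T] by simp

lemma measurable_sigma_borel: "(\<lambda>x. x) \<in> borel_measurable \<sigma>"
  by (simp add: measurable_cong_sets[OF sets_sigma refl] measurable_restrict_space1)

lemma borel_measurable_sigma: "f \<in> borel_measurable borel \<Longrightarrow> f \<in> borel_measurable \<sigma>"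
  using measurable_compose[OF measurable_sigma_borel] by blast

lemma borel_measurable_sigma_continuous:
  "continuous_on (sphere 0 1) f \<Longrightarrow> f \<in> borel_measurable \<sigma>"
  by (simp add: measurable_cong_sets[OF sets_sigma refl] borel_measurable_continuous_on_restrict)

lemma integrable_sigma_continuous:
  fixes f :: "vec3 \<Rightarrow> 'b::{banach, second_countable_topology}"
  assumes f: "continuous_on (sphere 0 1) f"
  shows "integrable \<sigma> f"
proof -
  have "compact (f ` sphere 0 1)" using f by (intro compact_continuous_image) auto
  then obtain B where "\<And>x. x \<in> sphere 0 1 \<Longrightarrow> norm (f x) \<le> B"
    using compact_imp_bounded bounded_iff by (metis imageI)
  then show ?thesis
    by (intro sigma.integrable_const_bound[of _ B] borel_measurable_sigma_continuous f AE_I2) auto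
qed

lemma sigma_measure_pos: "0 < measure \<sigma> (sphere 0 1)"
proof -
  have "emeasure lborel (ball (0 :: vec3) 1 - {0}) \<le> emeasure unit_cone (space unit_cone)"
    unfolding emeasure_unit_cone by (rule emeasure_mono) (use sets_unit_cone in auto)
  moreover have "emeasure lborel (ball (0 :: vec3) 1 - {0}) = emeasure lborel (ball (0 :: vec3) 1)"
    by (rule emeasure_Diff_null_set) auto
  moreover have "emeasure lborel (ball (0 :: vec3) 1) > 0"
    using content_ball_pos[of 1 "0::vec3"]
    by (simp add: measure_def enn2real_positive_iff)
  moreover note emeasure_sigma_space
  ultimately have "emeasure \<sigma> (sphere 0 1) > 0"
    by (simp add: ennreal_zero_less_mult_iff)
  then show ?thesis by (simp add: sigma.emeasure_eq_measure)
qed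

section \<open>Circle measure and Fubini's theorem\<close>

definition circ :: "real measure" where
  "circ = restrict_space lborel {0..2 * pi}"

lemma space_circ [simp]: "space circ = {0..2 * pi}"
  by (simp add: circ_def space_restrict_space)

lemma finite_measure_circ: "finite_measure circ"
  by standard (simp add: circ_def space_restrict_space emeasure_restrict_space)

interpretation circ: finite_measure circ
  by (rule finite_measure_circ)

lemma measure_circ [simp]: "measure circ {0..2 * pi} = 2 * pi"
  by (simp add: circ_def measure_restrict_space)

lemma measurable_circ_borel: "(\<lambda>x. x) \<in> borel_measurable circ"
  unfolding circ_def by (rule measurable_restrict_space1) simp

lemma borel_measurable_circ: "f \<in> borel_measurable borel \<Longrightarrow> f \<in> borel_measurable circ"
  using measurable_compose[OF measurable_circ_borel] by blast

lemma integrable_circ_continuous: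
  fixes f :: "real \<Rightarrow> 'b::euclidean_space"
  assumes "continuous_on UNIV f"
  shows "integrable circ f"
proof -
  have "compact (f ` {0..2 * pi})"
    using assms by (intro compact_continuous_image) (auto intro: continuous_on_subset)
  then obtain B where "\<And>x. x \<in> {0..2 * pi} \<Longrightarrow> norm (f x) \<le> B"
    using compact_imp_bounded bounded_iff by (metis imageI)
  then show ?thesis
    using assms by (intro circ.integrable_const_bound[of _ B] borel_measurable_circ borel_measurable_continuous_onI AE_I2) auto
qed

lemma integral_circ_eq:
  fixes f :: "real \<Rightarrow> 'b::euclidean_space"
  shows "(\<integral>x. f x \<partial>circ) = (\<integral>x. indicator {0..2 * pi} x *\<^sub>R f x \<partial>lborel)"
  unfolding circ_def by (rule integral_restrict_space) simp

lemma integral_circ_deriv: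
  fixes f :: "real \<Rightarrow> 'b::euclidean_space"
  assumes "\<And>x. (F has_vector_derivative f x) (at x)" "continuous_on UNIV f"
  shows "(\<integral>x. f x \<partial>circ) = F (2 * pi) - F 0"
  unfolding integral_circ_eq
  using assms by (intro integral_FTC_Icc) (auto intro: has_vector_derivative_at_within continuous_on_subset)

lemma fubini_bounded:
  fixes F :: "'a \<Rightarrow> 'b \<Rightarrow> 'c::{banach, second_countable_topology}"
  assumes M: "finite_measure M" and N: "finite_measure N"
    and meas: "case_prod F \<in> borel_measurable (M \<Otimes>\<^sub>M N)"
    and bd: "\<And>x y. x \<in> space M \<Longrightarrow> y \<in> space N \<Longrightarrow> norm (F x y) \<le> B"
  shows "integrable (M \<Otimes>\<^sub>M N) (case_prod F)"
    and "(\<integral>x. \<integral>y. F x y \<partial>N \<partial>M) = (\<integral>y. \<integral>x. F x y \<partial>M \<partial>N)"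
    and "integrable M (\<lambda>x. \<integral>y. F x y \<partial>N)"
    and "integrable N (\<lambda>y. \<integral>x. F x y \<partial>M)"
proof -
  interpret M: finite_measure M by fact
  interpret N: finite_measure N by fact
  interpret P: pair_sigma_finite M N ..
  interpret MN: finite_measure "M \<Otimes>\<^sub>M N" by (rule finite_measure_pair_measure) fact+
  show int: "integrable (M \<Otimes>\<^sub>M N) (case_prod F)"
    using meas bd by (intro MN.integrable_const_bound[of _ B] AE_I2) (auto simp: space_pair_measure)
  show "(\<integral>x. \<integral>y. F x y \<partial>N \<partial>M) = (\<integral>y. \<integral>x. F x y \<partial>M \<partial>N)"
    using P.Fubini_integral[OF int] by simp
  show "integrable M (\<lambda>x. \<integral>y. F x y \<partial>N)"
    using P.integrable_fst[OF int] .
  show "integrable N (\<lambda>y. \<integral>x. F x y \<partial>M)"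
    using P.integrable_snd[OF int] .
qed

lemma sphere_circ_fubini:
  fixes F :: "vec3 \<Rightarrow> real \<Rightarrow> 'c::euclidean_space"
  assumes cont: "continuous_on UNIV (\<lambda>(x, a). F x a)"
  shows "(\<integral>x. \<integral>a. F x a \<partial>circ \<partial>\<sigma>) = (\<integral>a. \<integral>x. F x a \<partial>\<sigma> \<partial>circ)"
    and "integrable \<sigma> (\<lambda>x. \<integral>a. F x a \<partial>circ)"
    and "integrable circ (\<lambda>a. \<integral>x. F x a \<partial>\<sigma>)"
    and "integrable (\<sigma> \<Otimes>\<^sub>M circ) (\<lambda>(x, a). F x a)"
proof -
  have "compact ((\<lambda>(x, a). F x a) ` (sphere 0 1 \<times> {0..2 * pi}))"
    using cont by (intro compact_continuous_image) (auto intro: continuous_on_subset compact_Times)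
  then obtain B where B: "\<And>z. z \<in> sphere 0 1 \<times> {0..2 * pi} \<Longrightarrow> norm ((\<lambda>(x, a). F x a) z) \<le> B"
    using compact_imp_bounded bounded_iff by (metis imageI)
  have "(\<lambda>(x, a). F x a) \<in> borel_measurable (borel \<Otimes>\<^sub>M borel)"
    unfolding borel_prod using cont by (rule borel_measurable_continuous_onI)
  moreover have "(\<lambda>z. (fst z, snd z)) \<in> \<sigma> \<Otimes>\<^sub>M circ \<rightarrow>\<^sub>M borel \<Otimes>\<^sub>M borel"
    by (intro measurable_Pair measurable_compose[OF measurable_fst measurable_sigma_borel]
        measurable_compose[OF measurable_snd measurable_circ_borel])
  ultimately have meas: "(\<lambda>(x, a). F x a) \<in> borel_measurable (\<sigma> \<Otimes>\<^sub>M circ)"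
    using measurable_compose by (fastforce simp: case_prod_beta)
  have bd: "\<And>x y. x \<in> space \<sigma> \<Longrightarrow> y \<in> space circ \<Longrightarrow> norm (F x y) \<le> B"
    using B by auto
  note fub = fubini_bounded[OF finite_measure_sigma finite_measure_circ meas bd]
  show "(\<integral>x. \<integral>a. F x a \<partial>circ \<partial>\<sigma>) = (\<integral>a. \<integral>x. F x a \<partial>\<sigma> \<partial>circ)"
    "integrable \<sigma> (\<lambda>x. \<integral>a. F x a \<partial>circ)" "integrable circ (\<lambda>a. \<integral>x. F x a \<partial>\<sigma>)"
    "integrable (\<sigma> \<Otimes>\<^sub>M circ) (\<lambda>(x, a). F x a)"
    using fub by auto
qed

section \<open>Rotations by Rodrigues' formula, and integration by parts on the sphere\<close>

definition rot :: "vec3 \<Rightarrow> real \<Rightarrow> vec3 \<Rightarrow> vec3" where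
  "rot \<xi> \<alpha> x = cos \<alpha> *\<^sub>R x + sin \<alpha> *\<^sub>R cross3 \<xi> x + ((1 - cos \<alpha>) * (\<xi> \<bullet> x)) *\<^sub>R \<xi>"

lemma continuous_on_rot [continuous_intros]:
  fixes S :: "'a::t2_space set"
  assumes "continuous_on S f" "continuous_on S g" "continuous_on S h"
  shows "continuous_on S (\<lambda>z. rot (f z) (g z) (h z))"
  unfolding rot_def using assms by (intro continuous_intros continuous_on_cross continuous_on_cos continuous_on_sin)

lemma linear_rot: "linear (rot \<xi> \<alpha>)"
  by (rule linearI) (simp_all add: rot_def cross_add_right cross_mult_right inner_add_right algebra_simps)

lemma norm_rot:
  assumes "norm \<xi> = 1" shows "norm (rot \<xi> \<alpha> x) = norm x"
proof -
  let ?c = "cos \<alpha>" and ?s = "sin \<alpha>" and ?p = "\<xi> \<bullet> x"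
  have xx: "\<xi> \<bullet> \<xi> = 1" using assms by (simp add: dot_square_norm)
  have cc: "cross3 \<xi> x \<bullet> cross3 \<xi> x = x \<bullet> x - ?p\<^sup>2"
    using norm_cross_dot[of \<xi> x] assms by (simp add: dot_square_norm)
  have "rot \<xi> \<alpha> x \<bullet> rot \<xi> \<alpha> x = ?c\<^sup>2 * (x \<bullet> x) + ?s\<^sup>2 * (x \<bullet> x - ?p\<^sup>2) + ((1 - ?c) * ?p)\<^sup>2 + 2 * ?c * (1 - ?c) * ?p\<^sup>2"
    unfolding rot_def
    by (simp add: inner_add_left inner_add_right cc xx dot_cross_self inner_commute[of x \<xi>] power2_eq_square algebra_simps)
  also have "\<dots> = x \<bullet> x"
    unfolding sin_squared_eq by (simp add: power2_eq_square algebra_simps)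
  finally show ?thesis by (simp add: norm_eq)
qed

lemma orthogonal_transformation_rot: "norm \<xi> = 1 \<Longrightarrow> orthogonal_transformation (rot \<xi> \<alpha>)"
  by (simp add: orthogonal_transformation linear_rot norm_rot)

lemma cross_cross_right: "cross3 e (cross3 u x) = (e \<bullet> x) *\<^sub>R u - (e \<bullet> u) *\<^sub>R x"
  by (simp add: vec_eq_iff forall_3 cross_components inner_vec_def sum_3 algebra_simps)

lemma cross_cross_left: "cross3 (cross3 e u) x = (e \<bullet> x) *\<^sub>R u - (u \<bullet> x) *\<^sub>R e"
  by (simp add: vec_eq_iff forall_3 cross_components inner_vec_def sum_3 algebra_simps)

lemma cross_rot:
  assumes "norm \<xi> = 1"
  shows "cross3 \<xi> (rot \<xi> \<alpha> x) = (- sin \<alpha>) *\<^sub>R x + cos \<alpha> *\<^sub>R cross3 \<xi> x + (sin \<alpha> * (\<xi> \<bullet> x)) *\<^sub>R \<xi>"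
proof -
  have "cross3 \<xi> (rot \<xi> \<alpha> x) = cos \<alpha> *\<^sub>R cross3 \<xi> x + sin \<alpha> *\<^sub>R ((\<xi> \<bullet> x) *\<^sub>R \<xi> - x)"
    using assms by (simp add: rot_def cross_add_right cross_mult_right cross_cross_right dot_square_norm)
  then show ?thesis by (simp add: algebra_simps)
qed

lemma rot_has_vector_derivative:
  assumes "norm \<xi> = 1"
  shows "((\<lambda>\<alpha>. rot \<xi> \<alpha> x) has_vector_derivative cross3 \<xi> (rot \<xi> \<alpha> x)) (at \<alpha>)"
proof -
  have "((\<lambda>\<alpha>. rot \<xi> \<alpha> x) has_vector_derivative
      (- sin \<alpha>) *\<^sub>R x + cos \<alpha> *\<^sub>R cross3 \<xi> x + (sin \<alpha> * (\<xi> \<bullet> x)) *\<^sub>R \<xi>) (at \<alpha>)"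
    unfolding rot_def by (auto intro!: derivative_eq_intros simp: algebra_simps)
  then show ?thesis using assms by (simp add: cross_rot)
qed

lemma rot_rot:
  assumes "norm \<xi> = 1"
  shows "rot \<xi> \<alpha> (rot \<xi> \<beta> x) = rot \<xi> (\<alpha> + \<beta>) x"
proof -
  have xx: "\<xi> \<bullet> \<xi> = 1" using assms by (simp add: dot_square_norm)
  have p: "\<xi> \<bullet> rot \<xi> \<beta> x = \<xi> \<bullet> x"
    by (simp add: rot_def inner_add_right xx dot_cross_self algebra_simps)
  show ?thesis
    unfolding rot_def[of \<xi> \<alpha>] p cross_rot[OF assms]
    by (simp add: rot_def cos_add sin_add algebra_simps)
qed

lemma rot_zero [simp]: "rot \<xi> 0 x = x"
  by (simp add: rot_def)

lemma rot_2pi [simp]: "rot \<xi> (2 * pi) x = x"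
  by (simp add: rot_def)

lemma measurable_rot_pair:
  assumes "norm \<xi> = 1"
  shows "(\<lambda>(x, a). rot \<xi> a x) \<in> \<sigma> \<Otimes>\<^sub>M circ \<rightarrow>\<^sub>M \<sigma>"
proof -
  have "continuous_on UNIV (\<lambda>(x, a). rot \<xi> a x)"
    unfolding case_prod_beta by (intro continuous_intros)
  then have "(\<lambda>(x, a). rot \<xi> a x) \<in> borel_measurable (borel \<Otimes>\<^sub>M borel)"
    unfolding borel_prod by (rule borel_measurable_continuous_onI)
  moreover have "(\<lambda>z. (fst z, snd z)) \<in> \<sigma> \<Otimes>\<^sub>M circ \<rightarrow>\<^sub>M borel \<Otimes>\<^sub>M borel"
    by (intro measurable_Pair measurable_compose[OF measurable_fst measurable_sigma_borel]
        measurable_compose[OF measurable_snd measurable_circ_borel])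
  ultimately have "(\<lambda>(x, a). rot \<xi> a x) \<in> borel_measurable (\<sigma> \<Otimes>\<^sub>M circ)"
    using measurable_compose by (fastforce simp: case_prod_beta)
  then show ?thesis
    unfolding measurable_cong_sets[OF refl sets_sigma]
    using assms by (intro measurable_restrict_space2) (auto simp: space_pair_measure norm_rot)
qed

text \<open>Integrating the derivative along the flow over one full turn gives zero, and rotation
  invariance identifies the average over the flow with the integral itself.\<close>

lemma integral_frechet_rot_zero:
  fixes \<phi> :: "vec3 \<Rightarrow> real"
  assumes xi: "norm \<xi> = 1"
    and diff: "\<And>x. norm x = 1 \<Longrightarrow> \<phi> differentiable (at x)"
    and cont: "continuous_on (sphere 0 1) (\<lambda>x. frechet_derivative \<phi> (at x) (cross3 \<xi> x))"
  shows "(\<integral>x. frechet_derivative \<phi> (at x) (cross3 \<xi> x) \<partial>\<sigma>) = 0"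
proof -
  define g where "g x = frechet_derivative \<phi> (at x) (cross3 \<xi> x)" for x
  have gm: "g \<in> borel_measurable \<sigma>"
    using cont unfolding g_def[abs_def] by (rule borel_measurable_sigma_continuous)
  have "compact (g ` sphere 0 1)" 
    using cont unfolding g_def[abs_def] by (intro compact_continuous_image) auto
  then obtain B where B: "\<And>x. x \<in> sphere 0 1 \<Longrightarrow> norm (g x) \<le> B"
    using compact_imp_bounded bounded_iff by (metis imageI)
  have meas: "(\<lambda>(x, a). g (rot \<xi> a x)) \<in> borel_measurable (\<sigma> \<Otimes>\<^sub>M circ)"
    using measurable_compose[OF measurable_rot_pair[OF xi] gm] by (simp add: case_prod_beta)
  have swap: "(\<integral>x. \<integral>a. g (rot \<xi> a x) \<partial>circ \<partial>\<sigma>) = (\<integral>a. \<integral>x. g (rot \<xi> a x) \<partial>\<sigma> \<partial>circ)"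
    by (rule fubini_bounded(2)[OF finite_measure_sigma finite_measure_circ meas, of B]) (use B in \<open>auto simp: norm_rot xi\<close>)
  have "(\<integral>a. g (rot \<xi> a x) \<partial>circ) = 0" if x: "norm x = 1" for x
  proof -
    have "((\<lambda>a. \<phi> (rot \<xi> a x)) has_vector_derivative g (rot \<xi> a x)) (at a)" for a
    proof -
      have "(\<phi> has_derivative frechet_derivative \<phi> (at (rot \<xi> a x))) (at (rot \<xi> a x))"
        using diff frechet_derivative_works norm_rot[OF xi] x by metis
      from vector_derivative_diff_chain_within[OF rot_has_vector_derivative[OF xi, of x a] has_derivative_at_withinI[OF this]]
      show ?thesis by (simp add: g_def o_def)
    qed
    moreover have "continuous_on UNIV (\<lambda>a. g (rot \<xi> a x))"
      using x xi by (intro continuous_on_compose2[OF cont[folded g_def]] continuous_intros) (auto simp: norm_rot)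
    ultimately have "(\<integral>a. g (rot \<xi> a x) \<partial>circ) = \<phi> (rot \<xi> (2 * pi) x) - \<phi> (rot \<xi> 0 x)"
      by (rule integral_circ_deriv)
    then show ?thesis by simp
  qed
  then have "(\<integral>x. \<integral>a. g (rot \<xi> a x) \<partial>circ \<partial>\<sigma>) = (\<integral>x. 0 \<partial>\<sigma>)"
    by (intro Bochner_Integration.integral_cong) auto
  moreover have "(\<integral>x. g (rot \<xi> a x) \<partial>\<sigma>) = (\<integral>x. g x \<partial>\<sigma>)" for a
    by (rule integral_sigma_orthogonal[OF orthogonal_transformation_rot[OF xi] gm])
  ultimately have "2 * pi * (\<integral>x. g x \<partial>\<sigma>) = 0"
    using swap by simp
  then show ?thesis by (simp add: g_def)
qed

lemma continuous_on_rpf: "rpf f \<Longrightarrow> continuous_on S f"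
  using continuous_on_polymonial_function[of f] by (auto simp: real_polynomial_function_eq)

lemma continuous_on_rpf_compose:
  assumes "rpf f" "continuous_on S g" shows "continuous_on S (\<lambda>z. f (g z))"
  by (rule continuous_on_compose2[OF continuous_on_rpf[OF assms(1), of UNIV] assms(2)]) auto

lemma integrable_sigma_rpf: "rpf f \<Longrightarrow> integrable \<sigma> f"
  by (intro integrable_sigma_continuous continuous_on_rpf)

lemma integral_Lop_zero: "rpf f \<Longrightarrow> (\<integral>x. Lop a f x \<partial>\<sigma>) = 0"
  unfolding Lop_def
  by (rule integral_frechet_rot_zero)
    (auto intro: rpf_differentiable continuous_on_rpf[OF rpf_Lop, unfolded Lop_def[abs_def]])

lemma integral_Lop_by_parts:
  assumes "rpf f" "rpf g"
  shows "(\<integral>x. Lop a f x * g x \<partial>\<sigma>) = - (\<integral>x. f x * Lop a g x \<partial>\<sigma>)"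
proof -
  have "(\<integral>x. Lop a (\<lambda>x. f x * g x) x \<partial>\<sigma>) = 0"
    using assms by (intro integral_Lop_zero) simp
  then show ?thesis
    using assms by (simp add: Lop_mult integrable_sigma_rpf)
qed

section \<open>Averages over all rotations\<close>

text \<open>The derivative of \<open>rot\<close> in its axis along \<open>v\<close>. Rodrigues'
  formula is taken for all vectors \<xi>, not only for unit ones, so that it can be differentiated
  in the ambient space.\<close>

definition drot :: "vec3 \<Rightarrow> real \<Rightarrow> vec3 \<Rightarrow> vec3 \<Rightarrow> vec3" where
  "drot \<xi> \<alpha> x v = sin \<alpha> *\<^sub>R cross3 v x + (1 - cos \<alpha>) *\<^sub>R ((v \<bullet> x) *\<^sub>R \<xi> + (\<xi> \<bullet> x) *\<^sub>R v)"

lemma linear_drot: "linear (drot \<xi> \<alpha> x)"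
  by (rule linearI) (simp_all add: drot_def cross_add_left cross_mult_left inner_add_left algebra_simps)

lemma rot_has_derivative_axis:
  "((\<lambda>\<xi>. rot \<xi> \<alpha> x) has_derivative drot \<xi> \<alpha> x) (at \<xi>)"
proof -
  have "bounded_linear (\<lambda>\<xi>. cross3 \<xi> x)"
    by (simp add: linear_conv_bounded_linear[symmetric] linearI cross_add_left cross_mult_left)
  then have "((\<lambda>\<xi>. cross3 \<xi> x) has_derivative (\<lambda>v. cross3 v x)) (at \<xi>)"
    by (rule bounded_linear_imp_has_derivative)
  then show ?thesis
    unfolding rot_def drot_def[abs_def]
    by (auto intro!: derivative_eq_intros simp: algebra_simps)
qed

lemma rpf_rot_axis:
  assumes "rpf f" shows "rpf (\<lambda>\<xi>. f (rot \<xi> \<alpha> x))"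
  using assms
proof (induction rule: rpf_induct)
  case (coord i)
  have "rpf (\<lambda>\<xi>. cos \<alpha> * x $ i + sin \<alpha> * cross3 \<xi> x $ i + ((1 - cos \<alpha>) * (x \<bullet> \<xi>)) * \<xi> $ i)"
    using exhaust_3[of i] by (auto simp: cross_components)
  then show ?case by (simp add: rot_def inner_commute)
qed auto

lemma rpf_has_derivative: "rpf f \<Longrightarrow> (f has_derivative frechet_derivative f (at x)) (at x)"
  using rpf_differentiable frechet_derivative_works by blast

lemma Lop_rot_axis:
  assumes "rpf f"
  shows "Lop b (\<lambda>\<xi>. f (rot \<xi> \<alpha> x)) \<xi> = frechet_derivative f (at (rot \<xi> \<alpha> x)) (drot \<xi> \<alpha> x (cross3 (axis b 1) \<xi>))"
proof -
  have "((\<lambda>\<xi>. f (rot \<xi> \<alpha> x)) has_derivative (\<lambda>v. frechet_derivative f (at (rot \<xi> \<alpha> x)) (drot \<xi> \<alpha> x v))) (at \<xi>)"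
    by (rule has_derivative_compose[OF rot_has_derivative_axis rpf_has_derivative[OF assms]])
  then show ?thesis
    unfolding Lop_def by (simp add: frechet_derivative_at[symmetric])
qed

text \<open>Evaluates \<xi> \<times> (\<xi> \<times> (e \<times> x)) in two ways by the double cross
  product formula.\<close>

lemma cross_decompose_unit:
  assumes "norm \<xi> = 1"
  shows "cross3 e x = (\<xi> \<bullet> x) *\<^sub>R cross3 e \<xi> + (e \<bullet> \<xi>) *\<^sub>R cross3 \<xi> x - (cross3 e \<xi> \<bullet> x) *\<^sub>R \<xi>"
proof -
  have "cross3 \<xi> (cross3 \<xi> (cross3 e x)) = (\<xi> \<bullet> cross3 e x) *\<^sub>R \<xi> - cross3 e x"
    using assms by (simp add: cross_cross_right[of \<xi> \<xi> "cross3 e x"] dot_square_norm)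
  moreover have "cross3 \<xi> (cross3 \<xi> (cross3 e x)) = - (\<xi> \<bullet> x) *\<^sub>R cross3 e \<xi> - (e \<bullet> \<xi>) *\<^sub>R cross3 \<xi> x"
    by (simp add: cross_cross_right[of \<xi> e x] Cross3.right_diff_distrib cross_mult_right cross_skew[of \<xi> e] inner_commute)
  moreover have "\<xi> \<bullet> cross3 e x = - (cross3 e \<xi> \<bullet> x)"
    by (simp add: inner_vec_def sum_3 cross_components algebra_simps)
  ultimately show ?thesis by (simp add: algebra_simps)
qed

text \<open>The vector field \<open>(e \<bullet> \<xi>) \<partial>\<^sub>\<alpha> + (w \<times> \<xi>) / (2 (1 - cos \<alpha>))\<close> on axis-angle
  space generates left multiplication by the infinitesimal rotation about \<open>e\<close>.\<close>

lemma rot_left_generator: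
  fixes \<alpha> :: real and e \<xi> x :: vec3
  assumes xi: "norm \<xi> = 1"
  defines "w \<equiv> sin \<alpha> *\<^sub>R cross3 \<xi> e + (1 - cos \<alpha>) *\<^sub>R e"
  shows "(1 - cos \<alpha>) *\<^sub>R cross3 e (rot \<xi> \<alpha> x) =
    ((e \<bullet> \<xi>) * (1 - cos \<alpha>)) *\<^sub>R cross3 \<xi> (rot \<xi> \<alpha> x) + (1 / 2) *\<^sub>R drot \<xi> \<alpha> x (cross3 w \<xi>)"
proof -
  define c s p q r t where "c = cos \<alpha>" and "s = sin \<alpha>" and "p = \<xi> \<bullet> x" and "q = e \<bullet> \<xi>" and "r = e \<bullet> x"
    and "t = cross3 e \<xi> \<bullet> x"
  have ss: "s * s = (1 - c) * (1 + c)"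
    using sin_squared_eq[of \<alpha>] by (simp add: s_def c_def power2_eq_square algebra_simps)
  define v where "v = s *\<^sub>R (e - q *\<^sub>R \<xi>) + (1 - c) *\<^sub>R cross3 e \<xi>"
  have v: "cross3 w \<xi> = v"
    using xi by (simp add: w_def v_def cross_add_left cross_mult_left cross_cross_left dot_square_norm
        s_def c_def q_def inner_commute)
  have y: "cross3 e (rot \<xi> \<alpha> x) = c *\<^sub>R cross3 e x + s *\<^sub>R (r *\<^sub>R \<xi> - q *\<^sub>R x) + ((1 - c) * p) *\<^sub>R cross3 e \<xi>"
    by (simp add: rot_def cross_add_right cross_mult_right cross_cross_right c_def s_def p_def q_def r_def)
  have z: "cross3 \<xi> (rot \<xi> \<alpha> x) = - s *\<^sub>R x + c *\<^sub>R cross3 \<xi> x + (s * p) *\<^sub>R \<xi>"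
    using cross_rot[OF xi] by (simp add: c_def s_def p_def)
  have vx: "cross3 v x = s *\<^sub>R (cross3 e x - q *\<^sub>R cross3 \<xi> x) + (1 - c) *\<^sub>R (r *\<^sub>R \<xi> - p *\<^sub>R e)"
    by (simp add: v_def cross_add_left cross_mult_left Cross3.left_diff_distrib cross_cross_left p_def r_def)
  have vd: "v \<bullet> x = s * (r - q * p) + (1 - c) * t"
    by (simp add: v_def inner_add_left inner_diff_left p_def r_def t_def)
  have d: "drot \<xi> \<alpha> x (cross3 w \<xi>) = s *\<^sub>R cross3 v x + (1 - c) *\<^sub>R ((v \<bullet> x) *\<^sub>R \<xi> + p *\<^sub>R v)"
    by (simp add: v drot_def s_def c_def p_def)
  have "((1 - c) *\<^sub>R cross3 e (rot \<xi> \<alpha> x)) $ i =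
    ((q * (1 - c)) *\<^sub>R cross3 \<xi> (rot \<xi> \<alpha> x) + (1 / 2) *\<^sub>R drot \<xi> \<alpha> x (cross3 w \<xi>)) $ i" for i
  proof -
    define A B E G X where "A = cross3 e \<xi> $ i" "B = cross3 \<xi> x $ i" "E = e $ i" "G = \<xi> $ i" "X = x $ i"
    have ex: "cross3 e x $ i = p * A + q * B - t * G"
      using arg_cong[OF cross_decompose_unit[OF xi, of e x], of "\<lambda>v. v $ i"]
      by (simp add: A_B_E_G_X_def p_def q_def t_def)
    have "(1 - c) * (c * (p * A + q * B - t * G) + s * (r * G - q * X) + (1 - c) * p * A) =
      q * (1 - c) * (- s * X + c * B + s * p * G) +
      1 / 2 * (s * (s * ((p * A + q * B - t * G) - q * B) + (1 - c) * (r * G - p * E))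
        + (1 - c) * ((s * (r - q * p) + (1 - c) * t) * G + p * (s * (E - q * G) + (1 - c) * A)))"
      (is "?L = ?R")
    proof -
      \<comment> \<open>Apart from linear algebra only sin^2 + cos^2 = 1 enters: twice the
        difference of the two sides is a multiple of its defect.\<close>
      have "2 * (?L - ?R) = ((1 - c) * (1 + c) - s * s) * (p * A - t * G)" by (simp add: field_simps)
      then have "2 * (?L - ?R) = 0" unfolding ss by simp
      then show ?thesis by (simp only: mult_eq_0_iff right_minus_eq) simp
    qed
    moreover have "v $ i = s * (E - q * G) + (1 - c) * A"
      by (simp add: v_def A_B_E_G_X_def)
    ultimately show ?thesis
      unfolding y z d vx vd
      by (simp add: ex A_B_E_G_X_def[symmetric])
  qed
  then show ?thesis by (simp add: vec_eq_iff c_def q_def)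
qed

lemma axis_expand: "(w :: vec3) = (\<Sum>b\<in>UNIV. w $ b *\<^sub>R axis b 1)"
  using basis_expansion[of w] by (simp add: scalar_mult_eq_scaleR)

text \<open>Applies the differential of \<open>f\<close> to \<open>rot_left_generator\<close> and
  rewrites the axis derivative as a divergence on the sphere of axes, which will integrate to zero.
  The product rule costs the divergence of the field w \<times> \<xi>, namely - 2 sin \<alpha> times
  the component of \<xi>; this is the origin of the middle term.\<close>

lemma Lop_rot_key:
  fixes \<alpha> :: real and a :: 3 and \<xi> x :: vec3
  assumes f: "rpf f" and xi: "norm \<xi> = 1"
  defines "w \<equiv> \<lambda>\<xi>. sin \<alpha> *\<^sub>R cross3 \<xi> (axis a 1) + (1 - cos \<alpha>) *\<^sub>R axis a 1"
  shows "(1 - cos \<alpha>) * Lop a f (rot \<xi> \<alpha> x) =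
    \<xi> $ a * (1 - cos \<alpha>) * frechet_derivative f (at (rot \<xi> \<alpha> x)) (cross3 \<xi> (rot \<xi> \<alpha> x))
    + \<xi> $ a * sin \<alpha> * f (rot \<xi> \<alpha> x)
    + 1 / 2 * (\<Sum>b\<in>UNIV. Lop b (\<lambda>\<xi>. w \<xi> $ b * f (rot \<xi> \<alpha> x)) \<xi>)"
proof -
  define y where "y = rot \<xi> \<alpha> x"
  define D where "D = frechet_derivative f (at y)"
  have D: "linear D" unfolding D_def by (rule linear_frechet_derivative[OF rpf_differentiable[OF f]])
  have rw: "rpf (\<lambda>\<xi>. w \<xi> $ b)" for b
    using exhaust_3[of b] by (auto simp: w_def cross_components)
  have Lw: "(\<Sum>b\<in>UNIV. Lop b (\<lambda>\<xi>. w \<xi> $ b) \<xi>) = - 2 * sin \<alpha> * \<xi> $ a"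
  proof -
    have "Lop b (\<lambda>\<xi>. w \<xi> $ b) \<xi> = (sin \<alpha> *\<^sub>R cross3 (cross3 (axis b 1) \<xi>) (axis a 1)) $ b" for b
    proof -
      have "linear (\<lambda>\<xi>. cross3 \<xi> (axis a 1))"
        by (rule linearI) (simp_all add: cross_add_left cross_mult_left scaleR_add_right)
      then have "((\<lambda>\<xi>. w \<xi>) has_derivative (\<lambda>\<xi>. sin \<alpha> *\<^sub>R cross3 \<xi> (axis a 1))) (at \<xi>)"
        unfolding w_def by (auto intro!: derivative_eq_intros linear_imp_has_derivative)
      then have "((\<lambda>\<xi>. w \<xi> $ b) has_derivative (\<lambda>\<xi>. (sin \<alpha> *\<^sub>R cross3 \<xi> (axis a 1)) $ b)) (at \<xi>)"
        by (rule bounded_linear.has_derivative[OF bounded_linear_vec_nth])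
      then show ?thesis unfolding Lop_def by (simp add: frechet_derivative_at[symmetric])
    qed
    then have "(\<Sum>b\<in>UNIV. Lop b (\<lambda>\<xi>. w \<xi> $ b) \<xi>) = (\<Sum>b\<in>UNIV. (sin \<alpha> *\<^sub>R cross3 (cross3 (axis b 1) \<xi>) (axis a 1)) $ b)"
      by simp
    also have "\<dots> = - 2 * sin \<alpha> * \<xi> $ a"
      using exhaust_3[of a] by (auto simp: sum_3 cross_components axis_def)
    finally show ?thesis .
  qed
  have "(\<Sum>b\<in>UNIV. Lop b (\<lambda>\<xi>. w \<xi> $ b * f (rot \<xi> \<alpha> x)) \<xi>)
      = (\<Sum>b\<in>UNIV. Lop b (\<lambda>\<xi>. w \<xi> $ b) \<xi>) * f y + (\<Sum>b\<in>UNIV. w \<xi> $ b * Lop b (\<lambda>\<xi>. f (rot \<xi> \<alpha> x)) \<xi>)"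
    by (simp add: Lop_mult rw rpf_rot_axis[OF f] y_def sum.distrib sum_distrib_right)
  also have "(\<Sum>b\<in>UNIV. w \<xi> $ b * Lop b (\<lambda>\<xi>. f (rot \<xi> \<alpha> x)) \<xi>) = D (drot \<xi> \<alpha> x (cross3 (w \<xi>) \<xi>))"
  proof -
    have "drot \<xi> \<alpha> x (cross3 (w \<xi>) \<xi>) = drot \<xi> \<alpha> x (cross3 (\<Sum>b\<in>UNIV. w \<xi> $ b *\<^sub>R axis b 1) \<xi>)"
      using axis_expand[of "w \<xi>"] by simp
    also have "\<dots> = (\<Sum>b\<in>UNIV. w \<xi> $ b *\<^sub>R drot \<xi> \<alpha> x (cross3 (axis b 1) \<xi>))"
      using linear_drot[of \<xi> \<alpha> x]
      by (simp add: sum_3 cross_add_left cross_mult_left linear_add linear_scale)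
    finally show ?thesis
      using D by (simp add: Lop_rot_axis[OF f] D_def[symmetric] y_def[symmetric] linear_sum linear_scale)
  qed
  finally have 1: "(\<Sum>b\<in>UNIV. Lop b (\<lambda>\<xi>. w \<xi> $ b * f (rot \<xi> \<alpha> x)) \<xi>)
     = - 2 * sin \<alpha> * \<xi> $ a * f y + D (drot \<xi> \<alpha> x (cross3 (w \<xi>) \<xi>))" unfolding Lw .
  have "D ((1 - cos \<alpha>) *\<^sub>R cross3 (axis a 1) y) =
     D (((axis a 1 \<bullet> \<xi>) * (1 - cos \<alpha>)) *\<^sub>R cross3 \<xi> y + (1 / 2) *\<^sub>R drot \<xi> \<alpha> x (cross3 (w \<xi>) \<xi>))"
    unfolding y_def w_def using rot_left_generator[OF xi, of \<alpha> "axis a 1" x] by simp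
  then have "(1 - cos \<alpha>) * D (cross3 (axis a 1) y) =
      \<xi> $ a * (1 - cos \<alpha>) * D (cross3 \<xi> y) + 1 / 2 * D (drot \<xi> \<alpha> x (cross3 (w \<xi>) \<xi>))"
    using D by (simp add: linear_add linear_scale inner_axis')
  moreover have "Lop a f y = D (cross3 (axis a 1) y)" by (simp add: Lop_def D_def)
  ultimately show ?thesis
    unfolding y_def[symmetric] D_def[symmetric] 1 by (simp add: field_simps)
qed

lemma rpf_rot_has_vector_derivative:
  assumes "rpf f" "norm \<xi> = 1"
  shows "((\<lambda>\<alpha>. f (rot \<xi> \<alpha> x)) has_real_derivative frechet_derivative f (at (rot \<xi> \<alpha> x)) (cross3 \<xi> (rot \<xi> \<alpha> x))) (at \<alpha>)"
  using vector_derivative_diff_chain_within[OF rot_has_vector_derivative[OF assms(2), of x \<alpha>] has_derivative_at_withinI[OF rpf_has_derivative[OF assms(1)]]]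
  by (simp add: o_def has_real_derivative_iff_has_vector_derivative)

lemma frechet_rpf_eq: "rpf f \<Longrightarrow> frechet_derivative f (at x) v = v$1 * pd 1 f x + v$2 * pd 2 f x + v$3 * pd 3 f x"
  by (simp add: frechet_derivative_pd rpf_differentiable sum_3)

text \<open>Integrates \<open>Lop_rot_key\<close> against \<open>\<kappa>\<close>: the axis
  divergence vanishes by rotation invariance, and the angular derivative is integrated by parts over
  one turn. The generator forces a factor 1 - cos \<alpha> into the weight \<open>q\<close>;
  \<open>\<kappa>\<close> is the quotient, supplied separately so that nothing is divided at
  \<alpha> = 0.\<close>

lemma integral_Lop_rot:
  assumes f: "rpf f"
    and q: "\<And>\<alpha>. q \<alpha> = (1 - cos \<alpha>) * \<kappa> \<alpha>" and r: "\<And>\<alpha>. r \<alpha> = sin \<alpha> * \<kappa> \<alpha>"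
    and q': "\<And>\<alpha>. (q has_real_derivative q' \<alpha>) (at \<alpha>)" and q0: "q (2 * pi) = q 0"
    and cont: "continuous_on UNIV \<kappa>" "continuous_on UNIV q'"
  shows "(\<integral>\<xi>. \<integral>\<alpha>. q \<alpha> * Lop a f (rot \<xi> \<alpha> x) \<partial>circ \<partial>\<sigma>) = (\<integral>\<xi>. \<integral>\<alpha>. \<xi> $ a * f (rot \<xi> \<alpha> x) * (r \<alpha> - q' \<alpha>) \<partial>circ \<partial>\<sigma>)"
proof -
  define w where "w \<alpha> \<xi> = sin \<alpha> *\<^sub>R cross3 \<xi> (axis a 1) + (1 - cos \<alpha>) *\<^sub>R axis a 1" for \<alpha> and \<xi> :: vec3
  define G where "G \<xi> \<alpha> = q \<alpha> * Lop a f (rot \<xi> \<alpha> x)" for \<xi> \<alpha>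
  \<comment> \<open>\<open>A\<close> is the \<alpha>-derivative of the product of \<xi>_a,
    \<open>q\<close> and \<open>f\<close> along the orbit, and \<open>C\<close> is the axis
    divergence; both integrate to zero, and \<open>B\<close> is what remains.\<close>
  define A where "A \<xi> \<alpha> = \<xi> $ a * (q' \<alpha> * f (rot \<xi> \<alpha> x) + q \<alpha> * frechet_derivative f (at (rot \<xi> \<alpha> x)) (cross3 \<xi> (rot \<xi> \<alpha> x)))" for \<xi> \<alpha>
  define B where "B \<xi> \<alpha> = \<xi> $ a * f (rot \<xi> \<alpha> x) * (r \<alpha> - q' \<alpha>)" for \<xi> \<alpha>
  define C where "C \<xi> \<alpha> = G \<xi> \<alpha> - A \<xi> \<alpha> - B \<xi> \<alpha>" for \<xi> \<alpha>
  have cq: "continuous_on UNIV q" "continuous_on UNIV r"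
    unfolding q[abs_def] r[abs_def] using cont by (auto intro!: continuous_intros)
  have cc: "continuous_on UNIV (\<lambda>z::vec3 \<times> real. h (snd z))" if "continuous_on UNIV h" for h :: "real \<Rightarrow> real"
    by (rule continuous_on_compose2[OF that]) (auto intro: continuous_intros)
  have crot: "continuous_on UNIV (\<lambda>z. rot (fst z) (snd z) x)" by (intro continuous_intros)
  have cf: "continuous_on UNIV (\<lambda>z. f (rot (fst z) (snd z) x))" "continuous_on UNIV (\<lambda>z. pd i f (rot (fst z) (snd z) x))"
     "continuous_on UNIV (\<lambda>z. Lop i f (rot (fst z) (snd z) x))" for i
    using f crot by (auto intro!: continuous_on_rpf_compose)
  have "continuous_on UNIV (\<lambda>z. cross3 (fst z) (rot (fst z) (snd z) x) $ i)" for i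
    by (intro continuous_intros continuous_on_cross)
  note cs = cc[OF cq(1)] cc[OF cq(2)] cc[OF cont(2)] cf this
  have cG: "continuous_on UNIV (\<lambda>(\<xi>, \<alpha>). G \<xi> \<alpha>)" and cA: "continuous_on UNIV (\<lambda>(\<xi>, \<alpha>). A \<xi> \<alpha>)"
    and cB: "continuous_on UNIV (\<lambda>(\<xi>, \<alpha>). B \<xi> \<alpha>)"
    unfolding G_def A_def B_def case_prod_beta frechet_rpf_eq[OF f]
    by (intro continuous_intros cs)+
  then have cC: "continuous_on UNIV (\<lambda>(\<xi>, \<alpha>). C \<xi> \<alpha>)"
    unfolding C_def case_prod_beta by (intro continuous_intros)
  have slice: "continuous_on UNIV (\<lambda>\<alpha>. F \<xi> \<alpha>)" if "continuous_on UNIV (\<lambda>(\<xi>, \<alpha>). F \<xi> \<alpha>)" for F :: "vec3 \<Rightarrow> real \<Rightarrow> real" and \<xi>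
    using continuous_on_compose2[OF that continuous_on_Pair[OF continuous_on_const[of UNIV \<xi>] continuous_on_id]] by simp
  have intA: "(\<integral>\<alpha>. A \<xi> \<alpha> \<partial>circ) = 0" if "norm \<xi> = 1" for \<xi>
  proof -
    have "((\<lambda>\<alpha>. \<xi> $ a * (q \<alpha> * f (rot \<xi> \<alpha> x))) has_real_derivative A \<xi> \<alpha>) (at \<alpha>)" for \<alpha>
      unfolding A_def using q'[of \<alpha>] rpf_rot_has_vector_derivative[OF f that, of x \<alpha>]
      by (auto intro!: derivative_eq_intros)
    then have "(\<integral>\<alpha>. A \<xi> \<alpha> \<partial>circ) = \<xi> $ a * (q (2 * pi) * f (rot \<xi> (2 * pi) x)) - \<xi> $ a * (q 0 * f (rot \<xi> 0 x))"
      using slice[OF cA] by (intro integral_circ_deriv) (auto simp: has_real_derivative_iff_has_vector_derivative)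
    then show ?thesis by (simp add: q0)
  qed
  have Ceq: "C \<xi> \<alpha> = \<kappa> \<alpha> / 2 * (\<Sum>b\<in>UNIV. Lop b (\<lambda>\<xi>. w \<alpha> \<xi> $ b * f (rot \<xi> \<alpha> x)) \<xi>)" if "norm \<xi> = 1" for \<xi> \<alpha>
  proof -
    have "G \<xi> \<alpha> = \<kappa> \<alpha> * ((1 - cos \<alpha>) * Lop a f (rot \<xi> \<alpha> x))" by (simp add: G_def q)
    also have "\<dots> = A \<xi> \<alpha> + B \<xi> \<alpha> + \<kappa> \<alpha> / 2 * (\<Sum>b\<in>UNIV. Lop b (\<lambda>\<xi>. w \<alpha> \<xi> $ b * f (rot \<xi> \<alpha> x)) \<xi>)"
      unfolding Lop_rot_key[OF f that] A_def B_def w_def q r by (simp add: algebra_simps)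
    finally show ?thesis by (simp add: C_def)
  qed
  have intC: "(\<integral>\<xi>. C \<xi> \<alpha> \<partial>\<sigma>) = 0" for \<alpha>
  proof -
    have rw: "rpf (\<lambda>\<xi>. w \<alpha> \<xi> $ b * f (rot \<xi> \<alpha> x))" for b
      using exhaust_3[of b] rpf_rot_axis[OF f] by (auto simp: w_def cross_components)
    have "(\<integral>\<xi>. C \<xi> \<alpha> \<partial>\<sigma>) = (\<integral>\<xi>. \<kappa> \<alpha> / 2 * (\<Sum>b\<in>UNIV. Lop b (\<lambda>\<xi>. w \<alpha> \<xi> $ b * f (rot \<xi> \<alpha> x)) \<xi>) \<partial>\<sigma>)"
      by (rule Bochner_Integration.integral_cong) (auto simp: Ceq)
    also have "\<dots> = \<kappa> \<alpha> / 2 * (\<Sum>b\<in>UNIV. \<integral>\<xi>. Lop b (\<lambda>\<xi>. w \<alpha> \<xi> $ b * f (rot \<xi> \<alpha> x)) \<xi> \<partial>\<sigma>)"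
      using rw by (simp add: integrable_sigma_rpf Bochner_Integration.integral_sum)
    also have "\<dots> = 0" using integral_Lop_zero[OF rw] by simp
    finally show ?thesis .
  qed
  note fub = sphere_circ_fubini
  have "(\<integral>\<xi>. \<integral>\<alpha>. G \<xi> \<alpha> \<partial>circ \<partial>\<sigma>) = (\<integral>\<xi>. (\<integral>\<alpha>. C \<xi> \<alpha> \<partial>circ) + (\<integral>\<alpha>. B \<xi> \<alpha> \<partial>circ) \<partial>\<sigma>)"
  proof (rule Bochner_Integration.integral_cong)
    fix \<xi> assume "\<xi> \<in> space \<sigma>"
    then have n: "norm \<xi> = 1" by simp
    have "(\<integral>\<alpha>. G \<xi> \<alpha> \<partial>circ) = (\<integral>\<alpha>. C \<xi> \<alpha> + B \<xi> \<alpha> + A \<xi> \<alpha> \<partial>circ)"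
      by (simp add: C_def)
    also have "\<dots> = (\<integral>\<alpha>. C \<xi> \<alpha> \<partial>circ) + (\<integral>\<alpha>. B \<xi> \<alpha> \<partial>circ) + (\<integral>\<alpha>. A \<xi> \<alpha> \<partial>circ)"
      using slice[OF cC] slice[OF cB] slice[OF cA] by (simp add: integrable_circ_continuous)
    finally show "(\<integral>\<alpha>. G \<xi> \<alpha> \<partial>circ) = (\<integral>\<alpha>. C \<xi> \<alpha> \<partial>circ) + (\<integral>\<alpha>. B \<xi> \<alpha> \<partial>circ)"
      using intA[OF n] by simp
  qed simp
  also have "\<dots> = (\<integral>\<xi>. \<integral>\<alpha>. C \<xi> \<alpha> \<partial>circ \<partial>\<sigma>) + (\<integral>\<xi>. \<integral>\<alpha>. B \<xi> \<alpha> \<partial>circ \<partial>\<sigma>)"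
    using fub(2)[OF cC] fub(2)[OF cB] by simp
  also have "(\<integral>\<xi>. \<integral>\<alpha>. C \<xi> \<alpha> \<partial>circ \<partial>\<sigma>) = 0"
    unfolding fub(1)[OF cC] intC by simp
  finally show ?thesis by (simp add: G_def B_def)
qed

section \<open>Trigonometric polynomials along rotation orbits and their Fourier
  coefficients\<close>

inductive trig :: "nat \<Rightarrow> (real \<Rightarrow> real) \<Rightarrow> bool" for N where
  trig_cos: "m \<le> N \<Longrightarrow> trig N (\<lambda>\<alpha>. cos (real m * \<alpha>))"
| trig_sin: "m \<le> N \<Longrightarrow> trig N (\<lambda>\<alpha>. sin (real m * \<alpha>))"
| trig_add: "trig N \<phi> \<Longrightarrow> trig N \<psi> \<Longrightarrow> trig N (\<lambda>\<alpha>. \<phi> \<alpha> + \<psi> \<alpha>)"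
| trig_cmult: "trig N \<phi> \<Longrightarrow> trig N (\<lambda>\<alpha>. c * \<phi> \<alpha>)"

lemma trig_mono: "trig M \<phi> \<Longrightarrow> M \<le> N \<Longrightarrow> trig N \<phi>"
  by (induction rule: trig.induct) (auto intro: trig.intros)

lemma trig_const: "trig N (\<lambda>\<alpha>. c)"
  using trig_cmult[OF trig_cos[of 0 N], of c] by simp

lemma trig_continuous: "trig N \<phi> \<Longrightarrow> continuous_on S \<phi>"
  by (induction rule: trig.induct) (auto intro!: continuous_intros)

lemma trig_cos_mult: "trig N \<phi> \<Longrightarrow> trig (Suc N) (\<lambda>\<alpha>. cos \<alpha> * \<phi> \<alpha>)"
proof (induction rule: trig.induct)
  case (trig_cos m)
  show ?case
  proof (cases m)
    case 0
    then show ?thesis using trig.trig_cos[of 1 "Suc N"] by simp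
  next
    case (Suc n)
    have "trig (Suc N) (\<lambda>\<alpha>. 1 / 2 * (cos (real n * \<alpha>) + cos (real (n + 2) * \<alpha>)))"
      using trig_cos Suc by (intro trig_cmult trig_add trig.trig_cos) auto
    moreover have "cos \<alpha> * cos (real m * \<alpha>) = 1 / 2 * (cos (real n * \<alpha>) + cos (real (n + 2) * \<alpha>))" for \<alpha>
    proof -
      have "real n * \<alpha> = real m * \<alpha> - \<alpha>" "real (n + 2) * \<alpha> = real m * \<alpha> + \<alpha>" by (simp_all add: Suc algebra_simps)
      then show ?thesis by (simp only: cos_add cos_diff) simp
    qed
    ultimately show ?thesis by (simp only:)
  qed
next
  case (trig_sin m)
  show ?case
  proof (cases m)
    case 0
    then show ?thesis using trig_const[of "Suc N" 0] by simp
  next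
    case (Suc n)
    have "trig (Suc N) (\<lambda>\<alpha>. 1 / 2 * (sin (real n * \<alpha>) + sin (real (n + 2) * \<alpha>)))"
      using trig_sin Suc by (intro trig_cmult trig_add trig.trig_sin) auto
    moreover have "cos \<alpha> * sin (real m * \<alpha>) = 1 / 2 * (sin (real n * \<alpha>) + sin (real (n + 2) * \<alpha>))" for \<alpha>
    proof -
      have "real n * \<alpha> = real m * \<alpha> - \<alpha>" "real (n + 2) * \<alpha> = real m * \<alpha> + \<alpha>" by (simp_all add: Suc algebra_simps)
      then show ?thesis by (simp only: sin_add sin_diff) simp
    qed
    ultimately show ?thesis by (simp only:)
  qed
next
  case (trig_add \<phi> \<psi>)
  then show ?case by (simp add: distrib_left trig.trig_add)
next
  case (trig_cmult \<phi> c)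
  then show ?case using trig.trig_cmult[OF trig_cmult.IH, of c] by (simp add: mult.left_commute)
qed

lemma trig_sin_mult: "trig N \<phi> \<Longrightarrow> trig (Suc N) (\<lambda>\<alpha>. sin \<alpha> * \<phi> \<alpha>)"
proof (induction rule: trig.induct)
  case (trig_cos m)
  show ?case
  proof (cases m)
    case 0
    then show ?thesis using trig.trig_sin[of 1 "Suc N"] by simp
  next
    case (Suc n)
    have "trig (Suc N) (\<lambda>\<alpha>. (- 1 / 2) * sin (real n * \<alpha>) + 1 / 2 * sin (real (n + 2) * \<alpha>))"
      using trig_cos Suc by (intro trig_cmult trig_add trig.trig_sin) auto
    moreover have "sin \<alpha> * cos (real m * \<alpha>) = (- 1 / 2) * sin (real n * \<alpha>) + 1 / 2 * sin (real (n + 2) * \<alpha>)" for \<alpha>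
    proof -
      have "real n * \<alpha> = real m * \<alpha> - \<alpha>" "real (n + 2) * \<alpha> = real m * \<alpha> + \<alpha>" by (simp_all add: Suc algebra_simps)
      then show ?thesis by (simp only: sin_add sin_diff) (simp add: algebra_simps)
    qed
    ultimately show ?thesis by (simp only:)
  qed
next
  case (trig_sin m)
  show ?case
  proof (cases m)
    case 0
    then show ?thesis using trig_const[of "Suc N" 0] by simp
  next
    case (Suc n)
    have "trig (Suc N) (\<lambda>\<alpha>. 1 / 2 * cos (real n * \<alpha>) + (- 1 / 2) * cos (real (n + 2) * \<alpha>))"
      using trig_sin Suc by (intro trig_cmult trig_add trig.trig_cos) auto
    moreover have "sin \<alpha> * sin (real m * \<alpha>) = 1 / 2 * cos (real n * \<alpha>) + (- 1 / 2) * cos (real (n + 2) * \<alpha>)" for \<alpha>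
    proof -
      have "real n * \<alpha> = real m * \<alpha> - \<alpha>" "real (n + 2) * \<alpha> = real m * \<alpha> + \<alpha>" by (simp_all add: Suc algebra_simps)
      then show ?thesis by (simp only: cos_add cos_diff) (simp add: algebra_simps)
    qed
    ultimately show ?thesis by (simp only:)
  qed
next
  case (trig_add \<phi> \<psi>)
  then show ?case by (simp add: distrib_left trig.trig_add)
next
  case (trig_cmult \<phi> c)
  then show ?case using trig.trig_cmult[OF trig_cmult.IH, of c] by (simp add: mult.left_commute)
qed

text \<open>Each coordinate of an orbit is a trigonometric polynomial of degree one. Hence a kernel
  that is correct for frequencies up to \<open>N\<close> treats polynomials of degree up to
  \<open>N\<close> exactly.\<close>

lemma hpoly_rot_trig: "hpoly n f \<Longrightarrow> trig n (\<lambda>\<alpha>. f (rot \<xi> \<alpha> x))"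
proof (induction rule: hpoly.induct)
  case (hpoly_const c)
  show ?case by (rule trig_const)
next
  case (hpoly_coord_mult n f i)
  define \<phi> where "\<phi> \<alpha> = f (rot \<xi> \<alpha> x)" for \<alpha>
  have "trig (Suc n) (\<lambda>\<alpha>. (x $ i - (\<xi> \<bullet> x) * \<xi> $ i) * (cos \<alpha> * \<phi> \<alpha>) + (cross3 \<xi> x $ i * (sin \<alpha> * \<phi> \<alpha>) + ((\<xi> \<bullet> x) * \<xi> $ i) * \<phi> \<alpha>))"
    using hpoly_coord_mult
    by (intro trig_add trig_cmult trig_cos_mult trig_sin_mult) (auto simp: \<phi>_def[abs_def] intro: trig_mono)
  moreover have "rot \<xi> \<alpha> x $ i * f (rot \<xi> \<alpha> x) = (x $ i - (\<xi> \<bullet> x) * \<xi> $ i) * (cos \<alpha> * \<phi> \<alpha>) + (cross3 \<xi> x $ i * (sin \<alpha> * \<phi> \<alpha>) + ((\<xi> \<bullet> x) * \<xi> $ i) * \<phi> \<alpha>)" for \<alpha>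
  proof -
    have "rot \<xi> \<alpha> x $ i = (x $ i - (\<xi> \<bullet> x) * \<xi> $ i) * cos \<alpha> + cross3 \<xi> x $ i * sin \<alpha> + (\<xi> \<bullet> x) * \<xi> $ i"
      by (simp add: rot_def algebra_simps)
    then show ?thesis unfolding \<phi>_def by (simp only: distrib_right mult.assoc add.assoc)
  qed
  ultimately show ?case by (simp only:)
next
  case (hpoly_add n f g)
  then show ?case by (simp add: trig_add)
qed

lemma integral_circ_cos: "(\<integral>\<alpha>. cos (of_int z * \<alpha>) \<partial>circ) = (if z = 0 then 2 * pi else 0)"
proof (cases "z = 0")
  case False
  have "((\<lambda>\<alpha>. sin (of_int z * \<alpha>) / of_int z) has_vector_derivative cos (of_int z * \<alpha>)) (at \<alpha>)" for \<alpha> :: real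
    unfolding has_real_derivative_iff_has_vector_derivative[symmetric]
    using False by (auto intro!: derivative_eq_intros)
  from integral_circ_deriv[OF this] have "(\<integral>\<alpha>. cos (of_int z * \<alpha>) \<partial>circ) = sin (of_int z * (2 * pi)) / of_int z"
    by (simp add: continuous_intros)
  also have "sin (of_int z * (2 * pi)) = 0"
    using sin_integer_2pi[of "of_int z"] by (simp add: mult_ac)
  finally show ?thesis using False by simp
qed simp

lemma integral_circ_sin: "(\<integral>\<alpha>. sin (of_int z * \<alpha>) \<partial>circ) = 0"
proof (cases "z = 0")
  case False
  have "((\<lambda>\<alpha>. - cos (of_int z * \<alpha>) / of_int z) has_vector_derivative sin (of_int z * \<alpha>)) (at \<alpha>)" for \<alpha> :: real
    unfolding has_real_derivative_iff_has_vector_derivative[symmetric]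
    using False by (auto intro!: derivative_eq_intros)
  from integral_circ_deriv[OF this] have "(\<integral>\<alpha>. sin (of_int z * \<alpha>) \<partial>circ) = (1 - cos (of_int z * (2 * pi))) / of_int z"
    by (simp add: continuous_intros diff_divide_distrib)
  also have "cos (of_int z * (2 * pi)) = 1"
    using cos_integer_2pi[of "of_int z"] by (simp add: mult_ac)
  finally show ?thesis by simp
qed simp

lemma integral_circ_products:
  fixes m n :: nat
  shows "(\<integral>\<alpha>. cos (real m * \<alpha>) * cos (real n * \<alpha>) \<partial>circ) = (if m = n then if m = 0 then 2 * pi else pi else 0)"
    and "(\<integral>\<alpha>. sin (real m * \<alpha>) * cos (real n * \<alpha>) \<partial>circ) = 0"
    and "(\<integral>\<alpha>. sin (real m * \<alpha>) * sin (real n * \<alpha>) \<partial>circ) = (if m = n \<and> m \<noteq> 0 then pi else 0)"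
proof -
  have i: "integrable circ (\<lambda>\<alpha>. cos (of_int z * \<alpha>))" "integrable circ (\<lambda>\<alpha>. sin (of_int z * \<alpha>))" for z
    by (intro integrable_circ_continuous continuous_intros)+
  have e: "real m * \<alpha> - real n * \<alpha> = of_int (int m - int n) * \<alpha>" "real m * \<alpha> + real n * \<alpha> = of_int (int m + int n) * \<alpha>" for \<alpha>
    by (simp_all add: algebra_simps)
  have "(\<integral>\<alpha>. cos (real m * \<alpha>) * cos (real n * \<alpha>) \<partial>circ)
    = (\<integral>\<alpha>. (cos (of_int (int m - int n) * \<alpha>) + cos (of_int (int m + int n) * \<alpha>)) / 2 \<partial>circ)"
    unfolding e[symmetric] cos_times_cos ..
  then show "(\<integral>\<alpha>. cos (real m * \<alpha>) * cos (real n * \<alpha>) \<partial>circ) = (if m = n then if m = 0 then 2 * pi else pi else 0)"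
    using i by (auto simp: integral_circ_cos simp del: of_int_diff of_int_add)
  have "(\<integral>\<alpha>. sin (real m * \<alpha>) * cos (real n * \<alpha>) \<partial>circ)
    = (\<integral>\<alpha>. (sin (of_int (int m + int n) * \<alpha>) + sin (of_int (int m - int n) * \<alpha>)) / 2 \<partial>circ)"
    unfolding e[symmetric] sin_times_cos ..
  then show "(\<integral>\<alpha>. sin (real m * \<alpha>) * cos (real n * \<alpha>) \<partial>circ) = 0"
    using i by (auto simp: integral_circ_sin simp del: of_int_diff of_int_add)
  have "(\<integral>\<alpha>. sin (real m * \<alpha>) * sin (real n * \<alpha>) \<partial>circ)
    = (\<integral>\<alpha>. (cos (of_int (int m - int n) * \<alpha>) - cos (of_int (int m + int n) * \<alpha>)) / 2 \<partial>circ)"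
    unfolding e[symmetric] sin_times_sin ..
  then show "(\<integral>\<alpha>. sin (real m * \<alpha>) * sin (real n * \<alpha>) \<partial>circ) = (if m = n \<and> m \<noteq> 0 then pi else 0)"
    using i by (auto simp: integral_circ_cos simp del: of_int_diff of_int_add)
qed

lemma integral_circ_products':
  fixes m n :: nat
  shows "(\<integral>\<alpha>. cos (real m * \<alpha>) * sin (real n * \<alpha>) \<partial>circ) = 0"
  using integral_circ_products(2)[of n m] by (simp add: mult.commute)

lemma trig_orthogonal:
  assumes "trig N \<phi>" "N < n"
  shows "(\<integral>\<alpha>. \<phi> \<alpha> * cos (real n * \<alpha>) \<partial>circ) = 0" "(\<integral>\<alpha>. \<phi> \<alpha> * sin (real n * \<alpha>) \<partial>circ) = 0"
proof -
  have "(\<integral>\<alpha>. \<phi> \<alpha> * cos (real n * \<alpha>) \<partial>circ) = 0 \<and> (\<integral>\<alpha>. \<phi> \<alpha> * sin (real n * \<alpha>) \<partial>circ) = 0"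
    using assms(1)
  proof (induction rule: trig.induct)
    case (trig_cos m)
    then show ?case using assms(2) by (auto simp: integral_circ_products integral_circ_products')
  next
    case (trig_sin m)
    then show ?case using assms(2) by (auto simp: integral_circ_products)
  next
    case (trig_add \<phi> \<psi>)
    have i: "integrable circ (\<lambda>\<alpha>. f \<alpha> * cos (real n * \<alpha>))" "integrable circ (\<lambda>\<alpha>. f \<alpha> * sin (real n * \<alpha>))" if "trig N f" for f
      by (intro integrable_circ_continuous continuous_intros trig_continuous[OF that])+
    show ?case using trig_add i[of \<phi>] i[of \<psi>] by (simp add: distrib_right)
  next
    case (trig_cmult \<phi> c)
    then show ?case by (simp add: mult.assoc)
  qed
  then show "(\<integral>\<alpha>. \<phi> \<alpha> * cos (real n * \<alpha>) \<partial>circ) = 0" "(\<integral>\<alpha>. \<phi> \<alpha> * sin (real n * \<alpha>) \<partial>circ) = 0" by auto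
qed

text \<open>Convolution with the Dirichlet kernel of order \<open>N\<close> reproduces trigonometric
  polynomials of degree \<open>N\<close>; this is its value at 0.\<close>

lemma trig_at_zero:
  assumes "trig N \<phi>"
  shows "2 * pi * \<phi> 0 = (\<integral>\<alpha>. \<phi> \<alpha> \<partial>circ) + 2 * (\<Sum>j=1..N. \<integral>\<alpha>. \<phi> \<alpha> * cos (real j * \<alpha>) \<partial>circ)"
  using assms
proof (induction rule: trig.induct)
  case (trig_cos m)
  show ?case
    using trig_cos integral_circ_cos[of "int m"]
    by (auto simp: integral_circ_products sum.delta' if_distrib[of "\<lambda>x. x * _"] cong: if_cong)
next
  case (trig_sin m)
  show ?case using integral_circ_sin[of "int m"] by (simp add: integral_circ_products)
next
  case (trig_add \<phi> \<psi>)
  have i: "integrable circ (\<lambda>\<alpha>. f \<alpha> * cos (real n * \<alpha>))" "integrable circ f" if "trig N f" for f n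
    by (intro integrable_circ_continuous continuous_intros trig_continuous[OF that])+
  show ?case using trig_add i[of \<phi>] i[of \<psi>] by (simp add: distrib_right sum.distrib distrib_left)
next
  case (trig_cmult \<phi> c)
  have "2 * pi * (c * \<phi> 0) = c * (2 * pi * \<phi> 0)" by simp
  also have "\<dots> = (\<integral>\<alpha>. c * \<phi> \<alpha> \<partial>circ) + 2 * (\<Sum>j=1..N. \<integral>\<alpha>. c * \<phi> \<alpha> * cos (real j * \<alpha>) \<partial>circ)"
    unfolding trig_cmult.IH by (simp add: mult.assoc distrib_left sum_distrib_left[symmetric])
  finally show ?case .
qed

section \<open>Dirichlet, Fejer and conjugate kernels\<close>

definition dirichlet :: "nat \<Rightarrow> real \<Rightarrow> real" where
  "dirichlet j \<alpha> = 1 + 2 * (\<Sum>m=1..j. cos (real m * \<alpha>))"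

lemma dirichlet_Suc: "dirichlet (Suc j) \<alpha> = dirichlet j \<alpha> + 2 * cos (real (Suc j) * \<alpha>)"
  by (simp add: dirichlet_def distrib_left)

text \<open>\<open>dirichlet j\<close> is the character of the rotation group in degree
  \<open>j\<close>. Taken as \<open>\<kappa>\<close> in \<open>integral_Lop_rot\<close>, it has the
  weight \<open>q\<close> found here and the weight \<open>r\<close> found in
  \<open>dirichlet_mult_sin\<close>.\<close>

lemma dirichlet_mult_cos: "(1 - cos \<alpha>) * dirichlet j \<alpha> = cos (real j * \<alpha>) - cos (real (Suc j) * \<alpha>)"
proof (induction j)
  case 0
  show ?case by (simp add: dirichlet_def)
next
  case (Suc j)
  have e: "real j * \<alpha> = real (Suc j) * \<alpha> - \<alpha>" "real (Suc (Suc j)) * \<alpha> = real (Suc j) * \<alpha> + \<alpha>"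
    by (simp_all add: algebra_simps)
  have "(1 - cos \<alpha>) * dirichlet (Suc j) \<alpha> = cos (real j * \<alpha>) - cos (real (Suc j) * \<alpha>) + 2 * (1 - cos \<alpha>) * cos (real (Suc j) * \<alpha>)"
    unfolding dirichlet_Suc distrib_left Suc by simp
  also have "\<dots> = cos (real (Suc j) * \<alpha>) - cos (real (Suc (Suc j)) * \<alpha>)"
    unfolding e by (simp add: cos_add cos_diff algebra_simps del: of_nat_Suc)
  finally show ?case .
qed

lemma dirichlet_mult_sin: "sin \<alpha> * dirichlet j \<alpha> = sin (real j * \<alpha>) + sin (real (Suc j) * \<alpha>)"
proof (induction j)
  case 0
  show ?case by (simp add: dirichlet_def)
next
  case (Suc j)
  have e: "real j * \<alpha> = real (Suc j) * \<alpha> - \<alpha>" "real (Suc (Suc j)) * \<alpha> = real (Suc j) * \<alpha> + \<alpha>"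
    by (simp_all add: algebra_simps)
  have "sin \<alpha> * dirichlet (Suc j) \<alpha> = sin (real j * \<alpha>) + sin (real (Suc j) * \<alpha>) + 2 * sin \<alpha> * cos (real (Suc j) * \<alpha>)"
    unfolding dirichlet_Suc distrib_left Suc by simp
  also have "\<dots> = sin (real (Suc j) * \<alpha>) + sin (real (Suc (Suc j)) * \<alpha>)"
    unfolding e by (simp add: sin_add sin_diff algebra_simps del: of_nat_Suc)
  finally show ?case .
qed

lemma continuous_on_dirichlet: "continuous_on S (dirichlet j)"
  unfolding dirichlet_def[abs_def] by (intro continuous_intros)

definition fejer :: "nat \<Rightarrow> real \<Rightarrow> real" where
  "fejer N \<alpha> = (\<Sum>j\<le>N. dirichlet j \<alpha>)"

text \<open>Equal to twice the sum of sin (m \<alpha>) for m from 1 to N, plus sin ((N + 1)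
  \<alpha>): a conjugate Dirichlet kernel with its top frequency halved. The grouping in pairs makes
  it sin \<alpha> times \<open>fejer N\<close>, the form required of \<open>r\<close> in
  \<open>integral_Lop_rot\<close>.\<close>

definition conj_kernel :: "nat \<Rightarrow> real \<Rightarrow> real" where
  "conj_kernel N \<alpha> = (\<Sum>j\<le>N. sin (real j * \<alpha>) + sin (real (Suc j) * \<alpha>))"

lemma fejer_mult_cos: "1 - cos (real (Suc N) * \<alpha>) = (1 - cos \<alpha>) * fejer N \<alpha>"
  unfolding fejer_def sum_distrib_left dirichlet_mult_cos
  using sum_telescope[of "\<lambda>j. cos (real j * \<alpha>)" N] by simp

lemma fejer_mult_sin: "conj_kernel N \<alpha> = sin \<alpha> * fejer N \<alpha>"
  unfolding fejer_def conj_kernel_def sum_distrib_left dirichlet_mult_sin ..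

lemma continuous_on_fejer: "continuous_on S (fejer N)"
  unfolding fejer_def[abs_def] by (intro continuous_intros continuous_on_dirichlet)

lemma continuous_on_conj_kernel: "continuous_on S (conj_kernel N)"
  unfolding conj_kernel_def[abs_def] by (intro continuous_intros)

text \<open>Haar measure corresponds, up to a constant, to the weight 1 - cos \<alpha>. The weight 1
  gives a different average, still invariant under conjugation, which harmonics of positive degree
  survive.\<close>

definition axis_avg :: "(real \<Rightarrow> real) \<Rightarrow> (vec3 \<Rightarrow> real) \<Rightarrow> vec3 \<Rightarrow> real" where
  "axis_avg w f x = (\<integral>\<xi>. \<integral>\<alpha>. w \<alpha> * f (rot \<xi> \<alpha> x) \<partial>circ \<partial>\<sigma>)"

lemma axis_continuous:
  assumes "rpf f" "continuous_on UNIV w"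
  shows "continuous_on UNIV (\<lambda>(\<xi>, \<alpha>). w \<alpha> * f (rot \<xi> \<alpha> x))"
proof -
  have "continuous_on UNIV (\<lambda>z::vec3 \<times> real. w (snd z))"
    by (rule continuous_on_compose2[OF assms(2)]) (auto intro: continuous_intros)
  then show ?thesis unfolding case_prod_beta
    by (intro continuous_intros continuous_on_rpf_compose[OF assms(1)])
qed

lemma axis_integrable:
  assumes "rpf f" "continuous_on UNIV w"
  shows "integrable \<sigma> (\<lambda>\<xi>. \<integral>\<alpha>. w \<alpha> * f (rot \<xi> \<alpha> x) \<partial>circ)"
    and "integrable circ (\<lambda>\<alpha>. w \<alpha> * f (rot \<xi> \<alpha> x))"
proof -
  show "integrable \<sigma> (\<lambda>\<xi>. \<integral>\<alpha>. w \<alpha> * f (rot \<xi> \<alpha> x) \<partial>circ)"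
    by (rule sphere_circ_fubini(2)[OF axis_continuous[OF assms]])
  show "integrable circ (\<lambda>\<alpha>. w \<alpha> * f (rot \<xi> \<alpha> x))"
    using assms by (intro integrable_circ_continuous continuous_intros continuous_on_rpf_compose)
qed

lemma axis_avg_add:
  assumes "rpf f" "rpf g" "continuous_on UNIV w"
  shows "axis_avg w (\<lambda>x. f x + g x) x = axis_avg w f x + axis_avg w g x"
  using axis_integrable[OF assms(1,3)] axis_integrable[OF assms(2,3)]
  by (simp add: axis_avg_def distrib_left)

lemma axis_avg_weight_diff:
  assumes "rpf f" "continuous_on UNIV v" "continuous_on UNIV w"
  shows "axis_avg (\<lambda>\<alpha>. v \<alpha> - w \<alpha>) f x = axis_avg v f x - axis_avg w f x"
  using axis_integrable[OF assms(1,2)] axis_integrable[OF assms(1,3)]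
  by (simp add: axis_avg_def left_diff_distrib)

lemma axis_avg_cmult: "axis_avg w (\<lambda>x. c * f x) x = c * axis_avg w f x"
  by (simp add: axis_avg_def mult.left_commute[of _ c])

lemma sum_coord_Lop:
  assumes "rpf f"
  shows "(\<Sum>a\<in>UNIV. \<xi> $ a * Lop a f y) = frechet_derivative f (at y) (cross3 \<xi> y)"
  using assms by (simp add: sum_3 Lop_pd frechet_rpf_eq cross_components algebra_simps)

text \<open>With the character \<open>dirichlet j\<close> as \<open>\<kappa>\<close>, integrating by
  parts twice shows that the weight cos (j \<alpha>) - cos ((j + 1) \<alpha>) averages
  \<open>Cas f\<close> to - j (j + 1) times the average of \<open>f\<close>. The true eigenvalue is
  - k (k + 1), so for \<open>j \<noteq> k\<close> the average vanishes.\<close>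

lemma axis_avg_cos_step:
  assumes f: "harmp k f" and "j \<noteq> k"
  shows "axis_avg (\<lambda>\<alpha>. cos (real j * \<alpha>)) f x = axis_avg (\<lambda>\<alpha>. cos (real (Suc j) * \<alpha>)) f x"
proof -
  define q q' r where "q \<alpha> = cos (real j * \<alpha>) - cos (real (Suc j) * \<alpha>)"
    and "q' \<alpha> = - real j * sin (real j * \<alpha>) + real (Suc j) * sin (real (Suc j) * \<alpha>)"
    and "r \<alpha> = sin (real j * \<alpha>) + sin (real (Suc j) * \<alpha>)" for \<alpha> :: real
  have rf: "rpf f" using f by (rule harmp_rpf)
  have rL: "rpf (Lop a f)" for a using rf by simp
  have cq: "continuous_on UNIV q" "continuous_on UNIV q'" "continuous_on UNIV r"
    unfolding q_def q'_def r_def by (intro continuous_intros)+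
  have q0: "q (2 * pi) = q 0"
    using cos_integer_2pi[of "real j"] cos_integer_2pi[of "real (Suc j)"]
    by (simp add: q_def mult_ac del: of_nat_Suc)
  have rq0: "r (2 * pi) - q' (2 * pi) = r 0 - q' 0"
    using sin_integer_2pi[of "real j"] sin_integer_2pi[of "real (Suc j)"]
    by (simp add: r_def q'_def mult_ac del: of_nat_Suc)
  have key: "(\<integral>\<xi>. \<integral>\<alpha>. q \<alpha> * Lop a (Lop a f) (rot \<xi> \<alpha> x) \<partial>circ \<partial>\<sigma>)
      = (\<integral>\<xi>. \<integral>\<alpha>. \<xi> $ a * Lop a f (rot \<xi> \<alpha> x) * (r \<alpha> - q' \<alpha>) \<partial>circ \<partial>\<sigma>)" for a
  proof (rule integral_Lop_rot[OF rL, where \<kappa> = "dirichlet j"])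
    show "(q has_real_derivative q' \<alpha>) (at \<alpha>)" for \<alpha>
      unfolding q_def q'_def by (auto intro!: derivative_eq_intros)
  qed (use q0 cq in \<open>auto simp: q_def r_def dirichlet_mult_cos dirichlet_mult_sin continuous_on_dirichlet\<close>)
  have cL: "continuous_on UNIV (\<lambda>(\<xi>, \<alpha>). \<xi> $ a * Lop a f (rot \<xi> \<alpha> x) * (r \<alpha> - q' \<alpha>))" for a
  proof -
    have "continuous_on UNIV (\<lambda>(\<xi>, \<alpha>). (r \<alpha> - q' \<alpha>) * Lop a f (rot \<xi> \<alpha> x))"
      using cq by (intro axis_continuous rL continuous_intros)
    moreover have "continuous_on UNIV (\<lambda>z::vec3 \<times> real. fst z $ a)" by (intro continuous_intros)
    ultimately have "continuous_on UNIV (\<lambda>z. fst z $ a * (case z of (\<xi>, \<alpha>) \<Rightarrow> (r \<alpha> - q' \<alpha>) * Lop a f (rot \<xi> \<alpha> x)))"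
      by (intro continuous_intros)
    then show ?thesis by (simp add: case_prod_beta mult_ac)
  qed
  have iL: "integrable circ (\<lambda>\<alpha>. \<xi> $ a * Lop a f (rot \<xi> \<alpha> x) * (r \<alpha> - q' \<alpha>))" for a \<xi>
    using cq by (intro integrable_circ_continuous continuous_intros continuous_on_rpf_compose[OF rL])
  have "axis_avg q (Cas f) x = (\<Sum>a\<in>UNIV. \<integral>\<xi>. \<integral>\<alpha>. q \<alpha> * Lop a (Lop a f) (rot \<xi> \<alpha> x) \<partial>circ \<partial>\<sigma>)"
    using rf cq by (simp add: Cas_def axis_avg_add) (simp add: axis_avg_def sum_3)
  also have "\<dots> = (\<integral>\<xi>. (\<Sum>a\<in>UNIV. \<integral>\<alpha>. \<xi> $ a * Lop a f (rot \<xi> \<alpha> x) * (r \<alpha> - q' \<alpha>) \<partial>circ) \<partial>\<sigma>)"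
    unfolding key using sphere_circ_fubini(2)[OF cL] by (simp add: Bochner_Integration.integral_sum)
  also have "\<dots> = (\<integral>\<xi>. \<integral>\<alpha>. - (real j * (real j + 1)) * (q \<alpha> * f (rot \<xi> \<alpha> x)) \<partial>circ \<partial>\<sigma>)"
  proof (rule Bochner_Integration.integral_cong)
    fix \<xi> assume "\<xi> \<in> space \<sigma>"
    then have n: "norm \<xi> = 1" by simp
    define D where "D \<alpha> = frechet_derivative f (at (rot \<xi> \<alpha> x)) (cross3 \<xi> (rot \<xi> \<alpha> x))" for \<alpha>
    have Dd: "((\<lambda>\<alpha>. f (rot \<xi> \<alpha> x)) has_real_derivative D \<alpha>) (at \<alpha>)" for \<alpha>
      unfolding D_def by (rule rpf_rot_has_vector_derivative[OF rf n])
    have cD: "continuous_on UNIV D"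
      unfolding D_def frechet_rpf_eq[OF rf]
      using rf by (intro continuous_intros continuous_on_rpf_compose continuous_on_cross) auto
    have cf: "continuous_on UNIV (\<lambda>\<alpha>. f (rot \<xi> \<alpha> x))"
      by (intro continuous_intros continuous_on_rpf_compose[OF rf])
    \<comment> \<open>This relation between the weights produces the factor j (j + 1) in the second
      integration by parts, the one in \<alpha>.\<close>
    have rq: "((\<lambda>\<alpha>. r \<alpha> - q' \<alpha>) has_real_derivative real j * (real j + 1) * q \<alpha>) (at \<alpha>)" for \<alpha>
      unfolding r_def q'_def q_def by (auto intro!: derivative_eq_intros simp: algebra_simps)
    have "((\<lambda>\<alpha>. f (rot \<xi> \<alpha> x) * (r \<alpha> - q' \<alpha>)) has_vector_derivative
        D \<alpha> * (r \<alpha> - q' \<alpha>) + real j * (real j + 1) * q \<alpha> * f (rot \<xi> \<alpha> x)) (at \<alpha>)" for \<alpha>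
      unfolding has_real_derivative_iff_has_vector_derivative[symmetric] by (rule DERIV_mult[OF Dd rq])
    from integral_circ_deriv[OF this]
    have "(\<integral>\<alpha>. D \<alpha> * (r \<alpha> - q' \<alpha>) + real j * (real j + 1) * q \<alpha> * f (rot \<xi> \<alpha> x) \<partial>circ) = 0"
      using cD cf cq rq0 by (simp add: continuous_intros)
    moreover have "integrable circ (\<lambda>\<alpha>. D \<alpha> * (r \<alpha> - q' \<alpha>))" "integrable circ (\<lambda>\<alpha>. q \<alpha> * f (rot \<xi> \<alpha> x))"
      using cD cf cq by (auto intro!: integrable_circ_continuous intro: continuous_on_mult continuous_on_diff)
    ultimately have "(\<integral>\<alpha>. D \<alpha> * (r \<alpha> - q' \<alpha>) \<partial>circ) = - (real j * (real j + 1)) * (\<integral>\<alpha>. q \<alpha> * f (rot \<xi> \<alpha> x) \<partial>circ)"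
      by (simp add: mult.assoc)
    moreover have "(\<Sum>a\<in>UNIV. \<integral>\<alpha>. \<xi> $ a * Lop a f (rot \<xi> \<alpha> x) * (r \<alpha> - q' \<alpha>) \<partial>circ) = (\<integral>\<alpha>. D \<alpha> * (r \<alpha> - q' \<alpha>) \<partial>circ)"
      unfolding D_def sum_coord_Lop[OF rf, symmetric] sum_distrib_right
      using iL by (simp add: Bochner_Integration.integral_sum)
    ultimately show "(\<Sum>a\<in>UNIV. \<integral>\<alpha>. \<xi> $ a * Lop a f (rot \<xi> \<alpha> x) * (r \<alpha> - q' \<alpha>) \<partial>circ)
      = (\<integral>\<alpha>. - (real j * (real j + 1)) * (q \<alpha> * f (rot \<xi> \<alpha> x)) \<partial>circ)" by simp
  qed simp
  also have "\<dots> = - (real j * (real j + 1)) * axis_avg q f x"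
    by (simp add: axis_avg_def)
  finally have "axis_avg q (Cas f) x = - (real j * (real j + 1)) * axis_avg q f x" .
  moreover have "axis_avg q (Cas f) x = - (real k * (real k + 1)) * axis_avg q f x"
  proof -
    have "Cas f = (\<lambda>x. - (real k * (real k + 1)) * f x)" using Cas_harm[OF f] by auto
    then show ?thesis by (simp only: axis_avg_cmult)
  qed
  ultimately have "(real k * (real k + 1) - real j * (real j + 1)) * axis_avg q f x = 0"
    by (simp add: algebra_simps)
  moreover have "real k * (real k + 1) - real j * (real j + 1) \<noteq> 0"
  proof -
    have "real k * (real k + 1) - real j * (real j + 1) = (real k - real j) * (real k + real j + 1)"
      by (simp add: algebra_simps)
    then show ?thesis using \<open>j \<noteq> k\<close> by (simp add: add_nonneg_eq_0_iff)
  qed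
  ultimately have "axis_avg q f x = 0" by simp
  then show ?thesis unfolding q_def
    by (subst (asm) axis_avg_weight_diff[OF rf]) (auto intro!: continuous_intros)
qed

definition sphere_circ_mass :: real where
  "sphere_circ_mass = 2 * pi * measure \<sigma> (sphere 0 1)"

lemma sphere_circ_mass_pos: "0 < sphere_circ_mass"
  using sigma_measure_pos by (simp add: sphere_circ_mass_def)

text \<open>Averages Fourier inversion on each orbit over all axes. By
  \<open>axis_avg_cos_step\<close> the \<open>k\<close> cosine averages all equal the average with
  weight 1, and the Dirichlet kernel counts them as 1 + 2 k.\<close>

theorem axis_avg_harmonic:
  assumes f: "harmp k f"
  shows "axis_avg (\<lambda>_. 1) f x = sphere_circ_mass / (2 * real k + 1) * f x"
proof -
  have rf: "rpf f" using f by (rule harmp_rpf)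
  define C where "C j = axis_avg (\<lambda>\<alpha>. cos (real j * \<alpha>)) f x" for j
  have C: "C j = C 0" if "j \<le> k" for j
    using that
  proof (induction j)
    case (Suc j)
    then show ?case using axis_avg_cos_step[OF f, of j x] by (simp add: C_def)
  qed simp
  have "2 * pi * f x = (\<integral>\<alpha>. f (rot \<xi> \<alpha> x) \<partial>circ) + 2 * (\<Sum>j=1..k. \<integral>\<alpha>. cos (real j * \<alpha>) * f (rot \<xi> \<alpha> x) \<partial>circ)" for \<xi>
    using trig_at_zero[OF hpoly_rot_trig[OF harmp_hpoly[OF f]], of \<xi> x] by (simp add: mult.commute)
  then have "(\<integral>\<xi>. 2 * pi * f x \<partial>\<sigma>) = (\<integral>\<xi>. (\<integral>\<alpha>. f (rot \<xi> \<alpha> x) \<partial>circ) + 2 * (\<Sum>j=1..k. \<integral>\<alpha>. cos (real j * \<alpha>) * f (rot \<xi> \<alpha> x) \<partial>circ) \<partial>\<sigma>)"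
    by simp
  also have "\<dots> = C 0 + 2 * (\<Sum>j=1..k. C j)"
  proof -
    have i: "integrable \<sigma> (\<lambda>\<xi>. \<integral>\<alpha>. cos (real j * \<alpha>) * f (rot \<xi> \<alpha> x) \<partial>circ)" for j
      by (intro axis_integrable rf continuous_intros)
    show ?thesis using i[of 0] i by (simp add: C_def axis_avg_def Bochner_Integration.integral_sum)
  qed
  also have "(\<Sum>j=1..k. C j) = (\<Sum>j=1..k. C 0)"
    by (intro sum.cong refl C) auto
  also have "C 0 + 2 * (\<Sum>j=1..k. C 0) = (2 * real k + 1) * C 0"
    by (simp add: algebra_simps)
  finally have "(2 * real k + 1) * C 0 = sphere_circ_mass * f x"
    by (simp add: sphere_circ_mass_def mult_ac)
  then show ?thesis by (simp add: C_def field_simps)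
qed

text \<open>\<open>integral_Lop_rot\<close> with \<open>fejer N\<close> as \<open>\<kappa>\<close>
  has the weight 1 - cos ((N + 1) \<alpha>). The frequency N + 1 is orthogonal to everything of
  degree \<open>k \<le> N\<close>, which turns this weight into 1 and removes \<open>q'\<close> on
  the other side; then \<open>axis_avg_harmonic\<close> applies to \<open>Lop a f\<close>.\<close>

theorem axis_avg_riesz:
  assumes f: "harmp k f" and "k \<le> N"
  shows "(\<integral>\<xi>. \<integral>\<alpha>. \<xi> $ a * f (rot \<xi> \<alpha> x) * conj_kernel N \<alpha> \<partial>circ \<partial>\<sigma>) = sphere_circ_mass / (2 * real k + 1) * Lop a f x"
proof -
  have rf: "rpf f" using f by (rule harmp_rpf)
  have hL: "harmp k (Lop a f)" using f by (rule harmp_Lop)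
  have rL: "rpf (Lop a f)" using rf by simp
  define q q' where "q \<alpha> = 1 - cos (real (Suc N) * \<alpha>)" and "q' \<alpha> = real (Suc N) * sin (real (Suc N) * \<alpha>)" for \<alpha> :: real
  have q0: "q (2 * pi) = q 0"
    using cos_integer_2pi[of "real (Suc N)"] by (simp add: q_def mult_ac del: of_nat_Suc)
  have cq: "continuous_on UNIV q" "continuous_on UNIV q'"
    unfolding q_def q'_def by (intro continuous_intros)+
  have key: "(\<integral>\<xi>. \<integral>\<alpha>. q \<alpha> * Lop a f (rot \<xi> \<alpha> x) \<partial>circ \<partial>\<sigma>)
      = (\<integral>\<xi>. \<integral>\<alpha>. \<xi> $ a * f (rot \<xi> \<alpha> x) * (conj_kernel N \<alpha> - q' \<alpha>) \<partial>circ \<partial>\<sigma>)"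
  proof (rule integral_Lop_rot[OF rf, where \<kappa> = "fejer N"])
    show "(q has_real_derivative q' \<alpha>) (at \<alpha>)" for \<alpha>
      unfolding q_def q'_def by (auto intro!: derivative_eq_intros)
  qed (use q0 cq in \<open>auto simp: q_def fejer_mult_cos[of N] fejer_mult_sin continuous_on_fejer simp del: of_nat_Suc\<close>)
  have kN: "k < Suc N" using \<open>k \<le> N\<close> by simp
  have "(\<integral>\<alpha>. q \<alpha> * Lop a f (rot \<xi> \<alpha> x) \<partial>circ) = (\<integral>\<alpha>. 1 * Lop a f (rot \<xi> \<alpha> x) \<partial>circ)" for \<xi>
  proof -
    have "integrable circ (\<lambda>\<alpha>. Lop a f (rot \<xi> \<alpha> x))" "integrable circ (\<lambda>\<alpha>. Lop a f (rot \<xi> \<alpha> x) * cos (real (Suc N) * \<alpha>))"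
      by (intro integrable_circ_continuous continuous_intros continuous_on_rpf_compose[OF rL])+
    then show ?thesis
      using trig_orthogonal(1)[OF hpoly_rot_trig[OF harmp_hpoly[OF hL]] kN, of \<xi> x]
      by (simp add: q_def left_diff_distrib mult.commute[of "cos _"] del: of_nat_Suc)
  qed
  moreover have "(\<integral>\<alpha>. \<xi> $ a * f (rot \<xi> \<alpha> x) * (conj_kernel N \<alpha> - q' \<alpha>) \<partial>circ) = (\<integral>\<alpha>. \<xi> $ a * f (rot \<xi> \<alpha> x) * conj_kernel N \<alpha> \<partial>circ)" for \<xi>
  proof -
    have "integrable circ (\<lambda>\<alpha>. \<xi> $ a * f (rot \<xi> \<alpha> x) * conj_kernel N \<alpha>)"
      "integrable circ (\<lambda>\<alpha>. f (rot \<xi> \<alpha> x) * sin (real (Suc N) * \<alpha>))"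
      by (intro integrable_circ_continuous continuous_intros continuous_on_rpf_compose[OF rf] continuous_on_conj_kernel)+
    moreover have "\<xi> $ a * f (rot \<xi> \<alpha> x) * (conj_kernel N \<alpha> - q' \<alpha>) = \<xi> $ a * f (rot \<xi> \<alpha> x) * conj_kernel N \<alpha>
       - (\<xi> $ a * real (Suc N)) * (f (rot \<xi> \<alpha> x) * sin (real (Suc N) * \<alpha>))" for \<alpha>
      by (simp add: q'_def right_diff_distrib mult_ac del: of_nat_Suc)
    ultimately show ?thesis
      using trig_orthogonal(2)[OF hpoly_rot_trig[OF harmp_hpoly[OF f]] kN, of \<xi> x]
      by (simp del: of_nat_Suc)
  qed
  ultimately have "axis_avg (\<lambda>_. 1) (Lop a f) x = (\<integral>\<xi>. \<integral>\<alpha>. \<xi> $ a * f (rot \<xi> \<alpha> x) * conj_kernel N \<alpha> \<partial>circ \<partial>\<sigma>)"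
    using key by (simp add: axis_avg_def)
  then show ?thesis using axis_avg_harmonic[OF hL] by simp
qed

text \<open>With \<open>\<kappa>\<close> = 1 the derivative of the weight equals \<open>r\<close>,
  and the right side of \<open>integral_Lop_rot\<close> vanishes: the Haar average annihilates all
  derivatives \<open>Lop\<close>, and for \<open>k \<noteq> 0\<close> the harmonic is itself a
  multiple of \<open>Cas f\<close>.\<close>

theorem axis_avg_haar:
  assumes f: "harmp k f" and "k \<noteq> 0"
  shows "axis_avg (\<lambda>\<alpha>. 1 - cos \<alpha>) f x = 0"
proof -
  have rf: "rpf f" using f by (rule harmp_rpf)
  have rL: "rpf (Lop a f)" for a using rf by simp
  have L: "axis_avg (\<lambda>\<alpha>. 1 - cos \<alpha>) (Lop a (Lop a f)) x = 0" for a
  proof -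
    have "(\<integral>\<xi>. \<integral>\<alpha>. (1 - cos \<alpha>) * Lop a (Lop a f) (rot \<xi> \<alpha> x) \<partial>circ \<partial>\<sigma>)
      = (\<integral>\<xi>. \<integral>\<alpha>. \<xi> $ a * Lop a f (rot \<xi> \<alpha> x) * (sin \<alpha> - sin \<alpha>) \<partial>circ \<partial>\<sigma>)"
      by (rule integral_Lop_rot[OF rL, where \<kappa> = "\<lambda>_. 1"]) (auto intro!: derivative_eq_intros continuous_intros)
    then show ?thesis by (simp add: axis_avg_def)
  qed
  have c: "continuous_on UNIV (\<lambda>\<alpha>::real. 1 - cos \<alpha>)" by (intro continuous_intros)
  have "axis_avg (\<lambda>\<alpha>. 1 - cos \<alpha>) (Cas f) x = 0"
    using rf c by (simp add: Cas_def axis_avg_add L)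
  moreover have "Cas f = (\<lambda>x. - (real k * (real k + 1)) * f x)" using Cas_harm[OF f] by auto
  ultimately have "- (real k * (real k + 1)) * axis_avg (\<lambda>\<alpha>. 1 - cos \<alpha>) f x = 0"
    by (simp only: axis_avg_cmult)
  then show ?thesis using \<open>k \<noteq> 0\<close> by (simp add: add_nonneg_eq_0_iff)
qed

section \<open>The conjugate function on the circle\<close>

text \<open>The sine coefficient of frequency 0 multiplies the zero function; setting it to 0 gives
  the conjugate function mean zero, as required at the centre of the disc in
  \<open>circle_regularized\<close>.\<close>

lemma trig_coefficients:
  assumes "trig N \<phi>"
  shows "\<exists>a b. b 0 = 0 \<and> (\<forall>\<alpha>. \<phi> \<alpha> = (\<Sum>m\<le>N. a m * cos (real m * \<alpha>) + b m * sin (real m * \<alpha>)))"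
  using assms
proof (induction rule: trig.induct)
  case (trig_cos m)
  then show ?case
    by (intro exI[of _ "\<lambda>j. if j = m then 1 else 0"] exI[of _ "\<lambda>j. 0"])
      (auto simp: if_distrib[of "\<lambda>x. x * _"] cong: if_cong)
next
  case (trig_sin m)
  show ?case
  proof (cases "m = 0")
    case True
    then show ?thesis by (intro exI[of _ "\<lambda>j. 0"]) auto
  next
    case False
    with trig_sin show ?thesis
      by (intro exI[of _ "\<lambda>j. 0"] exI[of _ "\<lambda>j. if j = m then 1 else 0"])
        (auto simp: if_distrib[of "\<lambda>x. x * _"] cong: if_cong)
  qed
next
  case (trig_add \<phi> \<psi>)
  then obtain a b c d where "b 0 = 0" "d 0 = 0"
    "\<And>\<alpha>. \<phi> \<alpha> = (\<Sum>m\<le>N. a m * cos (real m * \<alpha>) + b m * sin (real m * \<alpha>))"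
    "\<And>\<alpha>. \<psi> \<alpha> = (\<Sum>m\<le>N. c m * cos (real m * \<alpha>) + d m * sin (real m * \<alpha>))" by blast
  then show ?case
    by (intro exI[of _ "\<lambda>m. a m + c m"] exI[of _ "\<lambda>m. b m + d m"])
      (simp add: sum.distrib[symmetric] algebra_simps)
next
  case (trig_cmult \<phi> c)
  then obtain a b where "b 0 = 0"
    "\<And>\<alpha>. \<phi> \<alpha> = (\<Sum>m\<le>N. a m * cos (real m * \<alpha>) + b m * sin (real m * \<alpha>))" by blast
  then show ?case
    by (intro exI[of _ "\<lambda>m. c * a m"] exI[of _ "\<lambda>m. c * b m"])
      (simp add: sum_distrib_left algebra_simps)
qed

text \<open>Frequencies from 1 to \<open>N\<close> occur in both sums of the kernel and contribute
  pi each time; only the frequency N + 1 occurs once.\<close>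

lemma integral_conj_kernel:
  assumes "m \<le> N"
  shows "(\<integral>\<alpha>. conj_kernel N \<alpha> * cos (real m * \<alpha>) \<partial>circ) = 0"
    and "(\<integral>\<alpha>. conj_kernel N \<alpha> * sin (real m * \<alpha>) \<partial>circ) = (if m = 0 then 0 else 2 * pi)"
proof -
  have i: "integrable circ (\<lambda>\<alpha>. sin (real j * \<alpha>) * cos (real m * \<alpha>))"
    "integrable circ (\<lambda>\<alpha>. sin (real j * \<alpha>) * sin (real m * \<alpha>))" for j
    by (intro integrable_circ_continuous continuous_intros)+
  have "(\<integral>\<alpha>. conj_kernel N \<alpha> * cos (real m * \<alpha>) \<partial>circ)
    = (\<Sum>j\<le>N. (\<integral>\<alpha>. sin (real j * \<alpha>) * cos (real m * \<alpha>) \<partial>circ) + (\<integral>\<alpha>. sin (real (Suc j) * \<alpha>) * cos (real m * \<alpha>) \<partial>circ))"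
    unfolding conj_kernel_def sum_distrib_right distrib_right
    using i by (simp add: Bochner_Integration.integral_sum del: of_nat_Suc)
  then show "(\<integral>\<alpha>. conj_kernel N \<alpha> * cos (real m * \<alpha>) \<partial>circ) = 0"
    by (simp add: integral_circ_products del: of_nat_Suc)
  have "(\<integral>\<alpha>. conj_kernel N \<alpha> * sin (real m * \<alpha>) \<partial>circ)
    = (\<Sum>j\<le>N. (\<integral>\<alpha>. sin (real j * \<alpha>) * sin (real m * \<alpha>) \<partial>circ) + (\<integral>\<alpha>. sin (real (Suc j) * \<alpha>) * sin (real m * \<alpha>) \<partial>circ))"
    unfolding conj_kernel_def sum_distrib_right distrib_right
    using i by (simp add: Bochner_Integration.integral_sum del: of_nat_Suc)
  also have "\<dots> = (\<Sum>j\<le>N. if j = m \<and> m \<noteq> 0 then pi else 0) + (\<Sum>j\<le>N. if Suc j = m then pi else 0)"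
    by (simp add: integral_circ_products sum.distrib del: of_nat_Suc) (auto intro!: sum.cong)
  also have "\<dots> = (if m = 0 then 0 else 2 * pi)"
  proof (cases m)
    case (Suc n)
    then show ?thesis using assms by simp
  qed simp
  finally show "(\<integral>\<alpha>. conj_kernel N \<alpha> * sin (real m * \<alpha>) \<partial>circ) = (if m = 0 then 0 else 2 * pi)" .
qed

text \<open>Real part of the \<open>k\<close>-th derivative in \<open>s\<close> of the sum of (a_m -
  i b_m) exp (m (s + i \<theta>)); \<open>cpol\<close> is the imaginary part. With s = log r in
  place of the radius r, the Laplacian is up to a positive factor the plain sum of the second
  derivatives in \<open>s\<close> and \<theta>.\<close>

definition tpol :: "(nat \<Rightarrow> real) \<Rightarrow> (nat \<Rightarrow> real) \<Rightarrow> nat \<Rightarrow> nat \<Rightarrow> real \<Rightarrow> real \<Rightarrow> real" where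
  "tpol a b N k s \<theta> = (\<Sum>m\<le>N. real m ^ k * exp (real m * s) * (a m * cos (real m * \<theta>) + b m * sin (real m * \<theta>)))"

definition cpol :: "(nat \<Rightarrow> real) \<Rightarrow> (nat \<Rightarrow> real) \<Rightarrow> nat \<Rightarrow> nat \<Rightarrow> real \<Rightarrow> real \<Rightarrow> real" where
  "cpol a b N k s \<theta> = (\<Sum>m\<le>N. real m ^ k * exp (real m * s) * (a m * sin (real m * \<theta>) - b m * cos (real m * \<theta>)))"

text \<open>The last two are the Cauchy-Riemann equations.\<close>

lemma tpol_derivs:
  "((\<lambda>s. tpol a b N k s \<theta>) has_real_derivative tpol a b N (Suc k) s \<theta>) (at s)"
  "((\<lambda>s. cpol a b N k s \<theta>) has_real_derivative cpol a b N (Suc k) s \<theta>) (at s)"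
  "((\<lambda>\<theta>. tpol a b N k s \<theta>) has_real_derivative - cpol a b N (Suc k) s \<theta>) (at \<theta>)"
  "((\<lambda>\<theta>. cpol a b N k s \<theta>) has_real_derivative tpol a b N (Suc k) s \<theta>) (at \<theta>)"
  unfolding tpol_def cpol_def sum_negf[symmetric]
  by (auto intro!: derivative_eq_intros sum.cong simp: algebra_simps)

lemma tpol_continuous:
  fixes S :: "'z::t2_space set"
  assumes "continuous_on S f" "continuous_on S g"
  shows "continuous_on S (\<lambda>z. tpol a b N k (f z) (g z))" "continuous_on S (\<lambda>z. cpol a b N k (f z) (g z))"
  unfolding tpol_def cpol_def
  by (intro continuous_on_sum continuous_on_mult continuous_on_add continuous_on_diff continuous_on_const
      continuous_on_exp continuous_on_cos continuous_on_sin assms)+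

lemma tpol_periodic:
  "tpol a b N k s (2 * pi) = tpol a b N k s 0" "cpol a b N k s (2 * pi) = cpol a b N k s 0"
proof -
  have "cos (real m * (2 * pi)) = 1" "sin (real m * (2 * pi)) = 0" for m
    using cos_integer_2pi[of "real m"] sin_integer_2pi[of "real m"] by (simp_all add: mult_ac)
  then show "tpol a b N k s (2 * pi) = tpol a b N k s 0" "cpol a b N k s (2 * pi) = cpol a b N k s 0"
    by (simp_all add: tpol_def cpol_def)
qed

lemma powr_has_derivative:
  assumes "(f has_real_derivative f') (at x)" "f x > 0"
  shows "((\<lambda>x. f x powr q) has_real_derivative q * f x powr (q - 1) * f') (at x)"
  using DERIV_chain2[OF has_real_derivative_powr[OF assms(2), of q] assms(1)] .

lemma continuous_on_powr_pos:
  fixes f :: "'z::t2_space \<Rightarrow> real"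
  assumes "continuous_on S f" "\<And>z. z \<in> S \<Longrightarrow> f z > 0"
  shows "continuous_on S (\<lambda>z. f z powr q)"
  using assms by (intro continuous_on_powr continuous_on_const) force+

text \<open>In the range \<open>1 < p \<le> 2\<close>, for an analytic function \<open>F = u + i v\<close>, the Laplacian of
  \<open>|F|^p\<close> is dominated by a multiple of the Laplacian of \<open>|u|^p\<close>; here both are regularized
  by \<open>\<epsilon>\<close> and \<open>q = p / 2\<close>.\<close>

lemma hardy_stein_laplacian:
  fixes q \<epsilon> u v u' v' :: real
  assumes q: "1 / 2 < q" "q \<le> 1" and e: "0 < \<epsilon>"
  defines "\<rho> \<equiv> u\<^sup>2 + v\<^sup>2 + \<epsilon>" and "\<tau> \<equiv> u\<^sup>2 + \<epsilon>" and "J \<equiv> u'\<^sup>2 + v'\<^sup>2"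
  shows "q * (q - 1) * \<rho> powr (q - 2) * (4 * (u\<^sup>2 + v\<^sup>2) * J) + q * \<rho> powr (q - 1) * (4 * J)
    - 2 / (2 * q - 1) * (q * (q - 1) * \<tau> powr (q - 2) * (4 * u\<^sup>2 * J) + q * \<tau> powr (q - 1) * (2 * J)) \<le> 0"
proof -
  have J: "J \<ge> 0" by (simp add: J_def)
  have t: "\<tau> > 0" "\<rho> > 0" "\<tau> \<le> \<rho>" using e by (simp_all add: \<tau>_def \<rho>_def add_nonneg_pos)
  have "\<tau> powr (q - 1) = \<tau> powr (q - 2) * \<tau>"
    using t powr_add[of \<tau> "q - 2" 1] by simp
  then have "q * (q - 1) * \<tau> powr (q - 2) * (4 * u\<^sup>2 * J) + q * \<tau> powr (q - 1) * (2 * J)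
      = 2 * q * J * \<tau> powr (q - 2) * ((2 * q - 1) * u\<^sup>2 + \<epsilon>)"
    by (simp add: \<tau>_def algebra_simps)
  also have "\<dots> \<ge> 2 * q * J * \<tau> powr (q - 2) * ((2 * q - 1) * \<tau>)"
  proof (rule mult_left_mono)
    have "(2 * q - 1) * \<epsilon> \<le> 1 * \<epsilon>" using q e by (intro mult_right_mono) auto
    then show "(2 * q - 1) * \<tau> \<le> (2 * q - 1) * u\<^sup>2 + \<epsilon>" by (simp add: \<tau>_def distrib_left)
    show "0 \<le> 2 * q * J * \<tau> powr (q - 2)" using q J by simp
  qed
  also have "2 * q * J * \<tau> powr (q - 2) * ((2 * q - 1) * \<tau>) = (2 * q - 1) * (2 * q * J * \<tau> powr (q - 1))"
    using \<open>\<tau> powr (q - 1) = \<tau> powr (q - 2) * \<tau>\<close> by simp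
  finally have "2 / (2 * q - 1) * ((2 * q - 1) * (2 * q * J * \<tau> powr (q - 1)))
     \<le> 2 / (2 * q - 1) * (q * (q - 1) * \<tau> powr (q - 2) * (4 * u\<^sup>2 * J) + q * \<tau> powr (q - 1) * (2 * J))"
    using q by (intro mult_left_mono) auto
  then have 1: "4 * q * J * \<tau> powr (q - 1)
     \<le> 2 / (2 * q - 1) * (q * (q - 1) * \<tau> powr (q - 2) * (4 * u\<^sup>2 * J) + q * \<tau> powr (q - 1) * (2 * J))"
  proof -
    have "2 / (2 * q - 1) * ((2 * q - 1) * X) = 2 * X" for X using q by simp
    then show ?thesis
      using \<open>2 / (2 * q - 1) * ((2 * q - 1) * (2 * q * J * \<tau> powr (q - 1))) \<le> _\<close>
      by (simp only: mult.assoc)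
  qed
  \<comment> \<open>This comparison and the sign of the term discarded below both depend on q \<le>
    1, which is the origin of the restriction p \<le> 2.\<close>
  have "\<rho> powr (q - 1) \<le> \<tau> powr (q - 1)"
    using t q by (intro powr_mono2') auto
  then have 2: "4 * q * J * \<rho> powr (q - 1) \<le> 4 * q * J * \<tau> powr (q - 1)"
    using q J by (intro mult_left_mono) auto
  have "q * (q - 1) * \<rho> powr (q - 2) * (4 * (u\<^sup>2 + v\<^sup>2) * J) \<le> 0"
    using q J by (intro mult_nonpos_nonneg mult_nonneg_nonpos) auto
  with 1 2 show ?thesis by (simp add: mult_ac)
qed

text \<open>A concave function with positive slope at some point tends to minus infinity on its
  left, which the bound on the left half-line excludes.\<close>

lemma concave_bounded_nonincreasing:
  fixes m A A' :: "real \<Rightarrow> real"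
  assumes m: "\<And>s. (m has_real_derivative A s) (at s)"
    and A: "\<And>s. (A has_real_derivative A' s) (at s)" "\<And>s. A' s \<le> 0"
    and bd: "\<And>s. s \<le> 0 \<Longrightarrow> \<bar>m s\<bar> \<le> B"
    and s: "s \<le> 0"
  shows "m 0 \<le> m s"
proof -
  have mono: "A t \<le> A s" if "s \<le> t" for s t
    using DERIV_nonpos_imp_nonincreasing[OF that] A by blast
  have neg: "A t \<le> 0" if "t \<le> 0" for t
  proof (rule ccontr)
    assume "\<not> A t \<le> 0"
    then have pos: "A t > 0" by simp
    \<comment> \<open>At slope at least \<open>A t\<close> the function grows by at least 2 B + 1
      from \<open>r\<close> to \<open>t\<close>, more than the bound \<open>B\<close>
      permits.\<close>
    define r where "r = t - (2 * B + 1) / A t"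
    have B: "B \<ge> 0" using bd[of 0] by linarith
    have r: "r < t" unfolding r_def using pos B by (simp add: divide_pos_pos)
    obtain z where z: "r < z" "z < t" "m t - m r = (t - r) * A z"
      using MVT2[OF r, of m A] m by blast
    have "A t * (t - r) \<le> (t - r) * A z"
      using mono[of z t] z r by (simp add: mult.commute mult_right_mono)
    also have "A t * (t - r) = 2 * B + 1" using pos by (simp add: r_def)
    finally have "m t - m r \<ge> 2 * B + 1" using z by simp
    moreover have "\<bar>m t\<bar> \<le> B" "\<bar>m r\<bar> \<le> B" using bd that r by auto
    ultimately show False by linarith
  qed
  show ?thesis
  proof (rule DERIV_nonpos_imp_nonincreasing[OF s])
    fix x assume "s \<le> x" "x \<le> 0"
    then show "\<exists>y. (m has_real_derivative y) (at x) \<and> y \<le> 0" using m neg by blast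
  qed
qed

lemma integral_circ_HK:
  fixes f :: "real \<Rightarrow> real"
  assumes "continuous_on {0..2 * pi} f"
  shows "(\<integral>x. f x \<partial>circ) = integral {0..2 * pi} f"
  using set_borel_integral_eq_integral(2)[OF borel_integrable_compact[OF _ assms, folded set_integrable_def]]
  by (simp add: integral_circ_eq set_lebesgue_integral_def)

text \<open>Studies the circle means at radius e^s. Periodicity integrates the \<theta>-derivatives
  away, so the second derivative of the mean in \<open>s\<close> is the mean of the Laplacian,
  nonpositive by \<open>hardy_stein_laplacian\<close>. Concavity and boundedness bound the mean at
  radius 1 by its value at the centre, where the analytic function is the real number a_0.\<close>

lemma circle_regularized:
  fixes a b :: "nat \<Rightarrow> real" and N :: nat and q \<epsilon> :: real
  assumes q: "1 / 2 < q" "q \<le> 1" and e: "0 < \<epsilon>" and b0: "b 0 = 0"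
  defines "U \<equiv> tpol a b N" and "V \<equiv> cpol a b N"
  shows "integral {0..2 * pi} (\<lambda>\<theta>. ((U 0 0 \<theta>)\<^sup>2 + (V 0 0 \<theta>)\<^sup>2 + \<epsilon>) powr q)
    \<le> 2 / (2 * q - 1) * integral {0..2 * pi} (\<lambda>\<theta>. ((U 0 0 \<theta>)\<^sup>2 + \<epsilon>) powr q)"
proof -
  define C where "C = 2 / (2 * q - 1)"
  have C: "C \<ge> 1" using q by (simp add: C_def field_simps)
  define \<rho> where "\<rho> s \<theta> = (U 0 s \<theta>)\<^sup>2 + (V 0 s \<theta>)\<^sup>2 + \<epsilon>" for s \<theta>
  define \<tau> where "\<tau> s \<theta> = (U 0 s \<theta>)\<^sup>2 + \<epsilon>" for s \<theta>
  define W where "W s \<theta> = \<rho> s \<theta> powr q - C * \<tau> s \<theta> powr q" for s \<theta>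
  define \<rho>1 where "\<rho>1 s \<theta> = 2 * (U 0 s \<theta> * U 1 s \<theta> + V 0 s \<theta> * V 1 s \<theta>)" for s \<theta>
  define \<tau>1 where "\<tau>1 s \<theta> = 2 * (U 0 s \<theta> * U 1 s \<theta>)" for s \<theta>
  define \<rho>2 where "\<rho>2 s \<theta> = 2 * ((U 1 s \<theta>)\<^sup>2 + (V 1 s \<theta>)\<^sup>2 + U 0 s \<theta> * U 2 s \<theta> + V 0 s \<theta> * V 2 s \<theta>)" for s \<theta>
  define \<tau>2 where "\<tau>2 s \<theta> = 2 * ((U 1 s \<theta>)\<^sup>2 + U 0 s \<theta> * U 2 s \<theta>)" for s \<theta>
  define \<rho>t where "\<rho>t s \<theta> = 2 * (V 0 s \<theta> * U 1 s \<theta> - U 0 s \<theta> * V 1 s \<theta>)" for s \<theta>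
  define \<tau>t where "\<tau>t s \<theta> = - 2 * (U 0 s \<theta> * V 1 s \<theta>)" for s \<theta>
  define \<rho>tt where "\<rho>tt s \<theta> = 2 * ((U 1 s \<theta>)\<^sup>2 + (V 1 s \<theta>)\<^sup>2 - U 0 s \<theta> * U 2 s \<theta> - V 0 s \<theta> * V 2 s \<theta>)" for s \<theta>
  define \<tau>tt where "\<tau>tt s \<theta> = 2 * ((V 1 s \<theta>)\<^sup>2 - U 0 s \<theta> * U 2 s \<theta>)" for s \<theta>
  define W1 where "W1 s \<theta> = q * \<rho> s \<theta> powr (q - 1) * \<rho>1 s \<theta> - C * (q * \<tau> s \<theta> powr (q - 1) * \<tau>1 s \<theta>)" for s \<theta>
  define Wt where "Wt s \<theta> = q * \<rho> s \<theta> powr (q - 1) * \<rho>t s \<theta> - C * (q * \<tau> s \<theta> powr (q - 1) * \<tau>t s \<theta>)" for s \<theta>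
  define W2 where "W2 s \<theta> = (q * (q - 1) * \<rho> s \<theta> powr (q - 2) * (\<rho>1 s \<theta>)\<^sup>2 + q * \<rho> s \<theta> powr (q - 1) * \<rho>2 s \<theta>)
      - C * (q * (q - 1) * \<tau> s \<theta> powr (q - 2) * (\<tau>1 s \<theta>)\<^sup>2 + q * \<tau> s \<theta> powr (q - 1) * \<tau>2 s \<theta>)" for s \<theta>
  define Wtt where "Wtt s \<theta> = (q * (q - 1) * \<rho> s \<theta> powr (q - 2) * (\<rho>t s \<theta>)\<^sup>2 + q * \<rho> s \<theta> powr (q - 1) * \<rho>tt s \<theta>)
      - C * (q * (q - 1) * \<tau> s \<theta> powr (q - 2) * (\<tau>t s \<theta>)\<^sup>2 + q * \<tau> s \<theta> powr (q - 1) * \<tau>tt s \<theta>)" for s \<theta>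
  have pos: "\<rho> s \<theta> > 0" "\<tau> s \<theta> > 0" for s \<theta>
    using e by (simp_all add: \<rho>_def \<tau>_def add_nonneg_pos)
  have dU: "((\<lambda>s. U k s \<theta>) has_real_derivative U (Suc k) s \<theta>) (at s)"
    "((\<lambda>s. V k s \<theta>) has_real_derivative V (Suc k) s \<theta>) (at s)"
    "((\<lambda>\<theta>. U k s \<theta>) has_real_derivative - V (Suc k) s \<theta>) (at \<theta>)"
    "((\<lambda>\<theta>. V k s \<theta>) has_real_derivative U (Suc k) s \<theta>) (at \<theta>)" for k s \<theta>
    unfolding U_def V_def by (rule tpol_derivs)+
  note dU' = dU[of 0, simplified] dU[of 1, simplified, folded numeral_2_eq_2]
  have dr: "((\<lambda>s. \<rho> s \<theta>) has_real_derivative \<rho>1 s \<theta>) (at s)" "((\<lambda>s. \<tau> s \<theta>) has_real_derivative \<tau>1 s \<theta>) (at s)"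
    "((\<lambda>s. \<rho>1 s \<theta>) has_real_derivative \<rho>2 s \<theta>) (at s)" "((\<lambda>s. \<tau>1 s \<theta>) has_real_derivative \<tau>2 s \<theta>) (at s)"
    "((\<lambda>\<theta>. \<rho> s \<theta>) has_real_derivative \<rho>t s \<theta>) (at \<theta>)" "((\<lambda>\<theta>. \<tau> s \<theta>) has_real_derivative \<tau>t s \<theta>) (at \<theta>)"
    "((\<lambda>\<theta>. \<rho>t s \<theta>) has_real_derivative \<rho>tt s \<theta>) (at \<theta>)" "((\<lambda>\<theta>. \<tau>t s \<theta>) has_real_derivative \<tau>tt s \<theta>) (at \<theta>)" for s \<theta>
    unfolding \<rho>_def \<tau>_def \<rho>1_def \<tau>1_def \<rho>2_def \<tau>2_def \<rho>t_def \<tau>t_def \<rho>tt_def \<tau>tt_def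
    by (auto intro!: derivative_eq_intros dU' simp: power2_eq_square algebra_simps)
  have q2: "q - 1 - 1 = q - 2" by simp
  have dW: "((\<lambda>s. W s \<theta>) has_real_derivative W1 s \<theta>) (at s)" for s \<theta>
    unfolding W_def W1_def by (intro DERIV_diff DERIV_cmult powr_has_derivative dr pos)
  have dW1: "((\<lambda>s. W1 s \<theta>) has_real_derivative W2 s \<theta>) (at s)" for s \<theta>
    unfolding W1_def W2_def
    by (auto intro!: derivative_eq_intros powr_has_derivative dr pos simp: q2 power2_eq_square algebra_simps)
  have dWt: "((\<lambda>\<theta>. Wt s \<theta>) has_real_derivative Wtt s \<theta>) (at \<theta>)" for s \<theta>
    unfolding Wt_def Wtt_def
    by (auto intro!: derivative_eq_intros powr_has_derivative dr pos simp: q2 power2_eq_square algebra_simps)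
  have cU: "continuous_on S (\<lambda>z. U k (f z) (g z))" "continuous_on S (\<lambda>z. V k (f z) (g z))"
    if "continuous_on S f" "continuous_on S g" for S :: "'z::t2_space set" and f g k
    unfolding U_def V_def using tpol_continuous that by auto
  have cr: "continuous_on S (\<lambda>z. \<rho> (f z) (g z) powr p)" "continuous_on S (\<lambda>z. \<tau> (f z) (g z) powr p)"
    if "continuous_on S f" "continuous_on S g" for S :: "'z::t2_space set" and f g p
    using that pos by (auto intro!: continuous_on_powr_pos) (auto simp: \<rho>_def \<tau>_def intro!: continuous_intros cU)
  have cW: "continuous_on S (\<lambda>z. W (f z) (g z))" "continuous_on S (\<lambda>z. W1 (f z) (g z))"
      "continuous_on S (\<lambda>z. W2 (f z) (g z))" "continuous_on S (\<lambda>z. Wtt (f z) (g z))"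
    if "continuous_on S f" "continuous_on S g" for S :: "'z::t2_space set" and f g
    unfolding W_def W1_def W2_def Wtt_def \<rho>1_def \<tau>1_def \<rho>2_def \<tau>2_def \<rho>t_def \<tau>t_def \<rho>tt_def \<tau>tt_def
    by (intro continuous_on_add continuous_on_diff continuous_on_mult continuous_on_power continuous_on_const cr cU that)+
  define m where "m s = integral {0..2 * pi} (W s)" for s
  define A where "A s = integral {0..2 * pi} (W1 s)" for s
  define A' where "A' s = integral {0..2 * pi} (W2 s)" for s
  have iW: "W s integrable_on {0..2 * pi}" "W1 s integrable_on {0..2 * pi}" "W2 s integrable_on {0..2 * pi}"
    "Wtt s integrable_on {0..2 * pi}" for s
    by (intro integrable_continuous_interval cW continuous_on_const continuous_on_id)+
  have dm: "(m has_real_derivative A s) (at s)" for s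
  proof -
    have "((\<lambda>s. integral (cbox 0 (2 * pi)) (W s)) has_field_derivative integral (cbox 0 (2 * pi)) (W1 s)) (at s within UNIV)"
      by (rule leibniz_rule_field_derivative)
        (use dW iW in \<open>auto simp: case_prod_beta intro!: cW continuous_intros\<close>)
    then show ?thesis by (simp add: m_def[abs_def] A_def)
  qed
  have dA: "(A has_real_derivative A' s) (at s)" for s
  proof -
    have "((\<lambda>s. integral (cbox 0 (2 * pi)) (W1 s)) has_field_derivative integral (cbox 0 (2 * pi)) (W2 s)) (at s within UNIV)"
      by (rule leibniz_rule_field_derivative)
        (use dW1 iW in \<open>auto simp: case_prod_beta intro!: cW continuous_intros\<close>)
    then show ?thesis by (simp add: A_def[abs_def] A'_def)
  qed
  have A'neg: "A' s \<le> 0" for s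
  proof -
    have "(Wtt s has_integral (Wt s (2 * pi) - Wt s 0)) {0..2 * pi}"
      by (rule fundamental_theorem_of_calculus)
        (use dWt in \<open>auto simp: has_real_derivative_iff_has_vector_derivative intro: has_vector_derivative_at_within\<close>)
    moreover have "Wt s (2 * pi) - Wt s 0 = 0"
      by (simp add: Wt_def \<rho>_def \<tau>_def \<rho>t_def \<tau>t_def U_def V_def tpol_periodic)
    ultimately have "integral {0..2 * pi} (Wtt s) = 0" by (simp add: integral_unique)
    then have "A' s = integral {0..2 * pi} (\<lambda>\<theta>. W2 s \<theta> + Wtt s \<theta>)"
      using iW by (simp add: A'_def Henstock_Kurzweil_Integration.integral_add)
    also have "\<dots> \<le> integral {0..2 * pi} (\<lambda>\<theta>. 0)"
    proof (rule integral_le)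
      fix \<theta>
      define J where "J = (U 1 s \<theta>)\<^sup>2 + (V 1 s \<theta>)\<^sup>2"
      have s1: "(\<rho>1 s \<theta>)\<^sup>2 + (\<rho>t s \<theta>)\<^sup>2 = 4 * ((U 0 s \<theta>)\<^sup>2 + (V 0 s \<theta>)\<^sup>2) * J"
        "\<rho>2 s \<theta> + \<rho>tt s \<theta> = 4 * J" "(\<tau>1 s \<theta>)\<^sup>2 + (\<tau>t s \<theta>)\<^sup>2 = 4 * (U 0 s \<theta>)\<^sup>2 * J" "\<tau>2 s \<theta> + \<tau>tt s \<theta> = 2 * J"
        by (simp_all add: \<rho>1_def \<rho>t_def \<rho>2_def \<rho>tt_def \<tau>1_def \<tau>t_def \<tau>2_def \<tau>tt_def J_def power2_eq_square algebra_simps)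
      have "W2 s \<theta> + Wtt s \<theta> =
        q * (q - 1) * \<rho> s \<theta> powr (q - 2) * ((\<rho>1 s \<theta>)\<^sup>2 + (\<rho>t s \<theta>)\<^sup>2) + q * \<rho> s \<theta> powr (q - 1) * (\<rho>2 s \<theta> + \<rho>tt s \<theta>)
        - C * (q * (q - 1) * \<tau> s \<theta> powr (q - 2) * ((\<tau>1 s \<theta>)\<^sup>2 + (\<tau>t s \<theta>)\<^sup>2) + q * \<tau> s \<theta> powr (q - 1) * (\<tau>2 s \<theta> + \<tau>tt s \<theta>))"
        unfolding W2_def Wtt_def by (simp add: distrib_left)
      also have "\<dots> \<le> 0"
        unfolding s1 C_def \<rho>_def \<tau>_def J_def by (rule hardy_stein_laplacian[OF q e])
      finally show "W2 s \<theta> + Wtt s \<theta> \<le> 0" .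
    qed (use iW in \<open>auto intro!: integrable_add\<close>)
    finally show ?thesis by simp
  qed
  \<comment> \<open>In terms of r = e^s the means extend continuously to r = 0. Compactness then
    gives the bound for s \<le> 0, and continuity gives the limit at the centre.\<close>
  define P where "P r \<theta> = (\<Sum>j\<le>N. r ^ j * (a j * cos (real j * \<theta>) + b j * sin (real j * \<theta>)))" for r \<theta> :: real
  define Q where "Q r \<theta> = (\<Sum>j\<le>N. r ^ j * (a j * sin (real j * \<theta>) - b j * cos (real j * \<theta>)))" for r \<theta> :: real
  define Z where "Z r \<theta> = ((P r \<theta>)\<^sup>2 + (Q r \<theta>)\<^sup>2 + \<epsilon>) powr q - C * ((P r \<theta>)\<^sup>2 + \<epsilon>) powr q" for r \<theta>
  have WZ: "W s \<theta> = Z (exp s) \<theta>" for s \<theta>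
    by (simp add: W_def \<rho>_def \<tau>_def U_def V_def tpol_def cpol_def Z_def P_def Q_def exp_of_nat_mult)
  have cZ: "continuous_on UNIV (\<lambda>z. Z (fst z) (snd z))"
    unfolding Z_def P_def Q_def using e
    by (auto intro!: continuous_intros continuous_on_powr_pos simp: add_nonneg_pos)
  define M where "M r = integral {0..2 * pi} (Z r)" for r
  have cM: "continuous_on {0..1} M"
  proof -
    have "continuous_on {0..1} (\<lambda>r. integral (cbox 0 (2 * pi)) (Z r))"
      by (rule integral_continuous_on_param) (use cZ in \<open>auto simp: case_prod_beta intro: continuous_on_subset\<close>)
    then show ?thesis by (simp add: M_def[abs_def])
  qed
  have mM: "m s = M (exp s)" for s
    by (simp add: m_def M_def WZ[abs_def])
  have "compact (M ` {0..1})" by (rule compact_continuous_image[OF cM]) simp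
  then obtain B where "\<And>r. r \<in> {0..1} \<Longrightarrow> \<bar>M r\<bar> \<le> B"
    using compact_imp_bounded bounded_iff by (metis imageI real_norm_def)
  then have bd: "\<bar>m s\<bar> \<le> B" if "s \<le> 0" for s using that by (simp add: mM)
  have M1: "M 1 \<le> M r" if "0 < r" "r \<le> 1" for r
    using concave_bounded_nonincreasing[OF dm dA A'neg bd, of "ln r"] that by (simp add: mM)
  have "(M \<longlongrightarrow> M 0) (at 0 within {0..1})"
    using cM by (simp add: continuous_on)
  then have "(M \<longlongrightarrow> M 0) (at_right 0)"
    using at_within_Icc_at_right[of 0 "1::real"] by simp
  moreover have "\<forall>\<^sub>F r in at_right 0. M 1 \<le> M r"
    by (rule eventually_mono[OF eventually_at_right_real[of 0 1]]) (auto intro!: M1)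
  ultimately have "M 1 \<le> M 0"
    by (intro tendsto_lowerbound[of M "M 0" "at_right 0"]) auto
  \<comment> \<open>At the centre the conjugate part vanishes because \<open>b 0 = 0\<close>, and
    the sign comes from \<open>C \<ge> 1\<close>.\<close>
  also have "M 0 \<le> 0"
  proof -
    have "P 0 \<theta> = a 0" "Q 0 \<theta> = 0" for \<theta>
      unfolding P_def Q_def using b0 by (auto simp: power_0_left if_distrib[of "\<lambda>x. x * _"] cong: if_cong)
    then have "Z 0 = (\<lambda>\<theta>. (1 - C) * ((a 0)\<^sup>2 + \<epsilon>) powr q)"
      by (simp add: Z_def fun_eq_iff algebra_simps)
    then have "M 0 = (2 * pi) * ((1 - C) * ((a 0)\<^sup>2 + \<epsilon>) powr q)"
      by (simp add: M_def)
    moreover have "(1 - C) * ((a 0)\<^sup>2 + \<epsilon>) powr q \<le> 0"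
      using C by (intro mult_nonpos_nonneg) auto
    ultimately show ?thesis by (simp add: mult_nonneg_nonpos)
  qed
  finally have "m 0 \<le> 0" by (simp add: mM)
  moreover have "m 0 = integral {0..2 * pi} (\<lambda>\<theta>. \<rho> 0 \<theta> powr q) - C * integral {0..2 * pi} (\<lambda>\<theta>. \<tau> 0 \<theta> powr q)"
  proof -
    have "(\<lambda>\<theta>. \<rho> 0 \<theta> powr q) integrable_on {0..2 * pi}" "(\<lambda>\<theta>. \<tau> 0 \<theta> powr q) integrable_on {0..2 * pi}"
      by (intro integrable_continuous_interval cr continuous_on_const continuous_on_id)+
    then show ?thesis
      unfolding m_def W_def[abs_def]
      by (subst Henstock_Kurzweil_Integration.integral_diff) (auto intro: integrable_on_mult_right)
  qed
  ultimately show ?thesis by (simp add: \<rho>_def \<tau>_def C_def)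
qed

lemma add_powr_le:
  fixes x y q :: real
  assumes "0 \<le> x" "0 \<le> y" "0 < q" "q \<le> 1"
  shows "(x + y) powr q \<le> x powr q + y powr q"
proof (cases "x + y = 0")
  case False
  then have s: "x + y > 0" using assms by simp
  have le: "t \<le> t powr q" if "0 \<le> t" "t \<le> 1" for t :: real
    using powr_mono'[of q 1 t] that assms by simp
  have "1 = x / (x + y) + y / (x + y)" using s by (simp add: add_divide_distrib[symmetric])
  also have "\<dots> \<le> (x / (x + y)) powr q + (y / (x + y)) powr q"
    using assms s by (intro add_mono le) (auto simp: field_simps)
  also have "\<dots> = (x powr q + y powr q) / (x + y) powr q"
    using assms s by (simp add: powr_divide add_divide_distrib)
  finally show ?thesis using s by (simp add: field_simps)
qed (use assms in simp)

lemma square_powr: "(x\<^sup>2) powr (p / 2) = \<bar>x :: real\<bar> powr p"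
proof (cases "x = 0")
  case False
  then have "x\<^sup>2 = \<bar>x\<bar> powr 2" by simp
  then have "(x\<^sup>2) powr (p / 2) = (\<bar>x\<bar> powr 2) powr (p / 2)" by (simp only:)
  then show ?thesis by (simp only: powr_powr) simp
qed simp

text \<open>On trigonometric polynomials of degree \<open>N\<close> the convolution with
  \<open>conj_kernel N\<close> is conjugation times - 2 pi, without error; what remains is the
  regularized estimate with \<epsilon> tending to 0.\<close>

theorem conjugate_function_bound:
  assumes \<phi>: "trig N \<phi>" and p: "1 < p" "p \<le> 2"
  shows "(\<integral>\<beta>. \<bar>\<integral>\<alpha>. conj_kernel N \<alpha> * \<phi> (\<alpha> + \<beta>) \<partial>circ\<bar> powr p \<partial>circ)
    \<le> (2 * pi) powr p * (2 / (p - 1)) * (\<integral>\<beta>. \<bar>\<phi> \<beta>\<bar> powr p \<partial>circ)"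
proof -
  obtain a b where b0: "b 0 = 0" and ab: "\<And>\<alpha>. \<phi> \<alpha> = (\<Sum>m\<le>N. a m * cos (real m * \<alpha>) + b m * sin (real m * \<alpha>))"
    using trig_coefficients[OF \<phi>] by blast
  define U V where "U = tpol a b N 0 0" and "V = cpol a b N 0 0"
  define C where "C = 2 / (p - 1)"
  have C: "C > 0" using p by (simp add: C_def)
  have U: "\<phi> = U" by (simp add: fun_eq_iff ab U_def tpol_def)
  have V: "(\<integral>\<alpha>. conj_kernel N \<alpha> * \<phi> (\<alpha> + \<beta>) \<partial>circ) = - (2 * pi) * V \<beta>" for \<beta>
  proof -
    have i: "integrable circ (\<lambda>\<alpha>. conj_kernel N \<alpha> * cos (real m * \<alpha>))" "integrable circ (\<lambda>\<alpha>. conj_kernel N \<alpha> * sin (real m * \<alpha>))" for m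
      by (intro integrable_circ_continuous continuous_intros continuous_on_conj_kernel)+
    have "conj_kernel N \<alpha> * \<phi> (\<alpha> + \<beta>) = (\<Sum>m\<le>N. (a m * cos (real m * \<beta>) + b m * sin (real m * \<beta>)) * (conj_kernel N \<alpha> * cos (real m * \<alpha>))
        + (b m * cos (real m * \<beta>) - a m * sin (real m * \<beta>)) * (conj_kernel N \<alpha> * sin (real m * \<alpha>)))" for \<alpha>
      unfolding ab sum_distrib_left distrib_left[of "real _"] cos_add sin_add
      by (intro sum.cong refl) (simp add: algebra_simps)
    then have "(\<integral>\<alpha>. conj_kernel N \<alpha> * \<phi> (\<alpha> + \<beta>) \<partial>circ)
      = (\<Sum>m\<le>N. (a m * cos (real m * \<beta>) + b m * sin (real m * \<beta>)) * (\<integral>\<alpha>. conj_kernel N \<alpha> * cos (real m * \<alpha>) \<partial>circ)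
        + (b m * cos (real m * \<beta>) - a m * sin (real m * \<beta>)) * (\<integral>\<alpha>. conj_kernel N \<alpha> * sin (real m * \<alpha>) \<partial>circ))"
      using i by (simp add: Bochner_Integration.integral_sum)
    also have "\<dots> = (\<Sum>m\<le>N. - (2 * pi) * (a m * sin (real m * \<beta>) - b m * cos (real m * \<beta>)))"
    proof (intro sum.cong refl)
      fix m assume "m \<in> {..N}"
      then have m: "m \<le> N" by simp
      show "(a m * cos (real m * \<beta>) + b m * sin (real m * \<beta>)) * (\<integral>\<alpha>. conj_kernel N \<alpha> * cos (real m * \<alpha>) \<partial>circ)
        + (b m * cos (real m * \<beta>) - a m * sin (real m * \<beta>)) * (\<integral>\<alpha>. conj_kernel N \<alpha> * sin (real m * \<alpha>) \<partial>circ)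
        = - (2 * pi) * (a m * sin (real m * \<beta>) - b m * cos (real m * \<beta>))"
        unfolding integral_conj_kernel[OF m] using b0 by (cases "m = 0") (auto simp: algebra_simps)
    qed
    finally show ?thesis by (simp add: V_def cpol_def sum_distrib_left)
  qed
  have cUV: "continuous_on S U" "continuous_on S V" for S
    unfolding U_def V_def by (intro tpol_continuous continuous_intros)+
  have cp: "continuous_on S (\<lambda>\<theta>. \<bar>f \<theta>\<bar> powr p)" if "continuous_on S f" for S and f :: "real \<Rightarrow> real"
    using that p by (intro continuous_on_powr' continuous_intros) auto
  define I where "I f = integral {0..2 * pi} (\<lambda>\<theta>. \<bar>f \<theta>\<bar> powr p)" for f :: "real \<Rightarrow> real"
  have reg: "I V \<le> C * I U + C * (2 * pi * \<epsilon> powr (p / 2))" if e: "0 < \<epsilon>" for \<epsilon>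
  proof -
    have ce: "continuous_on {0..2 * pi} (\<lambda>\<theta>. ((U \<theta>)\<^sup>2 + (V \<theta>)\<^sup>2 + \<epsilon>) powr (p / 2))"
      "continuous_on {0..2 * pi} (\<lambda>\<theta>. ((U \<theta>)\<^sup>2 + \<epsilon>) powr (p / 2))"
      using e by (auto intro!: continuous_on_powr_pos continuous_intros cUV simp: add_nonneg_pos)
    have "I V \<le> integral {0..2 * pi} (\<lambda>\<theta>. ((U \<theta>)\<^sup>2 + (V \<theta>)\<^sup>2 + \<epsilon>) powr (p / 2))"
      unfolding I_def square_powr[symmetric]
      using e p ce cp[OF cUV(2)]
      by (intro integral_le integrable_continuous_interval powr_mono2) (auto simp: square_powr)
    also have "\<dots> \<le> C * integral {0..2 * pi} (\<lambda>\<theta>. ((U \<theta>)\<^sup>2 + \<epsilon>) powr (p / 2))"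
      using circle_regularized[of "p / 2" \<epsilon> b a N] p e b0 by (simp add: U_def V_def C_def)
    also have "\<dots> \<le> C * integral {0..2 * pi} (\<lambda>\<theta>. \<bar>U \<theta>\<bar> powr p + \<epsilon> powr (p / 2))"
      unfolding square_powr[symmetric]
      using C e p ce cp[OF cUV(1)]
      by (intro mult_left_mono integral_le integrable_continuous_interval add_powr_le) (auto simp: square_powr intro: continuous_on_add)
    also have "integral {0..2 * pi} (\<lambda>\<theta>. \<bar>U \<theta>\<bar> powr p + \<epsilon> powr (p / 2)) = I U + 2 * pi * \<epsilon> powr (p / 2)"
      unfolding I_def using cp[OF cUV(1)]
      by (subst Henstock_Kurzweil_Integration.integral_add) (auto intro: integrable_continuous_interval)
    finally show ?thesis by (simp add: distrib_left)
  qed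
  have "I V \<le> C * I U"
  proof (rule field_le_epsilon)
    fix \<delta> :: real assume d: "0 < \<delta>"
    \<comment> \<open>Chosen so that the regularization error is exactly \<delta>.\<close>
    define \<epsilon> where "\<epsilon> = (\<delta> / (C * (2 * pi))) powr (2 / p)"
    have "\<epsilon> > 0" using d C by (simp add: \<epsilon>_def)
    moreover have "\<epsilon> powr (p / 2) = \<delta> / (C * (2 * pi))" using d C p by (simp add: \<epsilon>_def powr_powr)
    ultimately show "I V \<le> C * I U + \<delta>" using reg[of \<epsilon>] C by simp
  qed
  have "(\<integral>\<beta>. \<bar>\<integral>\<alpha>. conj_kernel N \<alpha> * \<phi> (\<alpha> + \<beta>) \<partial>circ\<bar> powr p \<partial>circ) = (2 * pi) powr p * (\<integral>\<beta>. \<bar>V \<beta>\<bar> powr p \<partial>circ)"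
    unfolding V by (simp add: abs_mult powr_mult)
  also have "(\<integral>\<beta>. \<bar>V \<beta>\<bar> powr p \<partial>circ) = I V"
    unfolding I_def by (rule integral_circ_HK[OF cp[OF cUV(2)]])
  also have "(2 * pi) powr p * I V \<le> (2 * pi) powr p * (C * I U)"
    using \<open>I V \<le> C * I U\<close> by (rule mult_left_mono) simp
  also have "I U = (\<integral>\<beta>. \<bar>\<phi> \<beta>\<bar> powr p \<partial>circ)"
    unfolding I_def U by (rule integral_circ_HK[OF cp[OF cUV(1)], symmetric])
  finally show ?thesis by (simp add: C_def mult.assoc)
qed

section \<open>Boundedness of the averaging operators\<close>

lemma powr_tangent:
  fixes t m p :: real
  assumes "0 \<le> t" "0 \<le> m" "1 \<le> p"
  shows "m powr p + p * m powr (p - 1) * (t - m) \<le> t powr p"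
proof (cases "m = 0")
  case True
  then show ?thesis using assms by (cases "p = 1") auto
next
  case False
  then have m: "m > 0" using assms by simp
  show ?thesis
  proof (cases "t = m")
    case False
    have d: "((\<lambda>x. x powr p) has_real_derivative p * x powr (p - 1)) (at x)" if "x > 0" for x
      using has_real_derivative_powr[OF that] .
    consider "t < m" | "m < t" using False by linarith
    then show ?thesis
    proof cases
      case 1
      show ?thesis
      \<comment> \<open>The power is differentiated only at positive points, so the mean value
        theorem does not reach t = 0.\<close>
      proof (cases "t = 0")
        case True
        have "m powr p = m powr (p - 1) * m" using m powr_add[of m "p - 1" 1] by simp
        then have "m powr p + p * m powr (p - 1) * (t - m) = (1 - p) * m powr p" using True by (simp add: algebra_simps)
        also have "\<dots> \<le> 0" using assms by (intro mult_nonpos_nonneg) auto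
        finally show ?thesis using True by simp
      next
        case False
      then have t: "t > 0" using assms by simp
      obtain z where z: "t < z" "z < m" "m powr p - t powr p = (m - t) * (p * z powr (p - 1))"
        using MVT2[OF 1, of "\<lambda>x. x powr p" "\<lambda>x. p * x powr (p - 1)"] d t by force
      have "z powr (p - 1) \<le> m powr (p - 1)" using z assms by (intro powr_mono2) auto
      then have "(m - t) * (p * z powr (p - 1)) \<le> (m - t) * (p * m powr (p - 1))"
        using 1 assms by (intro mult_left_mono) auto
      with z show ?thesis by (simp add: algebra_simps)
      qed
    next
      case 2
      obtain z where z: "m < z" "z < t" "t powr p - m powr p = (t - m) * (p * z powr (p - 1))"
        using MVT2[OF 2, of "\<lambda>x. x powr p" "\<lambda>x. p * x powr (p - 1)"] d m by force
      have "m powr (p - 1) \<le> z powr (p - 1)" using z m assms by (intro powr_mono2) auto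
      then have "(t - m) * (p * m powr (p - 1)) \<le> (t - m) * (p * z powr (p - 1))"
        using 2 assms by (intro mult_left_mono) auto
      with z show ?thesis by (simp add: algebra_simps)
    qed
  qed simp
qed

text \<open>Integrates \<open>powr_tangent\<close> at the weighted mean \<open>m\<close>, where the
  linear term drops out.\<close>

lemma weighted_jensen:
  fixes g :: "'a \<Rightarrow> 'b::{banach, second_countable_topology}"
  assumes p: "1 \<le> p" and w: "integrable M w" "\<And>x. x \<in> space M \<Longrightarrow> 0 \<le> w x" and c: "(\<integral>x. w x \<partial>M) > 0"
    and g: "integrable M (\<lambda>x. w x *\<^sub>R g x)" and gp: "integrable M (\<lambda>x. w x * norm (g x) powr p)"
  shows "norm (\<integral>x. w x *\<^sub>R g x \<partial>M) powr p \<le> (\<integral>x. w x \<partial>M) powr (p - 1) * (\<integral>x. w x * norm (g x) powr p \<partial>M)"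
proof -
  define c where "c = (\<integral>x. w x \<partial>M)"
  define I where "I = (\<integral>x. w x * norm (g x) \<partial>M)"
  define m where "m = I / c"
  have cpos: "c > 0" using c by (simp add: c_def)
  have gn: "integrable M (\<lambda>x. w x * norm (g x))"
  proof -
    have "integrable M (\<lambda>x. norm (w x *\<^sub>R g x)) \<longleftrightarrow> integrable M (\<lambda>x. w x * norm (g x))"
      by (rule Bochner_Integration.integrable_cong) (auto simp: w)
    then show ?thesis using integrable_norm[OF g] by simp
  qed
  have I0: "I \<ge> 0" unfolding I_def using w by (intro Bochner_Integration.integral_nonneg) auto
  have m0: "m \<ge> 0" using I0 cpos by (simp add: m_def)
  have "norm (\<integral>x. w x *\<^sub>R g x \<partial>M) \<le> (\<integral>x. norm (w x *\<^sub>R g x) \<partial>M)"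
    by (rule integral_norm_bound)
  also have "\<dots> = I" unfolding I_def by (rule Bochner_Integration.integral_cong) (auto simp: w)
  finally have 1: "norm (\<integral>x. w x *\<^sub>R g x \<partial>M) powr p \<le> I powr p"
    using p by (intro powr_mono2) auto
  have "(\<integral>x. m powr p * w x + p * m powr (p - 1) * (w x * norm (g x) - m * w x) \<partial>M) \<le> (\<integral>x. w x * norm (g x) powr p \<partial>M)"
  proof (rule integral_mono)
    show "integrable M (\<lambda>x. m powr p * w x + p * m powr (p - 1) * (w x * norm (g x) - m * w x))"
      using w gn by (intro Bochner_Integration.integrable_add integrable_mult_right Bochner_Integration.integrable_diff)
    fix x assume "x \<in> space M"
    then have "w x * (m powr p + p * m powr (p - 1) * (norm (g x) - m)) \<le> w x * norm (g x) powr p"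
      using powr_tangent[of "norm (g x)" m p] m0 p w by (intro mult_left_mono) auto
    then show "m powr p * w x + p * m powr (p - 1) * (w x * norm (g x) - m * w x) \<le> w x * norm (g x) powr p"
      by (simp add: algebra_simps)
  qed (rule gp)
  also have "(\<integral>x. m powr p * w x + p * m powr (p - 1) * (w x * norm (g x) - m * w x) \<partial>M)
      = m powr p * c + p * m powr (p - 1) * (I - m * c)"
    using w gn by (simp add: c_def I_def)
  also have "\<dots> = m powr p * c" using cpos by (simp add: m_def)
  finally have "m powr p * c \<le> (\<integral>x. w x * norm (g x) powr p \<partial>M)" .
  then have "c powr (p - 1) * (m powr p * c) \<le> c powr (p - 1) * (\<integral>x. w x * norm (g x) powr p \<partial>M)"
    by (rule mult_left_mono) simp
  moreover have "c powr (p - 1) * (m powr p * c) = I powr p"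
  proof -
    have "c powr (p - 1) * c = c powr p" using cpos powr_add[of c "p - 1" 1] by simp
    moreover have "m powr p = I powr p / c powr p" using I0 cpos by (simp add: m_def powr_divide)
    moreover have "c powr (p - 1) * (m powr p * c) = (c powr (p - 1) * c) * m powr p" by simp
    ultimately show ?thesis using cpos by simp
  qed
  ultimately show ?thesis using 1 by (simp add: c_def)
qed

text \<open>The p-th power of the norm, without the root: rotation invariance, averaging and Fubini
  then concern a single integral, and sums are estimated with the factor 2^p of
  \<open>Np_add\<close>. The codomain is general so that scalar components are covered too.\<close>

definition Np :: "real \<Rightarrow> (vec3 \<Rightarrow> 'b::real_normed_vector) \<Rightarrow> real" where
  "Np p f = (\<integral>x. norm (f x) powr p \<partial>\<sigma>)"

lemma Np_nonneg: "Np p f \<ge> 0"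
  by (simp add: Np_def)

lemma Np_cong: "(\<And>x. norm x = 1 \<Longrightarrow> norm (f x) = norm (g x)) \<Longrightarrow> Np p f = Np p g"
  unfolding Np_def by (rule Bochner_Integration.integral_cong) auto

lemma integrable_powr_continuous:
  fixes f :: "vec3 \<Rightarrow> 'b::real_normed_vector"
  assumes "continuous_on (sphere 0 1) f" "0 < p"
  shows "integrable \<sigma> (\<lambda>x. norm (f x) powr p)"
  using assms by (intro integrable_sigma_continuous continuous_on_powr' continuous_intros) auto

lemma norm_add_powr_le:
  fixes a b :: "'b::real_normed_vector"
  assumes "0 \<le> p"
  shows "norm (a + b) powr p \<le> 2 powr p * (norm a powr p + norm b powr p)"
proof -
  define M where "M = max (norm a) (norm b)"
  have "norm (a + b) \<le> 2 * M" unfolding M_def using norm_triangle_ineq[of a b] by linarith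
  then have "norm (a + b) powr p \<le> (2 * M) powr p" using assms by (intro powr_mono2) auto
  also have "\<dots> = 2 powr p * M powr p" by (simp add: M_def powr_mult)
  also have "M powr p \<le> norm a powr p + norm b powr p" unfolding M_def by (cases "norm a \<le> norm b") auto
  finally show ?thesis by simp
qed

lemma Np_add:
  fixes f g :: "vec3 \<Rightarrow> 'b::real_normed_vector"
  assumes "continuous_on (sphere 0 1) f" "continuous_on (sphere 0 1) g" "0 < p"
  shows "Np p (\<lambda>x. f x + g x) \<le> 2 powr p * (Np p f + Np p g)"
proof -
  have "Np p (\<lambda>x. f x + g x) \<le> (\<integral>x. 2 powr p * (norm (f x) powr p + norm (g x) powr p) \<partial>\<sigma>)"
    unfolding Np_def using assms
    by (intro integral_mono norm_add_powr_le integrable_powr_continuous integrable_mult_right Bochner_Integration.integrable_add continuous_intros) auto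
  also have "\<dots> = 2 powr p * (Np p f + Np p g)"
    unfolding Np_def using assms by (simp add: integrable_powr_continuous)
  finally show ?thesis .
qed

lemma Np_scale: 
  fixes f :: "vec3 \<Rightarrow> 'b::real_normed_vector"
  shows "Np p (\<lambda>x. c *\<^sub>R f x) = \<bar>c\<bar> powr p * Np p f"
  by (simp add: Np_def powr_mult)

text \<open>Jensen's inequality pointwise in \<open>x\<close>, followed by Fubini: averaging
  functions of bounded norm costs only the total weight.\<close>

lemma Np_weighted_average:
  fixes G :: "'a \<Rightarrow> vec3 \<Rightarrow> 'b::{banach, second_countable_topology}"
  assumes p: "1 \<le> p" and M: "finite_measure M"
    and w: "w \<in> borel_measurable M" "\<And>s. s \<in> space M \<Longrightarrow> 0 \<le> w s" "\<And>s. s \<in> space M \<Longrightarrow> w s \<le> W" "(\<integral>s. w s \<partial>M) > 0"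
    and G: "(\<lambda>(s, x). G s x) \<in> borel_measurable (M \<Otimes>\<^sub>M \<sigma>)" "\<And>s x. s \<in> space M \<Longrightarrow> norm x = 1 \<Longrightarrow> norm (G s x) \<le> B"
    and D: "\<And>s. s \<in> space M \<Longrightarrow> Np p (G s) \<le> D"
  shows "Np p (\<lambda>x. \<integral>s. w s *\<^sub>R G s x \<partial>M) \<le> (\<integral>s. w s \<partial>M) powr p * D"
proof -
  interpret M: finite_measure M by fact
  define c where "c = (\<integral>s. w s \<partial>M)"
  have cpos: "c > 0" using w by (simp add: c_def)
  have "space M \<noteq> {}" using w(4) by (metis Bochner_Integration.integral_empty less_irrefl)
  then obtain s0 where s0: "s0 \<in> space M" by blast
  have W0: "0 \<le> W" using w s0 by force
  have B0: "0 \<le> B" using G(2)[OF s0, of "axis 1 1"] by (simp add: order_trans[OF norm_ge_zero])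
  have wi: "integrable M w" using w by (intro M.integrable_const_bound[of _ W] AE_I2) auto
  have Gx: "G' x \<in> borel_measurable M" if "x \<in> space \<sigma>" and "G' = (\<lambda>x s. G s x)" for x G'
  proof -
    have "(\<lambda>s. (s, x)) \<in> M \<rightarrow>\<^sub>M M \<Otimes>\<^sub>M \<sigma>" using that by simp
    from measurable_compose[OF this G(1)] show ?thesis using that by simp
  qed
  have m2: "(\<lambda>(s, x). w s * norm (G s x) powr p) \<in> borel_measurable (M \<Otimes>\<^sub>M \<sigma>)"
  proof -
    have "(\<lambda>z. w (fst z)) \<in> borel_measurable (M \<Otimes>\<^sub>M \<sigma>)" using w by (intro measurable_compose[OF measurable_fst])
    moreover have "(\<lambda>z. norm (case z of (s, x) \<Rightarrow> G s x) powr p) \<in> borel_measurable (M \<Otimes>\<^sub>M \<sigma>)"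
      using G(1) by measurable
    ultimately have "(\<lambda>z. w (fst z) * norm (case z of (s, x) \<Rightarrow> G s x) powr p) \<in> borel_measurable (M \<Otimes>\<^sub>M \<sigma>)"
      by measurable
    then show ?thesis by (simp add: case_prod_beta)
  qed
  have b2: "norm (w s * norm (G s x) powr p) \<le> W * B powr p" if "s \<in> space M" "x \<in> space \<sigma>" for s x
    using that w G(2)[of s x] p W0 by (auto simp: abs_mult intro!: mult_mono powr_mono2)
  note fub = fubini_bounded[OF M finite_measure_sigma m2 b2]
  have pt: "norm (\<integral>s. w s *\<^sub>R G s x \<partial>M) powr p \<le> c powr (p - 1) * (\<integral>s. w s * norm (G s x) powr p \<partial>M)"
    if "x \<in> space \<sigma>" for x
    unfolding c_def
  proof (rule weighted_jensen[OF p wi])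
    have gx: "(\<lambda>s. G s x) \<in> borel_measurable M" using Gx[OF that] by simp
    show "integrable M (\<lambda>s. w s *\<^sub>R G s x)"
      using w gx that W0 G(2)[of _ x] by (intro M.integrable_const_bound[of _ "W * B"] AE_I2) (auto intro!: mult_mono)
    show "integrable M (\<lambda>s. w s * norm (G s x) powr p)"
      using w gx that b2[of _ x] by (intro M.integrable_const_bound[of _ "W * B powr p"] AE_I2) auto
  qed (use w cpos in \<open>auto simp: c_def\<close>)
  have "Np p (\<lambda>x. \<integral>s. w s *\<^sub>R G s x \<partial>M) \<le> (\<integral>x. c powr (p - 1) * (\<integral>s. w s * norm (G s x) powr p \<partial>M) \<partial>\<sigma>)"
    unfolding Np_def
  proof (rule integral_mono_AE')
    show "integrable \<sigma> (\<lambda>x. c powr (p - 1) * (\<integral>s. w s * norm (G s x) powr p \<partial>M))"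
      using fub(4) by simp
    show "AE x in \<sigma>. norm (\<integral>s. w s *\<^sub>R G s x \<partial>M) powr p \<le> c powr (p - 1) * (\<integral>s. w s * norm (G s x) powr p \<partial>M)"
      using pt by (intro AE_I2)
    show "AE x in \<sigma>. 0 \<le> c powr (p - 1) * (\<integral>s. w s * norm (G s x) powr p \<partial>M)"
      using w by (intro AE_I2 mult_nonneg_nonneg Bochner_Integration.integral_nonneg) auto
  qed
  also have "\<dots> = c powr (p - 1) * (\<integral>s. w s * Np p (G s) \<partial>M)"
    using fub(2) by (simp add: Np_def)
  also have "\<dots> \<le> c powr (p - 1) * (\<integral>s. w s * D \<partial>M)"
  proof (intro mult_left_mono integral_mono)
    show "integrable M (\<lambda>s. w s * Np p (G s))" using fub(3) by (simp add: Np_def)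
  qed (use wi w D in \<open>auto intro!: mult_left_mono\<close>)
  also have "\<dots> = c powr (p - 1) * c * D" by (simp add: c_def)
  also have "c powr (p - 1) * c = c powr p" using cpos powr_add[of c "p - 1" 1] by simp
  finally show ?thesis by (simp add: c_def)
qed

lemma Np_orthogonal:
  fixes F :: "vec3 \<Rightarrow> 'b::{banach, second_countable_topology}"
  assumes "orthogonal_transformation T" "F \<in> borel_measurable \<sigma>"
  shows "Np p (\<lambda>x. F (T x)) = Np p F"
  unfolding Np_def
  by (rule integral_sigma_orthogonal[OF assms(1), of "\<lambda>x. norm (F x) powr p"]) (use assms(2) in measurable)

definition vpoly :: "(vec3 \<Rightarrow> vec3) \<Rightarrow> bool" where
  "vpoly F \<longleftrightarrow> (\<forall>i. rpf (\<lambda>x. F x $ i))"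

lemma vpoly_continuous: "vpoly F \<Longrightarrow> continuous_on S F"
proof -
  assume "vpoly F"
  then have "continuous_on S (\<lambda>x. \<chi> i. F x $ i)"
    by (intro continuous_on_vec_lambda continuous_on_rpf) (auto simp: vpoly_def)
  then show ?thesis by simp
qed

lemma continuous_on_vpoly_compose:
  assumes "vpoly F" "continuous_on S g" shows "continuous_on S (\<lambda>z. F (g z))"
  by (rule continuous_on_compose2[OF vpoly_continuous[OF assms(1), of UNIV] assms(2)]) auto

lemma bounded_on_compact_continuous:
  fixes F :: "'a::topological_space \<Rightarrow> 'b::real_normed_vector"
  assumes "compact K" "continuous_on K F"
  obtains B where "\<And>z. z \<in> K \<Longrightarrow> norm (F z) \<le> B"
  using compact_imp_bounded[OF compact_continuous_image[OF assms(2,1)]] bounded_iff by (metis imageI)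

definition vavg :: "(real \<Rightarrow> real) \<Rightarrow> (vec3 \<Rightarrow> vec3) \<Rightarrow> vec3 \<Rightarrow> vec3" where
  "vavg w F x = (\<integral>\<xi>. \<integral>\<alpha>. w \<alpha> *\<^sub>R F (rot \<xi> \<alpha> x) \<partial>circ \<partial>\<sigma>)"

lemma measurable_circ_sigma:
  assumes "continuous_on UNIV (\<lambda>(a, x). F a x)"
  shows "(\<lambda>(a, x). F a x) \<in> borel_measurable (circ \<Otimes>\<^sub>M \<sigma>)"
proof -
  have "(\<lambda>(a, x). F a x) \<in> borel_measurable (borel \<Otimes>\<^sub>M borel)"
    unfolding borel_prod using assms by (rule borel_measurable_continuous_onI)
  moreover have "(\<lambda>z. (fst z, snd z)) \<in> circ \<Otimes>\<^sub>M \<sigma> \<rightarrow>\<^sub>M borel \<Otimes>\<^sub>M borel"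
    by (intro measurable_Pair measurable_compose[OF measurable_snd measurable_sigma_borel]
        measurable_compose[OF measurable_fst measurable_circ_borel])
  ultimately show ?thesis
    using measurable_compose by (fastforce simp: case_prod_beta)
qed

lemma measurable_sigma_sigma:
  assumes "continuous_on UNIV (\<lambda>(a, x). F a x)"
  shows "(\<lambda>(a, x). F a x) \<in> borel_measurable (\<sigma> \<Otimes>\<^sub>M \<sigma>)"
proof -
  have "(\<lambda>(a, x). F a x) \<in> borel_measurable (borel \<Otimes>\<^sub>M borel)"
    unfolding borel_prod using assms by (rule borel_measurable_continuous_onI)
  moreover have "(\<lambda>z. (fst z, snd z)) \<in> \<sigma> \<Otimes>\<^sub>M \<sigma> \<rightarrow>\<^sub>M borel \<Otimes>\<^sub>M borel"
    by (intro measurable_Pair measurable_compose[OF measurable_snd measurable_sigma_borel]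
        measurable_compose[OF measurable_fst measurable_sigma_borel])
  ultimately show ?thesis
    using measurable_compose by (fastforce simp: case_prod_beta)
qed

lemma continuous_on_circ_integral:
  fixes F :: "real \<Rightarrow> 'a::t2_space \<Rightarrow> 'b::euclidean_space"
  assumes "continuous_on UNIV (\<lambda>(z, a). F a z)"
  shows "continuous_on UNIV (\<lambda>z. \<integral>a. F a z \<partial>circ)"
proof -
  have e: "(\<integral>a. F a z \<partial>circ) = integral (cbox 0 (2 * pi)) (\<lambda>a. F a z)" for z
  proof -
    have "continuous_on {0..2 * pi} (\<lambda>a. F a z)"
    proof -
      have "continuous_on {0..2 * pi} (\<lambda>a. (z, a))"
        by (intro continuous_on_Pair continuous_on_const continuous_on_id)
      from continuous_on_compose2[OF assms this] show ?thesis by simp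
    qed
    from set_borel_integral_eq_integral(2)[OF borel_integrable_compact[OF _ this, folded set_integrable_def]]
    show ?thesis by (simp add: integral_circ_eq set_lebesgue_integral_def)
  qed
  show ?thesis unfolding e
    by (rule integral_continuous_on_param) (use assms in \<open>auto intro: continuous_on_subset\<close>)
qed

lemma Np_circ_average:
  assumes F: "vpoly F" and xi: "norm \<xi> = 1" and p: "1 \<le> p"
    and w: "continuous_on UNIV w" "\<And>\<alpha>. 0 \<le> w \<alpha>" "(\<integral>\<alpha>. w \<alpha> \<partial>circ) > 0"
  shows "Np p (\<lambda>x. \<integral>\<alpha>. w \<alpha> *\<^sub>R F (rot \<xi> \<alpha> x) \<partial>circ) \<le> (\<integral>\<alpha>. w \<alpha> \<partial>circ) powr p * Np p F"
proof -
  obtain W where W: "\<And>\<alpha>. \<alpha> \<in> {0..2 * pi} \<Longrightarrow> norm (w \<alpha>) \<le> W"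
    using bounded_on_compact_continuous[of "{0..2 * pi}" w] w continuous_on_subset by blast
  obtain B where B: "\<And>x. x \<in> sphere 0 1 \<Longrightarrow> norm (F x) \<le> B"
    using bounded_on_compact_continuous[of "sphere 0 1" F] vpoly_continuous[OF F] by auto
  show ?thesis
  proof (rule Np_weighted_average[OF p finite_measure_circ, where W = W and B = B])
    show "w \<in> borel_measurable circ" using w by (intro borel_measurable_circ borel_measurable_continuous_onI)
    show "(\<lambda>(\<alpha>, x). F (rot \<xi> \<alpha> x)) \<in> borel_measurable (circ \<Otimes>\<^sub>M \<sigma>)"
    proof (rule measurable_circ_sigma)
      show "continuous_on UNIV (\<lambda>(\<alpha>, x). F (rot \<xi> \<alpha> x))"
        unfolding case_prod_beta
        by (intro continuous_on_vpoly_compose[OF F] continuous_on_rot continuous_on_const continuous_on_fst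
            continuous_on_snd continuous_on_id)
    qed
    show "Np p (\<lambda>x. F (rot \<xi> \<alpha> x)) \<le> Np p F" for \<alpha>
      using Np_orthogonal[OF orthogonal_transformation_rot[OF xi], of F p \<alpha>] vpoly_continuous[OF F]
      by (simp add: borel_measurable_sigma_continuous)
  qed (use w W B xi in \<open>auto simp: norm_rot abs_le_iff\<close>)
qed

text \<open>Rotations are isometries for the \<open>L^p\<close> norm, so a nonnegative average over
  them is bounded by its total weight, first over the angle and then over the axis.\<close>

lemma Np_vavg:
  assumes F: "vpoly F" and p: "1 \<le> p"
    and w: "continuous_on UNIV w" "\<And>\<alpha>. 0 \<le> w \<alpha>" "(\<integral>\<alpha>. w \<alpha> \<partial>circ) > 0"
  shows "Np p (vavg w F) \<le> ((\<integral>\<alpha>. w \<alpha> \<partial>circ) * measure \<sigma> (sphere 0 1)) powr p * Np p F"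
proof -
  define G where "G \<xi> x = (\<integral>\<alpha>. w \<alpha> *\<^sub>R F (rot \<xi> \<alpha> x) \<partial>circ)" for \<xi> x
  have "continuous_on UNIV (\<lambda>z. \<integral>\<alpha>. w \<alpha> *\<^sub>R F (rot (fst z) \<alpha> (snd z)) \<partial>circ)"
  proof (rule continuous_on_circ_integral)
    have "continuous_on UNIV (\<lambda>z::(vec3 \<times> vec3) \<times> real. w (snd z))"
      by (rule continuous_on_compose2[OF w(1)]) (auto intro: continuous_intros)
    then show "continuous_on UNIV (\<lambda>(z, \<alpha>). w \<alpha> *\<^sub>R F (rot (fst z) \<alpha> (snd z)))"
      unfolding case_prod_beta
      by (intro continuous_on_scaleR continuous_on_vpoly_compose[OF F] continuous_on_rot continuous_on_const
          continuous_on_fst continuous_on_snd continuous_on_id) simp_all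
  qed
  then have cG: "continuous_on UNIV (\<lambda>(\<xi>, x). G \<xi> x)" by (simp add: G_def case_prod_beta)
  obtain B where B: "\<And>z. z \<in> sphere 0 1 \<times> sphere 0 1 \<Longrightarrow> norm ((\<lambda>(\<xi>, x). G \<xi> x) z) \<le> B"
    by (rule bounded_on_compact_continuous[OF compact_Times[OF compact_sphere[of 0 1] compact_sphere[of 0 1]]
          continuous_on_subset[OF cG subset_UNIV]]) blast
  have "Np p (\<lambda>x. \<integral>\<xi>. 1 *\<^sub>R G \<xi> x \<partial>\<sigma>) \<le> (\<integral>\<xi>. 1 \<partial>\<sigma>) powr p * ((\<integral>\<alpha>. w \<alpha> \<partial>circ) powr p * Np p F)"
  proof (rule Np_weighted_average[OF p finite_measure_sigma, where W = 1 and B = B])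
    show "(\<lambda>(\<xi>, x). G \<xi> x) \<in> borel_measurable (\<sigma> \<Otimes>\<^sub>M \<sigma>)" by (rule measurable_sigma_sigma[OF cG])
    show "Np p (G \<xi>) \<le> (\<integral>\<alpha>. w \<alpha> \<partial>circ) powr p * Np p F" if "\<xi> \<in> space \<sigma>" for \<xi>
      using Np_circ_average[OF F _ p w, of \<xi>] that by (simp add: G_def[abs_def])
  qed (use B sigma_measure_pos in auto)
  then show ?thesis
    by (simp add: vavg_def[abs_def] G_def powr_mult mult_ac)
qed

text \<open>Transference: by rotation invariance the norm may be averaged over the rotations by
  \<beta> about \<xi>. On each orbit the operator is then the convolution of
  \<open>conjugate_function_bound\<close>, and the circle estimate is integrated over the
  orbits.\<close>

lemma Np_conjugate_axis:
  assumes h: "rpf h" and tr: "\<And>x. trig N (\<lambda>\<alpha>. h (rot \<xi> \<alpha> x))" and xi: "norm \<xi> = 1" and p: "1 < p" "p \<le> 2"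
  shows "Np p (\<lambda>x. \<integral>\<alpha>. conj_kernel N \<alpha> * h (rot \<xi> \<alpha> x) \<partial>circ) \<le> (2 * pi) powr p * (2 / (p - 1)) * Np p h"
proof -
  define g where "g x = (\<integral>\<alpha>. conj_kernel N \<alpha> * h (rot \<xi> \<alpha> x) \<partial>circ)" for x
  define K where "K = (2 * pi) powr p * (2 / (p - 1))"
  have ck: "continuous_on UNIV (\<lambda>z::vec3 \<times> real. conj_kernel N (snd z))"
    by (rule continuous_on_compose2[OF continuous_on_conj_kernel[of UNIV]]) (auto intro: continuous_intros)
  have cg: "continuous_on UNIV g"
    unfolding g_def[abs_def]
  proof (rule continuous_on_circ_integral)
    show "continuous_on UNIV (\<lambda>(x, \<alpha>). conj_kernel N \<alpha> * h (rot \<xi> \<alpha> x))"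
      unfolding case_prod_beta using ck
      by (intro continuous_on_mult continuous_on_rpf_compose[OF h] continuous_on_rot continuous_on_const
          continuous_on_fst continuous_on_snd continuous_on_id)
  qed
  have crot: "continuous_on UNIV (\<lambda>z. rot \<xi> (snd z) (fst z))"
    by (intro continuous_on_rot continuous_on_const continuous_on_fst continuous_on_snd continuous_on_id)
  have cp: "continuous_on UNIV (\<lambda>(x, \<beta>). norm (f (rot \<xi> \<beta> x)) powr p)" if "continuous_on UNIV f" for f :: "vec3 \<Rightarrow> real"
  proof -
    have "continuous_on UNIV (\<lambda>z. f (rot \<xi> (snd z) (fst z)))"
      using continuous_on_compose2[OF that crot] by simp
    then show ?thesis unfolding case_prod_beta using p
      by (intro continuous_on_powr' continuous_on_norm continuous_on_const) auto
  qed
  note ch = continuous_on_rpf[OF h, of UNIV]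
  have swap: "2 * pi * Np p f = (\<integral>x. \<integral>\<beta>. norm (f (rot \<xi> \<beta> x)) powr p \<partial>circ \<partial>\<sigma>)" if "continuous_on UNIV f" for f :: "vec3 \<Rightarrow> real"
  proof -
    have "Np p (\<lambda>x. f (rot \<xi> \<beta> x)) = Np p f" for \<beta>
      using continuous_on_subset[OF that subset_UNIV]
      by (intro Np_orthogonal orthogonal_transformation_rot xi borel_measurable_sigma_continuous)
    then have "(\<integral>\<beta>. \<integral>x. norm (f (rot \<xi> \<beta> x)) powr p \<partial>\<sigma> \<partial>circ) = (\<integral>\<beta>. Np p f \<partial>circ)"
      by (simp add: Np_def)
    then show ?thesis using sphere_circ_fubini(1)[OF cp[OF that]] by simp
  qed
  have "2 * pi * Np p g = (\<integral>x. \<integral>\<beta>. norm (g (rot \<xi> \<beta> x)) powr p \<partial>circ \<partial>\<sigma>)"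
    by (rule swap[OF cg])
  also have "\<dots> \<le> (\<integral>x. K * (\<integral>\<beta>. norm (h (rot \<xi> \<beta> x)) powr p \<partial>circ) \<partial>\<sigma>)"
  proof (rule integral_mono)
    show "integrable \<sigma> (\<lambda>x. \<integral>\<beta>. norm (g (rot \<xi> \<beta> x)) powr p \<partial>circ)"
      by (rule sphere_circ_fubini(2)[OF cp[OF cg]])
    show "integrable \<sigma> (\<lambda>x. K * (\<integral>\<beta>. norm (h (rot \<xi> \<beta> x)) powr p \<partial>circ))"
      using sphere_circ_fubini(2)[OF cp[OF ch]] by simp
    fix x
    have "g (rot \<xi> \<beta> x) = (\<integral>\<alpha>. conj_kernel N \<alpha> * h (rot \<xi> (\<alpha> + \<beta>) x) \<partial>circ)" for \<beta>
      by (simp add: g_def rot_rot[OF xi])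
    then show "(\<integral>\<beta>. norm (g (rot \<xi> \<beta> x)) powr p \<partial>circ) \<le> K * (\<integral>\<beta>. norm (h (rot \<xi> \<beta> x)) powr p \<partial>circ)"
      using conjugate_function_bound[OF tr[of x] p] by (simp add: K_def)
  qed
  also have "\<dots> = K * (2 * pi * Np p h)"
    using swap[OF ch] by simp
  finally have "2 * pi * Np p g \<le> 2 * pi * (K * Np p h)" by (simp add: mult_ac)
  then have "Np p g \<le> K * Np p h" by (rule mult_left_le_imp_le) simp
  then show ?thesis by (simp add: g_def[abs_def] K_def)
qed

lemma norm_vec3_powr_le:
  fixes v :: vec3
  assumes "0 \<le> p"
  shows "norm v powr p \<le> 3 powr p * (\<Sum>i\<in>UNIV. \<bar>v $ i\<bar> powr p)"
proof -
  define M where "M = Max ((\<lambda>i. \<bar>v $ i\<bar>) ` UNIV)"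
  have M: "\<bar>v $ i\<bar> \<le> M" for i unfolding M_def by (intro Max_ge) auto
  have "norm v \<le> (\<Sum>i\<in>UNIV. \<bar>v $ i\<bar>)" by (rule norm_le_l1_cart)
  also have "\<dots> \<le> (\<Sum>i\<in>(UNIV :: 3 set). M)" by (intro sum_mono M)
  also have "\<dots> = 3 * M" by simp
  finally have n: "norm v \<le> 3 * M" .
  obtain j where j: "M = \<bar>v $ j\<bar>"
  proof -
    have "M \<in> (\<lambda>i. \<bar>v $ i\<bar>) ` UNIV" unfolding M_def by (intro Max_in) auto
    then show ?thesis using that by blast
  qed
  have "norm v powr p \<le> (3 * M) powr p" using n assms by (intro powr_mono2) auto
  also have "\<dots> = 3 powr p * \<bar>v $ j\<bar> powr p" by (simp add: j powr_mult)
  also have "\<bar>v $ j\<bar> powr p \<le> (\<Sum>i\<in>UNIV. \<bar>v $ i\<bar> powr p)" by (intro member_le_sum) auto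
  finally show ?thesis by simp
qed

definition vconj :: "nat \<Rightarrow> (vec3 \<Rightarrow> vec3) \<Rightarrow> vec3 \<Rightarrow> vec3 \<Rightarrow> vec3" where
  "vconj N F \<xi> x = (\<integral>\<alpha>. conj_kernel N \<alpha> *\<^sub>R F (rot \<xi> \<alpha> x) \<partial>circ)"

text \<open>A Riesz transform: on fields with harmonic components of degree \<open>k \<le> N\<close> it is a constant
  times \<open>T / (2 k + 1)\<close>.\<close>

definition riesz :: "nat \<Rightarrow> (vec3 \<Rightarrow> vec3) \<Rightarrow> vec3 \<Rightarrow> vec3" where
  "riesz N F x = (\<integral>\<xi>. cross3 \<xi> (vconj N F \<xi> x) \<partial>\<sigma>)"

lemma weighted_integrable:
  assumes "vpoly F" "continuous_on UNIV w"
  shows "integrable circ (\<lambda>\<alpha>. w \<alpha> *\<^sub>R F (rot \<xi> \<alpha> x))"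
  by (intro integrable_circ_continuous continuous_on_scaleR assms continuous_on_vpoly_compose[OF assms(1)]
      continuous_on_rot continuous_on_const continuous_on_id)

lemma weighted_continuous:
  assumes "vpoly F" "continuous_on UNIV w"
  shows "continuous_on UNIV (\<lambda>(\<xi>, x). \<integral>\<alpha>. w \<alpha> *\<^sub>R F (rot \<xi> \<alpha> x) \<partial>circ)"
proof -
  have "continuous_on UNIV (\<lambda>z. \<integral>\<alpha>. w \<alpha> *\<^sub>R F (rot (fst z) \<alpha> (snd z)) \<partial>circ)"
  proof (rule continuous_on_circ_integral)
    have "continuous_on UNIV (\<lambda>z::(vec3 \<times> vec3) \<times> real. w (snd z))"
      by (rule continuous_on_compose2[OF assms(2)]) (auto intro: continuous_intros)
    then show "continuous_on UNIV (\<lambda>(z, \<alpha>). w \<alpha> *\<^sub>R F (rot (fst z) \<alpha> (snd z)))"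
      unfolding case_prod_beta
      by (intro continuous_on_scaleR continuous_on_vpoly_compose[OF assms(1)] continuous_on_rot continuous_on_const
          continuous_on_fst continuous_on_snd continuous_on_id) simp_all
  qed
  then show ?thesis by (simp add: case_prod_beta)
qed

lemma weighted_continuous_slice:
  assumes "vpoly F" "continuous_on UNIV w"
  shows "continuous_on S (\<lambda>\<xi>. \<integral>\<alpha>. w \<alpha> *\<^sub>R F (rot \<xi> \<alpha> x) \<partial>circ)"
proof -
  have "continuous_on S (\<lambda>\<xi>. (\<xi>, x))"
    by (intro continuous_on_Pair continuous_on_const continuous_on_id)
  from continuous_on_compose2[OF weighted_continuous[OF assms] this] show ?thesis by simp
qed

lemma weighted_component:
  assumes "vpoly F" "continuous_on UNIV w"
  shows "(\<integral>\<alpha>. w \<alpha> *\<^sub>R F (rot \<xi> \<alpha> x) \<partial>circ) $ i = (\<integral>\<alpha>. w \<alpha> * F (rot \<xi> \<alpha> x) $ i \<partial>circ)"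
  using integral_bounded_linear[OF bounded_linear_vec_nth weighted_integrable[OF assms]] by simp

lemma vavg_component:
  assumes "vpoly F" "continuous_on UNIV w"
  shows "vavg w F x $ i = axis_avg w (\<lambda>x. F x $ i) x"
proof -
  have "integrable \<sigma> (\<lambda>\<xi>. \<integral>\<alpha>. w \<alpha> *\<^sub>R F (rot \<xi> \<alpha> x) \<partial>circ)"
    by (intro integrable_sigma_continuous weighted_continuous_slice assms)
  from integral_bounded_linear[OF bounded_linear_vec_nth this] show ?thesis
    by (simp add: vavg_def axis_avg_def weighted_component[OF assms])
qed

lemma riesz_integrable:
  assumes "vpoly F" shows "integrable \<sigma> (\<lambda>\<xi>. cross3 \<xi> (vconj N F \<xi> x))"
  unfolding vconj_def
  by (intro integrable_sigma_continuous continuous_on_cross continuous_on_id weighted_continuous_slice assms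
      continuous_on_conj_kernel)

lemma vpoly_sum: "(\<And>j. j \<in> J \<Longrightarrow> vpoly (F j)) \<Longrightarrow> vpoly (\<lambda>x. \<Sum>j\<in>J. F j x)"
  by (simp add: vpoly_def)

lemma vpoly_add: "vpoly F \<Longrightarrow> vpoly G \<Longrightarrow> vpoly (\<lambda>x. F x + G x)"
  by (simp add: vpoly_def)

lemma vpoly_diff: "vpoly F \<Longrightarrow> vpoly G \<Longrightarrow> vpoly (\<lambda>x. F x - G x)"
  by (simp add: vpoly_def)

lemma vpoly_scaleR: "vpoly F \<Longrightarrow> vpoly (\<lambda>x. c *\<^sub>R F x)"
  by (simp add: vpoly_def)

lemma vpoly_zero: "vpoly (\<lambda>x. 0)"
  by (simp add: vpoly_def)

lemma vavg_sum:
  assumes F: "\<And>j. j \<in> J \<Longrightarrow> vpoly (F j)" and w: "continuous_on UNIV w"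
  shows "vavg w (\<lambda>x. \<Sum>j\<in>J. F j x) x = (\<Sum>j\<in>J. vavg w (F j) x)"
proof -
  have i: "integrable \<sigma> (\<lambda>\<xi>. \<integral>\<alpha>. w \<alpha> *\<^sub>R F j (rot \<xi> \<alpha> x) \<partial>circ)" if "j \<in> J" for j
    by (intro integrable_sigma_continuous weighted_continuous_slice F that w)
  show ?thesis
    unfolding vavg_def scaleR_sum_right
    using i weighted_integrable[OF F w] by (simp add: Bochner_Integration.integral_sum)
qed

lemma riesz_sum:
  assumes F: "\<And>j. j \<in> J \<Longrightarrow> vpoly (F j)" and J: "finite J"
  shows "riesz N (\<lambda>x. \<Sum>j\<in>J. F j x) x = (\<Sum>j\<in>J. riesz N (F j) x)"
proof -
  have "vconj N (\<lambda>x. \<Sum>j\<in>J. F j x) \<xi> x = (\<Sum>j\<in>J. vconj N (F j) \<xi> x)" for \<xi>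
    unfolding vconj_def scaleR_sum_right
    using weighted_integrable[OF F continuous_on_conj_kernel] by (simp add: Bochner_Integration.integral_sum)
  moreover have "cross3 \<xi> (\<Sum>j\<in>J. v j) = (\<Sum>j\<in>J. cross3 \<xi> (v j))" for \<xi> and v :: "'a \<Rightarrow> vec3"
    using J by (induction J rule: finite_induct) (auto simp: cross_add_right)
  ultimately show ?thesis
    unfolding riesz_def using riesz_integrable[OF F] by (simp add: Bochner_Integration.integral_sum)
qed

text \<open>The scalar bound is applied to each component, which costs 3^p times 3; the cross
  product with the unit vector \<xi> does not increase norms. The constant is independent of
  \<open>N\<close>.\<close>

lemma Np_riesz:
  assumes F: "vpoly F" and tr: "\<And>i \<xi> x. trig N (\<lambda>\<alpha>. F (rot \<xi> \<alpha> x) $ i)" and p: "1 < p" "p \<le> 2"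
  shows "Np p (riesz N F) \<le> measure \<sigma> (sphere 0 1) powr p * (3 powr p * 3 * ((2 * pi) powr p * (2 / (p - 1)))) * Np p F"
proof -
  define K where "K = (2 * pi) powr p * (2 / (p - 1))"
  have K: "K \<ge> 0" using p by (simp add: K_def)
  have rF: "rpf (\<lambda>x. F x $ i)" for i using F by (simp add: vpoly_def)
  have cc: "continuous_on UNIV (\<lambda>(\<xi>, x). vconj N F \<xi> x)"
    unfolding vconj_def by (intro weighted_continuous F continuous_on_conj_kernel)
  have cs: "continuous_on UNIV (vconj N F \<xi>)" for \<xi>
  proof -
    have "continuous_on UNIV (\<lambda>x. (\<xi>, x))"
      by (intro continuous_on_Pair continuous_on_const continuous_on_id)
    from continuous_on_compose2[OF cc this] show ?thesis by simp
  qed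
  have cG: "continuous_on UNIV (\<lambda>(\<xi>, x). cross3 \<xi> (vconj N F \<xi> x))"
    using cc unfolding case_prod_beta by (intro continuous_on_cross continuous_on_fst continuous_on_id)
  obtain B where B: "\<And>z. z \<in> sphere 0 1 \<times> sphere 0 1 \<Longrightarrow> norm ((\<lambda>(\<xi>, x). cross3 \<xi> (vconj N F \<xi> x)) z) \<le> B"
    by (rule bounded_on_compact_continuous[OF compact_Times[OF compact_sphere[of 0 1] compact_sphere[of 0 1]]
          continuous_on_subset[OF cG subset_UNIV]]) blast
  have H: "Np p (vconj N F \<xi>) \<le> 3 powr p * 3 * K * Np p F" if xi: "norm \<xi> = 1" for \<xi>
  proof -
    have cp: "continuous_on (sphere 0 1) (\<lambda>x. G x $ i)" if "continuous_on UNIV G" for G :: "vec3 \<Rightarrow> vec3" and i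
      using continuous_on_subset[OF that subset_UNIV] by (rule continuous_on_component)
    have ip: "integrable \<sigma> (\<lambda>x. \<bar>vconj N F \<xi> x $ i\<bar> powr p)" for i
    proof -
      have "integrable \<sigma> (\<lambda>x. norm (vconj N F \<xi> x $ i) powr p)"
        using p by (intro integrable_powr_continuous cp cs) auto
      then show ?thesis by (simp only: real_norm_def)
    qed
    have "Np p (vconj N F \<xi>) \<le> (\<integral>x. 3 powr p * (\<Sum>i\<in>UNIV. \<bar>vconj N F \<xi> x $ i\<bar> powr p) \<partial>\<sigma>)"
      unfolding Np_def
    proof (rule integral_mono)
      show "integrable \<sigma> (\<lambda>x. norm (vconj N F \<xi> x) powr p)"
        using p continuous_on_subset[OF cs subset_UNIV] by (intro integrable_powr_continuous) auto
      show "integrable \<sigma> (\<lambda>x. 3 powr p * (\<Sum>i\<in>UNIV. \<bar>vconj N F \<xi> x $ i\<bar> powr p))"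
        by (intro integrable_mult_right Bochner_Integration.integrable_sum ip)
      show "norm (vconj N F \<xi> x) powr p \<le> 3 powr p * (\<Sum>i\<in>UNIV. \<bar>vconj N F \<xi> x $ i\<bar> powr p)" for x
        using p by (intro norm_vec3_powr_le) auto
    qed
    also have "\<dots> = 3 powr p * (\<Sum>i\<in>UNIV. Np p (\<lambda>x. vconj N F \<xi> x $ i))"
      using ip by (simp add: Np_def Bochner_Integration.integral_sum)
    also have "(\<Sum>i\<in>UNIV. Np p (\<lambda>x. vconj N F \<xi> x $ i)) \<le> (\<Sum>i\<in>(UNIV :: 3 set). K * Np p F)"
    proof (intro sum_mono)
      fix i :: 3
      have "Np p (\<lambda>x. vconj N F \<xi> x $ i) \<le> K * Np p (\<lambda>x. F x $ i)"
        unfolding vconj_def weighted_component[OF F continuous_on_conj_kernel] K_def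
        by (rule Np_conjugate_axis[OF rF tr xi p])
      also have "Np p (\<lambda>x. F x $ i) \<le> Np p F"
        unfolding Np_def using p vpoly_continuous[OF F] continuous_on_rpf[OF rF]
        by (intro integral_mono integrable_powr_continuous powr_mono2) (auto simp: component_le_norm_cart)
      finally show "Np p (\<lambda>x. vconj N F \<xi> x $ i) \<le> K * Np p F" using K by (simp add: mult_left_mono)
    qed
    finally show ?thesis by (simp add: mult_ac)
  qed
  have "Np p (\<lambda>x. \<integral>\<xi>. 1 *\<^sub>R cross3 \<xi> (vconj N F \<xi> x) \<partial>\<sigma>) \<le> (\<integral>\<xi>. 1 \<partial>\<sigma>) powr p * (3 powr p * 3 * K * Np p F)"
  proof (rule Np_weighted_average[OF _ finite_measure_sigma, where W = 1 and B = B])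
    show "(\<lambda>(\<xi>, x). cross3 \<xi> (vconj N F \<xi> x)) \<in> borel_measurable (\<sigma> \<Otimes>\<^sub>M \<sigma>)"
      by (rule measurable_sigma_sigma[OF cG])
    show "Np p (\<lambda>x. cross3 \<xi> (vconj N F \<xi> x)) \<le> 3 powr p * 3 * K * Np p F" if "\<xi> \<in> space \<sigma>" for \<xi>
    proof -
      have xi: "norm \<xi> = 1" using that by simp
      have "norm (cross3 \<xi> v) \<le> norm v" for v
      proof -
        have "(norm (cross3 \<xi> v))\<^sup>2 + (\<xi> \<bullet> v)\<^sup>2 = (norm v)\<^sup>2"
          using norm_cross_dot[of \<xi> v] xi by simp
        then have "(norm (cross3 \<xi> v))\<^sup>2 \<le> (norm v)\<^sup>2"
          using zero_le_power2[of "\<xi> \<bullet> v"] by linarith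
        then show ?thesis by (rule power2_le_imp_le) simp
      qed
      then have "Np p (\<lambda>x. cross3 \<xi> (vconj N F \<xi> x)) \<le> Np p (vconj N F \<xi>)"
        unfolding Np_def using p continuous_on_subset[OF cs[of \<xi>] subset_UNIV]
        by (intro integral_mono integrable_powr_continuous powr_mono2 continuous_on_cross continuous_on_const) auto
      with H[OF xi] show ?thesis by linarith
    qed
  qed (use B sigma_measure_pos p in auto)
  then show ?thesis by (simp add: riesz_def[abs_def] K_def mult_ac)
qed

section \<open>Fields with harmonic components and the spin-orbit operator\<close>

definition vharm :: "nat \<Rightarrow> (vec3 \<Rightarrow> vec3) \<Rightarrow> bool" where
  "vharm k F \<longleftrightarrow> (\<forall>i. harmp k (\<lambda>x. F x $ i))"

text \<open>The operator \<open>T\<close>. In physical terms it couples orbital angular momentum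
  with spin one; the eigenvalues k, - 1 and - (k + 1) belong to total angular momentum k + 1, k and
  k - 1.\<close>

definition spin_orbit :: "(vec3 \<Rightarrow> vec3) \<Rightarrow> vec3 \<Rightarrow> vec3" where
  "spin_orbit F x = vector [Lop 2 (\<lambda>x. F x $ 3) x - Lop 3 (\<lambda>x. F x $ 2) x,
     Lop 3 (\<lambda>x. F x $ 1) x - Lop 1 (\<lambda>x. F x $ 3) x,
     Lop 1 (\<lambda>x. F x $ 2) x - Lop 2 (\<lambda>x. F x $ 1) x]"

lemma spin_orbit_component:
  "spin_orbit F x $ 1 = Lop 2 (\<lambda>x. F x $ 3) x - Lop 3 (\<lambda>x. F x $ 2) x"
  "spin_orbit F x $ 2 = Lop 3 (\<lambda>x. F x $ 1) x - Lop 1 (\<lambda>x. F x $ 3) x"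
  "spin_orbit F x $ 3 = Lop 1 (\<lambda>x. F x $ 2) x - Lop 2 (\<lambda>x. F x $ 1) x"
  by (simp_all add: spin_orbit_def)

lemma vharm_vpoly: "vharm k F \<Longrightarrow> vpoly F"
  unfolding vharm_def vpoly_def using harmp_rpf by blast

lemma vavg_vharm:
  assumes "vharm k F"
  shows "vavg (\<lambda>_. 1) F x = (sphere_circ_mass / (2 * real k + 1)) *\<^sub>R F x"
proof -
  have "axis_avg (\<lambda>_. 1) (\<lambda>x. F x $ i) x = sphere_circ_mass / (2 * real k + 1) * F x $ i" for i
    using assms by (intro axis_avg_harmonic) (simp add: vharm_def)
  then show ?thesis using vharm_vpoly[OF assms] by (simp add: vec_eq_iff vavg_component)
qed

lemma vavg_haar:
  assumes "vharm k F" "k \<noteq> 0"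
  shows "vavg (\<lambda>\<alpha>. 1 - cos \<alpha>) F x = 0"
proof -
  have "continuous_on UNIV (\<lambda>\<alpha>::real. 1 - cos \<alpha>)" by (intro continuous_intros)
  moreover have "axis_avg (\<lambda>\<alpha>. 1 - cos \<alpha>) (\<lambda>x. F x $ i) x = 0" for i
    using assms by (intro axis_avg_haar) (auto simp: vharm_def)
  ultimately show ?thesis using vharm_vpoly[OF assms(1)] by (simp add: vec_eq_iff vavg_component)
qed

lemma riesz_vharm:
  assumes F: "vharm k F" and k: "k \<le> N"
  shows "riesz N F x = (sphere_circ_mass / (2 * real k + 1)) *\<^sub>R spin_orbit F x"
proof -
  have vF: "vpoly F" using F by (rule vharm_vpoly)
  have hF: "harmp k (\<lambda>x. F x $ i)" for i using F by (simp add: vharm_def)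
  have m: "(\<integral>\<xi>. \<xi> $ a * vconj N F \<xi> x $ i \<partial>\<sigma>) = sphere_circ_mass / (2 * real k + 1) * Lop a (\<lambda>x. F x $ i) x" for a i
  proof -
    have "\<xi> $ a * vconj N F \<xi> x $ i = (\<integral>\<alpha>. \<xi> $ a * F (rot \<xi> \<alpha> x) $ i * conj_kernel N \<alpha> \<partial>circ)" for \<xi>
    proof -
      have "\<xi> $ a * vconj N F \<xi> x $ i = (\<integral>\<alpha>. \<xi> $ a * (conj_kernel N \<alpha> * F (rot \<xi> \<alpha> x) $ i) \<partial>circ)"
        unfolding vconj_def weighted_component[OF vF continuous_on_conj_kernel] by simp
      also have "(\<lambda>\<alpha>. \<xi> $ a * (conj_kernel N \<alpha> * F (rot \<xi> \<alpha> x) $ i)) = (\<lambda>\<alpha>. \<xi> $ a * F (rot \<xi> \<alpha> x) $ i * conj_kernel N \<alpha>)"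
        by (simp add: mult_ac)
      finally show ?thesis .
    qed
    then show ?thesis using axis_avg_riesz[OF hF[of i] k, of a x] by simp
  qed
  have i: "integrable \<sigma> (\<lambda>\<xi>. \<xi> $ a * vconj N F \<xi> x $ i)" for a i
    unfolding vconj_def
    by (intro integrable_sigma_continuous continuous_on_mult continuous_on_component continuous_on_id
        weighted_continuous_slice vF continuous_on_conj_kernel)
  have c: "riesz N F x $ i = (\<integral>\<xi>. cross3 \<xi> (vconj N F \<xi> x) $ i \<partial>\<sigma>)" for i
    unfolding riesz_def using integral_bounded_linear[OF bounded_linear_vec_nth riesz_integrable[OF vF]] by simp
  have "riesz N F x $ i = ((sphere_circ_mass / (2 * real k + 1)) *\<^sub>R spin_orbit F x) $ i" for i
    using exhaust_3[of i] i
    by (auto simp: c cross_components spin_orbit_component m mult.commute[of "vconj _ _ _ _ $ _"] right_diff_distrib' diff_divide_distrib)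
  then show ?thesis by (simp add: vec_eq_iff)
qed

section \<open>The three spectral projections\<close>

lemma vharm_add: "vharm k F \<Longrightarrow> vharm k G \<Longrightarrow> vharm k (\<lambda>x. F x + G x)"
  by (simp add: vharm_def harmp_add)

lemma vharm_scaleR: "vharm k F \<Longrightarrow> vharm k (\<lambda>x. c *\<^sub>R F x)"
  by (simp add: vharm_def harmp_cmult)

lemma vharm_diff: "vharm k F \<Longrightarrow> vharm k G \<Longrightarrow> vharm k (\<lambda>x. F x - G x)"
  by (simp add: vharm_def harmp_diff)

lemma vharm_sum: "(\<And>j. j \<in> J \<Longrightarrow> vharm k (F j)) \<Longrightarrow> vharm k (\<lambda>x. \<Sum>j\<in>J. F j x)"
  by (simp add: vharm_def harmp_sum)

lemma Lop_diff: "rpf f \<Longrightarrow> rpf g \<Longrightarrow> Lop a (\<lambda>x. f x - g x) = (\<lambda>x. Lop a f x - Lop a g x)"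
  using Lop_add[of f "\<lambda>x. - 1 * g x" a] Lop_cmult[of g a "- 1"] by simp

lemma spin_orbit_add:
  assumes "vpoly F" "vpoly G"
  shows "spin_orbit (\<lambda>x. F x + G x) x = spin_orbit F x + spin_orbit G x"
  using assms by (simp add: vec_eq_iff forall_3 spin_orbit_component vpoly_def Lop_add)

lemma spin_orbit_diff:
  assumes "vpoly F" "vpoly G"
  shows "spin_orbit (\<lambda>x. F x - G x) x = spin_orbit F x - spin_orbit G x"
  using assms by (simp add: vec_eq_iff forall_3 spin_orbit_component vpoly_def Lop_diff)

lemma spin_orbit_scaleR:
  assumes "vpoly F"
  shows "spin_orbit (\<lambda>x. c *\<^sub>R F x) x = c *\<^sub>R spin_orbit F x"
  using assms by (simp add: vec_eq_iff forall_3 spin_orbit_component vpoly_def Lop_cmult algebra_simps)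

definition hinv :: "(vec3 \<Rightarrow> vec3) \<Rightarrow> vec3 \<Rightarrow> vec3" where
  "hinv F x = (1 / sphere_circ_mass) *\<^sub>R vavg (\<lambda>_. 1) F x"

text \<open>The combination 2 T + 1 makes the outer eigenvalues k and - (k + 1) opposite, namely 2 k
  + 1 and - (2 k + 1), so that division by 2 k + 1 leaves nothing but a sign.\<close>

definition hsign :: "nat \<Rightarrow> (vec3 \<Rightarrow> vec3) \<Rightarrow> vec3 \<Rightarrow> vec3" where
  "hsign n F x = (2 / sphere_circ_mass) *\<^sub>R riesz n F x + hinv F x"

lemma hinv_sum:
  assumes "\<And>k. vharm k (G k)"
  shows "hinv (\<lambda>x. \<Sum>k\<le>n. G k x) x = (\<Sum>k\<le>n. (1 / (2 * real k + 1)) *\<^sub>R G k x)"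
  using sphere_circ_mass_pos
  by (simp add: hinv_def vavg_sum vharm_vpoly[OF assms] vavg_vharm[OF assms] scaleR_sum_right)

lemma hsign_sum:
  assumes "\<And>k. vharm k (G k)"
  shows "hsign n (\<lambda>x. \<Sum>k\<le>n. G k x) x = (\<Sum>k\<le>n. (1 / (2 * real k + 1)) *\<^sub>R (2 *\<^sub>R spin_orbit (G k) x + G k x))"
proof -
  have "riesz n (\<lambda>x. \<Sum>k\<le>n. G k x) x = (\<Sum>k\<le>n. (sphere_circ_mass / (2 * real k + 1)) *\<^sub>R spin_orbit (G k) x)"
    by (subst riesz_sum) (auto simp: vharm_vpoly[OF assms] riesz_vharm[OF assms])
  then show ?thesis
    using sphere_circ_mass_pos
    by (simp add: hsign_def hinv_sum[OF assms] scaleR_sum_right sum.distrib scaleR_add_right)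
qed

lemma Np_hinv:
  assumes F: "vpoly F" and p: "1 \<le> p"
  shows "Np p (hinv F) \<le> Np p F"
proof -
  have "Np p (hinv F) = (1 / sphere_circ_mass) powr p * Np p (vavg (\<lambda>_. 1) F)"
    unfolding hinv_def[abs_def] using sphere_circ_mass_pos by (simp add: Np_scale)
  also have "\<dots> \<le> (1 / sphere_circ_mass) powr p * (sphere_circ_mass powr p * Np p F)"
    using Np_vavg[OF F p, of "\<lambda>_. 1"] by (intro mult_left_mono) (auto simp: sphere_circ_mass_def)
  also have "\<dots> = Np p F" using sphere_circ_mass_pos by (simp add: powr_divide)
  finally show ?thesis .
qed

text \<open>Fields without constant part have zero Haar average, so the weights 1 and (1 + cos
  \<alpha>) / 2 average them equally. The latter is nonnegative and has half the total weight,
  whence the constant 1/2.\<close>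

lemma Np_hinv_mean_zero:
  fixes n :: nat
  assumes G: "\<And>k. vharm k (G k)" and G0: "\<And>x. G 0 x = 0" and p: "1 \<le> p"
  defines "F \<equiv> \<lambda>x. \<Sum>k\<le>n. G k x"
  shows "Np p (hinv F) \<le> (1 / 2) powr p * Np p F"
proof -
  have F: "vpoly F" unfolding F_def using vharm_vpoly[OF G] by (rule vpoly_sum)
  have cw: "continuous_on UNIV (\<lambda>\<alpha>::real. 1 + cos \<alpha>)" "continuous_on UNIV (\<lambda>\<alpha>::real. 1 - cos \<alpha>)"
    by (intro continuous_intros)+
  have haar: "vavg (\<lambda>\<alpha>. 1 - cos \<alpha>) F x = 0" for x
  proof -
    have "vavg (\<lambda>\<alpha>. 1 - cos \<alpha>) F x = (\<Sum>k\<le>n. vavg (\<lambda>\<alpha>. 1 - cos \<alpha>) (G k) x)"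
      unfolding F_def by (rule vavg_sum[OF vharm_vpoly[OF G] cw(2)])
    also have "\<dots> = 0"
    proof (intro sum.neutral ballI)
      fix k show "vavg (\<lambda>\<alpha>. 1 - cos \<alpha>) (G k) x = 0"
      proof (cases "k = 0")
        case True
        have "(\<lambda>x. G 0 x) = (\<lambda>x. 0)" using G0 by auto
        then have "G 0 = (\<lambda>x. 0)" by simp
        then show ?thesis using True by (simp add: vavg_def)
      qed (rule vavg_haar[OF G])
    qed
    finally show ?thesis .
  qed
  have "vavg (\<lambda>\<alpha>. 1 + cos \<alpha>) F x = 2 *\<^sub>R vavg (\<lambda>_. 1) F x" for x
  proof -
    have "vavg (\<lambda>\<alpha>. 1 + cos \<alpha>) F x $ i = 2 * vavg (\<lambda>_. 1) F x $ i" for i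
    proof -
      have r: "rpf (\<lambda>x. F x $ i)" using F by (simp add: vpoly_def)
      have "axis_avg (\<lambda>\<alpha>. 2 - (1 - cos \<alpha>)) (\<lambda>x. F x $ i) x = axis_avg (\<lambda>\<alpha>. 2) (\<lambda>x. F x $ i) x - axis_avg (\<lambda>\<alpha>. 1 - cos \<alpha>) (\<lambda>x. F x $ i) x"
        by (rule axis_avg_weight_diff[OF r continuous_on_const cw(2)])
      moreover have "axis_avg (\<lambda>\<alpha>. 1 - cos \<alpha>) (\<lambda>x. F x $ i) x = 0"
        using haar[of x] vavg_component[OF F cw(2), of x i] by simp
      moreover have "axis_avg (\<lambda>\<alpha>. 2) (\<lambda>x. F x $ i) x = 2 * axis_avg (\<lambda>_. 1) (\<lambda>x. F x $ i) x"
        by (simp add: axis_avg_def)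
      ultimately show ?thesis
        using vavg_component[OF F cw(1), of x i] vavg_component[OF F continuous_on_const, of 1 x i] by simp
    qed
    then show ?thesis by (simp add: vec_eq_iff)
  qed
  then have h: "hinv F = (\<lambda>x. (1 / (2 * sphere_circ_mass)) *\<^sub>R vavg (\<lambda>\<alpha>. 1 + cos \<alpha>) F x)"
    by (simp add: fun_eq_iff hinv_def)
  have w: "(\<integral>\<alpha>. 1 + cos \<alpha> \<partial>circ) = 2 * pi"
  proof -
    have "integrable circ (\<lambda>\<alpha>. cos \<alpha>)"
      by (rule integrable_circ_continuous) (intro continuous_on_cos continuous_on_id)
    then show ?thesis using integral_circ_cos[of 1] by simp
  qed
  have "Np p (hinv F) = (1 / (2 * sphere_circ_mass)) powr p * Np p (vavg (\<lambda>\<alpha>. 1 + cos \<alpha>) F)"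
    unfolding h using sphere_circ_mass_pos by (simp add: Np_scale)
  also have "\<dots> \<le> (1 / (2 * sphere_circ_mass)) powr p * (sphere_circ_mass powr p * Np p F)"
  proof (rule mult_left_mono)
    have "0 \<le> 1 + cos \<alpha>" for \<alpha> :: real using cos_ge_minus_one[of \<alpha>] by linarith
    then show "Np p (vavg (\<lambda>\<alpha>. 1 + cos \<alpha>) F) \<le> sphere_circ_mass powr p * Np p F"
      using Np_vavg[OF F p cw(1)] by (simp add: w sphere_circ_mass_def)
  qed simp
  also have "\<dots> = (1 / 2) powr p * Np p F" using sphere_circ_mass_pos by (simp add: powr_divide powr_mult)
  finally show ?thesis .
qed

lemma trig_sum: "(\<And>j. j \<in> J \<Longrightarrow> trig N (\<phi> j)) \<Longrightarrow> trig N (\<lambda>\<alpha>. \<Sum>j\<in>J. \<phi> j \<alpha>)"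
  by (induction J rule: infinite_finite_induct) (auto intro: trig_const trig_add)

lemma Np_hsign:
  assumes p: "1 < p" "p \<le> 2"
  shows "\<exists>K\<ge>0. \<forall>n G. (\<forall>k. vharm k (G k)) \<longrightarrow> Np p (hsign n (\<lambda>x. \<Sum>k\<le>n. G k x)) \<le> K * Np p (\<lambda>x. \<Sum>k\<le>n. G k x)"
proof -
  define K1 where "K1 = measure \<sigma> (sphere 0 1) powr p * (3 powr p * 3 * ((2 * pi) powr p * (2 / (p - 1))))"
  define K where "K = 2 powr p * ((2 / sphere_circ_mass) powr p * K1 + 1)"
  have K1: "K1 \<ge> 0" unfolding K1_def using p by simp
  then have K: "K \<ge> 0" unfolding K_def by simp
  have "Np p (hsign n F) \<le> K * Np p F" if G: "\<forall>k. vharm k (G k)" and F_def: "F = (\<lambda>x. \<Sum>k\<le>n. G k x)" for n G F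
  proof -
    have F: "vpoly F" unfolding F_def using vharm_vpoly G by (intro vpoly_sum) blast
    have tr: "trig n (\<lambda>\<alpha>. F (rot \<xi> \<alpha> x) $ i)" for \<xi> x i
    proof -
      have "trig n (\<lambda>\<alpha>. G k (rot \<xi> \<alpha> x) $ i)" if "k \<le> n" for k
      proof -
        have "hpoly k (\<lambda>x. G k x $ i)" using G by (auto simp: vharm_def intro: harmp_hpoly)
        then show ?thesis using that by (intro trig_mono[OF hpoly_rot_trig])
      qed
      then show ?thesis unfolding F_def sum_component by (intro trig_sum) auto
    qed
    have vG: "\<And>k. vharm k (G k)" using G by blast
    have cR: "continuous_on S (riesz n F)" "continuous_on S (hinv F)" for S
    proof -
      have "vpoly (\<lambda>x. \<Sum>k\<le>n. (1 / (2 * real k + 1)) *\<^sub>R G k x)"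
        by (intro vpoly_sum vpoly_scaleR vharm_vpoly[OF vG])
      then show "continuous_on S (hinv F)"
        unfolding F_def hinv_sum[OF vG, abs_def] by (rule vpoly_continuous)
      have s: "vpoly (spin_orbit (G k))" for k
        using vharm_vpoly[OF vG[of k]] by (auto simp: vpoly_def forall_3 spin_orbit_component)
      have "riesz n F = (\<lambda>x. \<Sum>k\<le>n. (sphere_circ_mass / (2 * real k + 1)) *\<^sub>R spin_orbit (G k) x)"
        unfolding F_def by (rule ext, subst riesz_sum) (auto simp: vharm_vpoly[OF vG] riesz_vharm[OF vG])
      then show "continuous_on S (riesz n F)"
        using s by (auto intro!: vpoly_continuous vpoly_sum vpoly_scaleR)
    qed
    have "Np p (hsign n F) \<le> 2 powr p * (Np p (\<lambda>x. (2 / sphere_circ_mass) *\<^sub>R riesz n F x) + Np p (hinv F))"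
      unfolding hsign_def[abs_def] using p cR
      by (intro Np_add continuous_on_scaleR continuous_on_const) auto
    also have "Np p (\<lambda>x. (2 / sphere_circ_mass) *\<^sub>R riesz n F x) = (2 / sphere_circ_mass) powr p * Np p (riesz n F)"
      using sphere_circ_mass_pos by (simp add: Np_scale)
    also have "2 powr p * ((2 / sphere_circ_mass) powr p * Np p (riesz n F) + Np p (hinv F))
       \<le> 2 powr p * ((2 / sphere_circ_mass) powr p * (K1 * Np p F) + Np p F)"
      using Np_riesz[OF F tr p] Np_hinv[OF F] p
      by (intro mult_left_mono add_mono) (auto simp: K1_def)
    also have "\<dots> = K * Np p F" by (simp add: K_def algebra_simps)
    finally show ?thesis .
  qed
  with K show ?thesis by blast
qed

text \<open>With \<open>R = hsign\<close> and \<open>H = hinv\<close> the eigenvalue relations read \<open>R = A - C - H B\<close> and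
  \<open>1 - R\<^sup>2 = (1 - H\<^sup>2) B\<close>, and \<open>H\<close> is a contraction with constant \<open>1/2\<close> on the range of \<open>B\<close>.\<close>

theorem eigenfield_projection_bound:
  assumes p: "1 < p" "p \<le> 2"
  shows "\<exists>K\<ge>0. \<forall>n A B C. (\<forall>k. vharm k (A k) \<and> vharm k (B k) \<and> vharm k (C k)) \<longrightarrow>
     (\<forall>k x. spin_orbit (A k) x = real k *\<^sub>R A k x) \<longrightarrow>
     (\<forall>k x. spin_orbit (B k) x = - B k x) \<longrightarrow>
     (\<forall>k x. spin_orbit (C k) x = - (real k + 1) *\<^sub>R C k x) \<longrightarrow>
     (\<forall>x. B 0 x = 0) \<longrightarrow>
     (let F = (\<lambda>x. \<Sum>k\<le>n. A k x + B k x + C k x) in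
       Np p (\<lambda>x. \<Sum>k\<le>n. A k x) \<le> K * Np p F \<and> Np p (\<lambda>x. \<Sum>k\<le>n. B k x) \<le> K * Np p F \<and>
       Np p (\<lambda>x. \<Sum>k\<le>n. C k x) \<le> K * Np p F)"
proof -
  obtain K2 where K2: "K2 \<ge> 0" and hs: "\<And>n G. (\<And>k. vharm k (G k)) \<Longrightarrow> Np p (hsign n (\<lambda>x. \<Sum>k\<le>n. G k x)) \<le> K2 * Np p (\<lambda>x. \<Sum>k\<le>n. G k x)"
    using Np_hsign[OF p] by blast
  \<comment> \<open>The outer 2 undoes the absorption of half of \<open>Np p SB\<close>; the powers
    of 2 come from two triangle inequalities, and K2^2 from applying \<open>hsign\<close>
    twice.\<close>
  define KB where "KB = 2 * (2 powr p * (2 powr p * (1 + K2 * K2)))"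
  define KA where "KA = 4 powr p * (1 + K2 + KB + KB)"
  have KB: "KB \<ge> 0" unfolding KB_def using K2 by simp
  have KA: "KA \<ge> 0" unfolding KA_def using K2 KB by simp
  have "Np p (\<lambda>x. \<Sum>k\<le>n. A k x) \<le> KA * Np p F \<and> Np p (\<lambda>x. \<Sum>k\<le>n. B k x) \<le> KB * Np p F \<and>
       Np p (\<lambda>x. \<Sum>k\<le>n. C k x) \<le> KA * Np p F"
    if vA: "\<And>k. vharm k (A k)" and vB: "\<And>k. vharm k (B k)" and vC: "\<And>k. vharm k (C k)"
      and sA: "\<And>k x. spin_orbit (A k) x = real k *\<^sub>R A k x" and sB: "\<And>k x. spin_orbit (B k) x = - B k x"
      and sC: "\<And>k x. spin_orbit (C k) x = - (real k + 1) *\<^sub>R C k x" and B0: "\<And>x. B 0 x = 0"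
      and F_def: "F = (\<lambda>x. \<Sum>k\<le>n. A k x + B k x + C k x)" for n A B C F
  proof -
    define d where "d k = 1 / (2 * real k + 1)" for k
    define SA where "SA x = (\<Sum>k\<le>n. A k x)" for x
    define SB where "SB x = (\<Sum>k\<le>n. B k x)" for x
    define SC where "SC x = (\<Sum>k\<le>n. C k x)" for x
    define HB where "HB x = (\<Sum>k\<le>n. d k *\<^sub>R B k x)" for x
    define HHB where "HHB x = (\<Sum>k\<le>n. (d k * d k) *\<^sub>R B k x)" for x
    define G where "G k x = A k x - d k *\<^sub>R B k x - C k x" for k x
    define RF where "RF x = (\<Sum>k\<le>n. G k x)" for x
    define RRF where "RRF x = (\<Sum>k\<le>n. A k x + (d k * d k) *\<^sub>R B k x + C k x)" for x
    note polys = vharm_vpoly[OF vA] vharm_vpoly[OF vB] vharm_vpoly[OF vC]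
    have vG: "vharm k (G k)" for k
      unfolding G_def[abs_def] by (intro vharm_diff vharm_scaleR vA vB vC)
    have vH: "vharm k (\<lambda>x. A k x + B k x + C k x)" for k
      by (intro vharm_add vA vB vC)
    have vp: "vpoly F" "vpoly SA" "vpoly SB" "vpoly SC" "vpoly HB" "vpoly HHB" "vpoly RF" "vpoly RRF"
      unfolding F_def SA_def[abs_def] SB_def[abs_def] SC_def[abs_def] HB_def[abs_def] HHB_def[abs_def] RF_def[abs_def] RRF_def[abs_def] G_def
      by (intro vpoly_sum vpoly_add vpoly_diff vpoly_scaleR polys)+
    note cont = vpoly_continuous[OF vp(1)] vpoly_continuous[OF vp(2)] vpoly_continuous[OF vp(3)] vpoly_continuous[OF vp(4)]
      vpoly_continuous[OF vp(5)] vpoly_continuous[OF vp(6)] vpoly_continuous[OF vp(7)] vpoly_continuous[OF vp(8)]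
    have sC': "spin_orbit (C k) x = - ((real k + 1) *\<^sub>R C k x)" for k x
      by (simp only: sC scaleR_minus_left)
    have RF: "hsign n F x = RF x" for x
    proof -
      have "spin_orbit (\<lambda>x. A k x + B k x + C k x) x = real k *\<^sub>R A k x - B k x - (real k + 1) *\<^sub>R C k x" for k
        by (simp add: spin_orbit_add polys vpoly_add sA sB sC')
      then have "hsign n F x = (\<Sum>k\<le>n. (1 / (2 * real k + 1)) *\<^sub>R
          (2 *\<^sub>R (real k *\<^sub>R A k x - B k x - (real k + 1) *\<^sub>R C k x) + (A k x + B k x + C k x)))"
        unfolding F_def by (subst hsign_sum[OF vH]) simp
      also have "\<dots> = RF x"
        unfolding RF_def G_def
      proof (intro sum.cong refl)
        fix k
        have "2 *\<^sub>R (real k *\<^sub>R A k x - B k x - (real k + 1) *\<^sub>R C k x) + (A k x + B k x + C k x)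
          = (2 * real k + 1) *\<^sub>R A k x - B k x - (2 * real k + 1) *\<^sub>R C k x"
          by (simp add: vec_eq_iff algebra_simps)
        then have e: "(1 / (2 * real k + 1)) *\<^sub>R (2 *\<^sub>R (real k *\<^sub>R A k x - B k x - (real k + 1) *\<^sub>R C k x) + (A k x + B k x + C k x))
          = (1 / (2 * real k + 1)) *\<^sub>R ((2 * real k + 1) *\<^sub>R A k x - B k x - (2 * real k + 1) *\<^sub>R C k x)" by (simp only:)
        show "(1 / (2 * real k + 1)) *\<^sub>R (2 *\<^sub>R (real k *\<^sub>R A k x - B k x - (real k + 1) *\<^sub>R C k x) + (A k x + B k x + C k x))
          = A k x - d k *\<^sub>R B k x - C k x"
          unfolding e by (simp add: scaleR_diff_right d_def)
      qed
      finally show ?thesis .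
    qed
    have RRF: "hsign n RF x = RRF x" for x
    proof -
      have "spin_orbit (G k) x = real k *\<^sub>R A k x + d k *\<^sub>R B k x + (real k + 1) *\<^sub>R C k x" for k
        unfolding G_def[abs_def]
        by (simp add: spin_orbit_diff spin_orbit_scaleR polys vpoly_diff vpoly_scaleR sA sB sC')
      then have "hsign n RF x = (\<Sum>k\<le>n. (1 / (2 * real k + 1)) *\<^sub>R
          (2 *\<^sub>R (real k *\<^sub>R A k x + d k *\<^sub>R B k x + (real k + 1) *\<^sub>R C k x) + G k x))"
        unfolding RF_def[abs_def] by (subst hsign_sum[OF vG]) simp
      also have "\<dots> = RRF x"
        unfolding RRF_def
      proof (intro sum.cong refl)
        fix k
        have "2 *\<^sub>R (real k *\<^sub>R A k x + d k *\<^sub>R B k x + (real k + 1) *\<^sub>R C k x) + G k x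
          = (2 * real k + 1) *\<^sub>R A k x + d k *\<^sub>R B k x + (2 * real k + 1) *\<^sub>R C k x"
          by (simp add: G_def vec_eq_iff algebra_simps)
        then have e: "(1 / (2 * real k + 1)) *\<^sub>R (2 *\<^sub>R (real k *\<^sub>R A k x + d k *\<^sub>R B k x + (real k + 1) *\<^sub>R C k x) + G k x)
          = (1 / (2 * real k + 1)) *\<^sub>R ((2 * real k + 1) *\<^sub>R A k x + d k *\<^sub>R B k x + (2 * real k + 1) *\<^sub>R C k x)" by (simp only:)
        show "(1 / (2 * real k + 1)) *\<^sub>R (2 *\<^sub>R (real k *\<^sub>R A k x + d k *\<^sub>R B k x + (real k + 1) *\<^sub>R C k x) + G k x)
          = A k x + (d k * d k) *\<^sub>R B k x + C k x"
          unfolding e by (simp add: scaleR_add_right d_def)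
      qed
      finally show ?thesis .
    qed
    have vHB: "vharm k (\<lambda>x. d k *\<^sub>R B k x)" for k by (intro vharm_scaleR vB)
    have HB: "hinv SB = HB" unfolding SB_def[abs_def] HB_def[abs_def] d_def using hinv_sum[OF vB] by auto
    have HHB: "hinv HB = HHB"
      unfolding HB_def[abs_def] HHB_def[abs_def] using hinv_sum[OF vHB] by (auto simp: d_def)
    have "Np p HB \<le> (1 / 2) powr p * Np p SB"
      using Np_hinv_mean_zero[OF vB B0, of p n] p HB by (simp add: SB_def[abs_def])
    moreover have "Np p HHB \<le> (1 / 2) powr p * Np p HB"
      using Np_hinv_mean_zero[OF vHB, of p n] p HHB B0 by (simp add: HB_def[abs_def])
    ultimately have nHHB: "Np p HHB \<le> (1 / 2) powr p * ((1 / 2) powr p * Np p SB)"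
      by (meson mult_left_mono order_trans powr_ge_zero)
    have nHB: "Np p HB \<le> Np p SB" using Np_hinv[OF vp(3), of p] p HB by simp
    have nRF: "Np p RF \<le> K2 * Np p F"
    proof -
      have "hsign n F = RF" by (rule ext) (rule RF)
      then show ?thesis using hs[OF vH, of n] by (simp add: F_def[symmetric])
    qed
    have "Np p RRF \<le> K2 * Np p RF"
    proof -
      have "hsign n RF = RRF" by (rule ext) (rule RRF)
      then show ?thesis using hs[OF vG, of n] by (simp add: RF_def[abs_def])
    qed
    also have "\<dots> \<le> K2 * (K2 * Np p F)" using nRF K2 by (rule mult_left_mono)
    finally have nRRF: "Np p RRF \<le> K2 * (K2 * Np p F)" .
    have neg: "Np p (\<lambda>x. - f x) = Np p f" for f :: "vec3 \<Rightarrow> vec3" by (simp add: Np_def)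
    have eB: "SB = (\<lambda>x. (F x + - RRF x) + HHB x)"
      by (simp add: fun_eq_iff SB_def F_def RRF_def HHB_def sum.distrib)
    have "Np p SB \<le> 2 powr p * (Np p (\<lambda>x. F x + - RRF x) + Np p HHB)"
      by (subst eB, rule Np_add) (use p in \<open>auto intro!: continuous_on_add continuous_on_minus continuous_on_diff cont\<close>)
    also have "\<dots> \<le> 2 powr p * (2 powr p * (Np p F + K2 * (K2 * Np p F)) + (1 / 2) powr p * ((1 / 2) powr p * Np p SB))"
    proof (intro mult_left_mono add_mono nHHB)
      have "Np p (\<lambda>x. F x + - RRF x) \<le> 2 powr p * (Np p F + Np p (\<lambda>x. - RRF x))"
        by (rule Np_add) (use p in \<open>auto intro!: continuous_on_minus continuous_on_diff cont\<close>)
      also have "\<dots> \<le> 2 powr p * (Np p F + K2 * (K2 * Np p F))"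
        unfolding neg using nRRF by (intro mult_left_mono add_left_mono) auto
      finally show "Np p (\<lambda>x. F x + - RRF x) \<le> 2 powr p * (Np p F + K2 * (K2 * Np p F))" .
    qed simp
    \<comment> \<open>Of the two factors (1/2)^p gained from two applications of
      \<open>hinv\<close>, one cancels the 2^p of the triangle inequality and the other is at most
      1/2, so that the term in \<open>SB\<close> can be absorbed on the left.\<close>
    also have "\<dots> = 2 powr p * (2 powr p * (1 + K2 * K2)) * Np p F + (2 powr p * (1 / 2) powr p) * ((1 / 2) powr p * Np p SB)"
      by (simp add: algebra_simps)
    also have "2 powr p * (1 / 2) powr p = 1" by (simp add: powr_divide)
    also have "1 * ((1 / 2) powr p * Np p SB) \<le> 1 / 2 * Np p SB"
    proof -
      have "(1 / 2) powr p \<le> (1 / 2 :: real)" using powr_mono'[of 1 p "1 / 2 :: real"] p by simp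
      from mult_right_mono[OF this Np_nonneg[of p SB]] show ?thesis by (simp only: mult_1_left)
    qed
    finally have nB: "Np p SB \<le> KB * Np p F" by (simp add: KB_def)
    have four: "Np p (\<lambda>x. (1 / 2) *\<^sub>R ((a x + b x) + (c x + e x))) \<le> 4 powr p * (Np p a + Np p b + Np p c + Np p e)"
      if "continuous_on (sphere 0 1) a" "continuous_on (sphere 0 1) b" "continuous_on (sphere 0 1) c" "continuous_on (sphere 0 1) e"
      for a b c e :: "vec3 \<Rightarrow> vec3"
    proof -
      have "Np p (\<lambda>x. (1 / 2) *\<^sub>R ((a x + b x) + (c x + e x))) = (1 / 2) powr p * Np p (\<lambda>x. (a x + b x) + (c x + e x))"
        unfolding Np_scale by simp
      also have "\<dots> \<le> 1 * Np p (\<lambda>x. (a x + b x) + (c x + e x))"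
        using p Np_nonneg by (intro mult_right_mono powr_le1) auto
      also have "\<dots> \<le> 2 powr p * (Np p (\<lambda>x. a x + b x) + Np p (\<lambda>x. c x + e x))"
        using Np_add[of "\<lambda>x. a x + b x" "\<lambda>x. c x + e x" p] that p by (auto intro!: continuous_on_add)
      also have "\<dots> \<le> 2 powr p * (2 powr p * (Np p a + Np p b) + 2 powr p * (Np p c + Np p e))"
        using that p by (intro mult_left_mono add_mono Np_add) auto
      also have "\<dots> = (2 powr p * 2 powr p) * (Np p a + Np p b + Np p c + Np p e)" by (simp add: algebra_simps)
      also have "2 powr p * 2 powr p = (4 :: real) powr p" by (simp add: powr_mult[symmetric])
      finally show ?thesis .
    qed
    \<comment> \<open>From F = A + B + C and R F = A - C - H B one gets F + R F - B + H B = 2 A, and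
      similarly F - R F - B - H B = 2 C for \<open>eC\<close>.\<close>
    have eA: "SA = (\<lambda>x. (1 / 2) *\<^sub>R ((F x + RF x) + (- SB x + HB x)))"
    proof
      fix x
      have "(F x + RF x) + (- SB x + HB x) = (\<Sum>k\<le>n. 2 *\<^sub>R A k x)"
        unfolding F_def RF_def SB_def HB_def G_def sum.distrib[symmetric] sum_negf[symmetric]
        by (intro sum.cong refl) (simp add: scaleR_2)
      then show "SA x = (1 / 2) *\<^sub>R ((F x + RF x) + (- SB x + HB x))"
        by (simp add: SA_def scaleR_sum_right[symmetric])
    qed
    have eC: "SC = (\<lambda>x. (1 / 2) *\<^sub>R ((F x + - RF x) + (- SB x + - HB x)))"
    proof
      fix x
      have "(F x + - RF x) + (- SB x + - HB x) = (\<Sum>k\<le>n. 2 *\<^sub>R C k x)"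
        unfolding F_def RF_def SB_def HB_def G_def sum.distrib[symmetric] sum_negf[symmetric]
        by (intro sum.cong refl) (simp add: scaleR_2)
      then show "SC x = (1 / 2) *\<^sub>R ((F x + - RF x) + (- SB x + - HB x))"
        by (simp add: SC_def scaleR_sum_right[symmetric])
    qed
    have tot: "4 powr p * (Np p F + Np p RF + Np p SB + Np p HB) \<le> KA * Np p F"
    proof -
      have "Np p F + Np p RF + Np p SB + Np p HB \<le> (1 + K2 + KB + KB) * Np p F"
        using nRF nB nHB by (simp add: algebra_simps)
      then have "4 powr p * (Np p F + Np p RF + Np p SB + Np p HB) \<le> 4 powr p * ((1 + K2 + KB + KB) * Np p F)"
        by (rule mult_left_mono) simp
      then show ?thesis by (simp add: KA_def mult.assoc)
    qed
    have "Np p SA \<le> 4 powr p * (Np p F + Np p RF + Np p (\<lambda>x. - SB x) + Np p HB)"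
      by (subst eA, rule four) (auto intro!: continuous_on_minus continuous_on_diff cont)
    then have nA: "Np p SA \<le> KA * Np p F" using tot neg[of SB] by simp
    have "Np p SC \<le> 4 powr p * (Np p F + Np p (\<lambda>x. - RF x) + Np p (\<lambda>x. - SB x) + Np p (\<lambda>x. - HB x))"
      by (subst eC, rule four) (auto intro!: continuous_on_minus continuous_on_diff cont)
    then have nC: "Np p SC \<le> KA * Np p F" using tot neg[of SB] neg[of RF] neg[of HB] by simp
    show ?thesis using nA nB nC by (simp add: SA_def[abs_def] SB_def[abs_def] SC_def[abs_def])
  qed
  note main = this
  show ?thesis
  proof (intro exI[of _ "KA + KB"] conjI allI impI)
    show "0 \<le> KA + KB" using KA KB by simp
    fix n :: nat and A B C :: "nat \<Rightarrow> vec3 \<Rightarrow> vec3"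
    assume h: "\<forall>k. vharm k (A k) \<and> vharm k (B k) \<and> vharm k (C k)" "\<forall>k x. spin_orbit (A k) x = real k *\<^sub>R A k x"
      "\<forall>k x. spin_orbit (B k) x = - B k x" "\<forall>k x. spin_orbit (C k) x = - (real k + 1) *\<^sub>R C k x" "\<forall>x. B 0 x = 0"
    define F where "F = (\<lambda>x. \<Sum>k\<le>n. A k x + B k x + C k x)"
    have m: "Np p (\<lambda>x. \<Sum>k\<le>n. A k x) \<le> KA * Np p F \<and> Np p (\<lambda>x. \<Sum>k\<le>n. B k x) \<le> KB * Np p F \<and>
       Np p (\<lambda>x. \<Sum>k\<le>n. C k x) \<le> KA * Np p F"
      by (rule main[OF _ _ _ _ _ _ _ F_def]) (use h in auto)
    have le: "KA * Np p F \<le> (KA + KB) * Np p F" "KB * Np p F \<le> (KA + KB) * Np p F"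
      using KA KB Np_nonneg[of p F] by (auto intro: mult_right_mono)
    show "let F = (\<lambda>x. \<Sum>k\<le>n. A k x + B k x + C k x) in
       Np p (\<lambda>x. \<Sum>k\<le>n. A k x) \<le> (KA + KB) * Np p F \<and> Np p (\<lambda>x. \<Sum>k\<le>n. B k x) \<le> (KA + KB) * Np p F \<and>
       Np p (\<lambda>x. \<Sum>k\<le>n. C k x) \<le> (KA + KB) * Np p F"
      unfolding Let_def F_def[symmetric] using m le by linarith
  qed
qed

section \<open>Vector spherical harmonics\<close>

definition grad :: "(vec3 \<Rightarrow> real) \<Rightarrow> vec3 \<Rightarrow> vec3" where
  "grad P x = (\<chi> i. pd i P x)"

definition Lvec :: "(vec3 \<Rightarrow> real) \<Rightarrow> vec3 \<Rightarrow> vec3" where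
  "Lvec P x = (\<chi> i. Lop i P x)"

text \<open>The gradient of the Kelvin transform \<open>|x|^(-2 l - 1) P\<close> of a harmonic polynomial, multiplied by
  \<open>- |x|^(2 l + 3)\<close>.\<close>

definition kgrad :: "nat \<Rightarrow> (vec3 \<Rightarrow> real) \<Rightarrow> vec3 \<Rightarrow> vec3" where
  "kgrad l P x = (2 * real l + 1) *\<^sub>R (P x *\<^sub>R x) - sqn x *\<^sub>R grad P x"

lemma lap_cmult: "rpf f \<Longrightarrow> lap (\<lambda>x. c * f x) = (\<lambda>x. c * lap f x)"
  by (simp add: lap_def algebra_simps)

lemma pd_cmult: "rpf f \<Longrightarrow> pd i (\<lambda>x. c * f x) = (\<lambda>x. c * pd i f x)"
  by simp

lemma pd_sqn: "pd i sqn = (\<lambda>x. 2 * x $ i)"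
  unfolding sqn_def[abs_def] using exhaust_3[of i] by (auto simp: fun_eq_iff)

lemma lap_sqn_mult:
  assumes "hpoly n g"
  shows "lap (\<lambda>x. sqn x * g x) x = (6 + 4 * real n) * g x + sqn x * lap g x"
proof -
  have g: "rpf g" using assms by (rule hpoly_rpf)
  have "lap (\<lambda>x. sqn x * g x) x = 6 * g x + 4 * (x$1 * pd 1 g x + x$2 * pd 2 g x + x$3 * pd 3 g x) + sqn x * lap g x"
    using g by (simp add: lap_def pd_sqn algebra_simps)
  then show ?thesis unfolding hpoly_pd_euler1[OF assms] by (simp add: algebra_simps)
qed

lemma vharm_grad: "harmp (Suc k) P \<Longrightarrow> vharm k (grad P)"
  using harmp_pd[of "Suc k" P] by (simp add: vharm_def grad_def)

lemma vharm_Lvec: "harmp k P \<Longrightarrow> vharm k (Lvec P)"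
  by (simp add: vharm_def Lvec_def harmp_Lop)

text \<open>The Laplacians of (2 l + 1) x_i P and of |x|^2 times the i-th derivative of P are both
  (4 l + 2) times that derivative, and cancel.\<close>

lemma vharm_kgrad:
  assumes P: "harmp l P" shows "vharm (Suc l) (kgrad l P)"
  unfolding vharm_def
proof
  fix i
  have rP: "rpf P" using P by (rule harmp_rpf)
  have hP: "hpoly l P" using P by (rule harmp_hpoly)
  have h1: "hpoly (Suc l) (\<lambda>x. sqn x * pd i P x)"
  proof (cases l)
    case 0
    with hP have "pd i P = (\<lambda>x. 0)" by (simp add: hpoly_0_pd)
    then show ?thesis by (simp add: hpoly_zero)
  next
    case (Suc n)
    then have "2 + (l - 1) = Suc l" by simp
    with hpoly_mult[OF hpoly_sqn hpoly_pd[OF hP, of i]] show ?thesis by metis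
  qed
  have h: "hpoly (Suc l) (\<lambda>x. (2 * real l + 1) * (x $ i * P x) - sqn x * pd i P x)"
    using h1 hP by (intro hpoly_diff hpoly_cmult hpoly_coord_mult)
  have l2: "lap (\<lambda>x. sqn x * pd i P x) x = (4 * real l + 2) * pd i P x" for x
  proof (cases l)
    case 0
    with hP have "pd i P = (\<lambda>x. 0)" by (simp add: hpoly_0_pd)
    then show ?thesis by (simp add: lap_def)
  next
    case (Suc n)
    have "lap (pd i P) x = 0" using harmp_pd[OF P, of i] by (simp add: harmp_def)
    then show ?thesis using lap_sqn_mult[OF hpoly_pd[OF hP, of i], of x] Suc by (simp add: algebra_simps)
  qed
  have "lap (\<lambda>x. (2 * real l + 1) * (x $ i * P x) - sqn x * pd i P x) x = 0" for x
  proof -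
    have "lap P x = 0" using P by (simp add: harmp_def)
    then have "lap (\<lambda>x. (2 * real l + 1) * (x $ i * P x)) x = (2 * real l + 1) * (2 * pd i P x)"
      using rP by (subst lap_cmult) (simp_all add: lap_coord_mult)
    then show ?thesis using rP l2[of x] by (simp add: lap_diff algebra_simps)
  qed
  with h have "harmp (Suc l) (\<lambda>x. (2 * real l + 1) * (x $ i * P x) - sqn x * pd i P x)"
    by (simp add: harmp_def)
  moreover have "(\<lambda>x. kgrad l P x $ i) = (\<lambda>x. (2 * real l + 1) * (x $ i * P x) - sqn x * pd i P x)"
    by (simp add: kgrad_def grad_def fun_eq_iff mult_ac)
  ultimately show "harmp (Suc l) (\<lambda>x. kgrad l P x $ i)" by simp
qed

lemma Lop_commute:
  assumes "rpf f"
  shows "Lop 1 (Lop 2 f) x = Lop 2 (Lop 1 f) x - Lop 3 f x"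
    and "Lop 2 (Lop 3 f) x = Lop 3 (Lop 2 f) x - Lop 1 f x"
    and "Lop 3 (Lop 1 f) x = Lop 1 (Lop 3 f) x - Lop 2 f x"
proof -
  have c: "pd 2 (pd 1 f) = pd 1 (pd 2 f)" "pd 3 (pd 1 f) = pd 1 (pd 3 f)" "pd 3 (pd 2 f) = pd 2 (pd 3 f)"
    by (rule pd_commute[OF assms])+
  show "Lop 1 (Lop 2 f) x = Lop 2 (Lop 1 f) x - Lop 3 f x"
    "Lop 2 (Lop 3 f) x = Lop 3 (Lop 2 f) x - Lop 1 f x"
    "Lop 3 (Lop 1 f) x = Lop 1 (Lop 3 f) x - Lop 2 f x"
    using assms by (simp_all add: Lop_pd c algebra_simps)
qed

text \<open>By symmetry of the Hessian, T applied to grad P is the Euler derivative of grad P minus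
  x times the Laplacian of P.\<close>

lemma spin_orbit_grad:
  assumes P: "harmp (Suc k) P"
  shows "spin_orbit (grad P) x = real k *\<^sub>R grad P x"
proof -
  have rP: "rpf P" using P by (rule harmp_rpf)
  have c: "pd 2 (pd 1 P) = pd 1 (pd 2 P)" "pd 3 (pd 1 P) = pd 1 (pd 3 P)" "pd 3 (pd 2 P) = pd 2 (pd 3 P)"
    by (rule pd_commute[OF rP])+
  have l: "pd 1 (pd 1 P) x = - pd 2 (pd 2 P) x - pd 3 (pd 3 P) x"
    using P by (simp add: harmp_def lap_def) (smt (verit))
  have l1: "pd 1 (pd 1 P) x = - pd 2 (pd 2 P) x - pd 3 (pd 3 P) x" by (rule l)
  have e: "x$1 * pd 1 (pd j P) x + x$2 * pd 2 (pd j P) x + x$3 * pd 3 (pd j P) x = real k * pd j P x" for j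
    using hpoly_pd_euler2[OF harmp_hpoly[OF P], of x j] by simp
  have "spin_orbit (grad P) x $ i = (real k *\<^sub>R grad P x) $ i" for i
  proof -
    consider "i = 1" | "i = 2" | "i = 3" using exhaust_3 by blast
    then show ?thesis
    proof cases
      case 1
      have "spin_orbit (grad P) x $ 1 = x$1 * (- pd 2 (pd 2 P) x - pd 3 (pd 3 P) x) + x$2 * pd 2 (pd 1 P) x + x$3 * pd 3 (pd 1 P) x"
        using rP by (simp add: spin_orbit_component grad_def Lop_pd c algebra_simps)
      then show ?thesis using 1 e[of 1] l by (simp add: grad_def)
    next
      case 2
      have "spin_orbit (grad P) x $ 2 = x$1 * pd 1 (pd 2 P) x + x$2 * (- pd 1 (pd 1 P) x - pd 3 (pd 3 P) x) + x$3 * pd 3 (pd 2 P) x"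
        using rP by (simp add: spin_orbit_component grad_def Lop_pd c algebra_simps)
      then show ?thesis using 2 e[of 2] l by (simp add: grad_def)
    next
      case 3
      have "spin_orbit (grad P) x $ 3 = x$1 * pd 1 (pd 3 P) x + x$2 * pd 2 (pd 3 P) x + x$3 * (- pd 1 (pd 1 P) x - pd 2 (pd 2 P) x)"
        using rP by (simp add: spin_orbit_component grad_def Lop_pd c algebra_simps)
      then show ?thesis using 3 e[of 3] l by (simp add: grad_def)
    qed
  qed
  then show ?thesis by (simp add: vec_eq_iff)
qed

text \<open>The commutation relations of the angular momentum components, read as L \<times> L = -
  L.\<close>

lemma spin_orbit_Lvec: "rpf P \<Longrightarrow> spin_orbit (Lvec P) x = - Lvec P x"
  by (simp add: vec_eq_iff forall_3 spin_orbit_component Lvec_def Lop_commute)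

lemma Lop_coord: "Lop a (\<lambda>x. x $ i) = (\<lambda>x. cross3 (axis a 1) x $ i)"
  using exhaust_3[of a] exhaust_3[of i] by (auto simp: Lop_pd cross_components axis_def fun_eq_iff)

lemma spin_orbit_sqn_mult:
  assumes "vpoly F"
  shows "spin_orbit (\<lambda>x. sqn x *\<^sub>R F x) x = sqn x *\<^sub>R spin_orbit F x"
  using assms by (simp add: vec_eq_iff forall_3 spin_orbit_component vpoly_def Lop_mult Lop_sqn algebra_simps)

lemma vpoly_coord_mult: "rpf P \<Longrightarrow> vpoly (\<lambda>x. P x *\<^sub>R x)"
  by (simp add: vpoly_def)

lemma vpoly_grad: "rpf P \<Longrightarrow> vpoly (grad P)"
  by (simp add: vpoly_def grad_def)

lemma vpoly_sqn_mult: "vpoly F \<Longrightarrow> vpoly (\<lambda>x. sqn x *\<^sub>R F x)"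
  by (simp add: vpoly_def)

lemma spin_orbit_radial:
  assumes "hpoly l P"
  shows "spin_orbit (\<lambda>x. P x *\<^sub>R x) x = sqn x *\<^sub>R grad P x - (real l + 2) *\<^sub>R (P x *\<^sub>R x)"
proof -
  have rP: "rpf P" using assms by (rule hpoly_rpf)
  have e: "real l * P x = x$1 * pd 1 P x + x$2 * pd 2 P x + x$3 * pd 3 P x"
    using hpoly_pd_euler1[OF assms, of x] by simp
  have s: "spin_orbit (\<lambda>x. P x *\<^sub>R x) x $ i = sqn x * pd i P x - (real l * P x) * x $ i - 2 * P x * x $ i" for i
    using exhaust_3[of i] rP unfolding e
    by (auto simp: spin_orbit_component Lop_mult Lop_coord Lop_pd sqn_def cross_components axis_def algebra_simps)
  show ?thesis by (simp add: vec_eq_iff s grad_def algebra_simps)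
qed

text \<open>T maps P x to a combination of P x and |x|^2 grad P, and multiplies the latter field by
  l - 1; the coefficients of \<open>kgrad\<close> are those of the other eigenvector of this
  triangular system.\<close>

lemma spin_orbit_kgrad:
  assumes P: "harmp l P"
  shows "spin_orbit (kgrad l P) x = - (real (Suc l) + 1) *\<^sub>R kgrad l P x"
proof -
  have rP: "rpf P" using P by (rule harmp_rpf)
  have g: "spin_orbit (grad P) x = (real l - 1) *\<^sub>R grad P x"
  proof (cases l)
    case 0
    with P have "\<And>i. pd i P = (\<lambda>x. 0)" by (simp add: harmp_def hpoly_0_pd)
    then have "grad P = (\<lambda>x. 0)" by (simp add: grad_def fun_eq_iff vec_eq_iff)
    then show ?thesis by (simp add: vec_eq_iff forall_3 spin_orbit_component Lop_const)
  next
    case (Suc n)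
    then show ?thesis using spin_orbit_grad[of n P x] P by simp
  qed
  have "spin_orbit (kgrad l P) x = (2 * real l + 1) *\<^sub>R (sqn x *\<^sub>R grad P x - (real l + 2) *\<^sub>R (P x *\<^sub>R x)) - sqn x *\<^sub>R ((real l - 1) *\<^sub>R grad P x)"
    unfolding kgrad_def[abs_def]
    by (simp add: spin_orbit_diff spin_orbit_scaleR spin_orbit_sqn_mult vpoly_coord_mult vpoly_grad vpoly_sqn_mult
        vpoly_scaleR rP spin_orbit_radial[OF harmp_hpoly[OF P]] g del: scaleR_scaleR)
  also have "\<dots> = - (real (Suc l) + 1) *\<^sub>R kgrad l P x"
    by (simp add: kgrad_def vec_eq_iff algebra_simps)
  finally show ?thesis .
qed

section \<open>The quadratic equation of the spin-orbit operator and its eigenfields\<close>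

definition Ldiv :: "(vec3 \<Rightarrow> vec3) \<Rightarrow> vec3 \<Rightarrow> real" where
  "Ldiv F x = Lop 1 (\<lambda>x. F x $ 1) x + Lop 2 (\<lambda>x. F x $ 2) x + Lop 3 (\<lambda>x. F x $ 3) x"

text \<open>The double cross product rule corrected by the commutation relations. On harmonic fields
  of degree \<open>k\<close> with vanishing \<open>Ldiv\<close> it reads T^2 + T = k (k + 1), with
  the roots k and - (k + 1).\<close>

lemma spin_orbit_square:
  assumes "vpoly F"
  shows "spin_orbit (spin_orbit F) x = - spin_orbit F x + Lvec (Ldiv F) x - (\<chi> i. Cas (\<lambda>x. F x $ i) x)"
proof -
  have r: "rpf (\<lambda>x. F x $ i)" for i using assms by (simp add: vpoly_def)
  show ?thesis
    by (simp add: vec_eq_iff forall_3 spin_orbit_component Lvec_def Ldiv_def[abs_def] Cas_def Lop_diff Lop_add r Lop_commute)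
qed

lemma vharm_spin_orbit: "vharm k F \<Longrightarrow> vharm k (spin_orbit F)"
  by (simp add: vharm_def forall_3 spin_orbit_component harmp_diff harmp_Lop)

lemma harmp_Ldiv: "vharm k F \<Longrightarrow> harmp k (Ldiv F)"
  unfolding Ldiv_def[abs_def] by (intro harmp_add harmp_Lop) (auto simp: vharm_def)

lemma Ldiv_diff: "vpoly F \<Longrightarrow> vpoly G \<Longrightarrow> Ldiv (\<lambda>x. F x - G x) x = Ldiv F x - Ldiv G x"
  by (simp add: Ldiv_def vpoly_def Lop_diff)

lemma Ldiv_Lvec: "Ldiv (Lvec P) x = Cas P x"
  by (simp add: Ldiv_def Lvec_def Cas_def)

definition divg :: "(vec3 \<Rightarrow> vec3) \<Rightarrow> vec3 \<Rightarrow> real" where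
  "divg F x = pd 1 (\<lambda>x. F x $ 1) x + pd 2 (\<lambda>x. F x $ 2) x + pd 3 (\<lambda>x. F x $ 3) x"

lemma spin_orbit_alt:
  assumes "vpoly F"
  shows "spin_orbit F x $ i = x$1 * pd i (\<lambda>x. F x $ 1) x + x$2 * pd i (\<lambda>x. F x $ 2) x + x$3 * pd i (\<lambda>x. F x $ 3) x - x$i * divg F x"
  using exhaust_3[of i] assms
  by (auto simp: spin_orbit_component vpoly_def Lop_pd divg_def algebra_simps)

definition radial :: "(vec3 \<Rightarrow> vec3) \<Rightarrow> vec3 \<Rightarrow> real" where
  "radial F x = x$1 * F x $ 1 + x$2 * F x $ 2 + x$3 * F x $ 3"

text \<open>Product rule and \<open>spin_orbit_alt\<close>: T measures how far the gradient of x . F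
  is from F + x div F.\<close>

lemma pd_radial:
  assumes "vpoly F"
  shows "pd i (radial F) x = F x $ i + (spin_orbit F x $ i + x$i * divg F x)"
  using exhaust_3[of i] assms unfolding radial_def[abs_def] spin_orbit_alt[OF assms]
  by (auto simp: vpoly_def algebra_simps)

lemma radial_spin_orbit:
  assumes F: "vharm k F"
  shows "radial (spin_orbit F) x = real k * radial F x - sqn x * divg F x"
proof -
  have v: "vpoly F" using F by (rule vharm_vpoly)
  have e: "x$1 * pd 1 (\<lambda>x. F x $ i) x + x$2 * pd 2 (\<lambda>x. F x $ i) x + x$3 * pd 3 (\<lambda>x. F x $ i) x = real k * F x $ i" for i
    using F by (intro hpoly_pd_euler1) (auto simp: vharm_def harmp_def)
  have "radial (spin_orbit F) x =
      x$1 * (x$1 * pd 1 (\<lambda>x. F x $ 1) x + x$2 * pd 2 (\<lambda>x. F x $ 1) x + x$3 * pd 3 (\<lambda>x. F x $ 1) x)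
    + x$2 * (x$1 * pd 1 (\<lambda>x. F x $ 2) x + x$2 * pd 2 (\<lambda>x. F x $ 2) x + x$3 * pd 3 (\<lambda>x. F x $ 2) x)
    + x$3 * (x$1 * pd 1 (\<lambda>x. F x $ 3) x + x$2 * pd 2 (\<lambda>x. F x $ 3) x + x$3 * pd 3 (\<lambda>x. F x $ 3) x)
    - sqn x * divg F x"
    unfolding radial_def spin_orbit_alt[OF v] by (simp add: sqn_def algebra_simps)
  then show ?thesis unfolding e by (simp add: radial_def algebra_simps)
qed

lemma hpoly_zero_of_sqn:
  assumes "hpoly n f" "\<And>x. sqn x * f x = 0"
  shows "f x = 0"
proof (cases "x = 0")
  case True
  have "f (0 *\<^sub>R axis 1 1) = 0 ^ n * f (axis 1 1)" by (rule hpoly_scale[OF assms(1)])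
  moreover have "f (axis 1 1) = 0" using assms(2)[of "axis 1 1"] by (simp add: sqn_eq)
  ultimately show ?thesis using True by simp
qed (use assms(2)[of x] in \<open>auto simp: sqn_eq\<close>)

lemma hpoly_divg: "vharm k F \<Longrightarrow> hpoly (k - 1) (divg F)"
  unfolding divg_def[abs_def] by (intro hpoly_add hpoly_pd) (auto simp: vharm_def harmp_def)

lemma harmp_divg: "vharm k F \<Longrightarrow> harmp (k - 1) (divg F)"
  unfolding divg_def[abs_def] by (intro harmp_add harmp_pd) (auto simp: vharm_def)

text \<open>The eigenvalue \<open>k\<close> forces |x|^2 div F = 0 in
  \<open>radial_spin_orbit\<close>; then \<open>pd_radial\<close> says that the gradient of x . F is
  (k + 1) F, which exhibits the potential.\<close>

lemma spin_orbit_eigen_grad: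
  assumes F: "vharm k F" and T: "\<And>x. spin_orbit F x = real k *\<^sub>R F x"
  shows "\<exists>P. harmp (Suc k) P \<and> F = grad P"
proof -
  have v: "vpoly F" using F by (rule vharm_vpoly)
  have r: "rpf (\<lambda>x. F x $ i)" for i using v by (simp add: vpoly_def)
  have "radial (spin_orbit F) x = real k * radial F x" for x
    by (simp add: radial_def T algebra_simps)
  then have "sqn x * divg F x = 0" for x using radial_spin_orbit[OF F, of x] by simp
  then have d: "divg F x = 0" for x by (rule hpoly_zero_of_sqn[OF hpoly_divg[OF F]])
  define P where "P x = 1 / (real k + 1) * radial F x" for x
  have rr: "rpf (radial F)" unfolding radial_def[abs_def] using r by simp
  have pP: "pd i P = (\<lambda>x. F x $ i)" for i
  proof
    fix x
    have "pd i P x = 1 / (real k + 1) * pd i (radial F) x"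
      unfolding P_def[abs_def] by (rule fun_cong[OF pd_cmult[OF rr]])
    also have "pd i (radial F) x = (real k + 1) * F x $ i"
      unfolding pd_radial[OF v] T d by (simp add: algebra_simps)
    finally show "pd i P x = F x $ i" by simp
  qed
  have "hpoly (Suc k) (radial F)"
    unfolding radial_def[abs_def] using F by (intro hpoly_add hpoly_coord_mult) (auto simp: vharm_def harmp_def)
  then have "hpoly (Suc k) P" unfolding P_def[abs_def] by (rule hpoly_cmult)
  moreover have "lap P x = 0" for x
    using d[of x] by (simp add: lap_def pP divg_def)
  ultimately have "harmp (Suc k) P" by (simp add: harmp_def)
  moreover have "F = grad P" by (simp add: fun_eq_iff grad_def vec_eq_iff pP)
  ultimately show ?thesis by blast
qed

text \<open>For this eigenvalue \<open>radial_spin_orbit\<close> gives (2 l + 3) x . F = |x|^2 div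
  F. Differentiating it and comparing with \<open>pd_radial\<close> expresses F through div F alone,
  so that the generating polynomial is a multiple of the divergence.\<close>

lemma spin_orbit_eigen_kgrad:
  assumes F: "vharm (Suc l) F" and T: "\<And>x. spin_orbit F x = - (real (Suc l) + 1) *\<^sub>R F x"
  shows "\<exists>P. harmp l P \<and> F = kgrad l P"
proof -
  have v: "vpoly F" using F by (rule vharm_vpoly)
  have r: "rpf (\<lambda>x. F x $ i)" for i using v by (simp add: vpoly_def)
  have D: "harmp l (divg F)" using harmp_divg[OF F] by simp
  have rD: "rpf (divg F)" using D by (rule harmp_rpf)
  have "radial (spin_orbit F) x = - (real l + 2) * radial F x" for x
    by (simp add: radial_def T algebra_simps)
  then have rad: "radial F = (\<lambda>x. 1 / (2 * real l + 3) * (sqn x * divg F x))"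
  proof -
    have "(2 * real l + 3) * radial F x = sqn x * divg F x" for x
      using radial_spin_orbit[OF F, of x] \<open>radial (spin_orbit F) x = - (real l + 2) * radial F x\<close>
      by (simp add: algebra_simps)
    then show ?thesis by (simp add: fun_eq_iff field_simps)
  qed
  define P where "P x = 1 / ((real l + 1) * (2 * real l + 3)) * divg F x" for x
  have P: "harmp l P" unfolding P_def[abs_def] using D by (rule harmp_cmult)
  have "F x $ i = kgrad l P x $ i" for x i
  proof -
    have "pd i (radial F) x = 1 / (2 * real l + 3) * (2 * x $ i * divg F x + sqn x * pd i (divg F) x)"
      unfolding rad using rD by (simp add: pd_sqn)
    moreover have "pd i (radial F) x = F x $ i - (real l + 2) * F x $ i + x $ i * divg F x"
      unfolding pd_radial[OF v] T by (simp add: algebra_simps)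
    ultimately have "(2 * real l + 3) * (x $ i * divg F x - (real l + 1) * F x $ i) = 2 * x $ i * divg F x + sqn x * pd i (divg F) x"
      by (simp add: field_simps)
    then have "(real l + 1) * (2 * real l + 3) * F x $ i = (2 * real l + 1) * (x $ i * divg F x) - sqn x * pd i (divg F) x"
      by (simp add: algebra_simps)
    moreover have "(real l + 1) * (2 * real l + 3) \<noteq> 0" by simp
    moreover have "kgrad l P x $ i = 1 / ((real l + 1) * (2 * real l + 3)) * ((2 * real l + 1) * (x $ i * divg F x) - sqn x * pd i (divg F) x)"
      unfolding kgrad_def grad_def P_def[abs_def] using rD by (simp add: right_diff_distrib' mult_ac diff_divide_distrib)
    ultimately show ?thesis by (metis nonzero_mult_div_cancel_left times_divide_eq_left mult_1)
  qed
  then have "F = kgrad l P" by (simp add: fun_eq_iff vec_eq_iff)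
  with P show ?thesis by blast
qed

text \<open>Subtracting an angular part \<open>Lvec Q\<close> makes \<open>Ldiv\<close> vanish; on
  the remainder T satisfies a quadratic equation with the roots k and - (k + 1), and its two
  spectral projections give the other summands. In degree 0 the field is constant, hence a
  gradient.\<close>

theorem vharm_decomposition:
  assumes F: "vharm k F"
  shows "\<exists>P Q S. harmp (Suc k) P \<and> harmp k Q \<and> (k \<noteq> 0 \<longrightarrow> harmp (k - 1) S) \<and>
    F = (\<lambda>x. grad P x + (if k = 0 then 0 else Lvec Q x) + (if k = 0 then 0 else kgrad (k - 1) S x))"
proof (cases k)
  case 0
  have "spin_orbit F x = real k *\<^sub>R F x" for x
  proof -
    have "pd j (\<lambda>x. F x $ i) = (\<lambda>x. 0)" for i j
      using F 0 by (intro hpoly_0_pd) (auto simp: vharm_def harmp_def)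
    then show ?thesis using 0 by (simp add: vec_eq_iff spin_orbit_alt[OF vharm_vpoly[OF F]] divg_def)
  qed
  from spin_orbit_eigen_grad[OF F this] obtain P where "harmp (Suc k) P" "F = grad P" by blast
  with 0 show ?thesis by (intro exI[of _ P] exI[of _ "\<lambda>x. 0"] exI[of _ "\<lambda>x. 0"]) (auto intro: harmp_zero)
next
  case (Suc n)
  define K where "K = real k * (real k + 1)"
  have K: "K > 0" using Suc by (simp add: K_def)
  have v: "vpoly F" using F by (rule vharm_vpoly)
  \<comment> \<open>\<open>Ldiv (Lvec Q)\<close> is \<open>Cas Q\<close>, that is - K times
    \<open>Q\<close>; this choice makes it equal to \<open>Ldiv F\<close>.\<close>
  define Q where "Q x = (- 1 / K) * Ldiv F x" for x
  have Q: "harmp k Q" unfolding Q_def[abs_def] by (rule harmp_cmult[OF harmp_Ldiv[OF F]])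
  define G where "G x = F x - Lvec Q x" for x
  have G: "vharm k G" unfolding G_def[abs_def] by (rule vharm_diff[OF F vharm_Lvec[OF Q]])
  have vG: "vpoly G" using G by (rule vharm_vpoly)
  have LG: "Ldiv G = (\<lambda>x. 0)"
  proof
    fix x
    have "Ldiv G x = Ldiv F x - Cas Q x"
      unfolding G_def[abs_def] using v vharm_vpoly[OF vharm_Lvec[OF Q]] by (simp add: Ldiv_diff Ldiv_Lvec)
    also have "Cas Q x = Ldiv F x" unfolding Cas_harm[OF Q] using K by (simp add: Q_def K_def[symmetric])
    finally show "Ldiv G x = 0" by simp
  qed
  have TG: "spin_orbit (spin_orbit G) x = K *\<^sub>R G x - spin_orbit G x" for x
  proof -
    have "Cas (\<lambda>x. G x $ i) x = - K * G x $ i" for i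
      unfolding K_def using G by (intro Cas_harm) (simp add: vharm_def)
    moreover have "Lvec (Ldiv G) x = 0" by (simp add: LG Lvec_def Lop_const vec_eq_iff)
    ultimately show ?thesis unfolding spin_orbit_square[OF vG] by (simp add: vec_eq_iff)
  qed
  have TG': "vharm k (spin_orbit G)" using G by (rule vharm_spin_orbit)
  \<comment> \<open>With \<open>c\<close> as the reciprocal of the distance of the two roots, (T + k
    + 1) / (2 k + 1) and (k - T) / (2 k + 1) are the spectral projections.\<close>
  define c where "c = 1 / (2 * real k + 1)"
  define Fm where "Fm x = c *\<^sub>R (spin_orbit G x + (real k + 1) *\<^sub>R G x)" for x
  define Fp where "Fp x = c *\<^sub>R (real k *\<^sub>R G x - spin_orbit G x)" for x
  have hm: "vharm k Fm" "vharm k Fp"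
    unfolding Fm_def[abs_def] Fp_def[abs_def] by (intro vharm_scaleR vharm_add vharm_diff G TG')+
  have "spin_orbit Fm x = real k *\<^sub>R Fm x" for x
  proof -
    have "spin_orbit Fm x = c *\<^sub>R (spin_orbit (spin_orbit G) x + (real k + 1) *\<^sub>R spin_orbit G x)"
      unfolding Fm_def[abs_def]
      by (simp add: spin_orbit_scaleR spin_orbit_add vpoly_add vpoly_scaleR vG vharm_vpoly[OF TG'] del: scaleR_scaleR)
    then show ?thesis unfolding TG by (simp add: Fm_def K_def vec_eq_iff algebra_simps)
  qed
  from spin_orbit_eigen_grad[OF hm(1) this] obtain P where P: "harmp (Suc k) P" "Fm = grad P" by blast
  have "spin_orbit Fp x = - (real (Suc n) + 1) *\<^sub>R Fp x" for x
  proof -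
    have "spin_orbit Fp x = c *\<^sub>R (real k *\<^sub>R spin_orbit G x - spin_orbit (spin_orbit G) x)"
      unfolding Fp_def[abs_def]
      by (simp add: spin_orbit_scaleR spin_orbit_diff vpoly_diff vpoly_scaleR vG vharm_vpoly[OF TG'] del: scaleR_scaleR)
    then show ?thesis unfolding TG by (simp add: Fp_def K_def Suc vec_eq_iff algebra_simps)
  qed
  from spin_orbit_eigen_kgrad[OF _ this] hm(2) Suc obtain S where S: "harmp n S" "Fp = kgrad n S" by blast
  have "F x = Fm x + Lvec Q x + Fp x" for x
  proof -
    have "Fm x + Fp x = c *\<^sub>R ((2 * real k + 1) *\<^sub>R G x)"
      by (simp add: Fm_def Fp_def vec_eq_iff algebra_simps)
    then have "Fm x + Fp x = G x" by (simp add: c_def)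
    then show ?thesis by (simp add: G_def algebra_simps)
  qed
  then have "F = (\<lambda>x. grad P x + Lvec Q x + kgrad n S x)" using P S by auto
  with P S Q Suc show ?thesis by (intro exI[of _ P] exI[of _ Q] exI[of _ S]) auto
qed

text \<open>In the notation of the paper, \<open>Grad\<close>, \<open>Tang\<close> and \<open>Kelv\<close> are the superscripts \<open>-\<close>, \<open>0\<close> and
  \<open>+\<close>.\<close>

datatype kind = Grad | Tang | Kelv

fun first_degree :: "kind \<Rightarrow> nat" where
  "first_degree Grad = 1" | "first_degree Tang = 1" | "first_degree Kelv = 0"

fun component_degree :: "kind \<Rightarrow> nat \<Rightarrow> nat" where
  "component_degree Grad l = l - 1" | "component_degree Tang l = l" | "component_degree Kelv l = Suc l"

fun mu :: "kind \<Rightarrow> nat \<Rightarrow> real" where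
  "mu Grad = mu_minus" | "mu Tang = mu_zero" | "mu Kelv = mu_plus"

fun raw_field :: "kind \<Rightarrow> nat \<Rightarrow> (vec3 \<Rightarrow> real) \<Rightarrow> vec3 \<Rightarrow> vec3" where
  "raw_field Grad l P = grad P" | "raw_field Tang l P = Lvec P" | "raw_field Kelv l P = kgrad l P"

fun paper_field :: "kind \<Rightarrow> (nat \<Rightarrow> int \<Rightarrow> vec3 \<Rightarrow> real) \<Rightarrow> nat \<Rightarrow> int \<Rightarrow> vec3 \<Rightarrow> vec3" where
  "paper_field Grad Y = E_minus Y" | "paper_field Tang Y = E_zero Y" | "paper_field Kelv Y = E_plus Y"

lemma mu_pos: "first_degree t \<le> l \<Longrightarrow> 0 < mu t l"
  by (cases t) (auto simp: mu_minus_def mu_zero_def mu_plus_def)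

lemma mu_square: "mu Grad l * mu Grad l = real l * (2 * real l + 1)" "mu Tang l * mu Tang l = real l * (real l + 1)"
  "mu Kelv l * mu Kelv l = (real l + 1) * (2 * real l + 1)"
  by (simp_all add: mu_minus_def mu_zero_def mu_plus_def)

lemma vharm_raw_field:
  assumes "harmp l P" "first_degree t \<le> l"
  shows "vharm (component_degree t l) (raw_field t l P)"
proof (cases t)
  case Grad
  then show ?thesis using assms vharm_grad[of "l - 1" P] by simp
qed (use assms vharm_Lvec vharm_kgrad in auto)

section \<open>Inner products of the vector harmonics and their form on the sphere\<close>

lemma normalize_has_derivative:
  fixes \<eta> :: vec3
  assumes "norm \<eta> = 1"
  shows "((\<lambda>x. x /\<^sub>R norm x) has_derivative (\<lambda>h. h - (\<eta> \<bullet> h) *\<^sub>R \<eta>)) (at \<eta>)"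
proof -
  have "\<eta> \<noteq> 0" using assms by auto
  then have "(norm has_derivative (\<lambda>h. \<eta> \<bullet> h)) (at \<eta>)"
    using has_derivative_norm[of \<eta>] assms by (simp add: sgn_div_norm inner_commute[of _ \<eta>])
  from Deriv.has_derivative_inverse[OF _ this] have "((\<lambda>x. inverse (norm x)) has_derivative (\<lambda>h. - (\<eta> \<bullet> h))) (at \<eta>)"
    using assms by simp
  from has_derivative_scaleR[OF this has_derivative_ident] show ?thesis
    using assms by (simp add: algebra_simps)
qed

lemma lagrange_cross: 
  fixes x a b :: vec3
  assumes "norm x = 1"
  shows "a \<bullet> b = (x \<bullet> a) * (x \<bullet> b) + cross3 x a \<bullet> cross3 x b"
proof -
  have "cross3 x a \<bullet> cross3 x b = (x \<bullet> x) * (a \<bullet> b) - (x \<bullet> a) * (x \<bullet> b)"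
    by (simp add: inner_vec_def sum_3 cross_components algebra_simps)
  then show ?thesis using assms by (simp add: dot_square_norm)
qed

lemma Lvec_cross: "rpf P \<Longrightarrow> Lvec P x = cross3 x (grad P x)"
  by (simp add: vec_eq_iff forall_3 Lvec_def grad_def cross_components Lop_pd algebra_simps)

lemma inner_grad: "hpoly l P \<Longrightarrow> x \<bullet> grad P x = real l * P x"
  using hpoly_pd_euler1[of l P x] by (simp add: inner_vec_def sum_3 grad_def)

lemma integrable_sigma_inner:
  assumes "vpoly F" "vpoly G" shows "integrable \<sigma> (\<lambda>x. F x \<bullet> G x)"
  by (intro integrable_sigma_continuous continuous_on_inner vpoly_continuous assms)

lemma integral_Lvec_Lvec:
  assumes "harmp l P" "harmp l' P'"
  shows "(\<integral>x. Lvec P x \<bullet> Lvec P' x \<partial>\<sigma>) = real l' * (real l' + 1) * (\<integral>x. P x * P' x \<partial>\<sigma>)"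
proof -
  have r: "rpf P" "rpf P'" using assms harmp_rpf by auto
  have "(\<integral>x. Lvec P x \<bullet> Lvec P' x \<partial>\<sigma>) = (\<Sum>a\<in>UNIV. \<integral>x. Lop a P x * Lop a P' x \<partial>\<sigma>)"
    using r by (simp add: inner_vec_def Lvec_def Bochner_Integration.integral_sum integrable_sigma_rpf)
  also have "\<dots> = - (\<Sum>a\<in>UNIV. \<integral>x. P x * Lop a (Lop a P') x \<partial>\<sigma>)"
    using r by (simp add: integral_Lop_by_parts sum_negf)
  also have "(\<Sum>a\<in>UNIV. \<integral>x. P x * Lop a (Lop a P') x \<partial>\<sigma>) = (\<integral>x. P x * Cas P' x \<partial>\<sigma>)"
    using r by (simp add: sum_3 Cas_def distrib_left integrable_sigma_rpf)
  also have "(\<integral>x. P x * Cas P' x \<partial>\<sigma>) = - (real l' * (real l' + 1)) * (\<integral>x. P x * P' x \<partial>\<sigma>)"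
    unfolding Cas_harm[OF assms(2)] integral_mult_right_zero[symmetric]
    by (rule Bochner_Integration.integral_cong) (auto simp: mult_ac)
  finally show ?thesis by simp
qed

text \<open>Integration by parts produces the sum of \<open>Lop a\<close> composed with
  \<open>pd a\<close>, which is zero by symmetry of second derivatives.\<close>

lemma integral_Lvec_grad:
  assumes "rpf P" "rpf P'"
  shows "(\<integral>x. Lvec P x \<bullet> grad P' x \<partial>\<sigma>) = 0"
proof -
  have c: "pd 2 (pd 1 P') = pd 1 (pd 2 P')" "pd 3 (pd 1 P') = pd 1 (pd 3 P')" "pd 3 (pd 2 P') = pd 2 (pd 3 P')"
    by (rule pd_commute[OF assms(2)])+
  have "(\<integral>x. Lvec P x \<bullet> grad P' x \<partial>\<sigma>) = (\<Sum>a\<in>UNIV. \<integral>x. Lop a P x * pd a P' x \<partial>\<sigma>)"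
    using assms by (simp add: inner_vec_def Lvec_def grad_def Bochner_Integration.integral_sum integrable_sigma_rpf)
  also have "\<dots> = - (\<Sum>a\<in>UNIV. \<integral>x. P x * Lop a (pd a P') x \<partial>\<sigma>)"
    using assms by (simp add: integral_Lop_by_parts sum_negf)
  also have "(\<Sum>a\<in>UNIV. \<integral>x. P x * Lop a (pd a P') x \<partial>\<sigma>) = (\<integral>x. P x * (Lop 1 (pd 1 P') x + Lop 2 (pd 2 P') x + Lop 3 (pd 3 P') x) \<partial>\<sigma>)"
    using assms by (simp add: sum_3 distrib_left integrable_sigma_rpf)
  also have "\<dots> = 0" using assms by (simp add: Lop_pd c)
  finally show ?thesis by simp
qed

text \<open>Completeness is derived: orthonormality makes the 2 l + 1 functions of each degree
  independent, and by \<open>harmp_span\<close> so many exhaust the degree.\<close>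

locale harmonic_basis =
  fixes Y :: "nat \<Rightarrow> int \<Rightarrow> vec3 \<Rightarrow> real"
  assumes harm: "\<And>l m. \<bar>m\<bar> \<le> int l \<Longrightarrow> spherical_harmonic l (Y l m)"
    and orth: "\<And>l m l' m'. \<bar>m\<bar> \<le> int l \<Longrightarrow> \<bar>m'\<bar> \<le> int l' \<Longrightarrow>
        (\<integral>\<eta>. Y l m \<eta> * Y l' m' \<eta> \<partial>\<sigma>) = (if l = l' \<and> m = m' then 1 else 0)"
begin

text \<open>\<open>Y l m\<close> is prescribed only on the sphere; all calculus is done with this
  polynomial extension.\<close>

definition solid :: "nat \<Rightarrow> int \<Rightarrow> vec3 \<Rightarrow> real" where
  "solid l m = (SOME P. harmp l P \<and> (\<forall>\<eta>. norm \<eta> = 1 \<longrightarrow> Y l m \<eta> = P \<eta>))"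

lemma solid:
  assumes "\<bar>m\<bar> \<le> int l"
  shows "harmp l (solid l m)" and "norm \<eta> = 1 \<Longrightarrow> Y l m \<eta> = solid l m \<eta>"
proof -
  obtain P where P: "hom_poly l P" "\<And>x. laplacian P x = 0" "\<And>\<eta>. \<eta> \<in> sphere 0 1 \<Longrightarrow> Y l m \<eta> = P \<eta>"
    using harm[OF assms] unfolding spherical_harmonic_def by blast
  have "hpoly l P" using P(1) by (rule hom_poly_imp_hpoly)
  then have "harmp l P" using P(2) laplacian_eq_lap[OF hpoly_rpf] by (simp add: harmp_def)
  then have "\<exists>P. harmp l P \<and> (\<forall>\<eta>. norm \<eta> = 1 \<longrightarrow> Y l m \<eta> = P \<eta>)" using P(3) by auto
  from someI_ex[OF this] show "harmp l (solid l m)" "norm \<eta> = 1 \<Longrightarrow> Y l m \<eta> = solid l m \<eta>"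
    unfolding solid_def by auto
qed

lemma solid_orthonormal:
  assumes "\<bar>m\<bar> \<le> int l" "\<bar>m'\<bar> \<le> int l'"
  shows "(\<integral>\<eta>. solid l m \<eta> * solid l' m' \<eta> \<partial>\<sigma>) = (if l = l' \<and> m = m' then 1 else 0)"
proof -
  have "(\<integral>\<eta>. solid l m \<eta> * solid l' m' \<eta> \<partial>\<sigma>) = (\<integral>\<eta>. Y l m \<eta> * Y l' m' \<eta> \<partial>\<sigma>)"
    using solid(2)[OF assms(1)] solid(2)[OF assms(2)] by (intro Bochner_Integration.integral_cong) auto
  then show ?thesis using orth[OF assms] by simp
qed

text \<open>The gradient of the 0-homogeneous extension is the tangential part of the full gradient;
  the radial part to be removed is l P by Euler's identity.\<close>

lemma sgrad_solid:
  assumes m: "\<bar>m\<bar> \<le> int l" and n: "norm \<eta> = 1"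
  shows "sgrad (Y l m) \<eta> = grad (solid l m) \<eta> - (real l * solid l m \<eta>) *\<^sub>R \<eta>"
proof -
  let ?P = "solid l m"
  have h: "harmp l ?P" using solid(1)[OF m] .
  have rP: "rpf ?P" using h by (rule harmp_rpf)
  have ne: "\<eta> /\<^sub>R norm \<eta> = \<eta>" using n by simp
  have d: "((\<lambda>x. ?P (x /\<^sub>R norm x)) has_derivative (\<lambda>v. frechet_derivative ?P (at \<eta>) (v - (\<eta> \<bullet> v) *\<^sub>R \<eta>))) (at \<eta>)"
    using has_derivative_compose[OF normalize_has_derivative[OF n], of ?P] rpf_has_derivative[OF rP, of \<eta>] by (simp add: ne)
  have o: "open (UNIV - {0 :: vec3})" "\<eta> \<in> UNIV - {0}" using n by auto
  have eq: "?P (x /\<^sub>R norm x) = Y l m (x /\<^sub>R norm x)" if "x \<in> UNIV - {0}" for x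
    using that by (intro solid(2)[OF m, symmetric]) auto
  have "((\<lambda>x. Y l m (x /\<^sub>R norm x)) has_derivative (\<lambda>v. frechet_derivative ?P (at \<eta>) (v - (\<eta> \<bullet> v) *\<^sub>R \<eta>))) (at \<eta>)"
    by (rule has_derivative_transform_within_open[OF d o eq])
  then have "frechet_derivative (\<lambda>x. Y l m (x /\<^sub>R norm x)) (at \<eta>) = (\<lambda>v. frechet_derivative ?P (at \<eta>) (v - (\<eta> \<bullet> v) *\<^sub>R \<eta>))"
    by (rule frechet_derivative_at[symmetric])
  then have "sgrad (Y l m) \<eta> $ i = pd i ?P \<eta> - \<eta> $ i * frechet_derivative ?P (at \<eta>) \<eta>" for i
    using linear_frechet_derivative[OF rpf_differentiable[OF rP], of \<eta>]
    by (simp add: sgrad_def linear_diff linear_scale pd_def inner_axis)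
  moreover have "frechet_derivative ?P (at \<eta>) \<eta> = real l * ?P \<eta>"
    using hpoly_pd_euler1[OF harmp_hpoly[OF h], of \<eta>] by (simp add: frechet_rpf_eq[OF rP])
  ultimately show ?thesis by (simp add: vec_eq_iff grad_def)
qed

definition e :: "kind \<Rightarrow> nat \<Rightarrow> int \<Rightarrow> vec3 \<Rightarrow> vec3" where
  "e t l m x = (1 / mu t l) *\<^sub>R raw_field t l (solid l m) x"

text \<open>The radial part l P \<eta> missing from the spherical gradient is exactly the radial
  term of \<open>E\<^sup>-\<close>, which becomes the full gradient. In \<open>E\<^sup>0\<close> it
  drops out of the cross product, and in \<open>E\<^sup>+\<close> it raises the coefficient l + 1 to
  the 2 l + 1 of \<open>kgrad\<close>.\<close>

lemma e_eq_paper_field: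
  assumes m: "\<bar>m\<bar> \<le> int l" and n: "norm \<eta> = 1"
  shows "paper_field t Y l m \<eta> /\<^sub>R mu t l = e t l m \<eta>"
proof -
  have rP: "rpf (solid l m)" using solid(1)[OF m] by (rule harmp_rpf)
  have "paper_field t Y l m \<eta> = raw_field t l (solid l m) \<eta>"
  proof (cases t)
    case Grad
    then show ?thesis by (simp add: E_minus_def sgrad_solid[OF m n] solid(2)[OF m n])
  next
    case Tang
    then show ?thesis
      by (simp add: E_zero_def sgrad_solid[OF m n] Lvec_cross[OF rP] Cross3.right_diff_distrib cross_mult_right)
  next
    case Kelv
    then show ?thesis using n
      by (simp add: E_plus_def sgrad_solid[OF m n] solid(2)[OF m n] kgrad_def sqn_eq vec_eq_iff algebra_simps)
  qed
  then show ?thesis by (simp add: e_def divide_inverse)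
qed

lemma vharm_e:
  assumes "\<bar>m\<bar> \<le> int l" "first_degree t \<le> l"
  shows "vharm (component_degree t l) (e t l m)"
  unfolding e_def[abs_def] by (intro vharm_scaleR vharm_raw_field solid assms)

lemma spin_orbit_e:
  assumes m: "\<bar>m\<bar> \<le> int l" and l: "first_degree t \<le> l"
  shows "spin_orbit (e t l m) x =
    (case t of Grad \<Rightarrow> real (component_degree t l) | Tang \<Rightarrow> - 1 | Kelv \<Rightarrow> - (real (component_degree t l) + 1)) *\<^sub>R e t l m x"
proof -
  have P: "harmp l (solid l m)" using solid(1)[OF m] .
  have "spin_orbit (e t l m) x = (1 / mu t l) *\<^sub>R spin_orbit (raw_field t l (solid l m)) x"
    unfolding e_def[abs_def] by (rule spin_orbit_scaleR[OF vharm_vpoly[OF vharm_raw_field[OF P l]]])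
  also have "\<dots> = (case t of Grad \<Rightarrow> real (component_degree t l) | Tang \<Rightarrow> - 1 | Kelv \<Rightarrow> - (real (component_degree t l) + 1)) *\<^sub>R e t l m x"
  proof (cases t)
    case Grad
    with l obtain k where "l = Suc k" by (cases l) auto
    then show ?thesis using Grad spin_orbit_grad[of k "solid l m" x] P by (simp add: e_def)
  next
    case Tang
    then show ?thesis using spin_orbit_Lvec[OF harmp_rpf[OF P]] by (simp add: e_def)
  next
    case Kelv
    then show ?thesis using spin_orbit_kgrad[OF P] by (simp add: e_def)
  qed
  finally show ?thesis .
qed

text \<open>Splitting gradients into radial and tangential parts reduces the products to P P' and
  \<open>Lvec P\<close> . \<open>Lvec P'\<close>, whose integrals are known, or to
  \<open>integral_Lvec_grad\<close>. For l = l' the coefficients cancel when the kinds differ and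
  add up to the squared \<open>mu\<close> when they agree.\<close>

lemma e_orthonormal:
  assumes m: "\<bar>m\<bar> \<le> int l" "first_degree t \<le> l" and m': "\<bar>m'\<bar> \<le> int l'" "first_degree t' \<le> l'"
  shows "inner_S (e t l m) (e t' l' m') = (if t = t' \<and> l = l' \<and> m = m' then 1 else 0)"
proof -
  let ?P = "solid l m" and ?P' = "solid l' m'"
  have P: "harmp l ?P" "harmp l' ?P'" using solid(1)[OF m(1)] solid(1)[OF m'(1)] .
  have r: "rpf ?P" "rpf ?P'" using P harmp_rpf by auto
  define \<delta> :: real where "\<delta> = (if l = l' \<and> m = m' then 1 else 0)"
  have o: "(\<integral>\<eta>. ?P \<eta> * ?P' \<eta> \<partial>\<sigma>) = \<delta>" using solid_orthonormal[OF m(1) m'(1)] by (simp add: \<delta>_def)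
  have LL: "(\<integral>x. Lvec ?P x \<bullet> Lvec ?P' x \<partial>\<sigma>) = real l' * (real l' + 1) * \<delta>"
    using integral_Lvec_Lvec[OF P] o by simp
  have iPP: "integrable \<sigma> (\<lambda>x. ?P x * ?P' x)" using r by (intro integrable_sigma_rpf) simp
  have iLL: "integrable \<sigma> (\<lambda>x. Lvec ?P x \<bullet> Lvec ?P' x)"
    by (intro integrable_sigma_inner vharm_vpoly[OF vharm_Lvec[OF P(1)]] vharm_vpoly[OF vharm_Lvec[OF P(2)]])
  have gg: "grad ?P x \<bullet> grad ?P' x = (real l * real l') * (?P x * ?P' x) + Lvec ?P x \<bullet> Lvec ?P' x" if "norm x = 1" for x
    using lagrange_cross[OF that, of "grad ?P x" "grad ?P' x"] r
    by (simp add: Lvec_cross inner_grad[OF harmp_hpoly[OF P(1)]] inner_grad[OF harmp_hpoly[OF P(2)]])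
  have comb: "(\<integral>x. a * (?P x * ?P' x) + b * (Lvec ?P x \<bullet> Lvec ?P' x) \<partial>\<sigma>) = (a + b * (real l' * (real l' + 1))) * \<delta>" for a b
    using iPP iLL o LL by (simp add: algebra_simps)
  have xx: "x \<bullet> x = 1" "sqn x = 1" if "norm x = 1" for x using that by (simp_all add: dot_square_norm sqn_eq)
  have ig: "x \<bullet> grad ?P x = real l * ?P x" "x \<bullet> grad ?P' x = real l' * ?P' x"
      "grad ?P x \<bullet> x = real l * ?P x" "grad ?P' x \<bullet> x = real l' * ?P' x" for x
    using inner_grad[OF harmp_hpoly[OF P(1)]] inner_grad[OF harmp_hpoly[OF P(2)]] by (auto simp: inner_commute)
  have iL: "Lvec ?P x \<bullet> x = 0" "x \<bullet> Lvec ?P' x = 0" "x \<bullet> Lvec ?P x = 0" "Lvec ?P' x \<bullet> x = 0" for x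
    using r by (auto simp: Lvec_cross dot_cross_self)
  have raw: "(\<integral>x. raw_field t l ?P x \<bullet> raw_field t' l' ?P' x \<partial>\<sigma>) = (if t = t' then mu t l * mu t' l' else 0) * \<delta>"
  proof (cases t; cases t')
    assume t: "t = Grad" "t' = Grad"
    have "(\<integral>x. raw_field t l ?P x \<bullet> raw_field t' l' ?P' x \<partial>\<sigma>) = (\<integral>x. (real l * real l') * (?P x * ?P' x) + 1 * (Lvec ?P x \<bullet> Lvec ?P' x) \<partial>\<sigma>)"
      using t by (intro Bochner_Integration.integral_cong) (auto simp: gg)
    also have "\<dots> = (if t = t' then mu t l * mu t' l' else 0) * \<delta>"
      unfolding comb using t mu_square(1)[of l] by (auto simp: \<delta>_def algebra_simps)
    finally show ?thesis .
  next
    assume t: "t = Grad" "t' = Kelv"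
    have "(\<integral>x. raw_field t l ?P x \<bullet> raw_field t' l' ?P' x \<partial>\<sigma>) = (\<integral>x. (real l * (real l' + 1)) * (?P x * ?P' x) + (- 1) * (Lvec ?P x \<bullet> Lvec ?P' x) \<partial>\<sigma>)"
      using t by (intro Bochner_Integration.integral_cong) (auto simp: gg kgrad_def xx ig inner_diff_right algebra_simps)
    also have "\<dots> = (if t = t' then mu t l * mu t' l' else 0) * \<delta>"
      unfolding comb using t by (auto simp: \<delta>_def algebra_simps)
    finally show ?thesis .
  next
    assume t: "t = Kelv" "t' = Grad"
    have "(\<integral>x. raw_field t l ?P x \<bullet> raw_field t' l' ?P' x \<partial>\<sigma>) = (\<integral>x. ((real l + 1) * real l') * (?P x * ?P' x) + (- 1) * (Lvec ?P x \<bullet> Lvec ?P' x) \<partial>\<sigma>)"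
      using t by (intro Bochner_Integration.integral_cong) (auto simp: gg kgrad_def xx ig inner_diff_left algebra_simps)
    also have "\<dots> = (if t = t' then mu t l * mu t' l' else 0) * \<delta>"
      unfolding comb using t by (auto simp: \<delta>_def algebra_simps)
    finally show ?thesis .
  next
    assume t: "t = Kelv" "t' = Kelv"
    have "(\<integral>x. raw_field t l ?P x \<bullet> raw_field t' l' ?P' x \<partial>\<sigma>) = (\<integral>x. ((real l + 1) * (real l' + 1)) * (?P x * ?P' x) + 1 * (Lvec ?P x \<bullet> Lvec ?P' x) \<partial>\<sigma>)"
      using t by (intro Bochner_Integration.integral_cong)
        (auto simp: gg kgrad_def xx ig inner_diff_left inner_diff_right algebra_simps)
    also have "\<dots> = (if t = t' then mu t l * mu t' l' else 0) * \<delta>"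
      unfolding comb using t mu_square(3)[of l] by (auto simp: \<delta>_def algebra_simps)
    finally show ?thesis .
  next
    assume t: "t = Tang" "t' = Tang"
    then show ?thesis using LL mu_square(2)[of l] by (auto simp: \<delta>_def)
  next
    assume t: "t = Tang" "t' = Grad"
    then show ?thesis using integral_Lvec_grad[OF r] by simp
  next
    assume t: "t = Grad" "t' = Tang"
    then show ?thesis using integral_Lvec_grad[OF r(2,1)] by (simp add: inner_commute)
  next
    assume t: "t = Tang" "t' = Kelv"
    have "(\<integral>x. raw_field t l ?P x \<bullet> raw_field t' l' ?P' x \<partial>\<sigma>) = (\<integral>x. - (Lvec ?P x \<bullet> grad ?P' x) \<partial>\<sigma>)"
      using t by (intro Bochner_Integration.integral_cong) (auto simp: kgrad_def xx iL inner_diff_right)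
    then show ?thesis using integral_Lvec_grad[OF r] t by simp
  next
    assume t: "t = Kelv" "t' = Tang"
    have "(\<integral>x. raw_field t l ?P x \<bullet> raw_field t' l' ?P' x \<partial>\<sigma>) = (\<integral>x. - (Lvec ?P' x \<bullet> grad ?P x) \<partial>\<sigma>)"
      using t by (intro Bochner_Integration.integral_cong) (auto simp: kgrad_def xx iL inner_diff_left inner_diff_right inner_commute)
    then show ?thesis using integral_Lvec_grad[OF r(2,1)] t by simp
  qed
  have "inner_S (e t l m) (e t' l' m') = (\<integral>x. (1 / (mu t l * mu t' l')) * (raw_field t l ?P x \<bullet> raw_field t' l' ?P' x) \<partial>\<sigma>)"
    unfolding inner_S_def e_def by (intro Bochner_Integration.integral_cong) auto
  also have "\<dots> = 1 / (mu t l * mu t' l') * ((if t = t' then mu t l * mu t' l' else 0) * \<delta>)"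
    using raw by simp
  also have "\<dots> = (if t = t' \<and> l = l' \<and> m = m' then 1 else 0)"
    using mu_pos[OF m(2)] mu_pos[OF m'(2)] by (auto simp: \<delta>_def)
  finally show ?thesis .
qed

section \<open>Completeness of the vector harmonics among polynomial fields\<close>

definition Adm :: "(kind \<times> nat \<times> int) set" where
  "Adm = {(t, l, m). first_degree t \<le> l \<and> \<bar>m\<bar> \<le> int l}"

fun ei :: "kind \<times> nat \<times> int \<Rightarrow> vec3 \<Rightarrow> vec3" where
  "ei (t, l, m) = e t l m"

lemma ei_orthonormal: "i \<in> Adm \<Longrightarrow> j \<in> Adm \<Longrightarrow> inner_S (ei i) (ei j) = (if i = j then 1 else 0)"
  by (cases i; cases j) (auto simp: Adm_def e_orthonormal)

lemma vpoly_ei: "i \<in> Adm \<Longrightarrow> vpoly (ei i)"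
  by (cases i) (auto simp: Adm_def intro: vharm_vpoly[OF vharm_e])

definition spanned :: "(vec3 \<Rightarrow> vec3) \<Rightarrow> bool" where
  "spanned F \<longleftrightarrow> (\<exists>I c. finite I \<and> I \<subseteq> Adm \<and> (\<forall>x. norm x = 1 \<longrightarrow> F x = (\<Sum>i\<in>I. c i *\<^sub>R ei i x)))"

lemma spanned_zero: "spanned (\<lambda>x. 0)"
  unfolding spanned_def by (intro exI[of _ "{}"]) auto

lemma spanned_cong: "spanned F \<Longrightarrow> (\<And>x. norm x = 1 \<Longrightarrow> G x = F x) \<Longrightarrow> spanned G"
  unfolding spanned_def by auto

lemma spanned_ei: "i \<in> Adm \<Longrightarrow> spanned (\<lambda>x. c *\<^sub>R ei i x)"
  unfolding spanned_def by (intro exI[of _ "{i}"] exI[of _ "\<lambda>_. c"]) auto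

lemma spanned_add:
  assumes "spanned F" "spanned G" shows "spanned (\<lambda>x. F x + G x)"
proof -
  obtain I c where I: "finite I" "I \<subseteq> Adm" "\<And>x. norm x = 1 \<Longrightarrow> F x = (\<Sum>i\<in>I. c i *\<^sub>R ei i x)"
    using assms(1) unfolding spanned_def by blast
  obtain J d where J: "finite J" "J \<subseteq> Adm" "\<And>x. norm x = 1 \<Longrightarrow> G x = (\<Sum>i\<in>J. d i *\<^sub>R ei i x)"
    using assms(2) unfolding spanned_def by blast
  define c' where "c' i = (if i \<in> I then c i else 0)" for i
  define d' where "d' i = (if i \<in> J then d i else 0)" for i
  have "F x + G x = (\<Sum>i\<in>I \<union> J. (c' i + d' i) *\<^sub>R ei i x)" if "norm x = 1" for x
  proof -
    have "F x = (\<Sum>i\<in>I \<union> J. c' i *\<^sub>R ei i x)"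
      unfolding I(3)[OF that] using I J by (intro sum.mono_neutral_cong_left) (auto simp: c'_def)
    moreover have "G x = (\<Sum>i\<in>I \<union> J. d' i *\<^sub>R ei i x)"
      unfolding J(3)[OF that] using I J by (intro sum.mono_neutral_cong_left) (auto simp: d'_def)
    ultimately show ?thesis by (simp add: scaleR_add_left sum.distrib)
  qed
  then show ?thesis unfolding spanned_def using I J by (intro exI[of _ "I \<union> J"] exI[of _ "\<lambda>i. c' i + d' i"]) auto
qed

lemma spanned_sum: "finite J \<Longrightarrow> (\<And>j. j \<in> J \<Longrightarrow> spanned (F j)) \<Longrightarrow> spanned (\<lambda>x. \<Sum>j\<in>J. F j x)"
  by (induction J rule: finite_induct) (auto intro: spanned_zero spanned_add)

lemma harmp_solid_span:
  assumes "harmp l P"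
  shows "\<exists>c. P = (\<lambda>x. \<Sum>m\<in>{- int l..int l}. c m * solid l m x)"
proof -
  have "\<exists>c. \<forall>x. P x = (\<Sum>m\<in>{- int l..int l}. c m * solid l m x)"
  proof (rule harmp_span[OF _ _ _ _ assms])
    show "harmp l (solid l m)" if "m \<in> {- int l..int l}" for m using that by (intro solid) auto
    fix w m assume w: "\<And>x. (\<Sum>m\<in>{- int l..int l}. w m * solid l m x) = 0" and m: "m \<in> {- int l..int l}"
    have rs: "rpf (\<lambda>x. solid l j x * solid l m x)" if "j \<in> {- int l..int l}" for j
      using that m harmp_rpf[OF solid(1)] by (intro rpf_mult) auto
    have "0 = (\<integral>x. (\<Sum>j\<in>{- int l..int l}. w j * solid l j x) * solid l m x \<partial>\<sigma>)" by (simp add: w)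
    also have "\<dots> = (\<integral>x. (\<Sum>j\<in>{- int l..int l}. w j * (solid l j x * solid l m x)) \<partial>\<sigma>)"
      by (simp add: sum_distrib_right mult.assoc)
    also have "\<dots> = (\<Sum>j\<in>{- int l..int l}. w j * (\<integral>x. solid l j x * solid l m x \<partial>\<sigma>))"
      using rs by (simp add: Bochner_Integration.integral_sum integrable_sigma_rpf)
    also have "\<dots> = (\<Sum>j\<in>{- int l..int l}. w j * (if j = m then 1 else 0))"
      using m by (intro sum.cong refl) (auto simp: solid_orthonormal)
    also have "\<dots> = w m" using m by (simp add: if_distrib[of "(*) _"] cong: if_cong)
    finally show "w m = 0" by simp
  qed auto
  then show ?thesis by auto
qed

lemma spanned_raw_field:
  assumes P: "harmp l P" and l: "first_degree t \<le> l"
  shows "spanned (raw_field t l P)"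
proof -
  obtain c where c: "P = (\<lambda>x. \<Sum>m\<in>{- int l..int l}. c m * solid l m x)"
    using harmp_solid_span[OF P] by blast
  have rs: "rpf (solid l m)" if "m \<in> {- int l..int l}" for m
    using that by (intro harmp_rpf[OF solid(1)]) auto
  have g: "grad P x = (\<Sum>m\<in>{- int l..int l}. c m *\<^sub>R grad (solid l m) x)" for x
  proof -
    have "pd i P x = (\<Sum>m\<in>{- int l..int l}. c m * pd i (solid l m) x)" for i
    proof -
      have "pd i P x = (\<Sum>m\<in>{- int l..int l}. pd i (\<lambda>x. c m * solid l m x) x)"
        unfolding c by (subst pd_sum) (use rs in auto)
      also have "\<dots> = (\<Sum>m\<in>{- int l..int l}. c m * pd i (solid l m) x)"
        by (intro sum.cong refl fun_cong[OF pd_cmult] rs)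
      finally show ?thesis .
    qed
    then show ?thesis by (simp add: vec_eq_iff grad_def)
  qed
  have P: "rpf P" unfolding c using rs by (intro rpf_sum rpf_mult rpf_const)
  have L: "Lvec P x = (\<Sum>m\<in>{- int l..int l}. c m *\<^sub>R Lvec (solid l m) x)" for x
  proof -
    have "cross3 x (\<Sum>m\<in>M. v m) = (\<Sum>m\<in>M. cross3 x (v m))" for v :: "int \<Rightarrow> vec3" and M
      by (induction M rule: infinite_finite_induct) (auto simp: cross_add_right)
    then have "Lvec P x = (\<Sum>m\<in>{- int l..int l}. c m *\<^sub>R cross3 x (grad (solid l m) x))"
      unfolding Lvec_cross[OF P] g by (simp add: cross_mult_right)
    then show ?thesis using rs by (simp add: Lvec_cross)
  qed
  have k: "kgrad l P x = (\<Sum>m\<in>{- int l..int l}. c m *\<^sub>R kgrad l (solid l m) x)" for x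
  proof -
    have "(\<Sum>m\<in>{- int l..int l}. c m *\<^sub>R kgrad l (solid l m) x)
      = (2 * real l + 1) *\<^sub>R ((\<Sum>m\<in>{- int l..int l}. c m * solid l m x) *\<^sub>R x) - sqn x *\<^sub>R (\<Sum>m\<in>{- int l..int l}. c m *\<^sub>R grad (solid l m) x)"
      unfolding kgrad_def scaleR_sum_left scaleR_sum_right sum_subtractf[symmetric]
      by (intro sum.cong refl) (simp add: algebra_simps)
    then show ?thesis unfolding kgrad_def g using c by simp
  qed
  have raw: "raw_field t l P x = (\<Sum>m\<in>{- int l..int l}. c m *\<^sub>R raw_field t l (solid l m) x)" for x
    by (cases t) (simp_all add: g L k)
  have "spanned (\<lambda>x. \<Sum>m\<in>{- int l..int l}. (c m * mu t l) *\<^sub>R ei (t, l, m) x)"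
    using l by (intro spanned_sum spanned_ei) (auto simp: Adm_def)
  then show ?thesis
    by (rule spanned_cong) (use mu_pos[OF l] in \<open>simp add: raw e_def\<close>)
qed

lemma spanned_vharm:
  assumes "vharm k F" shows "spanned F"
proof -
  obtain P Q S where h: "harmp (Suc k) P" "harmp k Q" "k \<noteq> 0 \<Longrightarrow> harmp (k - 1) S"
    and F: "F = (\<lambda>x. grad P x + (if k = 0 then 0 else Lvec Q x) + (if k = 0 then 0 else kgrad (k - 1) S x))"
    using vharm_decomposition[OF assms] by blast
  have G: "spanned (grad P)" using spanned_raw_field[OF h(1), of Grad] by simp
  have T: "spanned (Lvec Q)" if "k \<noteq> 0" using spanned_raw_field[OF h(2), of Tang] that by simp
  have S: "spanned (kgrad (k - 1) S)" if "k \<noteq> 0" using spanned_raw_field[OF h(3), of Kelv] that by simp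
  show ?thesis
  proof (cases "k = 0")
    case True
    then show ?thesis using G by (simp add: F)
  next
    case False
    then show ?thesis using spanned_add[OF spanned_add[OF G T] S] by (simp add: F)
  qed
qed

text \<open>By \<open>sphere_harmonic_induct\<close> each component is on the sphere a sum of
  harmonics, so the field is there a sum of fields to which \<open>vharm_decomposition\<close>
  applies.\<close>

theorem spanned_vpoly:
  assumes "vpoly F" shows "spanned F"
proof -
  have s: "spanned (\<lambda>x. f x *\<^sub>R axis i 1)" if "rpf f" for f and i :: 3
    using that
  proof (induction rule: sphere_harmonic_induct)
    case (harmp k h)
    have "vharm k (\<lambda>x. h x *\<^sub>R axis i 1)"
      unfolding vharm_def
    proof
      fix j show "harmp k (\<lambda>x. (h x *\<^sub>R axis i 1) $ j)"
        using harmp by (cases "j = i") (auto simp: axis_def harmp_zero)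
    qed
    then show ?case by (rule spanned_vharm)
  next
    case (add f g)
    then show ?case by (simp add: scaleR_add_left spanned_add)
  next
    case (cong f g)
    from cong(1) show ?case by (rule spanned_cong) (simp add: cong(2))
  qed
  have "spanned (\<lambda>x. \<Sum>i\<in>UNIV. F x $ i *\<^sub>R axis i 1)"
    using assms by (intro spanned_sum s) (auto simp: vpoly_def)
  then show ?thesis using axis_expand[of "F _"] by simp
qed

end

section \<open>Projections of polynomial fields\<close>

lemma integrable_sigma_inner_continuous:
  assumes "continuous_on (sphere 0 1) f" "continuous_on (sphere 0 1) g"
  shows "integrable \<sigma> (\<lambda>x. f x \<bullet> g x :: real)"
  by (intro integrable_sigma_continuous continuous_on_inner assms)

lemma inner_S_commute: "inner_S f g = inner_S g f"
  by (simp add: inner_S_def inner_commute)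

lemma inner_S_cong:
  "(\<And>x. norm x = 1 \<Longrightarrow> f x = f' x) \<Longrightarrow> (\<And>x. norm x = 1 \<Longrightarrow> g x = g' x) \<Longrightarrow> inner_S f g = inner_S f' g'"
  unfolding inner_S_def by (rule Bochner_Integration.integral_cong) auto

lemma inner_S_scale: "inner_S (\<lambda>x. c *\<^sub>R f x) g = c * inner_S f g"
  by (simp add: inner_S_def)

lemma inner_S_add:
  assumes "continuous_on (sphere 0 1) f" "continuous_on (sphere 0 1) g" "continuous_on (sphere 0 1) h"
  shows "inner_S (\<lambda>x. f x + g x) h = inner_S f h + inner_S g h"
  using assms by (simp add: inner_S_def inner_add_left integrable_sigma_inner_continuous)

lemma inner_S_diff:
  assumes "continuous_on (sphere 0 1) f" "continuous_on (sphere 0 1) g" "continuous_on (sphere 0 1) h"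
  shows "inner_S (\<lambda>x. f x - g x) h = inner_S f h - inner_S g h"
  using assms by (simp add: inner_S_def inner_diff_left integrable_sigma_inner_continuous)

lemma inner_S_sum:
  assumes "\<And>i. i \<in> I \<Longrightarrow> continuous_on (sphere 0 1) (f i)" "continuous_on (sphere 0 1) h"
  shows "inner_S (\<lambda>x. \<Sum>i\<in>I. c i *\<^sub>R f i x) h = (\<Sum>i\<in>I. c i * inner_S (f i) h)"
  using assms
  by (simp add: inner_S_def inner_sum_left integrable_sigma_inner_continuous Bochner_Integration.integral_sum)

lemma spin_orbit_zero: "spin_orbit (\<lambda>x. 0) x = 0"
  using spin_orbit_scaleR[OF vpoly_zero, of 0 x] by simp

lemma spin_orbit_sum:
  "(\<And>j. j \<in> J \<Longrightarrow> vpoly (F j)) \<Longrightarrow> spin_orbit (\<lambda>x. \<Sum>j\<in>J. F j x) x = (\<Sum>j\<in>J. spin_orbit (F j) x)"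
  by (induction J rule: infinite_finite_induct) (auto simp: spin_orbit_zero spin_orbit_add vpoly_sum)

context harmonic_basis
begin

definition coef :: "(vec3 \<Rightarrow> vec3) \<Rightarrow> kind \<times> nat \<times> int \<Rightarrow> real" where
  "coef F i = inner_S F (ei i)"

text \<open>For fields with finitely many nonzero coefficients only; the junk value of the sum over an
  infinite set is never used.\<close>

definition pr :: "kind \<Rightarrow> (vec3 \<Rightarrow> vec3) \<Rightarrow> vec3 \<Rightarrow> vec3" where
  "pr t F x = (\<Sum>i | i \<in> Adm \<and> fst i = t \<and> coef F i \<noteq> 0. coef F i *\<^sub>R ei i x)"

lemma continuous_on_ei: "i \<in> Adm \<Longrightarrow> continuous_on S (ei i)"
  by (intro vpoly_continuous vpoly_ei)

lemma coef_sum: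
  assumes "finite I" "I \<subseteq> Adm" "i \<in> Adm" "\<And>x. norm x = 1 \<Longrightarrow> F x = (\<Sum>i\<in>I. c i *\<^sub>R ei i x)"
  shows "coef F i = (if i \<in> I then c i else 0)"
proof -
  have "coef F i = inner_S (\<lambda>x. \<Sum>i\<in>I. c i *\<^sub>R ei i x) (ei i)"
    unfolding coef_def using assms(4) by (rule inner_S_cong) auto
  also have "\<dots> = (\<Sum>j\<in>I. c j * inner_S (ei j) (ei i))"
    using assms by (intro inner_S_sum continuous_on_ei) auto
  also have "\<dots> = (\<Sum>j\<in>I. c j * (if j = i then 1 else 0))"
    by (intro sum.cong refl) (simp add: ei_orthonormal[OF subsetD[OF assms(2)] assms(3)])
  also have "\<dots> = (if i \<in> I then c i else 0)"
    using assms(1) by (simp add: if_distrib[of "(*) _"] cong: if_cong)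
  finally show ?thesis .
qed

lemma vpoly_expansion:
  assumes "vpoly F"
  obtains I where "finite I" "I \<subseteq> Adm" "\<And>x. norm x = 1 \<Longrightarrow> F x = (\<Sum>i\<in>I. coef F i *\<^sub>R ei i x)"
    "\<forall>i\<in>Adm - I. coef F i = 0"
proof -
  obtain I c where I: "finite I" "I \<subseteq> Adm" "\<And>x. norm x = 1 \<Longrightarrow> F x = (\<Sum>i\<in>I. c i *\<^sub>R ei i x)"
    using spanned_vpoly[OF assms] unfolding spanned_def by blast
  have c: "coef F i = (if i \<in> I then c i else 0)" if "i \<in> Adm" for i using coef_sum[OF I(1,2) that I(3)] .
  show thesis
  proof (rule that[OF I(1,2)])
    show "F x = (\<Sum>i\<in>I. coef F i *\<^sub>R ei i x)" if "norm x = 1" for x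
      unfolding I(3)[OF that] using I(2) c by (intro sum.cong refl) auto
  qed (use c in auto)
qed

lemma coef_support:
  assumes "vpoly F"
  obtains I where "finite I" "I \<subseteq> Adm" "\<forall>i\<in>Adm - I. coef F i = 0"
proof -
  obtain I where I: "finite I" "I \<subseteq> Adm" "\<And>x. norm x = 1 \<Longrightarrow> F x = (\<Sum>i\<in>I. coef F i *\<^sub>R ei i x)"
    "\<forall>i\<in>Adm - I. coef F i = 0"
    by (rule vpoly_expansion[OF assms]) (rule that)
  show thesis by (rule that[OF I(1,2,4)])
qed

lemma pr_eq:
  assumes "finite I" "I \<subseteq> Adm" "\<forall>i\<in>Adm - I. coef F i = 0"
  shows "pr t F x = (\<Sum>i\<in>{i\<in>I. fst i = t}. coef F i *\<^sub>R ei i x)"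
  unfolding pr_def using assms by (intro sum.mono_neutral_left) auto

lemma vpoly_pr: 
  assumes "vpoly F" shows "vpoly (pr t F)"
proof -
  obtain I where I: "finite I" "I \<subseteq> Adm" "\<forall>i\<in>Adm - I. coef F i = 0"
    by (rule coef_support[OF assms]) (rule that)
  show ?thesis unfolding pr_eq[OF I, abs_def] using I(2) by (intro vpoly_sum vpoly_scaleR vpoly_ei) auto
qed

lemma coef_pr:
  assumes "vpoly F" "i \<in> Adm" shows "coef (pr t F) i = (if fst i = t then coef F i else 0)"
proof -
  obtain I where I: "finite I" "I \<subseteq> Adm" "\<forall>i\<in>Adm - I. coef F i = 0"
    by (rule coef_support[OF assms(1)]) (rule that)
  have "coef (pr t F) i = (if i \<in> {i\<in>I. fst i = t} then coef F i else 0)"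
    by (rule coef_sum) (use I assms in \<open>auto simp: pr_eq[OF I]\<close>)
  then show ?thesis using I(3) assms by auto
qed

lemma pr_pr:
  assumes "vpoly F" shows "pr t (pr s F) x = (if t = s then pr t F x else 0)"
proof -
  obtain I where I: "finite I" "I \<subseteq> Adm" "\<forall>i\<in>Adm - I. coef F i = 0"
    by (rule coef_support[OF assms]) (rule that)
  have I': "\<forall>i\<in>Adm - I. coef (pr s F) i = 0" using I(3) by (simp add: coef_pr[OF assms])
  have "pr t (pr s F) x = (\<Sum>i\<in>{i\<in>I. fst i = t}. (if t = s then coef F i else 0) *\<^sub>R ei i x)"
    unfolding pr_eq[OF I(1,2) I'] using I(2) by (intro sum.cong refl) (auto simp: coef_pr[OF assms])
  then show ?thesis by (simp add: pr_eq[OF I])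
qed

lemma pr_decomposition:
  assumes F: "vpoly F" and x: "norm x = 1"
  shows "F x = pr Kelv F x + pr Grad F x + pr Tang F x"
proof -
  obtain I where I: "finite I" "I \<subseteq> Adm" "\<And>x. norm x = 1 \<Longrightarrow> F x = (\<Sum>i\<in>I. coef F i *\<^sub>R ei i x)"
    "\<forall>i\<in>Adm - I. coef F i = 0"
    by (rule vpoly_expansion[OF F]) (rule that)
  have "I = {i\<in>I. fst i = Kelv} \<union> {i\<in>I. fst i = Grad} \<union> {i\<in>I. fst i = Tang}"
    using kind.exhaust by auto
  then have "F x = (\<Sum>i\<in>{i\<in>I. fst i = Kelv} \<union> {i\<in>I. fst i = Grad} \<union> {i\<in>I. fst i = Tang}. coef F i *\<^sub>R ei i x)"
    using I(3)[OF x] by simp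
  also have "\<dots> = pr Kelv F x + pr Grad F x + pr Tang F x"
    unfolding pr_eq[OF I(1,2,4)] using I(1)
    by (subst sum.union_disjoint; (subst sum.union_disjoint)?) auto
  finally show ?thesis .
qed

lemma coef_linear:
  assumes "continuous_on (sphere 0 1) F" "continuous_on (sphere 0 1) G" "i \<in> Adm"
  shows "coef (\<lambda>x. a *\<^sub>R F x + b *\<^sub>R G x) i = a * coef F i + b * coef G i"
  using assms by (simp add: coef_def inner_S_add inner_S_scale continuous_intros continuous_on_ei)

lemma pr_linear:
  assumes "vpoly F" "vpoly G"
  shows "pr t (\<lambda>x. a *\<^sub>R F x + b *\<^sub>R G x) x = a *\<^sub>R pr t F x + b *\<^sub>R pr t G x"
proof -
  obtain I where I: "finite I" "I \<subseteq> Adm" "\<forall>i\<in>Adm - I. coef F i = 0"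
    by (rule coef_support[OF assms(1)]) (rule that)
  obtain J where J: "finite J" "J \<subseteq> Adm" "\<forall>i\<in>Adm - J. coef G i = 0"
    by (rule coef_support[OF assms(2)]) (rule that)
  have l: "coef (\<lambda>x. a *\<^sub>R F x + b *\<^sub>R G x) i = a * coef F i + b * coef G i" if "i \<in> Adm" for i
    by (intro coef_linear vpoly_continuous assms that)
  have F: "pr t F x = (\<Sum>i\<in>{i\<in>I \<union> J. fst i = t}. coef F i *\<^sub>R ei i x)"
    by (rule pr_eq) (use I J in auto)
  have G: "pr t G x = (\<Sum>i\<in>{i\<in>I \<union> J. fst i = t}. coef G i *\<^sub>R ei i x)"
    by (rule pr_eq) (use I J in auto)
  have "pr t (\<lambda>x. a *\<^sub>R F x + b *\<^sub>R G x) x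
      = (\<Sum>i\<in>{i\<in>I \<union> J. fst i = t}. coef (\<lambda>x. a *\<^sub>R F x + b *\<^sub>R G x) i *\<^sub>R ei i x)"
    by (rule pr_eq) (use I J in \<open>auto simp: l\<close>)
  also have "\<dots> = (\<Sum>i\<in>{i\<in>I \<union> J. fst i = t}. a *\<^sub>R coef F i *\<^sub>R ei i x + b *\<^sub>R coef G i *\<^sub>R ei i x)"
    using I(2) J(2) by (intro sum.cong refl) (auto simp: l scaleR_add_left)
  finally show ?thesis unfolding F G by (simp add: sum.distrib scaleR_sum_right)
qed

text \<open>The symmetry through which a bound for one exponent yields, in
  \<open>Np_dual_bound\<close>, the bound for the conjugate exponent.\<close>

lemma pr_symmetric:
  assumes "vpoly F" "vpoly G"
  shows "inner_S (pr t F) G = inner_S F (pr t G)"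
proof -
  obtain I where I: "finite I" "I \<subseteq> Adm" "\<And>x. norm x = 1 \<Longrightarrow> F x = (\<Sum>i\<in>I. coef F i *\<^sub>R ei i x)"
    "\<forall>i\<in>Adm - I. coef F i = 0"
    by (rule vpoly_expansion[OF assms(1)]) (rule that)
  have e: "inner_S (ei i) H = coef H i" for i H by (simp add: coef_def inner_S_commute)
  have c: "continuous_on (sphere 0 1) G" "continuous_on (sphere 0 1) (pr t G)"
    by (intro vpoly_continuous vpoly_pr assms)+
  have "inner_S (pr t F) G = (\<Sum>i\<in>{i\<in>I. fst i = t}. coef F i * coef G i)"
    unfolding pr_eq[OF I(1,2,4), abs_def] e[symmetric]
    using I(2) c by (intro inner_S_sum continuous_on_ei) auto
  also have "\<dots> = (\<Sum>i\<in>I. coef F i * coef (pr t G) i)"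
  proof (rule sum.mono_neutral_cong_left)
    show "\<forall>i\<in>I - {i \<in> I. fst i = t}. coef F i * coef (pr t G) i = 0"
      using I(2) by (simp add: coef_pr[OF assms(2)] subset_iff del: split_paired_All)
  next
    fix i assume "i \<in> {i \<in> I. fst i = t}"
    then show "coef F i * coef G i = coef F i * coef (pr t G) i"
      using I(2) by (simp add: coef_pr[OF assms(2)] subset_iff del: split_paired_All)
  qed (use I(1) in auto)
  also have "\<dots> = inner_S (\<lambda>x. \<Sum>i\<in>I. coef F i *\<^sub>R ei i x) (pr t G)"
    unfolding e[symmetric] by (rule inner_S_sum[symmetric]) (use I(2) c continuous_on_ei in auto)
  also have "\<dots> = inner_S F (pr t G)" by (rule inner_S_cong) (use I(3) in auto)
  finally show ?thesis .
qed

fun degree_of :: "kind \<times> nat \<times> int \<Rightarrow> nat" where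
  "degree_of (t, l, m) = component_degree t l"

text \<open>The multipliers depend on the degree of the components and not on \<open>l\<close>, so
  the expansion is regrouped by \<open>degree_of\<close> into the eigenfields of
  \<open>eigenfield_projection_bound\<close>.\<close>

lemma Np_pr_le_two:
  assumes p: "1 < p" "p \<le> 2"
  shows "\<exists>K\<ge>0. \<forall>F t. vpoly F \<longrightarrow> Np p (pr t F) \<le> K * Np p F"
proof -
  from eigenfield_projection_bound[OF p, unfolded Let_def] show ?thesis
  proof (elim exE conjE, intro exI conjI allI impI)
    fix K :: real and F t
    assume K: "0 \<le> (K :: real)" and F: "vpoly F"
    assume KB: "\<forall>n A B C. (\<forall>k. vharm k (A k) \<and> vharm k (B k) \<and> vharm k (C k)) \<longrightarrow>
     (\<forall>k x. spin_orbit (A k) x = real k *\<^sub>R A k x) \<longrightarrow>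
     (\<forall>k x. spin_orbit (B k) x = - B k x) \<longrightarrow>
     (\<forall>k x. spin_orbit (C k) x = - (real k + 1) *\<^sub>R C k x) \<longrightarrow>
     (\<forall>x. B 0 x = 0) \<longrightarrow>
       Np p (\<lambda>x. \<Sum>k\<le>n. A k x) \<le> K * Np p (\<lambda>x. \<Sum>k\<le>n. A k x + B k x + C k x) \<and>
       Np p (\<lambda>x. \<Sum>k\<le>n. B k x) \<le> K * Np p (\<lambda>x. \<Sum>k\<le>n. A k x + B k x + C k x) \<and>
       Np p (\<lambda>x. \<Sum>k\<le>n. C k x) \<le> K * Np p (\<lambda>x. \<Sum>k\<le>n. A k x + B k x + C k x)"
    obtain I where I: "finite I" "I \<subseteq> Adm" "\<And>x. norm x = 1 \<Longrightarrow> F x = (\<Sum>i\<in>I. coef F i *\<^sub>R ei i x)"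
      "\<forall>i\<in>Adm - I. coef F i = 0"
      by (rule vpoly_expansion[OF F]) (rule that)
    define n where "n = Max (insert 0 (degree_of ` I))"
    define Q where "Q t k x = (\<Sum>i\<in>{i\<in>{i\<in>I. fst i = t}. degree_of i = k}. coef F i *\<^sub>R ei i x)" for t k x
    have n: "degree_of i \<le> n" if "i \<in> I" for i unfolding n_def using I(1) that by (intro Max_ge) auto
    have vh: "vharm (degree_of i) (ei i)" if "i \<in> Adm" for i
      using that by (cases i) (auto simp: Adm_def vharm_e)
    have so: "spin_orbit (ei i) x = (case fst i of Grad \<Rightarrow> real (degree_of i) | Tang \<Rightarrow> - 1 | Kelv \<Rightarrow> - (real (degree_of i) + 1)) *\<^sub>R ei i x"
      if "i \<in> Adm" for i x
      using that by (cases i) (auto simp: Adm_def spin_orbit_e split: kind.split)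
    have vQ: "vharm k (Q t k)" for t k
      unfolding Q_def[abs_def] using I(2) vh by (intro vharm_sum vharm_scaleR) auto
    have sQ: "spin_orbit (Q t k) x = (case t of Grad \<Rightarrow> real k | Tang \<Rightarrow> - 1 | Kelv \<Rightarrow> - (real k + 1)) *\<^sub>R Q t k x" for t k x
    proof -
      have "spin_orbit (Q t k) x = (\<Sum>i\<in>{i\<in>{i\<in>I. fst i = t}. degree_of i = k}. spin_orbit (\<lambda>x. coef F i *\<^sub>R ei i x) x)"
        unfolding Q_def[abs_def] using I(2) by (intro spin_orbit_sum vpoly_scaleR vpoly_ei) auto
      also have "\<dots> = (\<Sum>i\<in>{i\<in>{i\<in>I. fst i = t}. degree_of i = k}.
          (case t of Grad \<Rightarrow> real k | Tang \<Rightarrow> - 1 | Kelv \<Rightarrow> - (real k + 1)) *\<^sub>R coef F i *\<^sub>R ei i x)"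
        using I(2) by (intro sum.cong refl) (simp add: spin_orbit_scaleR vpoly_ei so subset_iff split: kind.split del: split_paired_All)
      finally show ?thesis by (simp add: Q_def scaleR_sum_right)
    qed
    \<comment> \<open>\<open>Tang\<close> starts at l = 1 and its components have degree l, so it
      has no constant part; this is the hypothesis on \<open>B\<close> from which the contraction
      constant 1/2 arises.\<close>
    have Q0: "Q Tang 0 x = 0" for x
      unfolding Q_def using I(2) by (intro sum.neutral) (auto simp: Adm_def)
    have pr: "pr t F x = (\<Sum>k\<le>n. Q t k x)" for t x
      unfolding pr_eq[OF I(1,2,4)] Q_def using I(1) n by (intro sum.group[symmetric]) auto
    have Fs: "Np p (\<lambda>x. \<Sum>k\<le>n. Q Grad k x + Q Tang k x + Q Kelv k x) = Np p F"
      by (rule Np_cong) (simp add: pr_decomposition[OF F] pr sum.distrib add_ac)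
    have "Np p (\<lambda>x. \<Sum>k\<le>n. Q Grad k x) \<le> K * Np p F \<and> Np p (\<lambda>x. \<Sum>k\<le>n. Q Tang k x) \<le> K * Np p F \<and>
       Np p (\<lambda>x. \<Sum>k\<le>n. Q Kelv k x) \<le> K * Np p F"
      unfolding Fs[symmetric] 
      by (rule KB[THEN spec, of n, THEN spec, of "Q Grad", THEN spec, of "Q Tang", THEN spec, of "Q Kelv",
            THEN mp, THEN mp, THEN mp, THEN mp, THEN mp]) (auto simp: vQ sQ Q0)
    then show "Np p (pr t F) \<le> K * Np p F" by (cases t) (auto simp: pr[abs_def])
  qed
qed

end

section \<open>Polynomial approximation and duality for exponents above 2\<close>

lemma vpoly_approx:
  assumes "continuous_on (sphere 0 1) f" "0 < \<epsilon>"
  obtains g where "vpoly g" "\<forall>x. norm x = 1 \<longrightarrow> norm (f x - g x) < \<epsilon>"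
proof -
  obtain g where g: "polynomial_function g" "\<forall>x\<in>sphere 0 1. norm (f x - g x) < \<epsilon>"
    using Stone_Weierstrass_polynomial_function[OF compact_sphere assms] by blast
  have "rpf (\<lambda>x. g x $ i)" for i
  proof -
    have "axis i (1 :: real) \<in> Basis" by (simp add: axis_in_Basis_iff)
    then have "rpf (\<lambda>x. g x \<bullet> axis i 1)" using g(1) polynomial_function_iff_Basis_inner[of g] by blast
    then show ?thesis by (simp add: inner_axis)
  qed
  then show thesis using g(2) by (intro that[of g]) (auto simp: vpoly_def)
qed

lemma young_le:
  fixes a b :: real
  assumes "1 < p" "0 \<le> a" "0 \<le> b"
  shows "a * b \<le> a powr p + b powr (p / (p - 1))"
proof -
  have q: "1 < p / (p - 1)" using assms by (simp add: field_simps)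
  have "a * b \<le> a powr p / p + b powr (p / (p - 1)) / (p / (p - 1))"
    using assms q by (intro Youngs_inequality) (auto simp: field_simps)
  also have "\<dots> \<le> a powr p + b powr (p / (p - 1))"
  proof (rule add_mono)
    have d: "u / r \<le> u" if "1 \<le> r" "0 \<le> u" for u r :: real
      using that mult_left_mono[of 1 r u] by (simp add: divide_le_eq)
    show "a powr p / p \<le> a powr p" by (rule d) (use assms in auto)
    show "b powr (p / (p - 1)) / (p / (p - 1)) \<le> b powr (p / (p - 1))" by (rule d) (use q in auto)
  qed
  finally show ?thesis .
qed

text \<open>Test \<open>T F\<close> against polynomial approximations of \<open>|T F|^(p - 2) T F\<close>, absorbing the resulting
  multiple of \<open>Np p (T F)\<close> by Young's inequality with a large parameter.\<close>

lemma Np_dual_bound: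
  assumes p: "2 < p"
    and T: "\<And>F. vpoly F \<Longrightarrow> vpoly (T F)" "\<And>F G. vpoly F \<Longrightarrow> vpoly G \<Longrightarrow> inner_S (T F) G = inner_S F (T G)"
    and C: "0 \<le> C" "\<And>F. vpoly F \<Longrightarrow> Np (p / (p - 1)) (T F) \<le> C * Np (p / (p - 1)) F"
    and F: "vpoly F"
  shows "Np p (T F) \<le> 2 * ((2 * C * 2 powr (p / (p - 1)) + 1) powr ((p - 1) / p)) powr p * Np p F"
proof -
  define q where "q = p / (p - 1)"
  \<comment> \<open>The parameter of Young's inequality: l^q = 2 C 2^q + 1 makes C 2^q / l^q at most
    1/2, and the summand 1 keeps \<open>l\<close> positive when \<open>C\<close> is 0.\<close>
  define l where "l = (2 * C * 2 powr q + 1) powr (1 / q)"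
  define h where "h = T F"
  \<comment> \<open>The dual field, normalized so that both |w|^q and h . w equal |h|^p.\<close>
  define w where "w x = norm (h x) powr (p - 2) *\<^sub>R h x" for x
  define X where "X = Np p h"
  define A where "A = (\<integral>x. norm (h x) \<partial>\<sigma>)"
  define m where "m = measure \<sigma> (sphere 0 1)"
  have q: "1 < q" using p by (simp add: q_def field_simps)
  have c1: "0 < 2 * C * 2 powr q + 1" using C(1) by (intro add_nonneg_pos) auto
  then have lp: "0 < l" by (simp add: l_def)
  have lq: "l powr q = 2 * C * 2 powr q + 1"
    using q c1 by (simp add: l_def powr_powr)
  have vh: "vpoly h" using T F by (simp add: h_def)
  have ch: "continuous_on (sphere 0 1) h" by (rule vpoly_continuous[OF vh])
  have cw: "continuous_on (sphere 0 1) w"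
    unfolding w_def using p ch by (intro continuous_on_scaleR continuous_on_powr' continuous_on_norm continuous_on_const) auto
  have wq: "norm (w x) powr q = norm (h x) powr p" for x
  proof -
    have "norm (w x) = norm (h x) powr (p - 2) * norm (h x)" by (simp add: w_def)
    also have "\<dots> = norm (h x) powr (p - 1)" using powr_add[of "norm (h x)" "p - 2" 1] by simp
    finally show ?thesis using p by (simp add: powr_powr q_def)
  qed
  have hw: "h x \<bullet> w x = norm (h x) powr p" for x
  proof -
    have "norm (h x) powr p = norm (h x) powr (p - 2) * norm (h x) powr 2"
      using powr_add[of "norm (h x)" "p - 2" 2] by simp
    then show ?thesis by (cases "h x = 0") (simp_all add: w_def dot_square_norm powr_numeral)
  qed
  have X: "X = inner_S h w" by (simp add: X_def Np_def inner_S_def hw)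
  have Xw: "Np q w = X" by (simp add: X_def Np_def wq)
  have key: "X \<le> 2 * (\<epsilon> * A + l powr p * Np p F + \<epsilon> powr q * m)" if e: "0 < \<epsilon>" for \<epsilon>
  proof -
    obtain g where g: "vpoly g" "\<forall>x. norm x = 1 \<longrightarrow> norm (w x - g x) < \<epsilon>"
      by (rule vpoly_approx[OF cw e])
    have cg: "continuous_on (sphere 0 1) g" by (rule vpoly_continuous[OF g(1)])
    have cT: "continuous_on (sphere 0 1) (T g)" by (intro vpoly_continuous T g)
    have cF: "continuous_on (sphere 0 1) F" by (rule vpoly_continuous[OF F])
    have "Np q g \<le> 2 powr q * (Np q w + Np q (\<lambda>x. g x - w x))"
      using Np_add[OF cw continuous_on_diff[OF cg cw], of q] q by simp
    also have "Np q (\<lambda>x. g x - w x) \<le> \<epsilon> powr q * m"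
    proof -
      have "Np q (\<lambda>x. g x - w x) \<le> (\<integral>x. \<epsilon> powr q \<partial>\<sigma>)"
        unfolding Np_def
      proof (rule integral_mono)
        show "integrable \<sigma> (\<lambda>x. norm (g x - w x) powr q)"
          using q by (intro integrable_powr_continuous continuous_on_diff cg cw) auto
        show "norm (g x - w x) powr q \<le> \<epsilon> powr q" if "x \<in> space \<sigma>" for x
          using that g(2) q by (intro powr_mono2) (auto simp: norm_minus_commute less_imp_le)
      qed simp
      then show ?thesis by (simp add: m_def mult.commute)
    qed
    finally have gq: "Np q g \<le> 2 powr q * (X + \<epsilon> powr q * m)" by (simp add: Xw)
    have "inner_S h (\<lambda>x. w x - g x) \<le> (\<integral>x. \<epsilon> * norm (h x) \<partial>\<sigma>)"
      unfolding inner_S_def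
    proof (rule integral_mono)
      show "integrable \<sigma> (\<lambda>x. h x \<bullet> (w x - g x))"
        by (intro integrable_sigma_inner_continuous ch continuous_on_diff cw cg)
      show "integrable \<sigma> (\<lambda>x. \<epsilon> * norm (h x))"
        by (intro integrable_mult_right integrable_sigma_continuous continuous_on_norm ch)
      fix x assume x: "x \<in> space \<sigma>"
      have "h x \<bullet> (w x - g x) \<le> norm (h x) * norm (w x - g x)" by (rule norm_cauchy_schwarz)
      also have "\<dots> \<le> norm (h x) * \<epsilon>" using g(2) x by (intro mult_left_mono) (auto simp: less_imp_le)
      finally show "h x \<bullet> (w x - g x) \<le> \<epsilon> * norm (h x)" by (simp add: mult.commute)
    qed
    then have 1: "X - inner_S h g \<le> \<epsilon> * A"
      using inner_S_diff[OF cw cg ch] by (simp add: A_def X inner_S_commute[of h])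
    have "inner_S h g = inner_S F (T g)" using T F g by (simp add: h_def)
    also have "\<dots> \<le> (\<integral>x. l powr p * norm (F x) powr p + (1 / l) powr q * norm (T g x) powr q \<partial>\<sigma>)"
      unfolding inner_S_def
    proof (rule integral_mono)
      show "integrable \<sigma> (\<lambda>x. F x \<bullet> T g x)" by (intro integrable_sigma_inner_continuous cF cT)
      show "integrable \<sigma> (\<lambda>x. l powr p * norm (F x) powr p + (1 / l) powr q * norm (T g x) powr q)"
        using p q by (intro Bochner_Integration.integrable_add integrable_mult_right integrable_powr_continuous cF cT) auto
      fix x
      have "F x \<bullet> T g x \<le> norm (F x) * norm (T g x)" by (rule norm_cauchy_schwarz)
      also have "\<dots> = (l * norm (F x)) * (1 / l * norm (T g x))" using lp by simp
      also have "\<dots> \<le> (l * norm (F x)) powr p + (1 / l * norm (T g x)) powr q"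
        unfolding q_def using lp p by (intro young_le) auto
      finally show "F x \<bullet> T g x \<le> l powr p * norm (F x) powr p + (1 / l) powr q * norm (T g x) powr q"
        using lp by (simp add: powr_mult powr_divide)
    qed
    also have "\<dots> = l powr p * Np p F + (1 / l) powr q * Np q (T g)"
      using p q cF cT by (simp add: Np_def integrable_powr_continuous)
    also have "\<dots> \<le> l powr p * Np p F + (1 / l) powr q * (C * (2 powr q * (X + \<epsilon> powr q * m)))"
      using C(2)[OF g(1)] mult_left_mono[OF gq C(1)] by (intro add_left_mono mult_left_mono) (auto simp: q_def)
    also have "(1 / l) powr q * (C * (2 powr q * (X + \<epsilon> powr q * m))) = (C * 2 powr q / l powr q) * (X + \<epsilon> powr q * m)"
      using lp by (simp add: powr_divide)
    also have "\<dots> \<le> 1 / 2 * (X + \<epsilon> powr q * m)"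
    proof (rule mult_right_mono)
      show "C * 2 powr q / l powr q \<le> 1 / 2" unfolding lq using c1 by (simp add: field_simps)
      show "0 \<le> X + \<epsilon> powr q * m" by (simp add: X_def Np_nonneg m_def)
    qed
    finally have 2: "inner_S h g \<le> l powr p * Np p F + 1 / 2 * (X + \<epsilon> powr q * m)" by simp
    have "0 \<le> \<epsilon> powr q * m" by (simp add: m_def)
    with 1 2 show ?thesis unfolding distrib_left by linarith
  qed
  have "((\<lambda>\<epsilon>. 2 * (\<epsilon> * A + l powr p * Np p F + \<epsilon> powr q * m)) \<longlongrightarrow> 2 * (0 * A + l powr p * Np p F + 0 powr q * m)) (at_right 0)"
    using q by (intro tendsto_intros) (auto simp: eventually_at_right_less intro!: eventually_at_rightI[of 0 1])
  then have "X \<le> 2 * (0 * A + l powr p * Np p F + 0 powr q * m)"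
  proof (rule tendsto_lowerbound)
    show "\<forall>\<^sub>F \<epsilon> in at_right 0. X \<le> 2 * (\<epsilon> * A + l powr p * Np p F + \<epsilon> powr q * m)"
      by (rule eventually_at_rightI[of 0 1]) (simp_all only: greaterThanLessThan_iff key zero_less_one)
  qed simp
  then show ?thesis by (simp add: X_def h_def l_def q_def)
qed

lemma (in harmonic_basis) Np_pr:
  assumes p: "1 < p"
  shows "\<exists>K\<ge>0. \<forall>F t. vpoly F \<longrightarrow> Np p (pr t F) \<le> K * Np p F"
proof (cases "p \<le> 2")
  case True
  then show ?thesis using Np_pr_le_two p by simp
next
  case False
  then have "1 < p / (p - 1)" "p / (p - 1) \<le> 2" using p by (auto simp: field_simps)
  from Np_pr_le_two[OF this] obtain C where
    C: "0 \<le> C" "\<forall>F t. vpoly F \<longrightarrow> Np (p / (p - 1)) (pr t F) \<le> C * Np (p / (p - 1)) F"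
    by auto
  show ?thesis
  proof (intro exI conjI allI impI)
    show "Np p (pr t F) \<le> 2 * ((2 * C * 2 powr (p / (p - 1)) + 1) powr ((p - 1) / p)) powr p * Np p F" if "vpoly F" for F t
      using Np_dual_bound[of p "pr t" C F] False C that by (simp add: vpoly_pr pr_symmetric)
  qed simp
qed

section \<open>Extension by density\<close>

lemma Lp_S_iff: "f \<in> Lp_S p \<longleftrightarrow> f \<in> borel_measurable \<sigma> \<and> integrable \<sigma> (\<lambda>x. norm (f x) powr p)"
  unfolding Lp_S_def by (auto simp: integrable_iff_bounded)

lemma Lp_S_measurable: "f \<in> Lp_S p \<Longrightarrow> f \<in> borel_measurable \<sigma>"
  by (simp add: Lp_S_def)

lemma Lp_S_integrable: "f \<in> Lp_S p \<Longrightarrow> integrable \<sigma> (\<lambda>x. norm (f x) powr p)"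
  by (simp add: Lp_S_iff)

lemma nn_integral_Np: "f \<in> Lp_S p \<Longrightarrow> (\<integral>\<^sup>+x. ennreal (norm (f x) powr p) \<partial>\<sigma>) = ennreal (Np p f)"
  unfolding Np_def by (intro nn_integral_eq_integral Lp_S_integrable) auto

lemma Lp_S_bounded:
  assumes "f \<in> borel_measurable \<sigma>" "(\<integral>\<^sup>+x. ennreal (norm (f x) powr p) \<partial>\<sigma>) \<le> ennreal B" "0 \<le> B"
  shows "f \<in> Lp_S p" "Np p f \<le> B"
proof -
  show "f \<in> Lp_S p" using assms by (auto simp: Lp_S_def intro: le_less_trans)
  from nn_integral_Np[OF this] assms show "Np p f \<le> B" by simp
qed

lemma Lp_norm_Np: "Lp_norm p f = Np p f powr (1 / p)"
  by (simp add: Lp_norm_def Np_def)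

lemma Lp_S_continuous: "continuous_on (sphere 0 1) f \<Longrightarrow> 0 < p \<Longrightarrow> f \<in> Lp_S p"
  by (simp add: Lp_S_iff integrable_powr_continuous borel_measurable_sigma_continuous)

lemma Lp_S_vpoly: "vpoly F \<Longrightarrow> 0 < p \<Longrightarrow> F \<in> Lp_S p"
  by (intro Lp_S_continuous vpoly_continuous)

lemma Lp_S_scale: "f \<in> Lp_S p \<Longrightarrow> (\<lambda>x. c *\<^sub>R f x) \<in> Lp_S p"
  by (auto simp: Lp_S_iff powr_mult)

lemma Lp_S_add:
  assumes "f \<in> Lp_S p" "g \<in> Lp_S p" "0 \<le> p"
  shows "(\<lambda>x. f x + g x) \<in> Lp_S p" "Np p (\<lambda>x. f x + g x) \<le> 2 powr p * (Np p f + Np p g)"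
proof -
  note [measurable] = Lp_S_measurable[OF assms(1)] Lp_S_measurable[OF assms(2)]
  have i: "integrable \<sigma> (\<lambda>x. 2 powr p * (norm (f x) powr p + norm (g x) powr p))"
    using assms by (intro integrable_mult_right Bochner_Integration.integrable_add Lp_S_integrable)
  have b: "norm (f x + g x) powr p \<le> 2 powr p * (norm (f x) powr p + norm (g x) powr p)" for x
    using assms by (intro norm_add_powr_le) auto
  have j: "integrable \<sigma> (\<lambda>x. norm (f x + g x) powr p)"
    using b by (intro Bochner_Integration.integrable_bound[OF i]) auto
  then show "(\<lambda>x. f x + g x) \<in> Lp_S p" by (simp add: Lp_S_iff)
  have "Np p (\<lambda>x. f x + g x) \<le> (\<integral>x. 2 powr p * (norm (f x) powr p + norm (g x) powr p) \<partial>\<sigma>)"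
    unfolding Np_def by (rule integral_mono[OF j i b])
  also have "\<dots> = 2 powr p * (Np p f + Np p g)"
    using assms by (simp add: Np_def Lp_S_integrable)
  finally show "Np p (\<lambda>x. f x + g x) \<le> 2 powr p * (Np p f + Np p g)" .
qed

lemma Lp_S_diff:
  assumes "f \<in> Lp_S p" "g \<in> Lp_S p" "0 \<le> p"
  shows "(\<lambda>x. f x - g x) \<in> Lp_S p" "Np p (\<lambda>x. f x - g x) \<le> 2 powr p * (Np p f + Np p g)"
  using Lp_S_add[OF assms(1) Lp_S_scale[OF assms(2), of "- 1"] assms(3)] Np_scale[of p "- 1" g] by auto

lemma Np_minus_commute: "Np p (\<lambda>x. f x - g x) = Np p (\<lambda>x. g x - f x)"
  by (rule Np_cong) (simp add: norm_minus_commute)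

lemma Np_triangle:
  assumes "f \<in> Lp_S p" "g \<in> Lp_S p" "h \<in> Lp_S p" "0 \<le> p"
  shows "Np p (\<lambda>x. f x - h x) \<le> 2 powr p * (Np p (\<lambda>x. f x - g x) + Np p (\<lambda>x. g x - h x))"
  using Lp_S_add(2)[OF Lp_S_diff(1)[OF assms(1,2,4)] Lp_S_diff(1)[OF assms(2,3,4)] assms(4)] by simp

lemma Np_AE_cong:
  assumes "AE x in \<sigma>. f x = g x" "f \<in> borel_measurable \<sigma>" "g \<in> borel_measurable \<sigma>"
  shows "Np p f = Np p g"
  unfolding Np_def using assms by (intro integral_cong_AE) auto

lemma Np_eq_0_AE:
  assumes "f \<in> Lp_S p" "Np p f = 0" shows "AE x in \<sigma>. f x = 0"
proof -
  have "AE x in \<sigma>. norm (f x) powr p = 0"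
    using assms integral_nonneg_eq_0_iff_AE[OF Lp_S_integrable[OF assms(1)]] by (simp add: Np_def)
  then show ?thesis by eventually_elim simp
qed

section \<open>Limits and completeness in \<open>L^p\<close>\<close>

definition Lp_lim :: "real \<Rightarrow> (nat \<Rightarrow> vec3 \<Rightarrow> vec3) \<Rightarrow> (vec3 \<Rightarrow> vec3) \<Rightarrow> bool" where
  "Lp_lim p u f \<longleftrightarrow> (\<forall>n. u n \<in> Lp_S p) \<and> f \<in> Lp_S p \<and> (\<lambda>n. Np p (\<lambda>x. u n x - f x)) \<longlonglongrightarrow> 0"

lemma Lp_limI:
  assumes "\<And>n. u n \<in> Lp_S p" "f \<in> Lp_S p" "\<And>n. Np p (\<lambda>x. u n x - f x) \<le> b n" "b \<longlonglongrightarrow> 0"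
  shows "Lp_lim p u f"
  unfolding Lp_lim_def
  using assms by (auto intro: tendsto_sandwich[OF _ _ tendsto_const[of 0] assms(4)] simp: Np_nonneg)

lemma Lp_lim_unique:
  assumes "Lp_lim p u f" "Lp_lim p u g" "0 \<le> p"
  shows "AE x in \<sigma>. f x = g x"
proof -
  have fg: "f \<in> Lp_S p" "g \<in> Lp_S p" using assms by (auto simp: Lp_lim_def)
  have b: "Np p (\<lambda>x. f x - g x) \<le> 2 powr p * (Np p (\<lambda>x. u n x - f x) + Np p (\<lambda>x. u n x - g x))" for n
    using Np_triangle[of f p "u n" g] assms fg Np_minus_commute[of p f "u n"] by (simp add: Lp_lim_def)
  have "(\<lambda>n. 2 powr p * (Np p (\<lambda>x. u n x - f x) + Np p (\<lambda>x. u n x - g x))) \<longlonglongrightarrow> 2 powr p * (0 + 0)"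
    using assms unfolding Lp_lim_def by (intro tendsto_intros) auto
  from LIMSEQ_le_const[OF this, of "Np p (\<lambda>x. f x - g x)"] b have "Np p (\<lambda>x. f x - g x) = 0"
    using Np_nonneg[of p "\<lambda>x. f x - g x"] by (intro order_antisym) auto
  from Np_eq_0_AE[OF Lp_S_diff(1)[OF fg assms(3)] this] show ?thesis by eventually_elim simp
qed

lemma Lp_lim_linear:
  assumes u: "Lp_lim p u f" and v: "Lp_lim p v g" and p: "0 \<le> p"
  shows "Lp_lim p (\<lambda>n x. a *\<^sub>R u n x + b *\<^sub>R v n x) (\<lambda>x. a *\<^sub>R f x + b *\<^sub>R g x)"
proof (rule Lp_limI)
  have L: "u n \<in> Lp_S p" "v n \<in> Lp_S p" "f \<in> Lp_S p" "g \<in> Lp_S p" for n using u v by (auto simp: Lp_lim_def)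
  show "(\<lambda>x. a *\<^sub>R u n x + b *\<^sub>R v n x) \<in> Lp_S p" "(\<lambda>x. a *\<^sub>R f x + b *\<^sub>R g x) \<in> Lp_S p" for n
    by (intro Lp_S_add(1) Lp_S_scale L p)+
  show "Np p (\<lambda>x. (a *\<^sub>R u n x + b *\<^sub>R v n x) - (a *\<^sub>R f x + b *\<^sub>R g x))
    \<le> 2 powr p * (\<bar>a\<bar> powr p * Np p (\<lambda>x. u n x - f x) + \<bar>b\<bar> powr p * Np p (\<lambda>x. v n x - g x))" for n
    unfolding add_diff_add scaleR_diff_right[symmetric] Np_scale[symmetric]
    by (intro Lp_S_add(2) Lp_S_scale Lp_S_diff(1) L p)
  have "(\<lambda>n. 2 powr p * (\<bar>a\<bar> powr p * Np p (\<lambda>x. u n x - f x) + \<bar>b\<bar> powr p * Np p (\<lambda>x. v n x - g x)))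
      \<longlonglongrightarrow> 2 powr p * (\<bar>a\<bar> powr p * 0 + \<bar>b\<bar> powr p * 0)"
    using u v unfolding Lp_lim_def by (intro tendsto_intros) auto
  then show "(\<lambda>n. 2 powr p * (\<bar>a\<bar> powr p * Np p (\<lambda>x. u n x - f x) + \<bar>b\<bar> powr p * Np p (\<lambda>x. v n x - g x))) \<longlonglongrightarrow> 0"
    by simp
qed

lemma fatou_powr:
  fixes u :: "nat \<Rightarrow> vec3 \<Rightarrow> vec3"
  assumes [measurable]: "\<And>n. u n \<in> borel_measurable \<sigma>" "g \<in> borel_measurable \<sigma>"
    and l: "AE x in \<sigma>. (\<lambda>n. u n x) \<longlonglongrightarrow> g x" and p: "0 < p"
    and B: "eventually (\<lambda>n. (\<integral>\<^sup>+x. ennreal (norm (u n x) powr p) \<partial>\<sigma>) \<le> B) sequentially"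
  shows "(\<integral>\<^sup>+x. ennreal (norm (g x) powr p) \<partial>\<sigma>) \<le> B"
proof -
  have "(\<integral>\<^sup>+x. ennreal (norm (g x) powr p) \<partial>\<sigma>) = (\<integral>\<^sup>+x. liminf (\<lambda>n. ennreal (norm (u n x) powr p)) \<partial>\<sigma>)"
  proof (rule nn_integral_cong_AE)
    show "AE x in \<sigma>. ennreal (norm (g x) powr p) = liminf (\<lambda>n. ennreal (norm (u n x) powr p))"
      using l
    proof eventually_elim
      case (elim x)
      then have "(\<lambda>n. ennreal (norm (u n x) powr p)) \<longlonglongrightarrow> ennreal (norm (g x) powr p)"
        using p by (intro tendsto_ennrealI tendsto_powr' tendsto_norm tendsto_const) auto
      then show ?case by (intro lim_imp_Liminf[symmetric]) auto
    qed
  qed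
  also have "\<dots> \<le> liminf (\<lambda>n. \<integral>\<^sup>+x. ennreal (norm (u n x) powr p) \<partial>\<sigma>)"
    by (rule nn_integral_liminf) measurable
  also have "\<dots> \<le> liminf (\<lambda>n::nat. B)" by (rule Liminf_mono[OF B])
  also have "\<dots> = B" by (simp add: Liminf_const)
  finally show ?thesis .
qed

text \<open>For t > \<delta> write t = t^(1 - p) t^p and use that t^(1 - p) does not increase. On a
  finite measure space this takes the place of Hoelder's inequality: p-th powers control first
  powers up to the free constant \<delta>.\<close>

lemma le_powr_interpolation:
  fixes t \<delta> p :: real
  assumes "0 \<le> t" "0 < \<delta>" "1 \<le> p"
  shows "t \<le> \<delta> + \<delta> powr (1 - p) * t powr p"
proof (cases "t \<le> \<delta>")
  case True
  then show ?thesis by (simp add: add_increasing2)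
next
  case False
  then have t: "t > \<delta>" "t > 0" using assms by auto
  have "t = t powr (1 - p) * t powr p" using t powr_add[of t "1 - p" p] by simp
  also have "\<dots> \<le> \<delta> powr (1 - p) * t powr p"
    using t assms by (intro mult_right_mono powr_mono2') auto
  finally show ?thesis using assms by linarith
qed

lemma AE_summable_norm:
  fixes d :: "nat \<Rightarrow> vec3 \<Rightarrow> vec3"
  assumes [measurable]: "\<And>n. d n \<in> borel_measurable \<sigma>"
    and b: "\<And>n. (\<integral>\<^sup>+x. ennreal (norm (d n x)) \<partial>\<sigma>) \<le> ennreal (b n)" "\<And>n. 0 \<le> b n" "summable b"
  shows "AE x in \<sigma>. summable (\<lambda>n. norm (d n x))"
proof -
  have "(\<integral>\<^sup>+x. (\<Sum>n. ennreal (norm (d n x))) \<partial>\<sigma>) = (\<Sum>n. \<integral>\<^sup>+x. ennreal (norm (d n x)) \<partial>\<sigma>)"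
    by (rule nn_integral_suminf) measurable
  also have "\<dots> \<le> (\<Sum>n. ennreal (b n))" by (intro suminf_le b) auto
  also have "\<dots> < top" using suminf_ennreal2[OF b(2,3)] by simp
  finally have "AE x in \<sigma>. (\<Sum>n. ennreal (norm (d n x))) \<noteq> \<infinity>"
    by (intro nn_integral_PInf_AE) auto
  then show ?thesis by eventually_elim (auto intro: summable_suminf_not_top)
qed

text \<open>The argument of Riesz and Fischer: the norms of consecutive differences have summable
  integrals, so the sequence converges almost everywhere, and Fatou's lemma carries the Cauchy
  estimate over to the limit.\<close>

lemma Lp_complete_rapid:
  assumes p: "1 \<le> p" and u: "\<And>n. u n \<in> Lp_S p" and C: "0 \<le> C"
    and c: "\<And>n m. n \<le> m \<Longrightarrow> Np p (\<lambda>x. u m x - u n x) \<le> C * ((1/2) ^ n) powr p"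
  shows "\<exists>g. Lp_lim p u g"
proof -
  note [measurable] = Lp_S_measurable[OF u]
  have p0: "0 \<le> p" "0 < p" using p by auto
  note D = Lp_S_diff(1)[OF u u p0(1)]
  define d where "d n x = u (Suc n) x - u n x" for n x
  define m where "m = measure \<sigma> (sphere 0 1)"
  have dL: "d n \<in> Lp_S p" for n unfolding d_def by (rule D)
  note [measurable] = Lp_S_measurable[OF dL]
  have "AE x in \<sigma>. summable (\<lambda>n. norm (d n x))"
  proof (rule AE_summable_norm)
    fix n
    \<comment> \<open>With this value, matching the rate in the hypothesis, both terms of the
      interpolation are of order 2^(-n).\<close>
    let ?\<delta> = "(1/2 :: real) ^ n"
    have i: "integrable \<sigma> (\<lambda>x. ?\<delta> + ?\<delta> powr (1 - p) * norm (d n x) powr p)"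
      by (intro Bochner_Integration.integrable_add integrable_mult_right Lp_S_integrable[OF dL]) simp
    have "(\<integral>\<^sup>+x. ennreal (norm (d n x)) \<partial>\<sigma>) \<le> (\<integral>\<^sup>+x. ennreal (?\<delta> + ?\<delta> powr (1 - p) * norm (d n x) powr p) \<partial>\<sigma>)"
      using p by (intro nn_integral_mono ennreal_leI le_powr_interpolation) auto
    also have "\<dots> = ennreal (\<integral>x. ?\<delta> + ?\<delta> powr (1 - p) * norm (d n x) powr p \<partial>\<sigma>)"
      by (rule nn_integral_eq_integral[OF i]) auto
    also have "(\<integral>x. ?\<delta> + ?\<delta> powr (1 - p) * norm (d n x) powr p \<partial>\<sigma>) = ?\<delta> * m + ?\<delta> powr (1 - p) * Np p (d n)"
      using Lp_S_integrable[OF dL] by (simp add: Np_def m_def)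
    also have "\<dots> \<le> ?\<delta> * m + ?\<delta> powr (1 - p) * (C * ?\<delta> powr p)"
      using c[of n "Suc n"] by (intro add_left_mono mult_left_mono) (auto simp: d_def[abs_def])
    also have "?\<delta> powr (1 - p) * (C * ?\<delta> powr p) = C * ?\<delta>"
      using powr_add[of ?\<delta> "1 - p" p] by simp
    finally show "(\<integral>\<^sup>+x. ennreal (norm (d n x)) \<partial>\<sigma>) \<le> ennreal ((1/2) ^ n * m + C * (1/2) ^ n)"
      by (simp add: ennreal_leI)
    show "0 \<le> (1/2) ^ n * m + C * (1/2) ^ n" using C by (simp add: m_def)
  qed (auto intro!: summable_add summable_mult summable_mult2 summable_geometric)
  then have cv: "AE x in \<sigma>. (\<lambda>n. u n x) \<longlonglongrightarrow> lim (\<lambda>n. u n x)"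
  proof eventually_elim
    case (elim x)
    then have "convergent (\<lambda>n. \<Sum>k<n. d k x)" by (simp add: summable_norm_cancel summable_iff_convergent[symmetric])
    then have "convergent (\<lambda>n. (\<Sum>k<n. d k x) + u 0 x)" by (intro convergent_add convergent_const)
    moreover have "(\<Sum>k<n. d k x) + u 0 x = u n x" for n
      unfolding d_def by (subst sum_lessThan_telescope) simp
    ultimately show ?case by (simp add: convergent_LIMSEQ_iff)
  qed
  define g where "g x = lim (\<lambda>n. u n x)" for x
  have [measurable]: "g \<in> borel_measurable \<sigma>" unfolding g_def by measurable
  have B: "(\<integral>\<^sup>+x. ennreal (norm (g x - u n x) powr p) \<partial>\<sigma>) \<le> ennreal (C * ((1/2) ^ n) powr p)" for n
  proof (rule fatou_powr[of "\<lambda>k x. u k x - u n x"])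
    show "AE x in \<sigma>. (\<lambda>k. u k x - u n x) \<longlonglongrightarrow> g x - u n x"
      using cv by eventually_elim (auto simp: g_def intro: tendsto_diff)
    show "\<forall>\<^sub>F k in sequentially. (\<integral>\<^sup>+x. ennreal (norm (u k x - u n x) powr p) \<partial>\<sigma>) \<le> ennreal (C * ((1/2) ^ n) powr p)"
      using c nn_integral_Np[OF D] by (intro eventually_sequentiallyI[of n]) (simp add: ennreal_leI)
  qed (use p in auto)
  have L: "(\<lambda>x. g x - u n x) \<in> Lp_S p" and N: "Np p (\<lambda>x. g x - u n x) \<le> C * ((1/2) ^ n) powr p" for n
    using Lp_S_bounded[OF _ B] C by auto
  have gL: "g \<in> Lp_S p" using Lp_S_add(1)[OF L u p0(1), of 0 0] by simp
  have "Lp_lim p u g"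
  proof (rule Lp_limI[OF u gL])
    show "Np p (\<lambda>x. u n x - g x) \<le> C * ((1/2) ^ n) powr p" for n using N[of n] Np_minus_commute[of p g "u n"] by simp
    have "(\<lambda>n. C * ((1/2) ^ n) powr p) \<longlonglongrightarrow> C * 0 powr p"
      using p by (intro tendsto_intros tendsto_powr' LIMSEQ_realpow_zero) auto
    then show "(\<lambda>n. C * ((1/2) ^ n) powr p) \<longlonglongrightarrow> 0" by simp
  qed
  then show ?thesis by (intro exI[of _ g])
qed

section \<open>Density of polynomial fields\<close>

definition approximable :: "real \<Rightarrow> (vec3 \<Rightarrow> vec3) \<Rightarrow> bool" where
  "approximable p f \<longleftrightarrow> f \<in> Lp_S p \<and> (\<forall>\<epsilon>>0. \<exists>F. vpoly F \<and> Np p (\<lambda>x. f x - F x) \<le> \<epsilon>)"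

lemma approximable_close:
  assumes p: "0 < p" and f: "f \<in> Lp_S p" and g: "\<And>\<epsilon>. 0 < \<epsilon> \<Longrightarrow> \<exists>g. approximable p g \<and> Np p (\<lambda>x. f x - g x) \<le> \<epsilon>"
  shows "approximable p f"
  unfolding approximable_def
proof (intro conjI allI impI f)
  fix \<epsilon> :: real assume e: "0 < \<epsilon>"
  define \<delta> where "\<delta> = \<epsilon> / (2 powr p * 2)"
  have d: "0 < \<delta>" using e by (simp add: \<delta>_def)
  obtain g where g: "approximable p g" "Np p (\<lambda>x. f x - g x) \<le> \<delta>" using g[OF d] by blast
  obtain F where F: "vpoly F" "Np p (\<lambda>x. g x - F x) \<le> \<delta>" using g(1) d by (auto simp: approximable_def)
  have "Np p (\<lambda>x. f x - F x) \<le> 2 powr p * (Np p (\<lambda>x. f x - g x) + Np p (\<lambda>x. g x - F x))"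
    using f g(1) p Lp_S_vpoly[OF F(1) p] by (intro Np_triangle) (auto simp: approximable_def)
  also have "\<dots> \<le> 2 powr p * (\<delta> + \<delta>)" using g F by (intro mult_left_mono add_mono) auto
  also have "\<dots> = \<epsilon>" by (simp add: \<delta>_def)
  finally show "\<exists>F. vpoly F \<and> Np p (\<lambda>x. f x - F x) \<le> \<epsilon>" using F(1) by blast
qed

lemma approximable_continuous:
  assumes p: "0 < p" and f: "continuous_on (sphere 0 1) f"
  shows "approximable p f"
  unfolding approximable_def
proof (intro conjI allI impI Lp_S_continuous[OF f p])
  fix \<epsilon> :: real assume e: "0 < \<epsilon>"
  define m where "m = measure \<sigma> (sphere 0 1)"
  define \<delta> where "\<delta> = (\<epsilon> / m) powr (1 / p)"
  have m: "0 < m" using sigma_measure_pos by (simp add: m_def)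
  have d: "0 < \<delta>" "\<delta> powr p = \<epsilon> / m" using e p m by (auto simp: \<delta>_def powr_powr)
  obtain F where F: "vpoly F" "\<forall>x. norm x = 1 \<longrightarrow> norm (f x - F x) < \<delta>"
    by (rule vpoly_approx[OF f d(1)])
  have "Np p (\<lambda>x. f x - F x) \<le> (\<integral>x. \<delta> powr p \<partial>\<sigma>)"
    unfolding Np_def
  proof (rule integral_mono)
    show "integrable \<sigma> (\<lambda>x. norm (f x - F x) powr p)"
      by (intro integrable_powr_continuous continuous_on_diff f vpoly_continuous F p)
    show "norm (f x - F x) powr p \<le> \<delta> powr p" if "x \<in> space \<sigma>" for x
      using that F(2) p by (intro powr_mono2) (auto simp: less_imp_le)
  qed simp
  also have "\<dots> = \<epsilon>" using m d by (simp add: m_def)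
  finally show "\<exists>F. vpoly F \<and> Np p (\<lambda>x. f x - F x) \<le> \<epsilon>" using F(1) by blast
qed

lemma approximable_add:
  assumes p: "0 < p" and f: "approximable p f" and g: "approximable p g"
  shows "approximable p (\<lambda>x. f x + g x)"
  unfolding approximable_def
proof (intro conjI allI impI)
  have L: "f \<in> Lp_S p" "g \<in> Lp_S p" using f g by (auto simp: approximable_def)
  then show "(\<lambda>x. f x + g x) \<in> Lp_S p" using p by (intro Lp_S_add) auto
  fix \<epsilon> :: real assume e: "0 < \<epsilon>"
  define \<delta> where "\<delta> = \<epsilon> / (2 powr p * 2)"
  have d: "0 < \<delta>" using e by (simp add: \<delta>_def)
  obtain F where F: "vpoly F" "Np p (\<lambda>x. f x - F x) \<le> \<delta>" using f d by (auto simp: approximable_def)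
  obtain G where G: "vpoly G" "Np p (\<lambda>x. g x - G x) \<le> \<delta>" using g d by (auto simp: approximable_def)
  have "Np p (\<lambda>x. (f x - F x) + (g x - G x)) \<le> 2 powr p * (Np p (\<lambda>x. f x - F x) + Np p (\<lambda>x. g x - G x))"
    using L p Lp_S_vpoly[OF F(1) p] Lp_S_vpoly[OF G(1) p] by (intro Lp_S_add Lp_S_diff) auto
  also have "\<dots> \<le> 2 powr p * (\<delta> + \<delta>)" using G F by (intro mult_left_mono add_mono) auto
  also have "\<dots> = \<epsilon>" by (simp add: \<delta>_def)
  finally have "Np p (\<lambda>x. f x + g x - (F x + G x)) \<le> \<epsilon>" by (simp add: add_diff_add)
  then show "\<exists>F. vpoly F \<and> Np p (\<lambda>x. f x + g x - F x) \<le> \<epsilon>" using vpoly_add[OF F(1) G(1)] by blast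
qed

lemma Np_dominated_limit:
  fixes u :: "nat \<Rightarrow> vec3 \<Rightarrow> vec3"
  assumes p: "0 < p" and [measurable]: "\<And>n. u n \<in> borel_measurable \<sigma>" "f \<in> borel_measurable \<sigma>"
    and w: "integrable \<sigma> w" "\<And>n x. norm x = 1 \<Longrightarrow> norm (f x - u n x) powr p \<le> w x"
    and l: "\<And>x. norm x = 1 \<Longrightarrow> (\<lambda>n. u n x) \<longlonglongrightarrow> f x"
  shows "(\<lambda>n. Np p (\<lambda>x. f x - u n x)) \<longlonglongrightarrow> 0"
proof -
  have "(\<lambda>n. \<integral>x. norm (f x - u n x) powr p \<partial>\<sigma>) \<longlonglongrightarrow> (\<integral>x. 0 \<partial>\<sigma>)"
  proof (rule integral_dominated_convergence[where w = w])
    have "(\<lambda>n. norm (f x - u n x) powr p) \<longlonglongrightarrow> norm (f x - f x) powr p" if "norm x = 1" for x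
      using p l[OF that] by (intro tendsto_powr' tendsto_norm tendsto_diff tendsto_const) auto
    then show "AE x in \<sigma>. (\<lambda>n. norm (f x - u n x) powr p) \<longlonglongrightarrow> 0" using p by (intro AE_I2) auto
  qed (use w in \<open>auto intro: AE_I2\<close>)
  then show ?thesis by (simp add: Np_def)
qed

lemma approximable_limit:
  assumes p: "0 < p" and "\<And>n. approximable p (u n)" "f \<in> Lp_S p" "(\<lambda>n. Np p (\<lambda>x. f x - u n x)) \<longlonglongrightarrow> 0"
  shows "approximable p f"
proof (rule approximable_close[OF p assms(3)])
  fix \<epsilon> :: real assume "0 < \<epsilon>"
  with assms(4) have "\<forall>\<^sub>F n in sequentially. Np p (\<lambda>x. f x - u n x) < \<epsilon>" by (auto dest: order_tendstoD)
  then obtain n where "Np p (\<lambda>x. f x - u n x) < \<epsilon>" by (auto simp: eventually_sequentially)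
  then show "\<exists>g. approximable p g \<and> Np p (\<lambda>x. f x - g x) \<le> \<epsilon>" using assms(2) less_imp_le by blast
qed

lemma approximable_indicator_compact:
  assumes p: "0 < p" and K: "compact K"
  shows "approximable p (\<lambda>x. indicator K x *\<^sub>R (c :: vec3))"
proof (cases "K = {}")
  case True
  then show ?thesis using approximable_continuous[OF p, of "\<lambda>x. 0"] by simp
next
  case False
  \<comment> \<open>Continuous cut-off functions that decrease to the indicator of
    \<open>K\<close>.\<close>
  define u where "u n x = max 0 (1 - real n * infdist x K) *\<^sub>R c" for n x
  have cu: "continuous_on UNIV (u n)" for n
    unfolding u_def by (intro continuous_on_scaleR continuous_on_max continuous_on_diff continuous_on_mult
        continuous_on_infdist continuous_on_const continuous_on_id)
  have [measurable]: "u n \<in> borel_measurable \<sigma>" for n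
    by (intro borel_measurable_sigma borel_measurable_continuous_onI cu)
  have [measurable]: "(\<lambda>x. indicator K x *\<^sub>R c) \<in> borel_measurable \<sigma>"
    using compact_imp_closed[OF K] by (intro borel_measurable_sigma) simp
  show ?thesis
  proof (rule approximable_limit[OF p])
    show "approximable p (u n)" for n by (intro approximable_continuous p continuous_on_subset[OF cu]) auto
    have "(\<lambda>x. norm (indicator K x *\<^sub>R c) powr p) = (\<lambda>x. indicator K x *\<^sub>R (norm c powr p))"
      using p by (auto simp: fun_eq_iff indicator_def)
    moreover have "integrable \<sigma> (\<lambda>x. indicator K x *\<^sub>R (norm c powr p))"
    proof (rule sigma.integrable_const_bound[where B = "norm c powr p"])
      have [measurable]: "K \<in> sets borel" using compact_imp_closed[OF K] by simp
      show "(\<lambda>x. indicator K x *\<^sub>R (norm c powr p)) \<in> borel_measurable \<sigma>"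
        by (intro borel_measurable_sigma) measurable
    qed (auto simp: indicator_def)
    ultimately show "(\<lambda>x. indicator K x *\<^sub>R c) \<in> Lp_S p" by (simp add: Lp_S_iff)
    show "(\<lambda>n. Np p (\<lambda>x. indicator K x *\<^sub>R c - u n x)) \<longlonglongrightarrow> 0"
    proof (rule Np_dominated_limit[OF p])
      show "integrable \<sigma> (\<lambda>x. norm c powr p)" by simp
      fix x :: vec3
      have i: "x \<in> K \<longleftrightarrow> infdist x K = 0" using K False by (intro in_closed_iff_infdist_zero compact_imp_closed)
      show "norm (indicator K x *\<^sub>R c - u n x) powr p \<le> norm c powr p" for n
      proof (rule powr_mono2)
        have "indicator K x *\<^sub>R c - u n x = (indicator K x - max 0 (1 - real n * infdist x K)) *\<^sub>R c"
          by (simp add: u_def algebra_simps)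
        moreover have "\<bar>indicator K x - max 0 (1 - real n * infdist x K)\<bar> \<le> 1"
          using i infdist_nonneg[of x K] by (auto simp: indicator_def)
        ultimately show "norm (indicator K x *\<^sub>R c - u n x) \<le> norm c" by (simp add: mult_left_le_one_le)
      qed (use p in auto)
      show "(\<lambda>n. u n x) \<longlonglongrightarrow> indicator K x *\<^sub>R c"
      proof (cases "x \<in> K")
        case True
        then show ?thesis using i by (simp add: u_def)
      next
        case False
        then have pos: "infdist x K > 0" using i infdist_nonneg[of x K] by linarith
        have "\<forall>\<^sub>F n in sequentially. u n x = 0"
        proof (rule eventually_sequentiallyI[of "nat \<lceil>1 / infdist x K\<rceil>"])
          fix n assume "nat \<lceil>1 / infdist x K\<rceil> \<le> n"
          then have "1 / infdist x K \<le> real n" by linarith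
          then have "1 - real n * infdist x K \<le> 0" using pos by (simp add: field_simps)
          then show "u n x = 0" by (simp add: u_def)
        qed
        then show ?thesis using False tendsto_eventually by simp
      qed
    qed auto
  qed
qed

lemma approximable_indicator:
  assumes p: "0 < p" and A: "A \<in> sets \<sigma>"
  shows "approximable p (\<lambda>x. indicator A x *\<^sub>R (c :: vec3))"
proof -
  have AB: "A \<in> sets borel" "A \<subseteq> sphere 0 1"
    using A by (auto simp: sets_sigma sets_restrict_space)
  \<comment> \<open>\<open>inner_regular\<close> concerns Borel measures on the whole space, so
    \<sigma> is pushed forward along the inclusion of the sphere.\<close>
  define M where "M = distr \<sigma> borel (\<lambda>x. x)"
  have M: "emeasure M B = emeasure \<sigma> (B \<inter> sphere 0 1)" if "B \<in> sets borel" for B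
    using that by (simp add: M_def emeasure_distr measurable_sigma_borel vimage_def Int_def)
  have "\<exists>g. approximable p g \<and> Np p (\<lambda>x. indicator A x *\<^sub>R c - g x) \<le> \<epsilon>" if e: "0 < \<epsilon>" for \<epsilon>
  proof -
    define \<delta> where "\<delta> = \<epsilon> / (norm c powr p + 1)"
    have d: "0 < \<delta>" using e by (simp add: \<delta>_def add_nonneg_pos)
    have "emeasure M A = (SUP K \<in> {K. K \<subseteq> A \<and> compact K}. emeasure M K)"
    proof (rule inner_regular)
      show "emeasure M (space M) \<noteq> \<infinity>" using M[of UNIV] by (simp add: M_def)
    qed (use AB in \<open>auto simp: M_def\<close>)
    moreover have "emeasure M A = ennreal (measure \<sigma> A)"
      using M[OF AB(1)] AB(2) by (simp add: Int_absorb2 sigma.emeasure_eq_measure)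
    ultimately have s: "ennreal (measure \<sigma> A) = (SUP K \<in> {K. K \<subseteq> A \<and> compact K}. emeasure M K)" by simp
    have "\<exists>K. K \<subseteq> A \<and> compact K \<and> measure \<sigma> A - \<delta> < measure \<sigma> K"
    proof (cases "measure \<sigma> A - \<delta> < 0")
      case True
      then show ?thesis by (intro exI[of _ "{}"]) simp
    next
      case False
      then have "ennreal (measure \<sigma> A - \<delta>) < (SUP K \<in> {K. K \<subseteq> A \<and> compact K}. emeasure M K)"
        unfolding s[symmetric] using d by (intro ennreal_lessI) auto
      then obtain K where K: "K \<subseteq> A" "compact K" "ennreal (measure \<sigma> A - \<delta>) < emeasure M K"
        by (auto simp: less_SUP_iff)
      have "K \<in> sets borel" using compact_imp_closed[OF K(2)] by simp
      then have "emeasure M K = ennreal (measure \<sigma> K)"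
        using M AB(2) K(1) by (simp add: Int_absorb2 sigma.emeasure_eq_measure)
      then show ?thesis using K False by (auto simp: ennreal_less_iff)
    qed
    then obtain K where K: "K \<subseteq> A" "compact K" "measure \<sigma> A - \<delta> < measure \<sigma> K" by blast
    have KS: "K \<in> sets \<sigma>"
      using K AB compact_imp_closed[OF K(2)] by (auto simp: sets_sigma sets_restrict_space intro!: image_eqI[of _ _ K])
    have "Np p (\<lambda>x. indicator A x *\<^sub>R c - indicator K x *\<^sub>R c) = (\<integral>x. norm c powr p * indicator (A - K) x \<partial>\<sigma>)"
      unfolding Np_def using K(1) p by (intro Bochner_Integration.integral_cong) (auto simp: indicator_def)
    also have "\<dots> = norm c powr p * (measure \<sigma> A - measure \<sigma> K)"
      using sigma.finite_measure_Diff[OF A KS K(1)] A KS sets.sets_into_space[OF A] by (simp add: Int_absorb1 Int_absorb2 subset_eq)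
    also have "\<dots> \<le> norm c powr p * \<delta>" using K(3) by (intro mult_left_mono) auto
    also have "\<dots> \<le> (norm c powr p + 1) * \<delta>" using d by (intro mult_right_mono) auto
    also have "\<dots> = \<epsilon>" using add_nonneg_pos[of "norm c powr p" 1] by (simp add: \<delta>_def)
    finally show ?thesis using approximable_indicator_compact[OF p K(2), of c] by blast
  qed
  moreover have "(\<lambda>x. indicator A x *\<^sub>R c) \<in> Lp_S p"
  proof -
    have "(\<lambda>x. norm (indicator A x *\<^sub>R c) powr p) = (\<lambda>x. indicator A x *\<^sub>R (norm c powr p))"
      using p by (auto simp: fun_eq_iff indicator_def)
    moreover have "integrable \<sigma> (indicat_real A)"
      using A by (intro integrable_real_indicator) (auto simp: sigma.emeasure_eq_measure)
    ultimately show ?thesis using A by (simp add: Lp_S_iff)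
  qed
  ultimately show ?thesis using p by (intro approximable_close) auto
qed

lemma approximable_cong:
  assumes "approximable p f" "g \<in> borel_measurable \<sigma>" "\<And>x. norm x = 1 \<Longrightarrow> f x = g x"
  shows "approximable p g"
proof -
  have "Np p (\<lambda>x. g x - F x) = Np p (\<lambda>x. f x - F x)" for F using assms(3) by (intro Np_cong) auto
  moreover have "integrable \<sigma> (\<lambda>x. norm (g x) powr p) \<longleftrightarrow> integrable \<sigma> (\<lambda>x. norm (f x) powr p)"
    using assms(3) by (intro Bochner_Integration.integrable_cong) auto
  ultimately show ?thesis using assms(1,2) by (auto simp: approximable_def Lp_S_iff)
qed

theorem vpoly_dense:
  assumes p: "0 < p" and f: "f \<in> Lp_S p"
  shows "approximable p f"
proof -
  note [measurable] = Lp_S_measurable[OF f]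
  obtain s where s0: "\<forall>i. simple_function \<sigma> (s i)" "\<forall>x\<in>space \<sigma>. (\<lambda>i. s i x) \<longlonglongrightarrow> f x"
    "\<forall>i. \<forall>x\<in>space \<sigma>. dist (s i x) 0 \<le> 2 * dist (f x) 0"
    using borel_measurable_implies_sequence_metric[OF Lp_S_measurable[OF f], of 0] by (elim exE conjE) (rule that)
  have s: "simple_function \<sigma> (s i)" "norm x = 1 \<Longrightarrow> (\<lambda>i. s i x) \<longlonglongrightarrow> f x" "norm x = 1 \<Longrightarrow> norm (s i x) \<le> 2 * norm (f x)" for i x
    using s0 by auto
  have [measurable]: "s i \<in> borel_measurable \<sigma>" for i using s(1) by (rule borel_measurable_simple_function)
  have a: "approximable p h" if "simple_function \<sigma> h" for h
    using that sigma.emeasure_finite[of "{y \<in> space \<sigma>. h y \<noteq> 0}", folded infinity_ennreal_def]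
  proof (induction rule: integrable_simple_function_induct)
    case (cong f g)
    then show ?case using approximable_cong[of p f g] borel_measurable_simple_function[of \<sigma> g] by auto
  next
    case (indicator A y)
    then show ?case by (intro approximable_indicator p)
  next
    case (add f g)
    then show ?case by (intro approximable_add p)
  qed
  show ?thesis
  proof (rule approximable_limit[OF p a[OF s(1)] f])
    show "(\<lambda>n. Np p (\<lambda>x. f x - s n x)) \<longlonglongrightarrow> 0"
    proof (rule Np_dominated_limit[OF p])
      show "integrable \<sigma> (\<lambda>x. 3 powr p * norm (f x) powr p)" by (intro integrable_mult_right Lp_S_integrable[OF f])
      fix n and x :: vec3 assume x: "norm x = 1"
      have "norm (f x - s n x) \<le> 3 * norm (f x)"
        using norm_triangle_ineq4[of "f x" "s n x"] s(3)[of x n] x by simp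
      then have "norm (f x - s n x) powr p \<le> (3 * norm (f x)) powr p" using p by (intro powr_mono2) auto
      then show "norm (f x - s n x) powr p \<le> 3 powr p * norm (f x) powr p" by (simp add: powr_mult)
    qed (use s in auto)
  qed
qed

section \<open>Extension of bounded operators from polynomial fields\<close>

lemma vpoly_rapid_approx:
  assumes p: "0 < p" and f: "f \<in> Lp_S p"
  obtains F where "\<And>n. vpoly (F n)" "\<And>n. Np p (\<lambda>x. F n x - f x) \<le> ((1/2) ^ n) powr p" "Lp_lim p F f"
proof -
  have "\<exists>F. vpoly F \<and> Np p (\<lambda>x. F x - f x) \<le> ((1/2) ^ n) powr p" for n :: nat
    using vpoly_dense[OF p f] Np_minus_commute[of p f] by (simp add: approximable_def)
  then have "\<exists>F. \<forall>n :: nat. vpoly (F n) \<and> Np p (\<lambda>x. F n x - f x) \<le> ((1/2) ^ n) powr p" by (intro choice allI)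
  then obtain F where F: "\<forall>n :: nat. vpoly (F n) \<and> Np p (\<lambda>x. F n x - f x) \<le> ((1/2) ^ n) powr p" by (rule exE)
  have "Lp_lim p F f"
  proof (rule Lp_limI)
    show "F n \<in> Lp_S p" for n using F p by (intro Lp_S_vpoly) auto
    show "Np p (\<lambda>x. F n x - f x) \<le> ((1/2) ^ n) powr p" for n using F[THEN spec, of n] by blast
    have "(\<lambda>n. ((1/2 :: real) ^ n) powr p) \<longlonglongrightarrow> 0 powr p"
      using p by (intro tendsto_powr' tendsto_const LIMSEQ_realpow_zero) auto
    then show "(\<lambda>n. ((1/2 :: real) ^ n) powr p) \<longlonglongrightarrow> 0" by simp
  qed (rule f)
  then show thesis using F that[of F] by simp
qed

text \<open>Demanded of every polynomial sequence converging to \<open>f\<close>, not of a chosen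
  one. Since functions and not classes are extended, this is what determines \<open>P f\<close>
  almost everywhere and lets linearity and idempotence pass to the limit.\<close>

definition extends_by_limits :: "real \<Rightarrow> ((vec3 \<Rightarrow> vec3) \<Rightarrow> vec3 \<Rightarrow> vec3) \<Rightarrow> ((vec3 \<Rightarrow> vec3) \<Rightarrow> vec3 \<Rightarrow> vec3) \<Rightarrow> bool" where
  "extends_by_limits p T P \<longleftrightarrow>
    (\<forall>f F. (\<forall>n. vpoly (F n)) \<longrightarrow> Lp_lim p F f \<longrightarrow> Lp_lim p (\<lambda>n. T (F n)) (P f))"

lemma extends_by_limitsD:
  "extends_by_limits p T P \<Longrightarrow> (\<And>n. vpoly (F n)) \<Longrightarrow> Lp_lim p F f \<Longrightarrow> Lp_lim p (\<lambda>n. T (F n)) (P f)"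
  by (simp add: extends_by_limits_def)

lemma extension_exists:
  assumes p: "1 \<le> p" and T: "\<And>F. vpoly F \<Longrightarrow> vpoly (T F)"
    and lin: "\<And>F G. vpoly F \<Longrightarrow> vpoly G \<Longrightarrow> T (\<lambda>x. F x - G x) = (\<lambda>x. T F x - T G x)"
    and K: "0 \<le> K" "\<And>F. vpoly F \<Longrightarrow> Np p (T F) \<le> K * Np p F"
  shows "\<exists>P. extends_by_limits p T P"
proof -
  have p0: "0 \<le> p" "0 < p" using p by auto
  \<comment> \<open>One rapidly convergent sequence produces \<open>g\<close>; by the estimate
    \<open>TD\<close> the images of any other sequence approach the same \<open>g\<close>.\<close>
  have *: "\<exists>g. \<forall>G. (\<forall>n. vpoly (G n)) \<longrightarrow> Lp_lim p G f \<longrightarrow> Lp_lim p (\<lambda>n. T (G n)) g" if f: "f \<in> Lp_S p" for f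
  proof -
    obtain F where F: "\<And>n. vpoly (F n)" "\<And>n. Np p (\<lambda>x. F n x - f x) \<le> ((1/2) ^ n) powr p" "Lp_lim p F f"
      by (rule vpoly_rapid_approx[OF p0(2) f]) (rule that)
    have L: "F n \<in> Lp_S p" "T (F n) \<in> Lp_S p" for n using F(1) T p0(2) by (auto intro: Lp_S_vpoly)
    have TD: "Np p (\<lambda>x. T G x - T H x) \<le> K * (2 powr p * (Np p (\<lambda>x. G x - f x) + Np p (\<lambda>x. H x - f x)))"
      if "vpoly G" "vpoly H" for G H
    proof -
      have "Np p (\<lambda>x. T G x - T H x) \<le> K * Np p (\<lambda>x. G x - H x)"
        using K(2)[of "\<lambda>x. G x - H x"] lin that by (simp add: vpoly_diff)
      also have "\<dots> \<le> K * (2 powr p * (Np p (\<lambda>x. G x - f x) + Np p (\<lambda>x. f x - H x)))"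
        using Lp_S_vpoly[OF that(1) p0(2)] Lp_S_vpoly[OF that(2) p0(2)] p0 f K(1) by (intro mult_left_mono Np_triangle)
      finally show ?thesis by (simp add: Np_minus_commute[of p f])
    qed
    have "\<exists>g. Lp_lim p (\<lambda>n. T (F n)) g"
    proof (rule Lp_complete_rapid[OF p L(2)])
      show "0 \<le> K * 2 powr p * 2" using K by simp
      fix n m :: nat assume nm: "n \<le> m"
      have "((1/2 :: real) ^ m) powr p \<le> ((1/2) ^ n) powr p"
        using p0 nm by (intro powr_mono2 power_decreasing) auto
      then have "Np p (\<lambda>x. F m x - f x) + Np p (\<lambda>x. F n x - f x) \<le> 2 * ((1/2) ^ n) powr p"
        using F(2)[of m] F(2)[of n] by linarith
      then have "K * (2 powr p * (Np p (\<lambda>x. F m x - f x) + Np p (\<lambda>x. F n x - f x))) \<le> K * (2 powr p * (2 * ((1/2) ^ n) powr p))"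
        using K by (intro mult_left_mono) auto
      with TD[OF F(1) F(1), of m n] show "Np p (\<lambda>x. T (F m) x - T (F n) x) \<le> K * 2 powr p * 2 * ((1/2) ^ n) powr p"
        by (simp only: mult.assoc)
    qed
    then obtain g where g: "Lp_lim p (\<lambda>n. T (F n)) g" by (rule exE)
    have gL: "g \<in> Lp_S p" using g by (simp add: Lp_lim_def)
    have "Lp_lim p (\<lambda>n. T (G n)) g" if G: "\<forall>n. vpoly (G n)" "Lp_lim p G f" for G
    proof (rule Lp_limI)
      show GL: "T (G n) \<in> Lp_S p" for n using G T p0(2) by (intro Lp_S_vpoly) auto
      show "Np p (\<lambda>x. T (G n) x - g x) \<le> 2 powr p * (K * (2 powr p * (Np p (\<lambda>x. G n x - f x) + Np p (\<lambda>x. F n x - f x))) + Np p (\<lambda>x. T (F n) x - g x))" for n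
        using Np_triangle[OF GL L(2) gL p0(1), of n n] TD[of "G n" "F n"] G F(1)
        by (smt (verit) mult_left_mono powr_ge_zero)
      have "(\<lambda>n. 2 powr p * (K * (2 powr p * (Np p (\<lambda>x. G n x - f x) + Np p (\<lambda>x. F n x - f x))) + Np p (\<lambda>x. T (F n) x - g x)))
          \<longlonglongrightarrow> 2 powr p * (K * (2 powr p * (0 + 0)) + 0)"
        using G(2) F(3) g unfolding Lp_lim_def by (intro tendsto_intros) auto
      then show "(\<lambda>n. 2 powr p * (K * (2 powr p * (Np p (\<lambda>x. G n x - f x) + Np p (\<lambda>x. F n x - f x))) + Np p (\<lambda>x. T (F n) x - g x))) \<longlonglongrightarrow> 0"
        by simp
    qed (rule gL)
    then show ?thesis by blast
  qed
  define P where "P f = (SOME g. \<forall>G. (\<forall>n. vpoly (G n)) \<longrightarrow> Lp_lim p G f \<longrightarrow> Lp_lim p (\<lambda>n. T (G n)) g)" for f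
  have "\<forall>G. (\<forall>n. vpoly (G n)) \<longrightarrow> Lp_lim p G f \<longrightarrow> Lp_lim p (\<lambda>n. T (G n)) (P f)" if "f \<in> Lp_S p" for f
    unfolding P_def by (rule someI_ex[OF *[OF that]])
  then have "extends_by_limits p T P" unfolding extends_by_limits_def by (auto simp: Lp_lim_def)
  then show ?thesis by (intro exI[of _ P])
qed

text \<open>The polynomial bound passes to the limit through two triangle inequalities, each of
  which costs 2^p.\<close>

lemma extension_bounded:
  assumes p: "1 \<le> p" and T: "\<And>F. vpoly F \<Longrightarrow> vpoly (T F)" and P: "extends_by_limits p T P"
    and K: "0 \<le> K" "\<And>F. vpoly F \<Longrightarrow> Np p (T F) \<le> K * Np p F" and f: "f \<in> Lp_S p"
  shows "Np p (P f) \<le> 2 powr p * K * 2 powr p * Np p f"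
proof -
  have p0: "0 \<le> p" "0 < p" using p by auto
  obtain F where F: "\<And>n. vpoly (F n)" "\<And>n. Np p (\<lambda>x. F n x - f x) \<le> ((1/2) ^ n) powr p" "Lp_lim p F f"
    by (rule vpoly_rapid_approx[OF p0(2) f]) (rule that)
  have l: "Lp_lim p (\<lambda>n. T (F n)) (P f)" by (rule extends_by_limitsD[OF P F(1,3)])
  have L: "F n \<in> Lp_S p" "T (F n) \<in> Lp_S p" "P f \<in> Lp_S p" for n
    using F(1) T p0(2) l by (auto intro: Lp_S_vpoly simp: Lp_lim_def)
  have b: "Np p (P f) \<le> 2 powr p * (Np p (\<lambda>x. T (F n) x - P f x) + K * (2 powr p * (Np p (\<lambda>x. F n x - f x) + Np p f)))" for n
  proof -
    have "Np p (P f) \<le> 2 powr p * (Np p (\<lambda>x. P f x - T (F n) x) + Np p (T (F n)))"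
      using Lp_S_add(2)[OF Lp_S_diff(1)[OF L(3,2) p0(1)] L(2) p0(1), of n n] by simp
    also have "Np p (T (F n)) \<le> K * Np p (F n)" by (intro K F)
    also have "Np p (F n) \<le> 2 powr p * (Np p (\<lambda>x. F n x - f x) + Np p f)"
      using Lp_S_add(2)[OF Lp_S_diff(1)[OF L(1) f p0(1)] f p0(1), of n] by simp
    finally show ?thesis using K(1) by (simp add: mult_left_mono Np_minus_commute[of p "P f"])
  qed
  have "(\<lambda>n. 2 powr p * (Np p (\<lambda>x. T (F n) x - P f x) + K * (2 powr p * (Np p (\<lambda>x. F n x - f x) + Np p f))))
    \<longlonglongrightarrow> 2 powr p * (0 + K * (2 powr p * (0 + Np p f)))"
    using l F(3) unfolding Lp_lim_def by (intro tendsto_intros) auto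
  from LIMSEQ_le_const[OF this, of "Np p (P f)"] b show ?thesis by (auto simp: mult.assoc)
qed

lemma Lp_lim_AE_cong:
  assumes "Lp_lim p u f" "AE x in \<sigma>. f x = g x" "g \<in> Lp_S p"
  shows "Lp_lim p u g"
proof -
  have [measurable]: "u n \<in> borel_measurable \<sigma>" "f \<in> borel_measurable \<sigma>" "g \<in> borel_measurable \<sigma>" for n
    using assms by (auto simp: Lp_lim_def intro: Lp_S_measurable[of _ p])
  have "Np p (\<lambda>x. u n x - g x) = Np p (\<lambda>x. u n x - f x)" for n
  proof (rule Np_AE_cong)
    show "AE x in \<sigma>. u n x - g x = u n x - f x" using assms(2) by eventually_elim simp
  qed measurable
  then show ?thesis using assms by (simp add: Lp_lim_def)
qed

lemma Lp_projection_extendingI: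
  assumes p: "1 < p" and T: "\<And>F. vpoly F \<Longrightarrow> vpoly (T F)"
    and lin: "\<And>F G a b. vpoly F \<Longrightarrow> vpoly G \<Longrightarrow> T (\<lambda>x. a *\<^sub>R F x + b *\<^sub>R G x) = (\<lambda>x. a *\<^sub>R T F x + b *\<^sub>R T G x)"
    and idem: "\<And>F. vpoly F \<Longrightarrow> T (T F) = T F"
    and K: "0 \<le> K" "\<And>F. vpoly F \<Longrightarrow> Np p (T F) \<le> K * Np p F"
    and P: "extends_by_limits p T P"
    and smooth: "\<And>f. smooth_field f \<Longrightarrow> AE x in \<sigma>. P f x = \<pi> f x"
  shows "Lp_projection_extending p P \<pi>"
  unfolding Lp_projection_extending_def
proof (intro conjI ballI allI impI)
  have p0: "0 \<le> p" "0 < p" using p by auto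
  have ap: "\<exists>F. (\<forall>n. vpoly (F n)) \<and> Lp_lim p F f" if "f \<in> Lp_S p" for f
    using vpoly_rapid_approx[OF p0(2) that] by metis
  show PL: "P f \<in> Lp_S p" if f: "f \<in> Lp_S p" for f
  proof -
    obtain F where "\<forall>n. vpoly (F n)" "Lp_lim p F f" using ap[OF f] by blast
    then show ?thesis using extends_by_limitsD[OF P, of F f] by (simp add: Lp_lim_def)
  qed
  fix f assume f: "f \<in> Lp_S p"
  obtain F where F: "\<forall>n. vpoly (F n)" "Lp_lim p F f" using ap[OF f] by blast
  have PF: "Lp_lim p (\<lambda>n. T (F n)) (P f)" using F by (intro extends_by_limitsD[OF P]) auto
  have "Lp_lim p (\<lambda>n. T (T (F n))) (P (P f))" using F T by (intro extends_by_limitsD[OF P _ PF]) auto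
  then have "Lp_lim p (\<lambda>n. T (F n)) (P (P f))" using F(1) idem by simp
  from Lp_lim_unique[OF this PF p0(1)] show "AE x in \<sigma>. P (P f) x = P f x" .
  fix g assume g: "g \<in> Lp_S p"
  show "AE x in \<sigma>. P f x = P g x" if e: "AE x in \<sigma>. f x = g x"
  proof -
    have "Lp_lim p (\<lambda>n. T (F n)) (P g)"
      using F by (intro extends_by_limitsD[OF P _ Lp_lim_AE_cong[OF F(2) e g]]) auto
    from Lp_lim_unique[OF PF this p0(1)] show ?thesis .
  qed
  fix a b :: real
  obtain G where G: "\<forall>n. vpoly (G n)" "Lp_lim p G g" using ap[OF g] by blast
  have PG: "Lp_lim p (\<lambda>n. T (G n)) (P g)" using G by (intro extends_by_limitsD[OF P]) auto
  have "Lp_lim p (\<lambda>n. T (\<lambda>x. a *\<^sub>R F n x + b *\<^sub>R G n x)) (P (\<lambda>x. a *\<^sub>R f x + b *\<^sub>R g x))"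
    using F G by (intro extends_by_limitsD[OF P _ Lp_lim_linear[OF F(2) G(2) p0(1)]] vpoly_add vpoly_scaleR) auto
  then have "Lp_lim p (\<lambda>n x. a *\<^sub>R T (F n) x + b *\<^sub>R T (G n) x) (P (\<lambda>x. a *\<^sub>R f x + b *\<^sub>R g x))"
    using F(1) G(1) lin by simp
  from Lp_lim_unique[OF this Lp_lim_linear[OF PF PG p0(1)] p0(1)]
  show "AE x in \<sigma>. P (\<lambda>y. a *\<^sub>R f y + b *\<^sub>R g y) x = a *\<^sub>R P f x + b *\<^sub>R P g x" .
next
  show "\<exists>C. \<forall>f\<in>Lp_S p. Lp_norm p (P f) \<le> C * Lp_norm p f"
  proof (intro exI ballI)
    fix f assume f: "f \<in> Lp_S p"
    have "Lp_norm p (P f) \<le> (2 powr p * K * 2 powr p * Np p f) powr (1 / p)"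
      unfolding Lp_norm_Np using extension_bounded[OF _ T P K f] p by (intro powr_mono2) (auto simp: Np_nonneg)
    also have "\<dots> = (2 powr p * K * 2 powr p) powr (1 / p) * Lp_norm p f"
      using K by (simp add: powr_mult Lp_norm_Np)
    finally show "Lp_norm p (P f) \<le> (2 powr p * K * 2 powr p) powr (1 / p) * Lp_norm p f" .
  qed
qed (rule smooth)

section \<open>The direct sum of the extended projections\<close>

context harmonic_basis
begin

lemma pr_zero: "pr t (\<lambda>x. 0) = (\<lambda>x. 0)"
  using pr_linear[OF vpoly_zero vpoly_zero, of t 0 0] by (simp add: fun_eq_iff)

text \<open>Evaluates \<open>P t1\<close> on the sum \<open>h\<close> in two ways. On approximating
  polynomials \<open>pr t1\<close> annihilates the other two kinds, so the result is
  \<open>P t1 f1\<close>; but \<open>h\<close> vanishes almost everywhere, so the result is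
  0.\<close>

lemma extension_pr_independent:
  assumes p: "1 < p" and P: "\<And>t. extends_by_limits p (pr t) (P t)"
    and f: "f1 \<in> Lp_S p" "f2 \<in> Lp_S p" "f3 \<in> Lp_S p" and t: "t1 \<noteq> t2" "t1 \<noteq> t3"
    and z: "AE x in \<sigma>. P t1 f1 x + P t2 f2 x + P t3 f3 x = 0"
  shows "AE x in \<sigma>. P t1 f1 x = 0"
proof -
  have p0: "0 \<le> p" "0 < p" using p by auto
  have "\<exists>F. (\<forall>n. vpoly (F n)) \<and> Lp_lim p F f" if "f \<in> Lp_S p" for f
    using vpoly_rapid_approx[OF p0(2) that] by metis
  then obtain F1 F2 F3 where F: "\<forall>n. vpoly (F1 n)" "Lp_lim p F1 f1" "\<forall>n. vpoly (F2 n)" "Lp_lim p F2 f2"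
      "\<forall>n. vpoly (F3 n)" "Lp_lim p F3 f3"
    using f by meson
  have l: "Lp_lim p (\<lambda>n. pr t1 (F1 n)) (P t1 f1)" "Lp_lim p (\<lambda>n. pr t2 (F2 n)) (P t2 f2)" "Lp_lim p (\<lambda>n. pr t3 (F3 n)) (P t3 f3)"
    using F by (auto intro!: extends_by_limitsD[OF P])
  define G where "G n x = pr t1 (F1 n) x + pr t2 (F2 n) x + pr t3 (F3 n) x" for n x
  define h where "h x = P t1 f1 x + P t2 f2 x + P t3 f3 x" for x
  have "Lp_lim p (\<lambda>n x. 1 *\<^sub>R (1 *\<^sub>R pr t1 (F1 n) x + 1 *\<^sub>R pr t2 (F2 n) x) + 1 *\<^sub>R pr t3 (F3 n) x)
      (\<lambda>x. 1 *\<^sub>R (1 *\<^sub>R P t1 f1 x + 1 *\<^sub>R P t2 f2 x) + 1 *\<^sub>R P t3 f3 x)"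
    by (intro Lp_lim_linear l p0)
  then have Gh: "Lp_lim p G h" by (simp add: G_def[abs_def] h_def[abs_def])
  have v: "vpoly (pr t1 (F1 n))" "vpoly (pr t2 (F2 n))" "vpoly (pr t3 (F3 n))" for n
    using F by (auto intro: vpoly_pr)
  have "vpoly (G n)" for n unfolding G_def[abs_def] by (intro vpoly_add v)
  from extends_by_limitsD[OF P this Gh] have "Lp_lim p (\<lambda>n. pr t1 (G n)) (P t1 h)" .
  moreover have "pr t1 (G n) = pr t1 (F1 n)" for n
  proof
    fix x
    have a: "pr t (\<lambda>x. U x + V x) x = pr t U x + pr t V x" if "vpoly U" "vpoly V" for t U V
      using pr_linear[OF that, of t 1 1 x] by simp
    have "pr t1 (G n) x = pr t1 (pr t1 (F1 n)) x + pr t1 (pr t2 (F2 n)) x + pr t1 (pr t3 (F3 n)) x"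
      unfolding G_def[abs_def] by (simp add: a v vpoly_add)
    then show "pr t1 (G n) x = pr t1 (F1 n) x" using F t by (simp add: pr_pr)
  qed
  ultimately have 1: "Lp_lim p (\<lambda>n. pr t1 (F1 n)) (P t1 h)" by simp
  have "Lp_lim p (\<lambda>n x. 0) h"
  proof -
    have "(\<lambda>x. 0 :: vec3) \<in> Lp_S p" using p0 by (intro Lp_S_vpoly vpoly_zero)
    then have "Lp_lim p (\<lambda>n x. 0) (\<lambda>x. 0)" using p0 by (simp add: Lp_lim_def Np_def)
    then show ?thesis
      by (rule Lp_lim_AE_cong) (use z Gh in \<open>auto simp: h_def Lp_lim_def\<close>)
  qed
  from extends_by_limitsD[OF P vpoly_zero this, of t1] have 2: "Lp_lim p (\<lambda>n x. 0) (P t1 h)" by (simp add: pr_zero)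
  have "(\<lambda>x. 0 :: vec3) \<in> Lp_S p" using p0 by (intro Lp_S_vpoly vpoly_zero)
  then have 3: "Lp_lim p (\<lambda>n x. 0) (\<lambda>x. 0)" using p0 by (simp add: Lp_lim_def Np_def)
  show ?thesis using Lp_lim_unique[OF 1 l(1) p0(1)] Lp_lim_unique[OF 2 3 p0(1)] by eventually_elim simp
qed

lemma extension_direct_sum:
  assumes p: "1 < p" and P: "\<And>t. extends_by_limits p (pr t) (P t)"
  shows "Lp_direct_sum3 p (P Kelv) (P Grad) (P Tang)"
  unfolding Lp_direct_sum3_def
proof (intro conjI ballI impI)
  have p0: "0 \<le> p" "0 < p" using p by auto
  fix f assume f: "f \<in> Lp_S p"
  obtain F where F: "\<And>n. vpoly (F n)" "\<And>n. Np p (\<lambda>x. F n x - f x) \<le> ((1/2) ^ n) powr p" "Lp_lim p F f"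
    by (rule vpoly_rapid_approx[OF p0(2) f]) (rule that)
  define G where "G n x = pr Kelv (F n) x + pr Grad (F n) x + pr Tang (F n) x" for n x
  have l: "Lp_lim p (\<lambda>n. pr t (F n)) (P t f)" for t by (rule extends_by_limitsD[OF P F(1,3)])
  have "Lp_lim p (\<lambda>n x. 1 *\<^sub>R (1 *\<^sub>R pr Kelv (F n) x + 1 *\<^sub>R pr Grad (F n) x) + 1 *\<^sub>R pr Tang (F n) x)
      (\<lambda>x. 1 *\<^sub>R (1 *\<^sub>R P Kelv f x + 1 *\<^sub>R P Grad f x) + 1 *\<^sub>R P Tang f x)"
    by (intro Lp_lim_linear l p0)
  then have 1: "Lp_lim p G (\<lambda>x. P Kelv f x + P Grad f x + P Tang f x)" by (simp add: G_def[abs_def])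
  have "Np p (\<lambda>x. G n x - f x) = Np p (\<lambda>x. F n x - f x)" for n
    by (rule Np_cong) (simp add: G_def pr_decomposition[OF F(1)])
  then have "Lp_lim p G f" using 1 F(3) by (simp add: Lp_lim_def)
  from Lp_lim_unique[OF this 1 p0(1)] show "AE x in \<sigma>. f x = P Kelv f x + P Grad f x + P Tang f x" .
next
  fix g1 g2 g3
  assume "g1 \<in> P Kelv ` Lp_S p" "g2 \<in> P Grad ` Lp_S p" "g3 \<in> P Tang ` Lp_S p"
    and z: "AE x in \<sigma>. g1 x + g2 x + g3 x = 0"
  then obtain f1 f2 f3 where f: "f1 \<in> Lp_S p" "f2 \<in> Lp_S p" "f3 \<in> Lp_S p"
    and g: "g1 = P Kelv f1" "g2 = P Grad f2" "g3 = P Tang f3" by blast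
  note ind = extension_pr_independent[OF p P]
  show "AE x in \<sigma>. g1 x = 0"
    unfolding g by (rule ind[OF f, where ?t2.0 = Grad and ?t3.0 = Tang]) (use z in \<open>simp_all add: g\<close>)
  show "AE x in \<sigma>. g2 x = 0"
    unfolding g by (rule ind[OF f(2,1,3), where ?t2.0 = Kelv and ?t3.0 = Tang]) (use z in \<open>simp_all add: g add_ac\<close>)
  show "AE x in \<sigma>. g3 x = 0"
    unfolding g by (rule ind[OF f(3,1,2), where ?t2.0 = Kelv and ?t3.0 = Grad]) (use z in \<open>simp_all add: g add_ac\<close>)
qed

end

section \<open>Smooth fields\<close>

text \<open>The 0-homogeneous extension of a smooth field is in general singular at 0, so regularity
  can be asked for only elsewhere.\<close>

definition C1_off_origin :: "(vec3 \<Rightarrow> real) \<Rightarrow> bool" where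
  "C1_off_origin u \<longleftrightarrow> (\<forall>x. x \<noteq> 0 \<longrightarrow> u differentiable (at x)) \<and> (\<forall>i. continuous_on (UNIV - {0}) (pd i u))"

lemma C1_off_origin_differentiable: "C1_off_origin u \<Longrightarrow> x \<noteq> 0 \<Longrightarrow> u differentiable (at x)"
  by (simp add: C1_off_origin_def)

lemma C1_off_origin_continuous: 
  assumes "C1_off_origin u" shows "continuous_on (UNIV - {0}) u"
proof (rule continuous_at_imp_continuous_on, rule ballI)
  fix x :: vec3 assume "x \<in> UNIV - {0}"
  then show "isCont u x" using assms by (intro differentiable_imp_continuous_within C1_off_origin_differentiable) auto
qed

lemma C1_off_origin_add:
  assumes "C1_off_origin u" "C1_off_origin v" shows "C1_off_origin (\<lambda>x. u x + v x)"
  unfolding C1_off_origin_def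
proof (intro conjI allI impI)
  show "(\<lambda>x. u x + v x) differentiable at x" if "x \<noteq> 0" for x
    using assms that by (intro differentiable_add C1_off_origin_differentiable)
  fix i
  have "continuous_on (UNIV - {0}) (\<lambda>x. pd i u x + pd i v x)"
    using assms by (intro continuous_on_add) (auto simp: C1_off_origin_def)
  then show "continuous_on (UNIV - {0}) (pd i (\<lambda>x. u x + v x))"
    by (rule continuous_on_eq) (use assms in \<open>auto simp: pd_add_at C1_off_origin_def\<close>)
qed

lemma C1_off_origin_mult_rpf:
  assumes "rpf g" "C1_off_origin u" shows "C1_off_origin (\<lambda>x. g x * u x)"
  unfolding C1_off_origin_def
proof (intro conjI allI impI)
  show "(\<lambda>x. g x * u x) differentiable at x" if "x \<noteq> 0" for x
    using assms that by (intro differentiable_mult C1_off_origin_differentiable rpf_differentiable)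
  fix i
  have r: "rpf (pd i g)" using assms(1) by simp
  then have "continuous_on (UNIV - {0}) (\<lambda>x. pd i g x * u x + g x * pd i u x)"
    using assms by (intro continuous_on_add continuous_on_mult continuous_on_rpf[OF assms(1)] continuous_on_rpf[OF r]
        C1_off_origin_continuous[OF assms(2)]) (auto simp: C1_off_origin_def)
  then show "continuous_on (UNIV - {0}) (pd i (\<lambda>x. g x * u x))"
    by (rule continuous_on_eq) (use assms in \<open>auto simp: pd_mult_at rpf_differentiable C1_off_origin_def\<close>)
qed

lemma Lop_pd_sum:
  assumes "u differentiable (at x)"
  shows "Lop a u x = cross3 (axis a 1) x $ 1 * pd 1 u x + (cross3 (axis a 1) x $ 2 * pd 2 u x + cross3 (axis a 1) x $ 3 * pd 3 u x)"
  unfolding Lop_def frechet_derivative_pd[OF assms] by (simp add: sum_3)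

lemma rpf_cross_axis: "rpf (\<lambda>x. cross3 (axis a 1) x $ i)"
  using exhaust_3[of i] by (auto simp: cross_components)

lemma continuous_on_Lop:
  assumes u: "C1_off_origin u" shows "continuous_on (UNIV - {0}) (Lop a u)"
proof -
  have "continuous_on (UNIV - {0}) (\<lambda>x. cross3 (axis a 1) x $ 1 * pd 1 u x +
      (cross3 (axis a 1) x $ 2 * pd 2 u x + cross3 (axis a 1) x $ 3 * pd 3 u x))"
    using u by (intro continuous_on_add continuous_on_mult continuous_on_rpf[OF rpf_cross_axis]) (auto simp: C1_off_origin_def)
  then show ?thesis
    by (rule continuous_on_eq) (use u in \<open>auto simp: Lop_pd_sum C1_off_origin_def\<close>)
qed

lemma Lop_C1_by_parts:
  assumes u: "C1_off_origin u" and g: "rpf g"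
  shows "(\<integral>x. Lop a u x * g x \<partial>\<sigma>) = - (\<integral>x. u x * Lop a g x \<partial>\<sigma>)"
proof -
  have S: "sphere 0 1 \<subseteq> UNIV - {0 :: vec3}" by auto
  have ne: "x \<noteq> 0" if "norm x = 1" for x :: vec3 using that by auto
  have gu: "C1_off_origin (\<lambda>x. g x * u x)" by (rule C1_off_origin_mult_rpf[OF g u])
  have "(\<integral>x. Lop a (\<lambda>x. g x * u x) x \<partial>\<sigma>) = 0"
    unfolding Lop_def
  proof (rule integral_frechet_rot_zero)
    show "(\<lambda>x. g x * u x) differentiable at x" if "norm x = 1" for x
      using gu ne[OF that] by (rule C1_off_origin_differentiable)
    show "continuous_on (sphere 0 1) (\<lambda>x. frechet_derivative (\<lambda>x. g x * u x) (at x) (cross3 (axis a 1) x))"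
      using continuous_on_subset[OF continuous_on_Lop[OF gu, of a] S] by (simp add: Lop_def[abs_def])
  qed simp
  also have "(\<integral>x. Lop a (\<lambda>x. g x * u x) x \<partial>\<sigma>) = (\<integral>x. Lop a u x * g x + u x * Lop a g x \<partial>\<sigma>)"
  proof (rule Bochner_Integration.integral_cong)
    fix x assume "x \<in> space \<sigma>"
    then have x: "x \<noteq> 0" using ne by auto
    have d: "g differentiable at x" "u differentiable at x" "(\<lambda>x. g x * u x) differentiable at x"
      using x u g gu by (auto intro: rpf_differentiable C1_off_origin_differentiable)
    show "Lop a (\<lambda>x. g x * u x) x = Lop a u x * g x + u x * Lop a g x"
      by (simp add: Lop_pd_sum d pd_mult_at algebra_simps)
  qed simp
  also have "\<dots> = (\<integral>x. Lop a u x * g x \<partial>\<sigma>) + (\<integral>x. u x * Lop a g x \<partial>\<sigma>)"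
    by (intro Bochner_Integration.integral_add integrable_sigma_continuous continuous_on_mult continuous_on_rpf[OF g]
        continuous_on_rpf[OF rpf_Lop[OF g]] continuous_on_subset[OF continuous_on_Lop[OF u, of a] S]
        continuous_on_subset[OF C1_off_origin_continuous[OF u] S])
  finally show ?thesis by simp
qed

text \<open>Two integrations by parts move the Casimir operator from the polynomial to
  \<open>u\<close>; \<open>c\<close> plays the role of \<open>Cas u\<close>.\<close>

lemma integral_Cas_by_parts:
  assumes u: "C1_off_origin u" "\<And>i. C1_off_origin (pd i u)"
  shows "\<exists>c. continuous_on (sphere 0 1) c \<and> (\<forall>g. rpf g \<longrightarrow> (\<integral>x. u x * Cas g x \<partial>\<sigma>) = (\<integral>x. c x * g x \<partial>\<sigma>))"
proof -
  \<comment> \<open>Equal to \<open>Lop a u\<close> off the origin, but written out in partial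
    derivatives so that the closure rules for \<open>C1_off_origin\<close> apply.\<close>
  define w where "w a x = cross3 (axis a 1) x $ 1 * pd 1 u x + (cross3 (axis a 1) x $ 2 * pd 2 u x + cross3 (axis a 1) x $ 3 * pd 3 u x)" for a x
  define c where "c x = Lop 1 (w 1) x + Lop 2 (w 2) x + Lop 3 (w 3) x" for x
  have S: "sphere 0 1 \<subseteq> UNIV - {0 :: vec3}" by auto
  have w: "C1_off_origin (w a)" for a
    unfolding w_def by (intro C1_off_origin_add C1_off_origin_mult_rpf rpf_cross_axis u)
  have cL: "continuous_on (sphere 0 1) (Lop a (w b))" for a b
    by (rule continuous_on_subset[OF continuous_on_Lop[OF w] S])
  have cu: "continuous_on (sphere 0 1) u"
    by (rule continuous_on_subset[OF C1_off_origin_continuous[OF u(1)] S])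
  have 1: "(\<integral>x. u x * Lop a (Lop a g) x \<partial>\<sigma>) = (\<integral>x. Lop a (w a) x * g x \<partial>\<sigma>)" if g: "rpf g" for a g
  proof -
    have "(\<integral>x. u x * Lop a (Lop a g) x \<partial>\<sigma>) = - (\<integral>x. Lop a u x * Lop a g x \<partial>\<sigma>)"
      using Lop_C1_by_parts[OF u(1), of "Lop a g" a] g by simp
    also have "(\<integral>x. Lop a u x * Lop a g x \<partial>\<sigma>) = (\<integral>x. w a x * Lop a g x \<partial>\<sigma>)"
    proof (rule Bochner_Integration.integral_cong)
      fix x assume "x \<in> space \<sigma>"
      then have "x \<noteq> 0" by auto
      then show "Lop a u x * Lop a g x = w a x * Lop a g x"
        using u(1) by (simp add: w_def Lop_pd_sum C1_off_origin_differentiable)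
    qed simp
    also have "- (\<integral>x. w a x * Lop a g x \<partial>\<sigma>) = (\<integral>x. Lop a (w a) x * g x \<partial>\<sigma>)"
      using Lop_C1_by_parts[OF w g, of a] by simp
    finally show ?thesis .
  qed
  have "(\<integral>x. u x * Cas g x \<partial>\<sigma>) = (\<integral>x. c x * g x \<partial>\<sigma>)" if g: "rpf g" for g
  proof -
    have i: "integrable \<sigma> (\<lambda>x. u x * Lop a (Lop a g) x)" for a
      by (intro integrable_sigma_continuous continuous_on_mult cu continuous_on_rpf[OF rpf_Lop[OF rpf_Lop[OF g]]])
    have j: "integrable \<sigma> (\<lambda>x. Lop a (w a) x * g x)" for a
      by (intro integrable_sigma_continuous continuous_on_mult cL continuous_on_rpf[OF g])
    have "(\<integral>x. u x * Cas g x \<partial>\<sigma>) = (\<integral>x. u x * Lop 1 (Lop 1 g) x \<partial>\<sigma>) + (\<integral>x. u x * Lop 2 (Lop 2 g) x \<partial>\<sigma>) + (\<integral>x. u x * Lop 3 (Lop 3 g) x \<partial>\<sigma>)"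
      using i by (simp add: Cas_def distrib_left)
    also have "\<dots> = (\<integral>x. c x * g x \<partial>\<sigma>)" using j by (simp add: 1 g c_def distrib_right)
    finally show ?thesis .
  qed
  moreover have "continuous_on (sphere 0 1) c" unfolding c_def by (intro continuous_on_add cL)
  ultimately show ?thesis by blast
qed

lemma smooth_on_component:
  assumes F: "smooth_on (UNIV - {0}) F"
  shows "x \<noteq> 0 \<Longrightarrow> (\<lambda>x. F x $ j) differentiable (at x)"
    and "x \<noteq> 0 \<Longrightarrow> pd i (\<lambda>x. F x $ j) x = frechet_derivative F (at x) (axis i 1) $ j"
    and "smooth_on (UNIV - {0}) (\<lambda>x. frechet_derivative F (at x) (axis i 1))"
proof -
  from F have D: "\<forall>x\<in>UNIV - {0}. F differentiable (at x)" by cases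
  from F show "smooth_on (UNIV - {0}) (\<lambda>x. frechet_derivative F (at x) (axis i 1))" by cases simp
  assume "x \<noteq> 0"
  then have "(F has_derivative frechet_derivative F (at x)) (at x)"
    using D frechet_derivative_works by blast
  from bounded_linear.has_derivative[OF bounded_linear_vec_nth this]
  have d: "((\<lambda>x. F x $ j) has_derivative (\<lambda>v. frechet_derivative F (at x) v $ j)) (at x)" .
  then show "(\<lambda>x. F x $ j) differentiable (at x)" by (auto simp: differentiable_def)
  from fun_cong[OF frechet_derivative_at[OF d], of "axis i 1"]
  show "pd i (\<lambda>x. F x $ j) x = frechet_derivative F (at x) (axis i 1) $ j" by (simp add: pd_def)
qed

lemma smooth_on_C1:
  assumes F: "smooth_on (UNIV - {0}) F" and u: "\<And>x. x \<noteq> 0 \<Longrightarrow> u x = F x $ j"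
  shows "C1_off_origin u" "\<And>x. x \<noteq> 0 \<Longrightarrow> pd i u x = frechet_derivative F (at x) (axis i 1) $ j"
proof -
  have o: "open (UNIV - {0 :: vec3})" by (intro open_Diff) auto
  have d: "(u has_derivative frechet_derivative (\<lambda>x. F x $ j) (at x)) (at x)" if x: "x \<noteq> 0" for x
  proof (rule has_derivative_transform_within_open[OF _ o])
    show "((\<lambda>x. F x $ j) has_derivative frechet_derivative (\<lambda>x. F x $ j) (at x)) (at x)"
      using smooth_on_component(1)[OF F x] by (simp add: frechet_derivative_works[symmetric])
  qed (use x u in auto)
  show p: "pd i u x = frechet_derivative F (at x) (axis i 1) $ j" if x: "x \<noteq> 0" for x i
    using fun_cong[OF frechet_derivative_at[OF d[OF x]], of "axis i 1"] smooth_on_component(2)[OF F x, of i j]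
    by (simp add: pd_def)
  show "C1_off_origin u"
    unfolding C1_off_origin_def
  proof (intro conjI allI impI)
    show "u differentiable at x" if "x \<noteq> 0" for x using d[OF that] by (auto simp: differentiable_def)
    fix i
    have "continuous_on (UNIV - {0}) (\<lambda>x. frechet_derivative F (at x) (axis i 1) $ j)"
      by (rule continuous_at_imp_continuous_on)
        (auto intro!: differentiable_imp_continuous_within smooth_on_component(1)[OF smooth_on_component(3)[OF F]])
    then show "continuous_on (UNIV - {0}) (pd i u)"
      by (rule continuous_on_eq) (use p in auto)
  qed
qed

lemma smooth_field_continuous:
  assumes "smooth_field f" shows "continuous_on (sphere 0 1) f"
proof -
  let ?F = "\<lambda>x. f (x /\<^sub>R norm x)"
  from assms have "smooth_on (UNIV - {0}) ?F" by (simp add: smooth_field_def)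
  then have "\<forall>x\<in>UNIV - {0}. ?F differentiable (at x)" by cases
  then have "continuous_on (sphere 0 1) ?F"
    by (intro continuous_at_imp_continuous_on ballI differentiable_imp_continuous_within) auto
  then show ?thesis by (rule continuous_on_eq) auto
qed

text \<open>\<open>G\<close> stands for the Laplace-Beltrami operator applied to the components of
  \<open>f\<close>. Its coefficients are those of \<open>f\<close> multiplied by the eigenvalue,
  which is what forces the latter to decay.\<close>

lemma smooth_field_Cas:
  assumes f: "smooth_field f"
  shows "\<exists>G. continuous_on (sphere 0 1) G \<and>
    (\<forall>k E. vharm k E \<longrightarrow> - (real k * (real k + 1)) * inner_S f E = inner_S G E)"
proof -
  let ?F = "\<lambda>x. f (x /\<^sub>R norm x)"
  have F: "smooth_on (UNIV - {0}) ?F" using f by (simp add: smooth_field_def)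
  have "\<exists>c. continuous_on (sphere 0 1) c \<and> (\<forall>g. rpf g \<longrightarrow> (\<integral>x. ?F x $ j * Cas g x \<partial>\<sigma>) = (\<integral>x. c x * g x \<partial>\<sigma>))" for j
  proof (rule integral_Cas_by_parts)
    show "C1_off_origin (\<lambda>x. ?F x $ j)" by (rule smooth_on_C1(1)[OF F refl])
    show "C1_off_origin (pd i (\<lambda>x. ?F x $ j))" for i
      by (rule smooth_on_C1(1)[OF smooth_on_component(3)[OF F, of i], of _ j]) (rule smooth_on_component(2)[OF F])
  qed
  then have "\<exists>c. \<forall>j. continuous_on (sphere 0 1) (c j) \<and> (\<forall>g. rpf g \<longrightarrow> (\<integral>x. ?F x $ j * Cas g x \<partial>\<sigma>) = (\<integral>x. c j x * g x \<partial>\<sigma>))"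
    by (intro choice allI)
  then obtain c where c: "\<forall>j. continuous_on (sphere 0 1) (c j) \<and> (\<forall>g. rpf g \<longrightarrow> (\<integral>x. ?F x $ j * Cas g x \<partial>\<sigma>) = (\<integral>x. c j x * g x \<partial>\<sigma>))"
    by (rule exE)
  define G where "G x = (\<chi> j. c j x)" for x
  have cf: "continuous_on (sphere 0 1) f" by (rule smooth_field_continuous[OF f])
  have "- (real k * (real k + 1)) * inner_S f E = inner_S G E" if E: "vharm k E" for k E
  proof -
    have h: "harmp k (\<lambda>x. E x $ j)" for j using E by (simp add: vharm_def)
    note r = harmp_rpf[OF h]
    have i1: "integrable \<sigma> (\<lambda>x. f x $ j * E x $ j)" for j
      by (intro integrable_sigma_continuous continuous_on_mult continuous_on_component cf continuous_on_rpf[OF r])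
    have i2: "integrable \<sigma> (\<lambda>x. c j x * E x $ j)" for j
      using c by (intro integrable_sigma_continuous continuous_on_mult continuous_on_rpf[OF r]) auto
    have "(\<integral>x. c j x * E x $ j \<partial>\<sigma>) = - (real k * (real k + 1)) * (\<integral>x. f x $ j * E x $ j \<partial>\<sigma>)" for j
    proof -
      have "(\<integral>x. c j x * E x $ j \<partial>\<sigma>) = (\<integral>x. ?F x $ j * Cas (\<lambda>x. E x $ j) x \<partial>\<sigma>)" using c r by simp
      also have "\<dots> = (\<integral>x. - (real k * (real k + 1)) * (f x $ j * E x $ j) \<partial>\<sigma>)"
        by (rule Bochner_Integration.integral_cong) (auto simp: Cas_harm[OF h] simp del: mult_minus_left minus_mult_minus)
      finally show ?thesis by simp
    qed
    then show ?thesis using i1 i2 by (simp add: inner_S_def inner_vec_def G_def sum_3 algebra_simps)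
  qed
  moreover have "continuous_on (sphere 0 1) G"
    unfolding G_def using c by (intro continuous_on_vec_lambda) auto
  ultimately show ?thesis by blast
qed

lemma Np_2: "Np 2 f = inner_S f f"
  by (simp add: Np_def inner_S_def dot_square_norm)

text \<open>Limits for different exponents become comparable in \<open>L^1\<close>: the extension is
  a limit for the exponent p, the series one for the exponent 2.\<close>

lemma Lp_lim_exponent_1:
  assumes u: "Lp_lim p u f" and p: "1 \<le> p" shows "Lp_lim 1 u f"
proof -
  define m where "m = measure \<sigma> (sphere 0 1)"
  have m: "0 < m" using sigma_measure_pos by (simp add: m_def)
  have b: "g \<in> Lp_S 1 \<and> Np 1 g \<le> \<delta> * m + \<delta> powr (1 - p) * Np p g" if g: "g \<in> Lp_S p" and d: "0 < \<delta>" for g \<delta>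
  proof (intro conjI)
    have gm: "g \<in> borel_measurable \<sigma>" using g by (rule Lp_S_measurable)
    have i: "integrable \<sigma> (\<lambda>x. \<delta> + \<delta> powr (1 - p) * norm (g x) powr p)"
      by (intro Bochner_Integration.integrable_add integrable_mult_right Lp_S_integrable[OF g]) simp
    have le: "norm (g x) powr 1 \<le> \<delta> + \<delta> powr (1 - p) * norm (g x) powr p" for x
      using le_powr_interpolation[of "norm (g x)" \<delta> p] d p by simp
    have j: "integrable \<sigma> (\<lambda>x. norm (g x) powr 1)"
      using le gm by (intro Bochner_Integration.integrable_bound[OF i]) (auto intro: order_trans[OF _ abs_ge_self])
    then show "g \<in> Lp_S 1" using gm by (simp add: Lp_S_iff)
    have "Np 1 g \<le> (\<integral>x. \<delta> + \<delta> powr (1 - p) * norm (g x) powr p \<partial>\<sigma>)"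
      unfolding Np_def by (rule integral_mono[OF j i le])
    also have "\<dots> = \<delta> * m + \<delta> powr (1 - p) * Np p g"
      using Lp_S_integrable[OF g] by (simp add: Np_def m_def)
    finally show "Np 1 g \<le> \<delta> * m + \<delta> powr (1 - p) * Np p g" .
  qed
  have L: "u n \<in> Lp_S p" "f \<in> Lp_S p" for n using u by (auto simp: Lp_lim_def)
  have uf: "(\<lambda>x. u n x - f x) \<in> Lp_S p" for n using L p by (intro Lp_S_diff) auto
  have "(\<lambda>n. Np 1 (\<lambda>x. u n x - f x)) \<longlonglongrightarrow> 0"
  proof (rule LIMSEQ_I)
    fix r :: real assume r: "0 < r"
    define \<delta> where "\<delta> = r / (2 * m)"
    have d: "0 < \<delta>" "\<delta> * m = r / 2" using r m by (auto simp: \<delta>_def)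
    have "(\<lambda>n. \<delta> powr (1 - p) * Np p (\<lambda>x. u n x - f x)) \<longlonglongrightarrow> \<delta> powr (1 - p) * 0"
      using u unfolding Lp_lim_def by (intro tendsto_intros) auto
    then have "\<forall>\<^sub>F n in sequentially. \<delta> powr (1 - p) * Np p (\<lambda>x. u n x - f x) < r / 2"
      using r by (intro order_tendstoD) auto
    then obtain N where "\<And>n. N \<le> n \<Longrightarrow> \<delta> powr (1 - p) * Np p (\<lambda>x. u n x - f x) < r / 2"
      by (auto simp: eventually_sequentially)
    then have "\<forall>n\<ge>N. norm (Np 1 (\<lambda>x. u n x - f x) - 0) < r"
      using b[OF uf d(1)] d(2) Np_nonneg[of 1] by (smt (verit) real_norm_def field_sum_of_halves)
    then show "\<exists>N. \<forall>n\<ge>N. norm (Np 1 (\<lambda>x. u n x - f x) - 0) < r" by blast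
  qed
  then show ?thesis using b[OF L(1) zero_less_one] b[OF L(2) zero_less_one] by (simp add: Lp_lim_def)
qed

section \<open>Bessel estimates and almost everywhere convergence of the series\<close>

context harmonic_basis
begin

lemma Np_2_sum:
  assumes "finite I" "I \<subseteq> Adm" shows "Np 2 (\<lambda>x. \<Sum>i\<in>I. c i *\<^sub>R ei i x) = (\<Sum>i\<in>I. (c i)\<^sup>2)"
proof -
  let ?R = "\<lambda>x. \<Sum>i\<in>I. c i *\<^sub>R ei i x"
  have cR: "continuous_on (sphere 0 1) ?R"
    using assms by (intro vpoly_continuous vpoly_sum vpoly_scaleR vpoly_ei) auto
  have "Np 2 ?R = (\<Sum>i\<in>I. c i * inner_S (ei i) ?R)"
    unfolding Np_2 using assms cR by (intro inner_S_sum continuous_on_ei) auto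
  also have "\<dots> = (\<Sum>i\<in>I. (c i)\<^sup>2)"
  proof (rule sum.cong[OF refl])
    fix i assume i: "i \<in> I"
    have "inner_S (ei i) ?R = coef ?R i" by (simp add: coef_def inner_S_commute)
    also have "\<dots> = c i" using coef_sum[OF assms, of i ?R c] i assms by auto
    finally show "c i * inner_S (ei i) ?R = (c i)\<^sup>2" by (simp add: power2_eq_square)
  qed
  finally show ?thesis .
qed

lemma bessel:
  assumes I: "finite I" "I \<subseteq> Adm" and f: "continuous_on (sphere 0 1) f"
  shows "(\<Sum>i\<in>I. (coef f i)\<^sup>2) \<le> Np 2 f"
proof -
  define R where "R x = (\<Sum>i\<in>I. coef f i *\<^sub>R ei i x)" for x
  have cR: "continuous_on (sphere 0 1) R"
    unfolding R_def[abs_def] using I by (intro vpoly_continuous vpoly_sum vpoly_scaleR vpoly_ei) auto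
  have Rf: "inner_S R f = (\<Sum>i\<in>I. (coef f i)\<^sup>2)"
  proof -
    have "inner_S R f = (\<Sum>i\<in>I. coef f i * inner_S (ei i) f)"
      unfolding R_def[abs_def] using I f by (intro inner_S_sum continuous_on_ei) auto
    then show ?thesis by (simp add: inner_S_commute[of _ f] coef_def power2_eq_square)
  qed
  have RR: "inner_S R R = (\<Sum>i\<in>I. (coef f i)\<^sup>2)" using Np_2_sum[OF I] by (simp add: Np_2[symmetric] R_def[abs_def])
  have c: "continuous_on (sphere 0 1) (\<lambda>x. f x - R x)" by (intro continuous_on_diff f cR)
  have "0 \<le> inner_S (\<lambda>x. f x - R x) (\<lambda>x. f x - R x)" using Np_nonneg[of 2 "\<lambda>x. f x - R x"] by (simp add: Np_2)
  also have "\<dots> = inner_S f (\<lambda>x. f x - R x) - inner_S R (\<lambda>x. f x - R x)" by (rule inner_S_diff[OF f cR c])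
  also have "inner_S f (\<lambda>x. f x - R x) = inner_S f f - inner_S R f"
    unfolding inner_S_commute[of f "\<lambda>x. f x - R x"] by (rule inner_S_diff[OF f cR f])
  also have "inner_S R (\<lambda>x. f x - R x) = inner_S f R - inner_S R R"
    unfolding inner_S_commute[of R "\<lambda>x. f x - R x"] by (rule inner_S_diff[OF f cR cR])
  finally show ?thesis using Rf RR inner_S_commute[of f R] by (simp add: Np_2)
qed

definition block :: "(vec3 \<Rightarrow> vec3) \<Rightarrow> kind \<Rightarrow> nat \<Rightarrow> vec3 \<Rightarrow> vec3" where
  "block f t l x = (\<Sum>m\<in>{- int l..int l}. coef f (t, l, m) *\<^sub>R e t l m x)"

definition series :: "(vec3 \<Rightarrow> vec3) \<Rightarrow> kind \<Rightarrow> vec3 \<Rightarrow> vec3" where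
  "series f t x = (\<Sum>k. block f t (k + first_degree t) x)"

text \<open>Index set of the first \<open>n\<close> blocks, with degrees from
  \<open>first_degree t\<close> to \<open>n + first_degree t - 1\<close>.\<close>

definition low :: "kind \<Rightarrow> nat \<Rightarrow> (kind \<times> nat \<times> int) set" where
  "low t n = {i \<in> Adm. fst i = t \<and> fst (snd i) < n + first_degree t}"

lemma block_sum: "block f t l x = (\<Sum>i\<in>(\<lambda>m. (t, l, m)) ` {- int l..int l}. coef f i *\<^sub>R ei i x)"
  unfolding block_def by (subst sum.reindex) (auto simp: inj_on_def)

lemma low_0: "low t 0 = {}"
  by (auto simp: low_def Adm_def)

lemma low_Suc: "low t (Suc n) = low t n \<union> (\<lambda>m. (t, n + first_degree t, m)) ` {- int (n + first_degree t)..int (n + first_degree t)}"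
  unfolding low_def Adm_def by (auto simp: less_Suc_eq abs_le_iff image_iff)

lemma low_Adm: "low t n \<subseteq> Adm"
  by (auto simp: low_def)

lemma finite_low: "finite (low t n)"
proof (induction n)
  case 0
  then show ?case by (simp add: low_0)
qed (simp add: low_Suc)

lemma partial_sum_block: "(\<Sum>k<n. block f t (k + first_degree t) x) = (\<Sum>i\<in>low t n. coef f i *\<^sub>R ei i x)"
proof (induction n)
  case 0
  then show ?case by (simp add: low_0)
next
  case (Suc n)
  have "(\<Sum>i\<in>low t (Suc n). coef f i *\<^sub>R ei i x) = (\<Sum>i\<in>low t n. coef f i *\<^sub>R ei i x) + block f t (n + first_degree t) x"
    unfolding low_Suc block_sum by (rule sum.union_disjoint) (auto simp: finite_low, auto simp: low_def)
  then show ?case using Suc by simp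
qed

lemma vpoly_block: "first_degree t \<le> l \<Longrightarrow> vpoly (block f t l)"
  unfolding block_def[abs_def] by (intro vpoly_sum vpoly_scaleR vharm_vpoly[OF vharm_e]) auto

text \<open>Bessel's inequality for the field \<open>G\<close> of \<open>smooth_field_Cas\<close>,
  divided by the square of the eigenvalue. Component degree 0 is excluded because its eigenvalue is
  0.\<close>

lemma Np_2_block_decay:
  assumes f: "smooth_field f"
  shows "\<exists>M\<ge>0. \<forall>t l. first_degree t \<le> l \<longrightarrow> 0 < component_degree t l \<longrightarrow>
    Np 2 (block f t l) \<le> M / (real (component_degree t l) * (real (component_degree t l) + 1))\<^sup>2"
proof -
  from smooth_field_Cas[OF f] obtain G where G: "continuous_on (sphere 0 1) G"
    "\<forall>k E. vharm k E \<longrightarrow> - (real k * (real k + 1)) * inner_S f E = inner_S G E" by (elim exE conjE) (rule that)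
  have "Np 2 (block f t l) \<le> Np 2 G / (real (component_degree t l) * (real (component_degree t l) + 1))\<^sup>2"
    if l: "first_degree t \<le> l" "0 < component_degree t l" for t l
  proof -
    define k where "k = real (component_degree t l) * (real (component_degree t l) + 1)"
    have k: "0 < k" using l by (simp add: k_def)
    let ?I = "(\<lambda>m. (t, l, m)) ` {- int l..int l}"
    have I: "finite ?I" "?I \<subseteq> Adm" using l by (auto simp: Adm_def)
    have c: "coef f i = - coef G i / k" if "i \<in> ?I" for i
    proof -
      have "vharm (component_degree t l) (ei i)" using that l by (auto intro!: vharm_e)
      then have "- k * coef f i = coef G i" using G(2) unfolding k_def coef_def by blast
      then show ?thesis using k by (simp add: field_simps)
    qed
    have "Np 2 (block f t l) = (\<Sum>i\<in>?I. (coef f i)\<^sup>2)"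
      unfolding block_sum[abs_def] by (rule Np_2_sum[OF I])
    also have "\<dots> = (\<Sum>i\<in>?I. (coef G i)\<^sup>2) / k\<^sup>2"
      unfolding sum_divide_distrib by (intro sum.cong refl) (simp add: c power_divide)
    also have "\<dots> \<le> Np 2 G / k\<^sup>2" using k by (intro divide_right_mono bessel[OF I G(1)]) auto
    finally show ?thesis by (simp add: k_def)
  qed
  then show ?thesis using Np_nonneg[of 2 G] by blast
qed

lemma AE_summable_block:
  assumes f: "smooth_field f"
  shows "AE x in \<sigma>. summable (\<lambda>k. norm (block f t (k + first_degree t) x))"
proof -
  obtain M where M: "0 \<le> M" "\<And>l. first_degree t \<le> l \<Longrightarrow> 0 < component_degree t l \<Longrightarrow>
    Np 2 (block f t l) \<le> M / (real (component_degree t l) * (real (component_degree t l) + 1))\<^sup>2"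
    using Np_2_block_decay[OF f] by blast
  define m where "m = measure \<sigma> (sphere 0 1)"
  \<comment> \<open>Interpolation at the exponent 2 with this \<delta> bounds the integral of the
    norm of a block by \<delta> m + \<delta>^(-1) M \<delta>^2, which is summable.\<close>
  define \<delta> where "\<delta> n = 1 / (real (Suc n))\<^sup>2" for n
  have d: "0 < \<delta> n" for n by (simp add: \<delta>_def)
  \<comment> \<open>The first block is skipped, since gradient fields with l = 1 have component
    degree 0 and no decay estimate.\<close>
  define d where "d n = block f t (Suc n + first_degree t)" for n
  have vd: "vpoly (d n)" for n unfolding d_def by (intro vpoly_block) simp
  have dL: "d n \<in> Lp_S 2" for n using vd by (intro Lp_S_vpoly) auto
  have N: "Np 2 (d n) \<le> M * (\<delta> n)\<^sup>2" for n
  proof -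
    define k where "k = component_degree t (Suc n + first_degree t)"
    have k: "Suc n \<le> k" unfolding k_def by (cases t) auto
    have "Np 2 (d n) \<le> M / (real k * (real k + 1))\<^sup>2"
      unfolding d_def k_def by (rule M) (use k in \<open>auto simp: k_def\<close>)
    also have "\<dots> \<le> M / ((real (Suc n))\<^sup>2)\<^sup>2"
    proof (intro divide_left_mono power_mono)
      show "(real (Suc n))\<^sup>2 \<le> real k * (real k + 1)"
        unfolding power2_eq_square using k by (intro mult_mono) auto
      show "0 < (real k * (real k + 1))\<^sup>2 * ((real (Suc n))\<^sup>2)\<^sup>2" using k by (intro mult_pos_pos zero_less_power) auto
    qed (use M in auto)
    finally show ?thesis by (simp add: \<delta>_def power_divide)
  qed
  have "AE x in \<sigma>. summable (\<lambda>n. norm (d n x))"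
  proof (rule AE_summable_norm)
    fix n
    have i: "integrable \<sigma> (\<lambda>x. \<delta> n + \<delta> n powr (1 - 2) * norm (d n x) powr 2)"
      by (intro Bochner_Integration.integrable_add integrable_mult_right Lp_S_integrable[OF dL]) simp
    have "(\<integral>\<^sup>+x. ennreal (norm (d n x)) \<partial>\<sigma>) \<le> (\<integral>\<^sup>+x. ennreal (\<delta> n + \<delta> n powr (1 - 2) * norm (d n x) powr 2) \<partial>\<sigma>)"
      using d by (intro nn_integral_mono ennreal_leI le_powr_interpolation) auto
    also have "\<dots> = ennreal (\<integral>x. \<delta> n + \<delta> n powr (1 - 2) * norm (d n x) powr 2 \<partial>\<sigma>)"
      using d[of n] by (intro nn_integral_eq_integral[OF i]) (auto simp: add_nonneg_nonneg less_imp_le)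
    also have "(\<integral>x. \<delta> n + \<delta> n powr (1 - 2) * norm (d n x) powr 2 \<partial>\<sigma>) = \<delta> n * m + \<delta> n powr (1 - 2) * Np 2 (d n)"
      using Lp_S_integrable[OF dL, of n] by (simp add: Np_def m_def)
    also have "\<dots> \<le> \<delta> n * m + \<delta> n powr (1 - 2) * (M * (\<delta> n)\<^sup>2)"
      using N by (intro add_left_mono mult_left_mono) auto
    also have "\<delta> n powr (1 - 2) * (M * (\<delta> n)\<^sup>2) = \<delta> n * M"
      using d[of n] by (simp add: powr_minus power2_eq_square)
    finally show "(\<integral>\<^sup>+x. ennreal (norm (d n x)) \<partial>\<sigma>) \<le> ennreal (\<delta> n * (m + M))"
      by (simp add: distrib_left ennreal_leI)
    show "0 \<le> \<delta> n * (m + M)" using d[of n] M by (simp add: m_def)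
    show "d n \<in> borel_measurable \<sigma>" by (rule Lp_S_measurable[OF dL])
  next
    have "summable (\<lambda>n. 1 / (real n)\<^sup>2)" using inverse_power_summable[of 2, where 'a = real] by (simp add: inverse_eq_divide)
    then have "summable \<delta>" unfolding \<delta>_def using summable_Suc_iff[of "\<lambda>n. 1 / (real n)\<^sup>2"] by simp
    then show "summable (\<lambda>n. \<delta> n * (m + M))" by (rule summable_mult2)
  qed
  then show ?thesis
  proof eventually_elim
    case (elim x)
    then show ?case using summable_Suc_iff[of "\<lambda>k. norm (block f t (k + first_degree t) x)"] by (simp add: d_def)
  qed
qed

text \<open>Once \<open>n\<close> exceeds the degrees occurring in \<open>F\<close>, the partial sum
  of the series minus \<open>pr t F\<close> is the partial sum belonging to f - F, which Bessel's
  inequality bounds; Fatou's lemma passes to the full series.\<close>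

lemma series_approx:
  assumes f: "smooth_field f" and F: "vpoly F"
  shows "(\<lambda>x. series f t x - pr t F x) \<in> Lp_S 2" "Np 2 (\<lambda>x. series f t x - pr t F x) \<le> Np 2 (\<lambda>x. f x - F x)"
proof -
  define S where "S n x = (\<Sum>k<n. block f t (k + first_degree t) x)" for n x
  have S: "S n x = (\<Sum>i\<in>low t n. coef f i *\<^sub>R ei i x)" for n x by (simp add: S_def partial_sum_block)
  have vS: "vpoly (S n)" for n
    unfolding S[abs_def] using low_Adm by (intro vpoly_sum vpoly_scaleR vpoly_ei) auto
  have vp: "vpoly (pr t F)" by (rule vpoly_pr[OF F])
  have cf: "continuous_on (sphere 0 1) f" by (rule smooth_field_continuous[OF f])
  have cF: "continuous_on (sphere 0 1) F" by (rule vpoly_continuous[OF F])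
  have [measurable]: "S n \<in> borel_measurable \<sigma>" "pr t F \<in> borel_measurable \<sigma>" for n
    by (intro borel_measurable_sigma_continuous vpoly_continuous vS vp)+
  have [measurable]: "series f t \<in> borel_measurable \<sigma>"
  proof -
    have "series f t = (\<lambda>x. lim (\<lambda>n. S n x))" by (simp add: fun_eq_iff series_def S_def suminf_eq_lim)
    then show ?thesis by simp
  qed
  obtain I where I: "finite I" "I \<subseteq> Adm" "\<forall>i\<in>Adm - I. coef F i = 0" by (rule coef_support[OF F]) (rule that)
  define N where "N = Suc (Max (insert 0 ((\<lambda>i. fst (snd i)) ` I)))"
  have N: "fst (snd i) < N" if "i \<in> I" for i unfolding N_def less_Suc_eq_le using I(1) that by (intro Max_ge) auto
  have b: "(\<integral>\<^sup>+x. ennreal (norm (series f t x - pr t F x) powr 2) \<partial>\<sigma>) \<le> ennreal (Np 2 (\<lambda>x. f x - F x))"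
  proof (rule fatou_powr[of "\<lambda>n x. S n x - pr t F x"])
    show "AE x in \<sigma>. (\<lambda>n. S n x - pr t F x) \<longlonglongrightarrow> series f t x - pr t F x"
      using AE_summable_block[OF f, of t]
      by eventually_elim (auto simp: S_def series_def intro!: tendsto_diff summable_LIMSEQ summable_norm_cancel)
    show "\<forall>\<^sub>F n in sequentially. (\<integral>\<^sup>+x. ennreal (norm (S n x - pr t F x) powr 2) \<partial>\<sigma>) \<le> ennreal (Np 2 (\<lambda>x. f x - F x))"
    proof (rule eventually_sequentiallyI[of N])
      fix n assume n: "N \<le> n"
      have "pr t F x = (\<Sum>i\<in>low t n. coef F i *\<^sub>R ei i x)" for x
        unfolding pr_eq[OF I]
      proof (rule sum.mono_neutral_left[OF finite_low])
        show "{i \<in> I. fst i = t} \<subseteq> low t n"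
        proof
          fix i assume "i \<in> {i \<in> I. fst i = t}"
          then show "i \<in> low t n" using N[of i] n I(2) by (simp add: low_def subset_iff del: split_paired_All)
        qed
        show "\<forall>i\<in>low t n - {i \<in> I. fst i = t}. coef F i *\<^sub>R ei i x = 0"
        proof
          fix i assume "i \<in> low t n - {i \<in> I. fst i = t}"
          then have "i \<in> Adm - I" unfolding low_def by blast
          then show "coef F i *\<^sub>R ei i x = 0" using I(3) by simp
        qed
      qed
      then have e: "S n x - pr t F x = (\<Sum>i\<in>low t n. coef (\<lambda>x. f x - F x) i *\<^sub>R ei i x)" for x
        using coef_linear[OF cf cF, of _ 1 "- 1"] subsetD[OF low_Adm]
        by (simp add: S sum_subtractf[symmetric] scaleR_diff_left[symmetric] cong: sum.cong)
      have "Np 2 (\<lambda>x. S n x - pr t F x) \<le> Np 2 (\<lambda>x. f x - F x)"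
        unfolding e Np_2_sum[OF finite_low low_Adm]
        by (intro bessel finite_low low_Adm continuous_on_diff cf cF)
      then show "(\<integral>\<^sup>+x. ennreal (norm (S n x - pr t F x) powr 2) \<partial>\<sigma>) \<le> ennreal (Np 2 (\<lambda>x. f x - F x))"
        using nn_integral_Np[OF Lp_S_vpoly[OF vpoly_diff[OF vS vp]], of 2 n] by (simp add: ennreal_leI)
    qed
  qed auto
  show "(\<lambda>x. series f t x - pr t F x) \<in> Lp_S 2" "Np 2 (\<lambda>x. series f t x - pr t F x) \<le> Np 2 (\<lambda>x. f x - F x)"
    using Lp_S_bounded[OF _ b Np_nonneg] by auto
qed

text \<open>A uniform approximation of \<open>f\<close> by polynomial fields converges for every
  exponent at once. Its images under \<open>pr t\<close> converge to \<open>P f\<close> for the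
  exponent p and to the series for the exponent 2, hence to both in \<open>L^1\<close>.\<close>

lemma extension_eq_series:
  assumes p: "1 < p" and P: "extends_by_limits p (pr t) P" and f: "smooth_field f"
  shows "AE x in \<sigma>. P f x = series f t x"
proof -
  have cf: "continuous_on (sphere 0 1) f" by (rule smooth_field_continuous[OF f])
  define m where "m = measure \<sigma> (sphere 0 1)"
  have "\<exists>F. vpoly F \<and> (\<forall>x. norm x = 1 \<longrightarrow> norm (f x - F x) < 1 / real (Suc n))" for n
    by (rule vpoly_approx[OF cf, of "1 / real (Suc n)"]) auto
  then have "\<exists>F. \<forall>n. vpoly (F n) \<and> (\<forall>x. norm x = 1 \<longrightarrow> norm (f x - F n x) < 1 / real (Suc n))" by (intro choice allI)
  then obtain F where F: "\<forall>n. vpoly (F n) \<and> (\<forall>x. norm x = 1 \<longrightarrow> norm (f x - F n x) < 1 / real (Suc n))" by (rule exE)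
  have v: "vpoly (F n)" for n using F by blast
  have lim: "Lp_lim q F f" if q: "0 < q" for q
  proof (rule Lp_limI)
    show "F n \<in> Lp_S q" for n using v q by (rule Lp_S_vpoly)
    show "f \<in> Lp_S q" using cf q by (rule Lp_S_continuous)
    show "Np q (\<lambda>x. F n x - f x) \<le> (1 / real (Suc n)) powr q * m" for n
    proof -
      have "Np q (\<lambda>x. F n x - f x) \<le> (\<integral>x. (1 / real (Suc n)) powr q \<partial>\<sigma>)"
        unfolding Np_def
      proof (rule integral_mono)
        show "integrable \<sigma> (\<lambda>x. norm (F n x - f x) powr q)"
          by (intro integrable_powr_continuous continuous_on_diff cf vpoly_continuous v q)
        fix x assume "x \<in> space \<sigma>"
        then have "norm (f x - F n x) < 1 / real (Suc n)" using F by simp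
        then show "norm (F n x - f x) powr q \<le> (1 / real (Suc n)) powr q"
          using q by (intro powr_mono2) (auto simp: norm_minus_commute)
      qed simp
      then show ?thesis by (simp add: m_def mult.commute)
    qed
    have "(\<lambda>n. (1 / real (Suc n)) powr q * m) \<longlonglongrightarrow> 0 powr q * m"
      using q LIMSEQ_Suc[OF lim_1_over_n] by (intro tendsto_mult tendsto_powr' tendsto_const) auto
    then show "(\<lambda>n. (1 / real (Suc n)) powr q * m) \<longlonglongrightarrow> 0" by simp
  qed
  have 1: "Lp_lim p (\<lambda>n. pr t (F n)) (P f)" using p by (intro extends_by_limitsD[OF P v lim]) auto
  have 2: "Lp_lim 2 (\<lambda>n. pr t (F n)) (series f t)"
  proof (rule Lp_limI)
    show L: "pr t (F n) \<in> Lp_S 2" for n by (intro Lp_S_vpoly vpoly_pr v) simp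
    show "series f t \<in> Lp_S 2" using Lp_S_add(1)[OF series_approx(1)[OF f v, of t 0] L, of 0] by simp
    show "Np 2 (\<lambda>x. pr t (F n) x - series f t x) \<le> Np 2 (\<lambda>x. F n x - f x)" for n
      using series_approx(2)[OF f v, of t n] by (simp add: Np_minus_commute[of 2 "series f t"] Np_minus_commute[of 2 f])
    show "(\<lambda>n. Np 2 (\<lambda>x. F n x - f x)) \<longlonglongrightarrow> 0" using lim[of 2] by (simp add: Lp_lim_def)
  qed
  show ?thesis
    by (rule Lp_lim_unique[OF Lp_lim_exponent_1[OF 1] Lp_lim_exponent_1[OF 2]]) (use p in auto)
qed

lemma proj_series_eq_series:
  assumes "norm \<eta> = 1"
  shows "proj_series (first_degree t) (paper_field t Y) (mu t) f \<eta> = series f t \<eta>"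
  unfolding proj_series_def series_def Let_def block_def
proof (intro arg_cong[where f = suminf] ext sum.cong refl)
  fix k m assume m: "m \<in> {- int (k + first_degree t)..int (k + first_degree t)}"
  then have m: "\<bar>m\<bar> \<le> int (k + first_degree t)" by auto
  have "inner_S f (\<lambda>x. paper_field t Y (k + first_degree t) m x /\<^sub>R mu t (k + first_degree t)) = coef f (t, k + first_degree t, m)"
    unfolding coef_def ei.simps by (rule inner_S_cong) (auto simp: e_eq_paper_field[OF m])
  then show "inner_S f (\<lambda>x. paper_field t Y (k + first_degree t) m x /\<^sub>R mu t (k + first_degree t)) *\<^sub>R
      (paper_field t Y (k + first_degree t) m \<eta> /\<^sub>R mu t (k + first_degree t)) =
      coef f (t, k + first_degree t, m) *\<^sub>R e t (k + first_degree t) m \<eta>"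
    by (simp only: e_eq_paper_field[OF m assms])
qed

theorem Lp_decomposition:
  assumes p: "1 < p"
  shows "\<exists>P. (\<forall>t. Lp_projection_extending p (P t) (proj_series (first_degree t) (paper_field t Y) (mu t))) \<and>
    Lp_direct_sum3 p (P Kelv) (P Grad) (P Tang)"
proof -
  from Np_pr[OF p] obtain K where K: "0 \<le> K" "\<forall>F t. vpoly F \<longrightarrow> Np p (pr t F) \<le> K * Np p F"
    by (elim exE conjE) (rule that)
  have lin: "pr t (\<lambda>x. a *\<^sub>R F x + b *\<^sub>R G x) = (\<lambda>x. a *\<^sub>R pr t F x + b *\<^sub>R pr t G x)" if "vpoly F" "vpoly G" for t a b F G
    using pr_linear[OF that] by (rule ext)
  have "\<exists>P. extends_by_limits p (pr t) P" for t
  proof (rule extension_exists[where K = K])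
    show "pr t (\<lambda>x. F x - G x) = (\<lambda>x. pr t F x - pr t G x)" if "vpoly F" "vpoly G" for F G
      using lin[OF that, of t 1 "- 1"] by simp
  qed (use p K vpoly_pr in auto)
  then have "\<exists>P. \<forall>t. extends_by_limits p (pr t) (P t)" by (intro choice allI)
  then obtain P where P: "\<forall>t. extends_by_limits p (pr t) (P t)" by (rule exE)
  have "Lp_projection_extending p (P t) (proj_series (first_degree t) (paper_field t Y) (mu t))" for t
  proof (rule Lp_projection_extendingI[where T = "pr t" and K = K])
    show "pr t (pr t F) = pr t F" if "vpoly F" for F using pr_pr[OF that, of t t] by (simp add: fun_eq_iff)
    show "AE x in \<sigma>. P t f x = proj_series (first_degree t) (paper_field t Y) (mu t) f x" if "smooth_field f" for f
    proof -
      have "AE x in \<sigma>. norm x = 1" by (rule AE_I2) simp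
      with extension_eq_series[OF p spec[OF P] that] show ?thesis
        by eventually_elim (simp add: proj_series_eq_series)
    qed
  qed (use p K vpoly_pr lin P in auto)
  moreover have "Lp_direct_sum3 p (P Kelv) (P Grad) (P Tang)" by (rule extension_direct_sum[OF p spec[OF P]])
  ultimately show ?thesis by (intro exI[of _ P]) simp
qed

end

theorem mainTheorem8:
  fixes p :: real and Y :: "nat \<Rightarrow> int \<Rightarrow> real^3 \<Rightarrow> real"
  assumes p: "1 < p"
    and harm: "\<And>l m. \<bar>m\<bar> \<le> int l \<Longrightarrow> spherical_harmonic l (Y l m)"
    and orth: "\<And>l m l' m'. \<bar>m\<bar> \<le> int l \<Longrightarrow> \<bar>m'\<bar> \<le> int l' \<Longrightarrow>
        (\<integral>\<eta>. Y l m \<eta> * Y l' m' \<eta> \<partial>sphere_measure) = (if l = l' \<and> m = m' then 1 else 0)"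
  shows "\<exists>Pp Pm P0.
     Lp_projection_extending p Pp (pi_plus Y) \<and>
     Lp_projection_extending p Pm (pi_minus Y) \<and>
     Lp_projection_extending p P0 (pi_zero Y) \<and>
     Lp_direct_sum3 p Pp Pm P0"
proof -
  interpret harmonic_basis Y by unfold_locales (rule harm orth; assumption)+
  obtain P where P: "\<forall>t. Lp_projection_extending p (P t) (proj_series (first_degree t) (paper_field t Y) (mu t))"
    "Lp_direct_sum3 p (P Kelv) (P Grad) (P Tang)"
    using Lp_decomposition[OF p] by (elim exE conjE) (rule that)
  show ?thesis
    using P(1)[THEN spec, of Kelv] P(1)[THEN spec, of Grad] P(1)[THEN spec, of Tang] P(2)
    unfolding pi_plus_def pi_minus_def pi_zero_def
    by (intro exI[of _ "P Kelv"] exI[of _ "P Grad"] exI[of _ "P Tang"]) simp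
qed

end
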